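(* Consider the closed-loop system (CL) described in the context (semilinear wave equation in the variables $(w^1,w^2)$, integral component $\zeta$, and dynamic state feedback $\dot v(t)=KX(t)$, where $K$ is a fixed gain such that $A+BK$ is Hurwitz). There exist $\kappa\in(0,1)$ and $\overline{C}_1,\delta>0$ such that, for any $\eta\in[0,1)$, there exists $\overline{C}_2>0$ such that, for any (real-valued) initial condition $W(0)\in D(\mathcal{A})$, $\xi(0)\in\mathbb{R}$, $v(0)\in\mathbb{R}$ satisfying $$\Vert W(0)\Vert_{\mathcal{H}}^2+|\xi(0)|^2+|v(0)|^2\leq\delta$$ and any continuously differentiable reference input $z_r:[0,+\infty)\to\mathbb{R}$ with $$\Vert z_r\Vert_{L^\infty(\mathbb{R}_+)}^2\leq\delta,$$ the classical solution of (CL) is well defined on $\mathbb{R}_+=[0,+\infty)$ and satisfies, for all $t\geq 0$, $$\Vert w^1(t,\cdot)\Vert_{L^\infty(0,L)}<1$$ and $$\Vert W(t)\Vert_{\mathcal{H}}^2+|\xi(t)|^2+|v(t)|^2\leq\overline{C}_1e^{-2\kappa t}\left(\Vert W(0)\Vert_{\mathcal{H}}^2+|\xi(0)|^2+|v(0)|^2\right)+\overline{C}_2\sup_{0\leq s\leq t}e^{-2\eta\kappa(t-s)}|z_r(s)|^2 .$$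
   Context: **Data.** $L>0$; $f:\mathbb{R}\to\mathbb{R}$ of class $\mathcal{C}^2$; $y_e\in\mathcal{C}^2([0,L])$ is a real-valued function with $y_e''+f(y_e)=0$ on $(0,L)$ and $y_e(0)=0$ (a steady state, with $u_e=y_e'(L)$, $z_e=y_e'(0)$). The constant $\alpha>1$ is chosen so that $\frac{1}{2L}\log\left(\frac{\alpha-1}{\alpha+1}\right)<-1$. **Space and operator.** $\mathcal{H}=\{(w^1,w^2)\in H^1(0,L)\times L^2(0,L): w^1(0)=0\}$ (complex-valued functions) with inner product $\langle(w^1,w^2),(z^1,z^2)\rangle_{\mathcal{H}}=\int_0^L (w^1)'\overline{(z^1)'}+w^2\overline{z^2}\,dx$. The operator $\mathcal{A}$ is $\mathcal{A}(w^1,w^2)=(w^2,\,(w^1)''+f'(y_e)w^1)$ on $$D(\mathcal{A})=\{(w^1,w^2)\in\mathcal{H}: w^1\in H^2(0,L),\ w^2\in H^1(0,L),\ w^2(0)=0,\ (w^1)'(L)+\alpha w^2(L)=0\}.$$ Put $a(x)=(x/(\alpha L),0)$, $b(x)=(0,-x/(\alpha L))$, elements of $\mathcal{H}$. **Riesz basis.** The following spectral facts are taken as known. There are a Riesz basis $(e_k)_{k\in\mathbb{Z}}$ of $\mathcal{H}$, $e_k=(e_k^1,e_k^2)\in D(\mathcal{A})$, $\Vert e_k\Vert_{\mathcal H}=1$, with dual Riesz basis $(f_k)_{k\in\mathbb{Z}}$ ($\langle e_k,f_l\rangle_{\mathcal H}=\delta_{k,l}$), an integer $n_0\geq 0$,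 and complex numbers $\lambda_k$, such that: - for $|k|\geq n_0+1$: $\lambda_k$ is an algebraically simple eigenvalue of $\mathcal{A}$, $\mathcal{A}e_k=\lambda_ke_k$, $\mathcal{A}^*f_k=\overline{\lambda_k}f_k$, $\operatorname{Re}\lambda_k<-1$, $e_{-k}=\overline{e_k}$, $f_{-k}=\overline{f_k}$; - $\lambda_k=\frac{1}{2L}\log\left(\frac{\alpha-1}{\alpha+1}\right)+i\frac{k\pi}{L}+O(1/|k|)$ and $(e_k^1)'(0)=O(1)$ as $|k|\to+\infty$; - for $|k|\leq n_0$: $e_k,f_k$ are real-valued, $\mathcal{A}e_k\in\mathrm{span}\{e_p:|p|\leq n_0\}$ and $\mathcal{A}^*f_k\in\mathrm{span}\{f_p:|p|\leq n_0\}$; - all eigenvalues of $\mathcal{A}$ are geometrically simple. Such a family and integer $n_0$ are fixed. **Finite-dimensional matrices.** Let $a_k=\langle a,f_k\rangle_{\mathcal H}$, $b_k=\langle b,f_k\rangle_{\mathcal H}$; $A_0=(\langle\mathcal{A}e_k,f_j\rangle_{\mathcal H})_{-n_0\leq j,k\leq n_0}$ ($j$ row index); $B_{0,1}=(a_k)_{|k|\leq n_0}$, $B_{0,2}=(b_k)_{|k|\leq n_0}$ (columns in $\mathbb{R}^{2n_0+1}$); $$A_1=\begin{bmatrix} 0 & 0 \\ B_{0,1} & A_0 \end{bmatrix},\quad B_1=\begin{bmatrix} 1 \\ B_{0,2} \end{bmatrix},\quad \alpha_0=-\sum_{|k|\geq n_0+1}\frac{(e_k^1)'(0)}{\lambda_k}a_k,\quad\beta_0=-\sum_{|k|\geq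 n_0+1}\frac{(e_k^1)'(0)}{\lambda_k}b_k,$$ $$L_1=\begin{bmatrix}\alpha_0&(e_{-n_0}^1)'(0)&\cdots&(e_{n_0}^1)'(0)\end{bmatrix},\quad A=\begin{bmatrix} A_1 & 0 \\ L_1 & 0 \end{bmatrix}\in\mathbb{R}^{(2n_0+3)\times(2n_0+3)},\quad B=\begin{bmatrix} B_1 \\ \beta_0 \end{bmatrix}\in\mathbb{R}^{2n_0+3}.$$ The pair $(A,B)$ is controllable, and $K\in\mathbb{R}^{1\times(2n_0+3)}$ is a fixed gain such that $A_K=A+BK$ is Hurwitz. **Closed-loop system (CL).** Unknowns: $W(t)=(w^1(t,\cdot),w^2(t,\cdot))\in\mathcal{H}$ (real-valued), $\zeta(t)\in\mathbb{R}$, $v(t)\in\mathbb{R}$; input: the reference signal $z_r(t)\in\mathbb{R}$. For $t>0$, $x\in(0,L)$: $$\partial_tw^1=w^2+\frac{x}{\alpha L}v(t),\qquad\partial_tw^2=\partial_{xx}w^1+f'(y_e)w^1+r(t,x)-\frac{x}{\alpha L}\dot v(t),$$ $$\dot\zeta(t)=\partial_xw^1(t,0)-z_r(t),\qquad w^1(t,0)=0,\qquad\partial_xw^1(t,L)+\alpha w^2(t,L)=0,$$ $$r(t,x)=(w^1(t,x))^2\int_0^1(1-s)f''(y_e(x)+sw^1(t,x))\,ds,$$ $$\dot v(t)=KX(t),\quad X(t)=\begin{bmatrix}v(t)&w_{-n_0}(t)&\cdots&w_{n_0}(t)&\xi(t)\end{bmatrix}^\top,\quad w_k(t)=\langle W(t),f_k\rangle_{\mathcal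 H},$$ $$\xi(t)=\zeta(t)-\sum_{|k|\geq n_0+1}\frac{(e_k^1)'(0)}{\lambda_k}w_k(t).$$ Equivalently $\dot W=\mathcal{A}W+av+b\dot v+(0,r)$ in $\mathcal{H}$ together with the equations for $\zeta$ and $v$. (This is the system $\partial_{tt}y=\partial_{xx}y+f(y)$, $y(t,0)=0$, $\partial_xy(t,L)=u(t)$ with $u=u_e-\alpha\partial_ty(t,L)+v$, $w^1=y-y_e$, $w^2=\partial_ty-\frac{x}{\alpha L}v$.) Prescribing $(W(0),\xi(0),v(0))$ is equivalent to prescribing $(W(0),\zeta(0),v(0))$. For $W(0)\in D(\mathcal{A})$ and $z_r$ continuously differentiable, a classical solution on $[0,T)$ is one with $W\in\mathcal{C}^0([0,T);D(\mathcal{A}))\cap\mathcal{C}^1([0,T);\mathcal{H})$ (graph norm on $D(\mathcal{A})$) and $\zeta,v\in\mathcal{C}^1([0,T))$; "well defined on $\mathbb{R}_+$" means that the maximal classical solution is defined for all $t\geq 0$. *)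

theory Defs
  imports
    "HOL-Analysis.Analysis"
    "HOL-Probability.Essential_Supremum"
    "HOL-Library.Landau_Symbols"
    "HOL-Library.Function_Algebras"
    "Jordan_Normal_Form.Char_Poly"
    "Jordan_Normal_Form.DL_Rank"
begin

unbundle no vec_syntax

definition C1_on :: "real set \<Rightarrow> (real \<Rightarrow> real) \<Rightarrow> bool" where
  "C1_on S g \<longleftrightarrow> (\<exists>g'. (\<forall>t\<in>S. (g has_real_derivative g' t) (at t within S)) \<and> continuous_on S g')"

definition C2_on :: "real set \<Rightarrow> (real \<Rightarrow> real) \<Rightarrow> bool" where
  "C2_on S g \<longleftrightarrow> (\<exists>g'. (\<forall>t\<in>S. (g has_real_derivative g' t) (at t within S)) \<and> C1_on S g')"

definition Linf_norm :: "real set \<Rightarrow> (real \<Rightarrow> real) \<Rightarrow> ereal" where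
  "Linf_norm S u = esssup (lebesgue_on S) (\<lambda>x. ereal \<bar>u x\<bar>)"

definition steady_state :: "real \<Rightarrow> (real \<Rightarrow> real) \<Rightarrow> (real \<Rightarrow> real) \<Rightarrow> bool" where
  "steady_state L f ye \<longleftrightarrow>
     C2_on {0..L} ye \<and> (\<forall>x\<in>{0<..<L}. deriv (deriv ye) x + f (ye x) = 0) \<and> ye 0 = 0"

text \<open>
  Functions on \<open>(0,L)\<close> are represented by functions on \<^typ>\<open>real\<close> whose values outside \<open>[0,L]\<close> are
  irrelevant. An element of \<open>L\<^sup>2(0,L)\<close> is any representative of its class. An element of
  \<open>H\<^sup>1(0,L)\<close> is always taken to be its absolutely continuous representative on \<open>[0,L]\<close>, that is, the
  indefinite integral of its weak derivative, so that traces at the endpoints are point values.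
\<close>

definition L2 :: "real \<Rightarrow> (real \<Rightarrow> complex) \<Rightarrow> bool" where
  "L2 L u \<longleftrightarrow> u \<in> borel_measurable (lebesgue_on {0..L}) \<and>
     integrable (lebesgue_on {0..L}) (\<lambda>x. (norm (u x))\<^sup>2)"

definition has_wderiv :: "real \<Rightarrow> (real \<Rightarrow> complex) \<Rightarrow> (real \<Rightarrow> complex) \<Rightarrow> bool" where
  "has_wderiv L u g \<longleftrightarrow>
     L2 L g \<and> (\<forall>x\<in>{0..L}. u x = u 0 + integral\<^sup>L (lebesgue_on {0..x}) g)"

text \<open>The weak derivative, determined up to a null set.\<close>

definition wderiv :: "real \<Rightarrow> (real \<Rightarrow> complex) \<Rightarrow> real \<Rightarrow> complex" where
  "wderiv L u = (SOME g. has_wderiv L u g)"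

definition H1 :: "real \<Rightarrow> (real \<Rightarrow> complex) \<Rightarrow> bool" where
  "H1 L u \<longleftrightarrow> (\<exists>g. has_wderiv L u g)"

definition H2 :: "real \<Rightarrow> (real \<Rightarrow> complex) \<Rightarrow> bool" where
  "H2 L u \<longleftrightarrow> (\<exists>g. has_wderiv L u g \<and> H1 L g)"

text \<open>
  The pointwise derivative on \<open>[0,L]\<close>, one-sided at the endpoints. For \<open>u \<in> H\<^sup>2(0,L)\<close>, it is the
  absolutely continuous representative of the weak derivative.
\<close>

definition pointwise_deriv :: "real \<Rightarrow> (real \<Rightarrow> 'a::real_normed_vector) \<Rightarrow> real \<Rightarrow> 'a" where
  "pointwise_deriv L u x = vector_derivative u (at x within {0..L})"

type_synonym state = "(real \<Rightarrow> complex) \<times> (real \<Rightarrow> complex)"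
type_synonym rstate = "(real \<Rightarrow> real) \<times> (real \<Rightarrow> real)"

definition cstate :: "rstate \<Rightarrow> state" where
  "cstate w = (\<lambda>x. complex_of_real (fst w x), \<lambda>x. complex_of_real (snd w x))"

definition hscale :: "complex \<Rightarrow> state \<Rightarrow> state" where
  "hscale c w = (\<lambda>x. c * fst w x, \<lambda>x. c * snd w x)"

definition hcnj :: "state \<Rightarrow> state" where
  "hcnj w = (\<lambda>x. cnj (fst w x), \<lambda>x. cnj (snd w x))"

definition hspace :: "real \<Rightarrow> state set" where
  "hspace L = {w. H1 L (fst w) \<and> fst w 0 = 0 \<and> L2 L (snd w)}"

text \<open>Two representatives of the same element of \<open>\<H>\<close>.\<close>

definition heq :: "real \<Rightarrow> state \<Rightarrow> state \<Rightarrow> bool" where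
  "heq L w z \<longleftrightarrow>
     (\<forall>x\<in>{0..L}. fst w x = fst z x) \<and> (AE x in lebesgue_on {0..L}. snd w x = snd z x)"

definition hinner :: "real \<Rightarrow> state \<Rightarrow> state \<Rightarrow> complex" where
  "hinner L w z = (LINT x|lebesgue_on {0..L}.
     wderiv L (fst w) x * cnj (wderiv L (fst z) x) + snd w x * cnj (snd z x))"

definition hnorm :: "real \<Rightarrow> state \<Rightarrow> real" where
  "hnorm L w = sqrt (Re (hinner L w w))"

definition domA :: "real \<Rightarrow> real \<Rightarrow> state set" where
  "domA L \<alpha> = {w \<in> hspace L. H2 L (fst w) \<and> H1 L (snd w) \<and> snd w 0 = 0 \<and>
     pointwise_deriv L (fst w) L + of_real \<alpha> * snd w L = 0}"

definition opA :: "real \<Rightarrow> (real \<Rightarrow> real) \<Rightarrow> (real \<Rightarrow> real) \<Rightarrow> state \<Rightarrow> state" where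
  "opA L f ye w =
     (snd w, \<lambda>x. wderiv L (pointwise_deriv L (fst w)) x + of_real (deriv f (ye x)) * fst w x)"

text \<open>\<open>z\<close> lies in the domain of the adjoint \<open>\<A>\<^sup>*\<close> and \<open>\<A>\<^sup>* z = h\<close>.\<close>

definition adjA_eq ::
    "real \<Rightarrow> real \<Rightarrow> (real \<Rightarrow> real) \<Rightarrow> (real \<Rightarrow> real) \<Rightarrow> state \<Rightarrow> state \<Rightarrow> bool" where
  "adjA_eq L \<alpha> f ye z h \<longleftrightarrow> z \<in> hspace L \<and> h \<in> hspace L \<and>
     (\<forall>w\<in>domA L \<alpha>. hinner L (opA L f ye w) z = hinner L w h)"

definition vec_a :: "real \<Rightarrow> real \<Rightarrow> state" where
  "vec_a L \<alpha> = (\<lambda>x. of_real (x / (\<alpha> * L)), \<lambda>x. 0)"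

definition vec_b :: "real \<Rightarrow> real \<Rightarrow> state" where
  "vec_b L \<alpha> = (\<lambda>x. 0, \<lambda>x. of_real (- x / (\<alpha> * L)))"

definition eigenpair ::
    "real \<Rightarrow> real \<Rightarrow> (real \<Rightarrow> real) \<Rightarrow> (real \<Rightarrow> real) \<Rightarrow> complex \<Rightarrow> state \<Rightarrow> bool" where
  "eigenpair L \<alpha> f ye \<mu> w \<longleftrightarrow>
     w \<in> domA L \<alpha> \<and> \<not> heq L w 0 \<and> heq L (opA L f ye w) (hscale \<mu> w)"

definition geom_simple ::
    "real \<Rightarrow> real \<Rightarrow> (real \<Rightarrow> real) \<Rightarrow> (real \<Rightarrow> real) \<Rightarrow> complex \<Rightarrow> bool" where
  "geom_simple L \<alpha> f ye \<mu> \<longleftrightarrow> (\<exists>w. eigenpair L \<alpha> f ye \<mu> w) \<and>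
     (\<forall>w z. eigenpair L \<alpha> f ye \<mu> w \<and> eigenpair L \<alpha> f ye \<mu> z \<longrightarrow> (\<exists>c. heq L z (hscale c w)))"

text \<open>
  \<open>in_gen_kernel L \<alpha> f ye \<mu> n w\<close> states \<open>w \<in> ker (\<A> - \<mu>)\<^sup>n\<close>. The variable \<open>z\<close> is a representative of
  \<open>(\<A> - \<mu>) w\<close> suited to membership in the domain.
\<close>

fun in_gen_kernel ::
    "real \<Rightarrow> real \<Rightarrow> (real \<Rightarrow> real) \<Rightarrow> (real \<Rightarrow> real) \<Rightarrow> complex \<Rightarrow> nat \<Rightarrow> state \<Rightarrow> bool" where
  "in_gen_kernel L \<alpha> f ye \<mu> 0 w = heq L w 0"
| "in_gen_kernel L \<alpha> f ye \<mu> (Suc n) w = (w \<in> domA L \<alpha> \<and>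
     (\<exists>z. heq L z (opA L f ye w - hscale \<mu> w) \<and> in_gen_kernel L \<alpha> f ye \<mu> n z))"

definition alg_simple ::
    "real \<Rightarrow> real \<Rightarrow> (real \<Rightarrow> real) \<Rightarrow> (real \<Rightarrow> real) \<Rightarrow> complex \<Rightarrow> bool" where
  "alg_simple L \<alpha> f ye \<mu> \<longleftrightarrow> (\<exists>w. eigenpair L \<alpha> f ye \<mu> w \<and>
     (\<forall>n z. in_gen_kernel L \<alpha> f ye \<mu> n z \<longrightarrow> (\<exists>c. heq L z (hscale c w))))"

definition riesz_basis :: "real \<Rightarrow> (int \<Rightarrow> state) \<Rightarrow> bool" where
  "riesz_basis L e \<longleftrightarrow> (\<forall>k. e k \<in> hspace L) \<and>
     (\<forall>w\<in>hspace L. \<forall>\<epsilon>>0. \<exists>F c. finite F \<and> hnorm L (w - (\<Sum>k\<in>F. hscale (c k) (e k))) < \<epsilon>) \<and>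
     (\<exists>m>0. \<exists>M>0. \<forall>F c. finite F \<longrightarrow>
        m * (\<Sum>k\<in>F. (cmod (c k))\<^sup>2) \<le> (hnorm L (\<Sum>k\<in>F. hscale (c k) (e k)))\<^sup>2 \<and>
        (hnorm L (\<Sum>k\<in>F. hscale (c k) (e k)))\<^sup>2 \<le> M * (\<Sum>k\<in>F. (cmod (c k))\<^sup>2))"

definition low_modes :: "nat \<Rightarrow> int set" where
  "low_modes n0 = {k. \<bar>k\<bar> \<le> int n0}"

definition high_modes :: "nat \<Rightarrow> int set" where
  "high_modes n0 = {k. \<bar>k\<bar> \<ge> int n0 + 1}"

text \<open>The family \<open>d\<close> is the dual basis.\<close>

definition spectral_family ::
    "real \<Rightarrow> real \<Rightarrow> (real \<Rightarrow> real) \<Rightarrow> (real \<Rightarrow> real) \<Rightarrow> nat \<Rightarrow> (int \<Rightarrow> state) \<Rightarrow> (int \<Rightarrow> state) \<Rightarrow>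
     (int \<Rightarrow> complex) \<Rightarrow> bool" where
  "spectral_family L \<alpha> f ye n0 e d lam \<longleftrightarrow>
     riesz_basis L e \<and> riesz_basis L d \<and>
     (\<forall>k. e k \<in> domA L \<alpha> \<and> hnorm L (e k) = 1) \<and>
     (\<forall>k l. hinner L (e k) (d l) = (if k = l then 1 else 0)) \<and>
     (\<forall>k\<in>high_modes n0.
        alg_simple L \<alpha> f ye (lam k) \<and>
        heq L (opA L f ye (e k)) (hscale (lam k) (e k)) \<and>
        adjA_eq L \<alpha> f ye (d k) (hscale (cnj (lam k)) (d k)) \<and>
        Re (lam k) < -1 \<and>
        heq L (e (- k)) (hcnj (e k)) \<and> heq L (d (- k)) (hcnj (d k))) \<and>
     (\<lambda>k. lam k - (of_real (1 / (2 * L) * ln ((\<alpha> - 1) / (\<alpha> + 1)))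
                     + \<i> * of_real (of_int k * pi / L)))
        \<in> O[cofinite](\<lambda>k. of_real (1 / of_int \<bar>k\<bar>)) \<and>
     (\<lambda>k. pointwise_deriv L (fst (e k)) 0) \<in> O[cofinite](\<lambda>_. 1) \<and>
     (\<forall>k\<in>low_modes n0.
        heq L (hcnj (e k)) (e k) \<and> heq L (hcnj (d k)) (d k) \<and>
        (\<exists>c. heq L (opA L f ye (e k)) (\<Sum>p\<in>low_modes n0. hscale (c p) (e p))) \<and>
        (\<exists>c. adjA_eq L \<alpha> f ye (d k) (\<Sum>p\<in>low_modes n0. hscale (c p) (d p)))) \<and>
     (\<forall>\<mu>. (\<exists>w. eigenpair L \<alpha> f ye \<mu> w) \<longrightarrow> geom_simple L \<alpha> f ye \<mu>)"

text \<open>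
  For a real-valued state \<open>w\<close>, the real parts taken from here on do not discard anything: the low
  modes are real-valued, and the terms of the series with indices \<open>k\<close> and \<open>-k\<close> are conjugate.
\<close>

definition tail_sum ::
    "real \<Rightarrow> nat \<Rightarrow> (int \<Rightarrow> state) \<Rightarrow> (int \<Rightarrow> state) \<Rightarrow> (int \<Rightarrow> complex) \<Rightarrow> state \<Rightarrow> real" where
  "tail_sum L n0 e d lam w =
     Re (\<Sum>\<^sub>\<infinity>k\<in>high_modes n0. pointwise_deriv L (fst (e k)) 0 / lam k * hinner L w (d k))"

definition mode :: "real \<Rightarrow> (int \<Rightarrow> state) \<Rightarrow> state \<Rightarrow> int \<Rightarrow> real" where
  "mode L d w k = Re (hinner L w (d k))"

definition mat_A0 ::
    "real \<Rightarrow> (real \<Rightarrow> real) \<Rightarrow> (real \<Rightarrow> real) \<Rightarrow> nat \<Rightarrow> (int \<Rightarrow> state) \<Rightarrow> (int \<Rightarrow> state) \<Rightarrow> real mat" where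
  "mat_A0 L f ye n0 e d = mat (2 * n0 + 1) (2 * n0 + 1)
     (\<lambda>(i, j). mode L d (opA L f ye (e (int j - int n0))) (int i - int n0))"

definition mat_B0 :: "real \<Rightarrow> nat \<Rightarrow> (int \<Rightarrow> state) \<Rightarrow> state \<Rightarrow> real mat" where
  "mat_B0 L n0 d w = mat (2 * n0 + 1) 1 (\<lambda>(i, _). mode L d w (int i - int n0))"

definition mat_A1 ::
    "real \<Rightarrow> real \<Rightarrow> (real \<Rightarrow> real) \<Rightarrow> (real \<Rightarrow> real) \<Rightarrow> nat \<Rightarrow> (int \<Rightarrow> state) \<Rightarrow> (int \<Rightarrow> state) \<Rightarrow>
     real mat" where
  "mat_A1 L \<alpha> f ye n0 e d =
     four_block_mat (0\<^sub>m 1 1) (0\<^sub>m 1 (2 * n0 + 1))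
       (mat_B0 L n0 d (vec_a L \<alpha>)) (mat_A0 L f ye n0 e d)"

definition mat_B1 :: "real \<Rightarrow> real \<Rightarrow> nat \<Rightarrow> (int \<Rightarrow> state) \<Rightarrow> real mat" where
  "mat_B1 L \<alpha> n0 d = 1\<^sub>m 1 @\<^sub>r mat_B0 L n0 d (vec_b L \<alpha>)"

definition mat_L1 ::
    "real \<Rightarrow> real \<Rightarrow> nat \<Rightarrow> (int \<Rightarrow> state) \<Rightarrow> (int \<Rightarrow> state) \<Rightarrow> (int \<Rightarrow> complex) \<Rightarrow> real mat" where
  "mat_L1 L \<alpha> n0 e d lam = mat 1 (2 * n0 + 2) (\<lambda>(_, j).
     if j = 0 then - tail_sum L n0 e d lam (vec_a L \<alpha>)
     else Re (pointwise_deriv L (fst (e (int j - 1 - int n0))) 0))"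

definition mat_A ::
    "real \<Rightarrow> real \<Rightarrow> (real \<Rightarrow> real) \<Rightarrow> (real \<Rightarrow> real) \<Rightarrow> nat \<Rightarrow> (int \<Rightarrow> state) \<Rightarrow> (int \<Rightarrow> state) \<Rightarrow>
     (int \<Rightarrow> complex) \<Rightarrow> real mat" where
  "mat_A L \<alpha> f ye n0 e d lam =
     four_block_mat (mat_A1 L \<alpha> f ye n0 e d) (0\<^sub>m (2 * n0 + 2) 1)
       (mat_L1 L \<alpha> n0 e d lam) (0\<^sub>m 1 1)"

definition mat_B ::
    "real \<Rightarrow> real \<Rightarrow> nat \<Rightarrow> (int \<Rightarrow> state) \<Rightarrow> (int \<Rightarrow> state) \<Rightarrow> (int \<Rightarrow> complex) \<Rightarrow> real mat" where
  "mat_B L \<alpha> n0 e d lam =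
     mat_B1 L \<alpha> n0 d @\<^sub>r mat 1 1 (\<lambda>_. - tail_sum L n0 e d lam (vec_b L \<alpha>))"

text \<open>Kalman's rank condition for a single-input pair.\<close>

definition controllable :: "real mat \<Rightarrow> real mat \<Rightarrow> bool" where
  "controllable A B \<longleftrightarrow> (let n = dim_row A in
     vec_space.rank n (mat n n (\<lambda>(i, j). ((A ^\<^sub>m j) * B) $$ (i, 0))) = n)"

definition hurwitz :: "real mat \<Rightarrow> bool" where
  "hurwitz M \<longleftrightarrow> (\<forall>\<mu>. eigenvalue (map_mat complex_of_real M) \<mu> \<longrightarrow> Re \<mu> < 0)"

definition residual :: "(real \<Rightarrow> real) \<Rightarrow> (real \<Rightarrow> real) \<Rightarrow> (real \<Rightarrow> real) \<Rightarrow> real \<Rightarrow> real" where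
  "residual f ye w1 x =
     (w1 x)\<^sup>2 * integral {0..1} (\<lambda>s. (1 - s) * deriv (deriv f) (ye x + s * w1 x))"

definition xi ::
    "real \<Rightarrow> nat \<Rightarrow> (int \<Rightarrow> state) \<Rightarrow> (int \<Rightarrow> state) \<Rightarrow> (int \<Rightarrow> complex) \<Rightarrow> rstate \<Rightarrow> real \<Rightarrow> real" where
  "xi L n0 e d lam w \<zeta> = \<zeta> - tail_sum L n0 e d lam (cstate w)"

definition vec_X ::
    "real \<Rightarrow> nat \<Rightarrow> (int \<Rightarrow> state) \<Rightarrow> (int \<Rightarrow> state) \<Rightarrow> (int \<Rightarrow> complex) \<Rightarrow>
     rstate \<Rightarrow> real \<Rightarrow> real \<Rightarrow> real mat" where
  "vec_X L n0 e d lam w \<zeta> v = mat (2 * n0 + 3) 1 (\<lambda>(i, _).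
     if i = 0 then v
     else if i = 2 * n0 + 2 then xi L n0 e d lam w \<zeta>
     else mode L d (cstate w) (int i - 1 - int n0))"

definition graph_norm ::
    "real \<Rightarrow> (real \<Rightarrow> real) \<Rightarrow> (real \<Rightarrow> real) \<Rightarrow> state \<Rightarrow> real" where
  "graph_norm L f ye w = sqrt ((hnorm L w)\<^sup>2 + (hnorm L (opA L f ye w))\<^sup>2)"

definition norm_continuous_on :: "(state \<Rightarrow> real) \<Rightarrow> real set \<Rightarrow> (real \<Rightarrow> state) \<Rightarrow> bool" where
  "norm_continuous_on N J U \<longleftrightarrow>
     (\<forall>t\<in>J. ((\<lambda>s. N (U s - U t)) \<longlongrightarrow> 0) (at t within J))"

definition has_hderiv :: "real \<Rightarrow> real set \<Rightarrow> (real \<Rightarrow> state) \<Rightarrow> state \<Rightarrow> real \<Rightarrow> bool" where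
  "has_hderiv L J U D t \<longleftrightarrow>
     ((\<lambda>s. hnorm L (hscale (of_real (1 / (s - t))) (U s - U t) - D)) \<longlongrightarrow> 0) (at t within J)"

text \<open>
  Classical solutions on \<open>[0,T)\<close>, where \<open>T = \<infinity>\<close> is allowed. The boundary conditions are part of
  membership in the domain of \<open>\<A>\<close>.
\<close>

definition classical_solution ::
    "real \<Rightarrow> real \<Rightarrow> (real \<Rightarrow> real) \<Rightarrow> (real \<Rightarrow> real) \<Rightarrow> nat \<Rightarrow> (int \<Rightarrow> state) \<Rightarrow> (int \<Rightarrow> state) \<Rightarrow>
     (int \<Rightarrow> complex) \<Rightarrow> real mat \<Rightarrow> (real \<Rightarrow> real) \<Rightarrow> ereal \<Rightarrow>
     (real \<Rightarrow> rstate) \<Rightarrow> (real \<Rightarrow> real) \<Rightarrow> (real \<Rightarrow> real) \<Rightarrow> bool" where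
  "classical_solution L \<alpha> f ye n0 e d lam K zr T W \<zeta> v \<longleftrightarrow> 0 < T \<and>
     (let J = {t. 0 \<le> t \<and> ereal t < T} in
       (\<forall>t\<in>J. cstate (W t) \<in> domA L \<alpha>) \<and>
       norm_continuous_on (graph_norm L f ye) J (\<lambda>t. cstate (W t)) \<and>
       (\<exists>W' \<zeta>' v'.
         (\<forall>t\<in>J. W' t \<in> hspace L \<and> has_hderiv L J (\<lambda>t. cstate (W t)) (W' t) t) \<and>
         norm_continuous_on (hnorm L) J W' \<and>
         (\<forall>t\<in>J. (\<zeta> has_real_derivative \<zeta>' t) (at t within J)) \<and> continuous_on J \<zeta>' \<and>
         (\<forall>t\<in>J. (v has_real_derivative v' t) (at t within J)) \<and> continuous_on J v' \<and>
         (\<forall>t\<in>J. 0 < t \<longrightarrow>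
            heq L (W' t)
              (opA L f ye (cstate (W t)) + hscale (of_real (v t)) (vec_a L \<alpha>)
                + hscale (of_real (v' t)) (vec_b L \<alpha>)
                + cstate (\<lambda>x. 0, residual f ye (fst (W t)))) \<and>
            \<zeta>' t = pointwise_deriv L (fst (W t)) 0 - zr t \<and>
            v' t = (K * vec_X L n0 e d lam (W t) (\<zeta> t) (v t)) $$ (0, 0))))"

definition solution_from ::
    "real \<Rightarrow> real \<Rightarrow> (real \<Rightarrow> real) \<Rightarrow> (real \<Rightarrow> real) \<Rightarrow> nat \<Rightarrow> (int \<Rightarrow> state) \<Rightarrow> (int \<Rightarrow> state) \<Rightarrow>
     (int \<Rightarrow> complex) \<Rightarrow> real mat \<Rightarrow> (real \<Rightarrow> real) \<Rightarrow> rstate \<Rightarrow> real \<Rightarrow> real \<Rightarrow> ereal \<Rightarrow>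
     (real \<Rightarrow> rstate) \<Rightarrow> (real \<Rightarrow> real) \<Rightarrow> (real \<Rightarrow> real) \<Rightarrow> bool" where
  "solution_from L \<alpha> f ye n0 e d lam K zr W0 \<xi>0 v0 T W \<zeta> v \<longleftrightarrow>
     classical_solution L \<alpha> f ye n0 e d lam K zr T W \<zeta> v \<and>
     heq L (cstate (W 0)) (cstate W0) \<and> xi L n0 e d lam (W 0) (\<zeta> 0) = \<xi>0 \<and> v 0 = v0"

text \<open>The maximal solution is the one of which every other solution with the same data is a restriction.\<close>

definition maximal_solution ::
    "real \<Rightarrow> real \<Rightarrow> (real \<Rightarrow> real) \<Rightarrow> (real \<Rightarrow> real) \<Rightarrow> nat \<Rightarrow> (int \<Rightarrow> state) \<Rightarrow> (int \<Rightarrow> state) \<Rightarrow>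
     (int \<Rightarrow> complex) \<Rightarrow> real mat \<Rightarrow> (real \<Rightarrow> real) \<Rightarrow> rstate \<Rightarrow> real \<Rightarrow> real \<Rightarrow> ereal \<Rightarrow>
     (real \<Rightarrow> rstate) \<Rightarrow> (real \<Rightarrow> real) \<Rightarrow> (real \<Rightarrow> real) \<Rightarrow> bool" where
  "maximal_solution L \<alpha> f ye n0 e d lam K zr W0 \<xi>0 v0 T W \<zeta> v \<longleftrightarrow>
     solution_from L \<alpha> f ye n0 e d lam K zr W0 \<xi>0 v0 T W \<zeta> v \<and>
     (\<forall>T' W' \<zeta>' v'. solution_from L \<alpha> f ye n0 e d lam K zr W0 \<xi>0 v0 T' W' \<zeta>' v' \<longrightarrow>
        T' \<le> T \<and> (\<forall>t. 0 \<le> t \<and> ereal t < T' \<longrightarrow>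
          heq L (cstate (W' t)) (cstate (W t)) \<and> \<zeta>' t = \<zeta> t \<and> v' t = v t))"

end

theory Submission
  imports Defs "Jordan_Normal_Form.Schur_Decomposition"
begin

text \<open>
  In the coordinates of the Riesz basis, the closed loop is a diagonal system for the high modes, with
  exponents of real part less than \<open>-1\<close>, coupled to \<open>X' = A\<^sub>K X + \<dots>\<close>. A rescaled Schur basis
  of \<open>A\<^sub>K\<close> turns the latter into a diagonal system up to an arbitrarily small term, and at the same time makes the
  influence of \<open>X\<close> on the high modes arbitrarily small. Clamping the first component of \<open>W\<close> in the
  quadratic residual makes the nonlinearity globally Lipschitz with a small constant. What results is a small
  Lipschitz perturbation of an exponentially stable diagonal semigroup, forced by \<open>z\<^sub>r\<close>:
  a fixed point argument yields a global mild solution and Gronwall's inequality yields the estimate.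
  For small data, that estimate and the embedding of \<open>H\<^sup>1\<close> in \<open>L\<^sup>\<infinity>\<close> show that the clamping is never active.

  The mild solution is classical since the residual is continuously differentiable in time with values in
  \<open>L\<^sup>2\<close>. Conversely, the coordinates of any classical solution form a mild solution, whence uniqueness.
\<close>

section \<open>Square-summable families\<close>

text \<open>The trace w1'(0) that drives \<zeta> is unbounded on the energy space, but its
  coefficients divided by \<lambda>_k are square-summable. The high part of w1'(0) is the series in
  the definition of \<xi> applied to \<A> W, so subtracting this series from \<zeta> leaves an
  equation for \<xi> in X, the residual and z_r only: X closes on itself up to the residual.
  Coordinates also stand in for semigroup theory. States are functions up to null sets, with weak
  derivatives fixed by choice, while coordinates form a true Banach space. The price is the way
  back: membership in the domain of \<A> is read off coordinates through closedness of \<A>, and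
  real-valuedness is recovered from a symmetry of the coordinates. The uncoupled diagonal system
  decays at a rate w. The linear coupling and the residual may each consume w/4, which leaves
  \<kappa> = w/2. The parameter \<eta> only splits the exponential kernel acting on z_r, so it
  enters the last constant, through 1/(1-\<eta>), and not \<kappa>.\<close>

definition in_ell2 :: "('i \<Rightarrow> complex) \<Rightarrow> bool" where
  "in_ell2 f \<longleftrightarrow> (\<exists>B. \<forall>F. finite F \<longrightarrow> L2_set (\<lambda>i. cmod (f i)) F \<le> B)"

lemma in_ell2I: "(\<And>F. finite F \<Longrightarrow> L2_set (\<lambda>i. cmod (f i)) F \<le> B) \<Longrightarrow> in_ell2 f"
  unfolding in_ell2_def by blast

text \<open>A type of coordinate families gives a genuine Banach space, to which derivatives,
  integrals and fixed point theorems apply. The scalars of the normed space are real, as only real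
  combinations occur in time, while the components are complex.\<close>

typedef 'i ell2 = "{f :: 'i \<Rightarrow> complex. in_ell2 f}"
  morphisms ec mk_ell2
  by (intro exI[of _ "\<lambda>_. 0"]) (auto simp: in_ell2_def L2_set_def)

setup_lifting type_definition_ell2

lemma in_ell2_ec: "in_ell2 (ec x)"
  using ec by auto

lemma ec_mk: "in_ell2 f \<Longrightarrow> ec (mk_ell2 f) = f"
  by (simp add: mk_ell2_inverse)

lemma ell2_eqI: "(\<And>i. ec x i = ec y i) \<Longrightarrow> x = y"
  by (metis ec_inject ext)

lemma L2_set_cmod_add:
  "L2_set (\<lambda>i. cmod (f i + g i)) F \<le> L2_set (\<lambda>i. cmod (f i)) F + L2_set (\<lambda>i. cmod (g i)) F"
  by (rule order_trans[OF L2_set_mono L2_set_triangle_ineq]) (auto intro: norm_triangle_ineq)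

lemma in_ell2_add: "in_ell2 f \<Longrightarrow> in_ell2 g \<Longrightarrow> in_ell2 (\<lambda>i. f i + g i)"
proof -
  assume "in_ell2 f" "in_ell2 g"
  then obtain B C where B: "\<And>F. finite F \<Longrightarrow> L2_set (\<lambda>i. cmod (f i)) F \<le> B"
    and C: "\<And>F. finite F \<Longrightarrow> L2_set (\<lambda>i. cmod (g i)) F \<le> C"
    unfolding in_ell2_def by blast
  show ?thesis
    by (rule in_ell2I[of _ "B + C"]) (rule order_trans[OF L2_set_cmod_add add_mono], auto intro: B C)
qed

lemma L2_set_mult_le:
  assumes "\<And>i. i \<in> F \<Longrightarrow> cmod (g i) \<le> c" "0 \<le> c"
  shows "L2_set (\<lambda>i. cmod (g i * f i)) F \<le> c * L2_set (\<lambda>i. cmod (f i)) F"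
proof -
  have "L2_set (\<lambda>i. cmod (g i * f i)) F \<le> L2_set (\<lambda>i. c * cmod (f i)) F"
    by (rule L2_set_mono) (auto simp: norm_mult assms intro!: mult_right_mono)
  also have "\<dots> = c * L2_set (\<lambda>i. cmod (f i)) F"
    using assms(2) by (simp add: L2_set_right_distrib)
  finally show ?thesis .
qed

lemma in_ell2_mult:
  assumes "\<And>i. cmod (g i) \<le> c" "in_ell2 f"
  shows "in_ell2 (\<lambda>i. g i * f i)"
proof -
  have c: "0 \<le> c" using order_trans[OF norm_ge_zero assms(1)] .
  obtain B where B: "\<And>F. finite F \<Longrightarrow> L2_set (\<lambda>i. cmod (f i)) F \<le> B"
    using assms unfolding in_ell2_def by blast
  show ?thesis
    by (rule in_ell2I[of _ "c * B"])
      (rule order_trans[OF L2_set_mult_le[OF assms(1) c]], auto intro!: mult_left_mono B c)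
qed

lemma in_ell2_scaleR: "in_ell2 f \<Longrightarrow> in_ell2 (\<lambda>i. r *\<^sub>R f i)"
  using in_ell2_mult[of "\<lambda>_. of_real r" "\<bar>r\<bar>"] by (simp add: scaleR_conv_of_real)

lemma in_ell2_uminus: "in_ell2 f \<Longrightarrow> in_ell2 (\<lambda>i. - f i)"
  by (simp add: in_ell2_def)

lemma in_ell2_diff: "in_ell2 f \<Longrightarrow> in_ell2 g \<Longrightarrow> in_ell2 (\<lambda>i. f i - g i)"
  using in_ell2_add[of f "\<lambda>i. - g i"] in_ell2_uminus[of g] by simp

lemma in_ell2_zero: "in_ell2 (\<lambda>_. 0)"
  by (auto simp: in_ell2_def L2_set_def)

instantiation ell2 :: (type) real_normed_vector
begin

lift_definition zero_ell2 :: "'a ell2" is "\<lambda>_. 0" by (rule in_ell2_zero)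
lift_definition plus_ell2 :: "'a ell2 \<Rightarrow> 'a ell2 \<Rightarrow> 'a ell2" is "\<lambda>f g i. f i + g i"
  by (rule in_ell2_add)
lift_definition minus_ell2 :: "'a ell2 \<Rightarrow> 'a ell2 \<Rightarrow> 'a ell2" is "\<lambda>f g i. f i - g i"
  by (rule in_ell2_diff)
lift_definition uminus_ell2 :: "'a ell2 \<Rightarrow> 'a ell2" is "\<lambda>f i. - f i"
  by (rule in_ell2_uminus)
lift_definition scaleR_ell2 :: "real \<Rightarrow> 'a ell2 \<Rightarrow> 'a ell2" is "\<lambda>r f i. r *\<^sub>R f i"
  by (rule in_ell2_scaleR)
definition norm_ell2 :: "'a ell2 \<Rightarrow> real" where
  "norm_ell2 x = (SUP F\<in>Collect finite. L2_set (\<lambda>i. cmod (ec x i)) F)"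
definition dist_ell2 :: "'a ell2 \<Rightarrow> 'a ell2 \<Rightarrow> real" where "dist_ell2 x y = norm (x - y)"
definition sgn_ell2 :: "'a ell2 \<Rightarrow> 'a ell2" where "sgn_ell2 x = scaleR (inverse (norm x)) x"
definition uniformity_ell2 :: "('a ell2 \<times> 'a ell2) filter" where
  "uniformity_ell2 = (INF e\<in>{0<..}. principal {(x, y). dist x y < e})"
definition open_ell2 :: "'a ell2 set \<Rightarrow> bool" where
  "open_ell2 U = (\<forall>x\<in>U. \<forall>\<^sub>F (x', y) in uniformity. x' = x \<longrightarrow> y \<in> U)"

lemma L2_set_le_norm_ell2: "finite F \<Longrightarrow> L2_set (\<lambda>i. cmod (ec x i)) F \<le> norm x"
proof -
  assume F: "finite F"
  obtain B where "\<And>F. finite F \<Longrightarrow> L2_set (\<lambda>i. cmod (ec x i)) F \<le> B"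
    using in_ell2_ec[of x] unfolding in_ell2_def by blast
  then have "bdd_above ((\<lambda>F. L2_set (\<lambda>i. cmod (ec x i)) F) ` Collect finite)"
    by (intro bdd_aboveI2[of _ _ B]) simp
  then show ?thesis unfolding norm_ell2_def by (rule cSUP_upper[rotated]) (use F in simp)
qed

lemma norm_ell2_le: "(\<And>F. finite F \<Longrightarrow> L2_set (\<lambda>i. cmod (ec x i)) F \<le> B) \<Longrightarrow> norm x \<le> B"
  unfolding norm_ell2_def by (rule cSUP_least) (auto intro: exI[of _ "{}"])

lemma cmod_ec_le: "cmod (ec x i) \<le> norm x"
  using L2_set_le_norm_ell2[of "{i}" x] by simp

instance
proof
  fix x y :: "'a ell2" and r s :: real
  show "x + y + z = x + (y + z)" "x + y = y + x" "0 + x = x" "- x + x = 0" "x - y = x + - y" for z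
    by (rule ell2_eqI, simp add: zero_ell2.rep_eq plus_ell2.rep_eq minus_ell2.rep_eq
        uminus_ell2.rep_eq algebra_simps)+
  show "r *\<^sub>R (x + y) = r *\<^sub>R x + r *\<^sub>R y" "(r + s) *\<^sub>R x = r *\<^sub>R x + s *\<^sub>R x"
    "r *\<^sub>R s *\<^sub>R x = (r * s) *\<^sub>R x" "1 *\<^sub>R x = x"
    by (rule ell2_eqI, simp add: plus_ell2.rep_eq scaleR_ell2.rep_eq algebra_simps)+
  show "dist x y = norm (x - y)" "sgn x = inverse (norm x) *\<^sub>R x" by (simp_all add: dist_ell2_def sgn_ell2_def)
  show "uniformity = (INF e\<in>{0<..}. principal {(x, y :: 'a ell2). dist x y < e})"
    by (simp add: uniformity_ell2_def)
  show "open U \<longleftrightarrow> (\<forall>x\<in>U. \<forall>\<^sub>F (x', y) in uniformity. x' = x \<longrightarrow> y \<in> U)" for U :: "'a ell2 set"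
    by (simp add: open_ell2_def)
  have nonneg: "0 \<le> norm y" for y :: "'a ell2"
    using L2_set_le_norm_ell2[of "{}" y] by simp
  have n0: "norm (0 :: 'a ell2) = 0"
    by (intro antisym nonneg norm_ell2_le) (simp add: zero_ell2.rep_eq L2_set_def)
  show "norm x = 0 \<longleftrightarrow> x = 0"
  proof
    assume "norm x = 0"
    then have "ec x i = 0" for i using cmod_ec_le[of x i] by simp
    then show "x = 0" by (intro ell2_eqI) (simp add: zero_ell2.rep_eq)
  qed (use n0 in simp)
  show "norm (x + y) \<le> norm x + norm y"
    by (rule norm_ell2_le, unfold plus_ell2.rep_eq)
      (rule order_trans[OF L2_set_cmod_add add_mono], auto intro: L2_set_le_norm_ell2)
  \<comment> \<open>Applied once more with \<open>1 / r\<close> in place of \<open>r\<close>, this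
    inequality yields its own converse.\<close>
  have le: "norm (r *\<^sub>R x) \<le> \<bar>r\<bar> * norm x" for r and x :: "'a ell2"
  proof (rule norm_ell2_le, unfold scaleR_ell2.rep_eq norm_scaleR)
    fix F :: "'a set" assume "finite F"
    then show "L2_set (\<lambda>i. \<bar>r\<bar> * cmod (ec x i)) F \<le> \<bar>r\<bar> * norm x"
      by (simp add: L2_set_right_distrib[symmetric] mult_left_mono L2_set_le_norm_ell2)
  qed
  show "norm (r *\<^sub>R x) = \<bar>r\<bar> * norm x"
  proof (cases "r = 0")
    case True
    then show ?thesis using le[of r x] nonneg[of "r *\<^sub>R x"] by simp
  next
    case False
    have eq: "(1 / r) *\<^sub>R r *\<^sub>R x = x" using False by (intro ell2_eqI) (simp add: scaleR_ell2.rep_eq)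
    have "norm x \<le> \<bar>1 / r\<bar> * norm (r *\<^sub>R x)" using le[of "1 / r" "r *\<^sub>R x"] unfolding eq .
    then have "\<bar>r\<bar> * norm x \<le> norm (r *\<^sub>R x)" using False by (simp add: field_simps abs_divide)
    with le[of r x] show ?thesis by simp
  qed
qed
end

lemmas ec_simps [simp] =
  zero_ell2.rep_eq plus_ell2.rep_eq minus_ell2.rep_eq uminus_ell2.rep_eq scaleR_ell2.rep_eq

lemma sum_cmod_sq_le_norm: "finite F \<Longrightarrow> (\<Sum>i\<in>F. (cmod (ec x i))\<^sup>2) \<le> (norm x)\<^sup>2"
  using power_mono[OF L2_set_le_norm_ell2[of F x] L2_set_nonneg, of 2]
  by (simp add: L2_set_def sum_nonneg)

lemma norm_ell2_sq_le:
  assumes "\<And>F. finite F \<Longrightarrow> (\<Sum>i\<in>F. (cmod (ec x i))\<^sup>2) \<le> B\<^sup>2" "0 \<le> B"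
  shows "norm x \<le> B"
  by (rule norm_ell2_le) (simp add: L2_set_def real_le_lsqrt assms)

lemma in_ell2_sqI:
  assumes "\<And>F. finite F \<Longrightarrow> (\<Sum>i\<in>F. (cmod (f i))\<^sup>2) \<le> B"
  shows "in_ell2 f"
  by (rule in_ell2I[of _ "sqrt B"]) (simp add: L2_set_def assms)

lemma bounded_linear_ec [bounded_linear]: "bounded_linear (\<lambda>x. ec x i)"
  by (rule bounded_linear_intro[of _ 1]) (auto simp: cmod_ec_le)

lemma continuous_on_ec: "continuous_on S f \<Longrightarrow> continuous_on S (\<lambda>t. ec (f t) i)"
  by (rule bounded_linear.continuous_on[OF bounded_linear_ec])

text \<open>The candidate is the componentwise limit. On a finite index set the Cauchy bound passes
  to the limit, with a threshold independent of the set; this gives both square-summability of the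
  limit and convergence in norm.\<close>

instance ell2 :: (type) banach
proof
  fix X :: "nat \<Rightarrow> 'a ell2"
  assume X: "Cauchy X"
  have "Cauchy (\<lambda>n. ec (X n) i)" for i
    by (rule bounded_linear.Cauchy[OF bounded_linear_ec X])
  then obtain l where l: "\<And>i. (\<lambda>n. ec (X n) i) \<longlonglongrightarrow> l i"
    unfolding Cauchy_convergent_iff convergent_def by metis
  have key: "\<exists>N. \<forall>n\<ge>N. \<forall>F. finite F \<longrightarrow> L2_set (\<lambda>i. cmod (l i - ec (X n) i)) F \<le> e" if "e > 0" for e
  proof -
    obtain N where N: "\<And>m n. m \<ge> N \<Longrightarrow> n \<ge> N \<Longrightarrow> norm (X m - X n) < e"
      using X \<open>e > 0\<close> unfolding Cauchy_iff by blast
    have "L2_set (\<lambda>i. cmod (l i - ec (X n) i)) F \<le> e" if n: "n \<ge> N" and F: "finite F" for n F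
    proof (rule LIMSEQ_le_const2)
      show "(\<lambda>m. L2_set (\<lambda>i. cmod (ec (X m) i - ec (X n) i)) F)
        \<longlonglongrightarrow> L2_set (\<lambda>i. cmod (l i - ec (X n) i)) F"
        unfolding L2_set_def by (intro tendsto_intros l)
      show "\<exists>M. \<forall>m\<ge>M. L2_set (\<lambda>i. cmod (ec (X m) i - ec (X n) i)) F \<le> e"
      proof (intro exI[of _ N] allI impI)
        fix m assume "N \<le> m"
        then show "L2_set (\<lambda>i. cmod (ec (X m) i - ec (X n) i)) F \<le> e"
          using L2_set_le_norm_ell2[OF F, of "X m - X n"] N[of m n] n by auto
      qed
    qed
    then show ?thesis by blast
  qed
  have l2: "in_ell2 l"
  proof -
    obtain N where N: "\<And>F. finite F \<Longrightarrow> L2_set (\<lambda>i. cmod (l i - ec (X N) i)) F \<le> 1"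
      using key[of 1] by auto
    have "in_ell2 (\<lambda>i. l i - ec (X N) i)" by (rule in_ell2I[of _ 1]) (rule N)
    then have "in_ell2 (\<lambda>i. (l i - ec (X N) i) + ec (X N) i)" by (rule in_ell2_add[OF _ in_ell2_ec])
    then show ?thesis by simp
  qed
  have "X \<longlonglongrightarrow> mk_ell2 l"
  proof (rule LIMSEQ_I)
    fix r :: real assume "r > 0"
    then obtain N where N: "\<And>n F. n \<ge> N \<Longrightarrow> finite F \<Longrightarrow>
        L2_set (\<lambda>i. cmod (l i - ec (X n) i)) F \<le> r / 2"
      using key[of "r / 2"] by auto
    have "norm (X n - mk_ell2 l) < r" if "n \<ge> N" for n
    proof -
      have "norm (X n - mk_ell2 l) \<le> r / 2"
        using N[OF that] by (intro norm_ell2_le) (simp add: ec_mk[OF l2] norm_minus_commute)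
      then show ?thesis using \<open>r > 0\<close> by simp
    qed
    then show "\<exists>N. \<forall>n\<ge>N. norm (X n - mk_ell2 l) < r"
      by blast
  qed
  then show "convergent X" by (auto simp: convergent_def)
qed

text \<open>Used with finite \<open>F\<close> for approximation, and with the set of high modes as a
  projection.\<close>

definition ell2_trunc :: "'i set \<Rightarrow> 'i ell2 \<Rightarrow> 'i ell2" where
  "ell2_trunc F x = mk_ell2 (\<lambda>i. if i \<in> F then ec x i else 0)"

lemma ec_ell2_trunc [simp]: "ec (ell2_trunc F x) i = (if i \<in> F then ec x i else 0)"
proof -
  have "(\<lambda>i. if i \<in> F then ec x i else 0) = (\<lambda>i. of_bool (i \<in> F) * ec x i)" by auto
  then have "in_ell2 (\<lambda>i. if i \<in> F then ec x i else 0)"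
    using in_ell2_mult[OF _ in_ell2_ec, of "\<lambda>i. of_bool (i \<in> F)" 1 x] by simp
  then show ?thesis unfolding ell2_trunc_def by (simp add: ec_mk)
qed

lemma tendsto_ell2_trunc:
  "((\<lambda>F. ell2_trunc F x) \<longlongrightarrow> x) (finite_subsets_at_top UNIV)"
proof (rule tendstoI)
  fix e :: real assume e: "e > 0"
  \<comment> \<open>Otherwise \<open>(norm x)\<^sup>2 - (e / 2)\<^sup>2\<close> would bound all
    finite partial sums, hence the square of the norm itself.\<close>
  have "\<exists>F0. finite F0 \<and> (norm x)\<^sup>2 - (e / 2)\<^sup>2 < (\<Sum>i\<in>F0. (cmod (ec x i))\<^sup>2)"
  proof (rule ccontr)
    assume "\<not> ?thesis"
    then have *: "\<And>F. finite F \<Longrightarrow> (\<Sum>i\<in>F. (cmod (ec x i))\<^sup>2) \<le> (norm x)\<^sup>2 - (e / 2)\<^sup>2"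
      by (meson not_le)
    have nn: "0 \<le> (norm x)\<^sup>2 - (e / 2)\<^sup>2" using *[of "{}"] by simp
    have "norm x \<le> sqrt ((norm x)\<^sup>2 - (e / 2)\<^sup>2)"
      by (rule norm_ell2_sq_le) (use * nn in auto)
    from power_mono[OF this norm_ge_zero, of 2]
    have "(norm x)\<^sup>2 \<le> (norm x)\<^sup>2 - (e / 2)\<^sup>2"
      by (simp only: real_sqrt_pow2[OF nn])
    then show False using e by simp
  qed
  then obtain F0 where F0: "finite F0" "(norm x)\<^sup>2 - (e / 2)\<^sup>2 < (\<Sum>i\<in>F0. (cmod (ec x i))\<^sup>2)" by blast
  have "dist (ell2_trunc F x) x < e" if F: "finite F" "F0 \<subseteq> F" for F
  proof -
    have "norm (ell2_trunc F x - x) \<le> e / 2"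
    proof (rule norm_ell2_sq_le)
      fix G :: "'a set" assume G: "finite G"
      have "(\<Sum>i\<in>G. (cmod (ec (ell2_trunc F x - x) i))\<^sup>2) = (\<Sum>i\<in>G - F. (cmod (ec x i))\<^sup>2)"
        by (rule sum.mono_neutral_cong_right[OF G]) auto
      also have "\<dots> = (\<Sum>i\<in>(G - F) \<union> F. (cmod (ec x i))\<^sup>2) - (\<Sum>i\<in>F. (cmod (ec x i))\<^sup>2)"
        using F G by (subst sum.union_disjoint) auto
      also have "\<dots> \<le> (norm x)\<^sup>2 - (\<Sum>i\<in>F0. (cmod (ec x i))\<^sup>2)"
        using sum_cmod_sq_le_norm[of "(G - F) \<union> F" x] F G
          sum_mono2[of F F0 "\<lambda>i. (cmod (ec x i))\<^sup>2"] by simp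
      finally show "(\<Sum>i\<in>G. (cmod (ec (ell2_trunc F x - x) i))\<^sup>2) \<le> (e / 2)\<^sup>2"
        using F0 by simp
    qed (use e in simp)
    then show ?thesis using e by (simp add: dist_norm)
  qed
  then show "\<forall>\<^sub>F F in finite_subsets_at_top UNIV. dist (ell2_trunc F x) x < e"
    unfolding eventually_finite_subsets_at_top using F0(1) by (intro exI[of _ F0]) auto
qed

definition ell2_mult :: "('i \<Rightarrow> complex) \<Rightarrow> 'i ell2 \<Rightarrow> 'i ell2" where
  "ell2_mult g x = mk_ell2 (\<lambda>i. g i * ec x i)"

lemma ec_ell2_mult:
  assumes "\<And>i. cmod (g i) \<le> c"
  shows "ec (ell2_mult g x) i = g i * ec x i"
  unfolding ell2_mult_def using in_ell2_mult[OF assms in_ell2_ec[of x]] by (simp add: ec_mk)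

lemma norm_ell2_mult_le:
  assumes "\<And>i. cmod (g i) \<le> c"
  shows "norm (ell2_mult g x) \<le> c * norm x"
proof (rule norm_ell2_le)
  fix F :: "'a set" assume F: "finite F"
  have c: "0 \<le> c" using order_trans[OF norm_ge_zero assms] .
  have "L2_set (\<lambda>i. cmod (ec (ell2_mult g x) i)) F \<le> c * L2_set (\<lambda>i. cmod (ec x i)) F"
    unfolding ec_ell2_mult[of g c, OF assms] by (rule L2_set_mult_le[OF assms c])
  also have "\<dots> \<le> c * norm x" by (intro mult_left_mono L2_set_le_norm_ell2 F c)
  finally show "L2_set (\<lambda>i. cmod (ec (ell2_mult g x) i)) F \<le> c * norm x" .
qed

text \<open>Cauchy-Schwarz on finite sets. The pairing is bilinear, without conjugation; it will
  represent the functional \<open>tail\<close>.\<close>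

lemma ell2_pairing_summable:
  "(\<lambda>i. norm (ec x i * ec y i)) summable_on UNIV" (is ?A)
  "cmod (\<Sum>\<^sub>\<infinity>i. ec x i * ec y i) \<le> norm x * norm y" (is ?B)
proof -
  have b: "(\<Sum>i\<in>F. norm (ec x i * ec y i)) \<le> norm x * norm y" if F: "finite F" for F
  proof -
    have "(\<Sum>i\<in>F. norm (ec x i * ec y i)) \<le>
        L2_set (\<lambda>i. cmod (ec x i)) F * L2_set (\<lambda>i. cmod (ec y i)) F"
      using L2_set_mult_ineq[of "\<lambda>i. cmod (ec x i)" "\<lambda>i. cmod (ec y i)" F] by (simp add: norm_mult)
    also have "\<dots> \<le> norm x * norm y"
      by (intro mult_mono L2_set_le_norm_ell2 F L2_set_nonneg norm_ge_zero)
    finally show ?thesis .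
  qed
  show A: ?A
    by (rule nonneg_bdd_above_summable_on) (auto simp: bdd_above_def intro!: exI[of _ "norm x * norm y"] b)
  have "cmod (\<Sum>\<^sub>\<infinity>i. ec x i * ec y i) \<le> (\<Sum>\<^sub>\<infinity>i. norm (ec x i * ec y i))"
    by (rule norm_infsum_bound[OF A])
  also have "\<dots> \<le> norm x * norm y"
    by (rule infsum_le_finite_sums[OF A]) (use b in auto)
  finally show ?B .
qed

section \<open>Semilinear equations with a diagonal generator\<close>

lemma norm_ell2_finite_support:
  assumes "finite F" "\<And>i. i \<notin> F \<Longrightarrow> ec x i = 0"
  shows "norm x \<le> (\<Sum>i\<in>F. cmod (ec x i))"
proof (rule norm_ell2_le)
  fix G :: "'a set" assume G: "finite G"
  have "L2_set (\<lambda>i. cmod (ec x i)) G \<le> (\<Sum>i\<in>G. cmod (ec x i))"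
    by (rule L2_set_le_sum) auto
  also have "\<dots> = (\<Sum>i\<in>G \<inter> F. cmod (ec x i))"
    using G assms(2) by (intro sum.mono_neutral_right) auto
  also have "\<dots> \<le> (\<Sum>i\<in>F. cmod (ec x i))"
    using assms(1) by (intro sum_mono2) auto
  finally show "L2_set (\<lambda>i. cmod (ec x i)) G \<le> (\<Sum>i\<in>F. cmod (ec x i))" .
qed

lemma has_integral_exp_decay:
  fixes a t :: real
  assumes "a \<noteq> 0" "0 \<le> t"
  shows "((\<lambda>s. exp (- a * (t - s))) has_integral (1 - exp (- a * t)) / a) {0..t}"
proof -
  have "((\<lambda>s. exp (- a * (t - s))) has_integral
      exp (- a * (t - t)) / a - exp (- a * (t - 0)) / a) {0..t}"
    by (rule fundamental_theorem_of_calculus[OF assms(2)])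
      (auto intro!: derivative_eq_intros simp: has_real_derivative_iff_has_vector_derivative[symmetric] assms)
  then show ?thesis by (simp add: diff_divide_distrib)
qed

lemma has_vector_derivative_integral_atLeast:
  fixes g :: "real \<Rightarrow> 'a::banach"
  assumes g: "continuous_on {0..} g" and t: "0 \<le> t"
  shows "((\<lambda>s. integral {0..s} g) has_vector_derivative g t) (at t within {0..})"
proof -
  have "((\<lambda>s. integral {0..s} g) has_vector_derivative g t) (at t within {0..t + 1})"
    by (rule integral_has_vector_derivative) (use t g in \<open>auto intro: continuous_on_subset\<close>)
  moreover have at_eq: "at t within {0..t + 1} = at t within {0..}"
    by (rule at_within_nhd[of t "{..<t + 1}"]) (use t in auto)
  ultimately show ?thesis by (simp only: at_eq)
qed

text \<open>The integrating factor removes the term in \<open>y\<close>: the derivative of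
  \<open>exp ((t - s) m) y s\<close> in \<open>s\<close> is \<open>exp ((t - s) m) h s\<close>. The
  fundamental theorem of calculus then applies without regularity of \<open>h\<close>.\<close>

lemma scalar_variation_of_constants:
  fixes y h :: "real \<Rightarrow> complex"
  assumes "0 \<le> t"
    and y: "\<And>s. s \<in> {0..t} \<Longrightarrow> (y has_vector_derivative m * y s + h s) (at s within {0..t})"
  shows "((\<lambda>s. exp (of_real (t - s) * m) * h s) has_integral (y t - exp (of_real t * m) * y 0)) {0..t}"
proof -
  have e: "((\<lambda>s. exp (of_real (t - s) * m)) has_vector_derivative - m * exp (of_real (t - s) * m)) (at s within X)" for s X
  proof -
    have "((\<lambda>z. exp ((of_real t - z) * m)) has_field_derivative - m * exp ((of_real t - of_real s) * m))
        (at (of_real s))"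
      by (auto intro!: derivative_eq_intros)
    from has_vector_derivative_real_field[OF this] show ?thesis by simp
  qed
  have "((\<lambda>s. exp (of_real (t - s) * m) * h s) has_integral
      exp (of_real (t - t) * m) * y t - exp (of_real (t - 0) * m) * y 0) {0..t}"
  proof (rule fundamental_theorem_of_calculus[OF assms(1)])
    fix s assume s: "s \<in> {0..t}"
    show "((\<lambda>s. exp (of_real (t - s) * m) * y s) has_vector_derivative
        exp (of_real (t - s) * m) * h s) (at s within {0..t})"
      by (rule has_vector_derivative_eq_rhs[OF has_vector_derivative_mult[OF e y[OF s]]])
        (simp add: algebra_simps)
  qed
  then show ?thesis by simp
qed

lemma scalar_variation_of_constants_converse:
  fixes h :: "real \<Rightarrow> complex" and m x :: complex
  assumes h: "continuous_on {0..} h" and t: "0 \<le> t"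
  defines "y \<equiv> \<lambda>t. exp (of_real t * m) * x + integral {0..t} (\<lambda>s. exp (of_real (t - s) * m) * h s)"
  shows "(y has_vector_derivative m * y t + h t) (at t within {0..})"
proof -
  define g where "g = (\<lambda>s. exp (of_real (- s) * m) * h s)"
  have g: "continuous_on {0..} g" unfolding g_def by (intro continuous_intros h)
  \<comment> \<open>With the exponential of the upper limit taken out, the integrand no longer
    depends on that limit and the product rule applies.\<close>
  have yeq: "y s = exp (of_real s * m) * (x + integral {0..s} g)" for s
  proof -
    have "exp (of_real (s - r) * m) * h r = exp (of_real s * m) * g r" for r
      by (simp add: g_def exp_add[symmetric] algebra_simps flip: mult.assoc)
    then show ?thesis unfolding y_def by (simp add: distrib_left)
  qed
  have e: "((\<lambda>s. exp (of_real s * m)) has_vector_derivative m * exp (of_real s * m)) (at s within X)" for s X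
  proof -
    have "((\<lambda>z. exp (z * m)) has_field_derivative m * exp (of_real s * m)) (at (of_real s))"
      by (auto intro!: derivative_eq_intros)
    from has_vector_derivative_real_field[OF this] show ?thesis by simp
  qed
  have i: "((\<lambda>s. integral {0..s} g) has_vector_derivative g t) (at t within {0..})"
    by (rule has_vector_derivative_integral_atLeast[OF g t])
  have "((\<lambda>s. exp (of_real s * m) * (x + integral {0..s} g)) has_vector_derivative
      m * y t + h t) (at t within {0..})"
    by (rule has_vector_derivative_eq_rhs[OF has_vector_derivative_mult[OF e has_vector_derivative_add[OF has_vector_derivative_const i]]])
      (simp add: yeq g_def algebra_simps exp_minus)
  then show ?thesis unfolding yeq[abs_def] .
qed

section \<open>The diagonal semigroup and its mild solutions\<close>

locale decaying_spectrum =
  fixes m :: "'i \<Rightarrow> complex" and w :: real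
  assumes w_pos: "w > 0" and Re_m: "\<And>i. Re (m i) \<le> - w"
begin

text \<open>The cutoff makes \<open>E t\<close> the identity for negative \<open>t\<close>, where
  the exponential factors could be unbounded.\<close>

definition E :: "real \<Rightarrow> 'i ell2 \<Rightarrow> 'i ell2" where
  "E t = ell2_mult (\<lambda>i. exp (of_real (max 0 t) * m i))"

lemma cmod_exp_le: "0 \<le> t \<Longrightarrow> cmod (exp (of_real (max 0 t) * m i)) \<le> exp (- w * t)"
  using mult_left_mono[OF Re_m[of i], of t] by (simp add: mult.commute)

lemma ec_E: "0 \<le> t \<Longrightarrow> ec (E t x) i = exp (of_real t * m i) * ec x i"
  unfolding E_def by (subst ec_ell2_mult[OF cmod_exp_le]) auto

lemma norm_E_le: "0 \<le> t \<Longrightarrow> norm (E t x) \<le> exp (- w * t) * norm x"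
  unfolding E_def by (rule norm_ell2_mult_le[OF cmod_exp_le])

lemma norm_E_le': "0 \<le> t \<Longrightarrow> norm (E t x) \<le> norm x"
  using norm_E_le[of t x] mult_right_mono[of "exp (- w * t)" 1 "norm x"] w_pos by simp

lemma E_diff: "0 \<le> t \<Longrightarrow> E t (x - y) = E t x - E t y"
  by (rule ell2_eqI) (simp add: ec_E algebra_simps)

text \<open>The exponents may be unbounded, so the factors need not be continuous in
  \<open>t\<close> uniformly in the index. Each finite truncation is continuous, and truncations
  converge uniformly in \<open>t\<close> because \<open>E t\<close> is a contraction.\<close>

lemma continuous_on_E: "continuous_on {0..} (\<lambda>t. E t x)"
proof (rule uniform_limit_theorem)
  show "\<forall>\<^sub>F F in finite_subsets_at_top UNIV. continuous_on {0..} (\<lambda>t. E t (ell2_trunc F x))"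
  proof (rule eventually_finite_subsets_at_top_weakI)
    fix F :: "'i set" assume F: "finite F"
    show "continuous_on {0..} (\<lambda>t. E t (ell2_trunc F x))"
      unfolding continuous_on_def
    proof
      fix s :: real assume s: "s \<in> {0..}"
      have "((\<lambda>t. \<Sum>i\<in>F. cmod (exp (of_real t * m i) * ec x i - exp (of_real s * m i) * ec x i))
          \<longlongrightarrow> (\<Sum>i\<in>F. cmod (exp (of_real s * m i) * ec x i - exp (of_real s * m i) * ec x i))) (at s within {0..})"
        by (intro tendsto_intros)
      then have 1: "((\<lambda>t. \<Sum>i\<in>F. cmod (exp (of_real t * m i) * ec x i - exp (of_real s * m i) * ec x i))
          \<longlongrightarrow> 0) (at s within {0..})" by simp
      have "((\<lambda>t. E t (ell2_trunc F x) - E s (ell2_trunc F x)) \<longlongrightarrow> 0) (at s within {0..})"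
      proof (rule Lim_null_comparison[OF _ 1])
        show "\<forall>\<^sub>F t in at s within {0..}. norm (E t (ell2_trunc F x) - E s (ell2_trunc F x))
          \<le> (\<Sum>i\<in>F. cmod (exp (of_real t * m i) * ec x i - exp (of_real s * m i) * ec x i))"
          unfolding eventually_at_filter
        proof (intro always_eventually allI impI)
          fix t :: real assume "t \<in> {0..}"
          then have "norm (E t (ell2_trunc F x) - E s (ell2_trunc F x)) \<le>
            (\<Sum>i\<in>F. cmod (ec (E t (ell2_trunc F x) - E s (ell2_trunc F x)) i))"
            using s by (intro norm_ell2_finite_support F) (simp add: ec_E)
          also have "\<dots> = (\<Sum>i\<in>F. cmod (exp (of_real t * m i) * ec x i - exp (of_real s * m i) * ec x i))"
            using \<open>t \<in> {0..}\<close> s by (intro sum.cong) (auto simp: ec_E)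
          finally show "norm (E t (ell2_trunc F x) - E s (ell2_trunc F x)) \<le> \<dots>" .
        qed
      qed
      then show "((\<lambda>t. E t (ell2_trunc F x)) \<longlongrightarrow> E s (ell2_trunc F x)) (at s within {0..})"
        by (rule LIM_zero_cancel)
    qed
  qed
  show "uniform_limit {0..} (\<lambda>F t. E t (ell2_trunc F x)) (\<lambda>t. E t x) (finite_subsets_at_top UNIV)"
  proof (rule uniform_limitI)
    fix e :: real assume "e > 0"
    with tendsto_ell2_trunc[of x] have "\<forall>\<^sub>F F in finite_subsets_at_top UNIV. dist (ell2_trunc F x) x < e"
      by (rule tendstoD)
    then show "\<forall>\<^sub>F F in finite_subsets_at_top UNIV. \<forall>t\<in>{0..}. dist (E t (ell2_trunc F x)) (E t x) < e"
      by (rule eventually_mono)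
        (auto simp: dist_norm E_diff[symmetric] intro: le_less_trans[OF norm_E_le'])
  qed
qed simp

text \<open>In \<open>E (g p) (h p - h p0) + E (g p) (h p0)\<close>, contractivity makes the first
  term small and strong continuity on a fixed vector handles the second.\<close>

lemma continuous_on_E_joint:
  assumes g: "continuous_on S g" "\<And>p. p \<in> S \<Longrightarrow> 0 \<le> g p" and h: "continuous_on S h"
  shows "continuous_on S (\<lambda>p. E (g p) (h p))"
  unfolding continuous_on_def
proof
  fix p0 assume p0: "p0 \<in> S"
  have "continuous_on S (\<lambda>p. E (g p) (h p0))"
    by (rule continuous_on_compose2[OF continuous_on_E g(1)]) (use g(2) in auto)
  then have 1: "((\<lambda>p. E (g p) (h p0)) \<longlongrightarrow> E (g p0) (h p0)) (at p0 within S)"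
    using p0 by (simp add: continuous_on_def)
  have "((\<lambda>p. norm (h p - h p0)) \<longlongrightarrow> 0) (at p0 within S)"
    using h p0 by (simp add: continuous_on_def tendsto_norm_zero LIM_zero)
  then have 2: "((\<lambda>p. E (g p) (h p - h p0)) \<longlongrightarrow> 0) (at p0 within S)"
    by (rule Lim_null_comparison[rotated])
      (auto simp: eventually_at_filter g(2) intro!: always_eventually norm_E_le')
  have "((\<lambda>p. E (g p) (h p - h p0) + E (g p) (h p0)) \<longlongrightarrow> 0 + E (g p0) (h p0)) (at p0 within S)"
    by (rule tendsto_add[OF 2 1])
  moreover have "\<forall>\<^sub>F p in at p0 within S. E (g p) (h p - h p0) + E (g p) (h p0) = E (g p) (h p)"
    by (auto simp: eventually_at_filter E_diff g(2) intro!: always_eventually)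
  ultimately show "((\<lambda>p. E (g p) (h p)) \<longlongrightarrow> E (g p0) (h p0)) (at p0 within S)"
    using Lim_transform_eventually by fastforce
qed

text \<open>
  The equation \<open>U' = m U + H\<close> is only required componentwise, so that \<open>U\<close> need not lie in the domain of
  the multiplication operator \<open>m\<close>: these are the mild solutions.
\<close>

definition modal_solution :: "real set \<Rightarrow> (real \<Rightarrow> 'i ell2) \<Rightarrow> (real \<Rightarrow> 'i ell2) \<Rightarrow> bool" where
  "modal_solution S U H \<longleftrightarrow> continuous_on S U \<and> continuous_on S H \<and>
    (\<forall>i. \<forall>t\<in>S. ((\<lambda>t. ec (U t) i) has_vector_derivative m i * ec (U t) i + ec (H t) i) (at t within S))"

lemma modal_solution_subset: "modal_solution S U H \<Longrightarrow> S' \<subseteq> S \<Longrightarrow> modal_solution S' U H"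
  unfolding modal_solution_def
  by (meson continuous_on_subset has_vector_derivative_within_subset subsetD)

lemma modal_solution_diff:
  "modal_solution S U H \<Longrightarrow> modal_solution S U' H' \<Longrightarrow> modal_solution S (\<lambda>t. U t - U' t) (\<lambda>t. H t - H' t)"
  unfolding modal_solution_def
  by (auto intro!: continuous_intros has_vector_derivative_eq_rhs[OF has_vector_derivative_diff] simp: algebra_simps)

definition duhamel :: "(real \<Rightarrow> 'i ell2) \<Rightarrow> real \<Rightarrow> 'i ell2" where
  "duhamel H t = integral {0..t} (\<lambda>s. E (t - s) (H s))"

lemma duhamel_integrable:
  assumes "continuous_on {0..t} H"
  shows "(\<lambda>s. E (t - s) (H s)) integrable_on {0..t}"
  by (intro integrable_continuous_interval continuous_on_E_joint continuous_intros assms) auto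

lemma ec_duhamel:
  assumes "continuous_on {0..t} H"
  shows "ec (duhamel H t) i = integral {0..t} (\<lambda>s. exp (of_real (t - s) * m i) * ec (H s) i)"
proof -
  have "ec (duhamel H t) i = integral {0..t} ((\<lambda>x. ec x i) \<circ> (\<lambda>s. E (t - s) (H s)))"
    unfolding duhamel_def by (rule integral_linear[OF duhamel_integrable[OF assms] bounded_linear_ec, symmetric])
  also have "\<dots> = integral {0..t} (\<lambda>s. exp (of_real (t - s) * m i) * ec (H s) i)"
    by (rule integral_cong) (simp add: ec_E)
  finally show ?thesis .
qed

lemma norm_duhamel_le:
  assumes "continuous_on {0..t} H" "continuous_on {0..t} b" "\<And>s. s \<in> {0..t} \<Longrightarrow> norm (H s) \<le> b s"
  shows "norm (duhamel H t) \<le> integral {0..t} (\<lambda>s. exp (- w * (t - s)) * b s)"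
  unfolding duhamel_def
proof (rule integral_norm_bound_integral)
  show "(\<lambda>s. E (t - s) (H s)) integrable_on {0..t}" by (rule duhamel_integrable[OF assms(1)])
  show "(\<lambda>s. exp (- w * (t - s)) * b s) integrable_on {0..t}"
    by (intro integrable_continuous_interval continuous_intros assms(2))
  fix s assume s: "s \<in> {0..t}"
  then have "norm (E (t - s) (H s)) \<le> exp (- w * (t - s)) * norm (H s)" by (intro norm_E_le) auto
  also have "\<dots> \<le> exp (- w * (t - s)) * b s" by (intro mult_left_mono assms(3) s) auto
  finally show "norm (E (t - s) (H s)) \<le> exp (- w * (t - s)) * b s" .
qed

text \<open>Both the domain of integration and the integrand depend on \<open>t\<close>. The
  substitution \<open>s = t r\<close> moves the dependence into an integrand over
  \<open>{0..1}\<close>; at \<open>t = 0\<close> it degenerates, hence the case distinction.\<close>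

lemma continuous_on_duhamel:
  assumes "continuous_on {0..} H"
  shows "continuous_on {0..} (duhamel H)"
proof -
  have "continuous_on ({0..} \<times> cbox 0 1) (\<lambda>p. E (fst p * (1 - snd p)) (H (fst p * snd p)))"
    by (intro continuous_on_E_joint continuous_intros continuous_on_compose2[OF assms])
      (auto simp: mult_nonneg_nonneg)
  then have "continuous_on ({0..} \<times> cbox 0 1) (\<lambda>(t, r). E (t * (1 - r)) (H (t * r)))"
    by (simp add: case_prod_unfold)
  then have "continuous_on {0..} (\<lambda>t. integral (cbox 0 1) (\<lambda>r. E (t * (1 - r)) (H (t * r))))"
    by (rule integral_continuous_on_param)
  then have c: "continuous_on {0..} (\<lambda>t. t *\<^sub>R integral {0..1} (\<lambda>r. E (t * (1 - r)) (H (t * r))))"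
    by (intro continuous_intros) simp
  have "duhamel H t = t *\<^sub>R integral {0..1} (\<lambda>r. E (t * (1 - r)) (H (t * r)))" if "t \<in> {0..}" for t
  proof (cases "t = 0")
    case False
    with that have t: "t > 0" by simp
    have "((\<lambda>s. E (t - s) (H s)) has_integral duhamel H t) (cbox 0 t)"
      unfolding duhamel_def cbox_interval
      by (rule integrable_integral[OF duhamel_integrable]) (auto intro: continuous_on_subset[OF assms])
    from has_integral_affinity[OF this False, of 0]
    have "((\<lambda>r. E (t * (1 - r)) (H (t * r))) has_integral (1 / t) *\<^sub>R duhamel H t) ((\<lambda>x. x / t) ` {0..t})"
      using t by (simp add: algebra_simps)
    moreover have "(\<lambda>x. x / t) ` {0..t} = {0..1}"
    proof -
      have "x \<in> (\<lambda>x. x / t) ` {0..t}" if "0 \<le> x" "x \<le> 1" for x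
        using t that by (intro image_eqI[of _ _ "t * x"]) (auto simp: mult_left_le)
      then show ?thesis using t by auto
    qed
    ultimately have "integral {0..1} (\<lambda>r. E (t * (1 - r)) (H (t * r))) = (1 / t) *\<^sub>R duhamel H t"
      by (simp add: integral_unique)
    then show ?thesis using t by simp
  qed (simp add: duhamel_def)
  then show ?thesis using c by (subst continuous_on_cong[OF refl])
qed

lemma modal_solution_exists:
  assumes "continuous_on {0..} H"
  shows "modal_solution {0..} (\<lambda>t. E t x + duhamel H t) H" "E 0 x + duhamel H 0 = x"
proof -
  show "modal_solution {0..} (\<lambda>t. E t x + duhamel H t) H"
    unfolding modal_solution_def
  proof (intro conjI allI ballI)
    show "continuous_on {0..} (\<lambda>t. E t x + duhamel H t)"
      by (intro continuous_intros continuous_on_E continuous_on_duhamel assms)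
    fix i and t :: real assume t: "t \<in> {0..}"
    have *: "ec (E t x + duhamel H t) i = exp (of_real t * m i) * ec x i +
        integral {0..t} (\<lambda>s. exp (of_real (t - s) * m i) * ec (H s) i)" if "t \<in> {0..}" for t
      using that by (subst ec_simps(2), subst ec_E, simp, subst ec_duhamel)
        (auto intro: continuous_on_subset[OF assms])
    have "((\<lambda>t. exp (of_real t * m i) * ec x i + integral {0..t} (\<lambda>s. exp (of_real (t - s) * m i) * ec (H s) i))
        has_vector_derivative m i * ec (E t x + duhamel H t) i + ec (H t) i) (at t within {0..})"
      unfolding *[OF t] using t
      by (intro scalar_variation_of_constants_converse continuous_on_ec assms) simp
    then show "((\<lambda>t. ec (E t x + duhamel H t) i) has_vector_derivative
        m i * ec (E t x + duhamel H t) i + ec (H t) i) (at t within {0..})"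
      by (rule has_vector_derivative_transform[OF t, rotated]) (simp only: *)
  qed (rule assms)
  show "E 0 x + duhamel H 0 = x"
    by (rule ell2_eqI) (simp add: ec_E duhamel_def)
qed

text \<open>The componentwise equations determine the family, so every mild solution is given by
  Duhamel's formula.\<close>

lemma modal_solution_formula:
  assumes "modal_solution {0..t} U H" "0 \<le> t"
  shows "U t = E t (U 0) + duhamel H t"
proof (rule ell2_eqI)
  fix i
  have "((\<lambda>s. exp (of_real (t - s) * m i) * ec (H s) i) has_integral
      (ec (U t) i - exp (of_real t * m i) * ec (U 0) i)) {0..t}"
    using assms by (intro scalar_variation_of_constants) (auto simp: modal_solution_def)
  then have "integral {0..t} (\<lambda>s. exp (of_real (t - s) * m i) * ec (H s) i) =
      ec (U t) i - exp (of_real t * m i) * ec (U 0) i" by (rule integral_unique)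
  then show "ec (U t) i = ec (E t (U 0) + duhamel H t) i"
    using assms by (simp add: ec_E ec_duhamel modal_solution_def)
qed

lemma modal_solution_norm_le:
  assumes "modal_solution {0..t} U H" "0 \<le> t"
    and "continuous_on {0..t} b" "\<And>s. s \<in> {0..t} \<Longrightarrow> norm (H s) \<le> b s"
  shows "norm (U t) \<le> exp (- w * t) * norm (U 0) + integral {0..t} (\<lambda>s. exp (- w * (t - s)) * b s)"
proof -
  have "norm (duhamel H t) \<le> integral {0..t} (\<lambda>s. exp (- w * (t - s)) * b s)"
    using assms by (intro norm_duhamel_le) (auto simp: modal_solution_def)
  then show ?thesis
    using norm_E_le[OF assms(2), of "U 0"] norm_triangle_ineq[of "E t (U 0)" "duhamel H t"]
      modal_solution_formula[OF assms(1,2)] by simp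
qed

text \<open>A perturbation of relative size \<open>\<epsilon>\<close> costs exactly
  \<open>\<epsilon>\<close> of the decay rate, and the same reduced rate governs the influence of
  the forcing \<open>g\<close>.\<close>

lemma modal_solution_gronwall:
  assumes sol: "modal_solution {0..t} U H" and t: "0 \<le> t" and g: "continuous_on {0..t} g"
    and eps: "0 \<le> \<epsilon>" and H: "\<And>s. s \<in> {0..t} \<Longrightarrow> norm (H s) \<le> \<epsilon> * norm (U s) + g s"
  shows "norm (U t) \<le> exp (- (w - \<epsilon>) * t) * norm (U 0) +
    integral {0..t} (\<lambda>s. exp (- (w - \<epsilon>) * (t - s)) * g s)"
proof -
  define b where "b = (\<lambda>s. \<epsilon> * norm (U s) + g s)"
  have b: "continuous_on {0..t} b"
    unfolding b_def using sol by (auto simp: modal_solution_def intro!: continuous_intros g)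
  \<comment> \<open>\<open>Q\<close> majorizes \<open>exp (w * r) * norm (U r)\<close> and, unlike a
    norm in general, is differentiable. \<open>R\<close> collects the weighted forcing; the
    combination \<open>Z\<close> introduced below is then nonincreasing.\<close>
  define Q where "Q = (\<lambda>r. norm (U 0) + integral {0..r} (\<lambda>s. exp (w * s) * b s))"
  define R where "R = (\<lambda>r. integral {0..r} (\<lambda>s. exp ((w - \<epsilon>) * s) * g s))"
  have UQ: "exp (w * r) * norm (U r) \<le> Q r" if r: "r \<in> {0..t}" for r
  proof -
    have "norm (U r) \<le> exp (- w * r) * norm (U 0) + integral {0..r} (\<lambda>s. exp (- w * (r - s)) * b s)"
      using r by (intro modal_solution_norm_le[of r U H] modal_solution_subset[OF sol]
          continuous_on_subset[OF b]) (auto simp: b_def H)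
    also have "(\<lambda>s. exp (- w * (r - s)) * b s) = (\<lambda>s. exp (- w * r) * (exp (w * s) * b s))"
      by (auto simp: exp_add[symmetric] algebra_simps simp flip: mult.assoc)
    finally have "norm (U r) \<le> exp (- w * r) * Q r"
      by (simp add: Q_def distrib_left)
    then have "exp (w * r) * norm (U r) \<le> exp (w * r) * (exp (- w * r) * Q r)"
      by (intro mult_left_mono) auto
    then show ?thesis by (simp add: mult.assoc[symmetric] exp_add[symmetric])
  qed
  define Z where "Z = (\<lambda>r. exp (- \<epsilon> * r) * Q r - R r)"
  have Qd: "(Q has_real_derivative exp (w * r) * b r) (at r within {0..t})"
    and Rd: "(R has_real_derivative exp ((w - \<epsilon>) * r) * g r) (at r within {0..t})" if r: "r \<in> {0..t}" for r
    unfolding Q_def R_def has_real_derivative_iff_has_vector_derivative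
    using r by (auto intro!: derivative_eq_intros integral_has_vector_derivative continuous_intros b g)
  have Zd: "(Z has_real_derivative
      (exp (- \<epsilon> * r) * (exp (w * r) * b r) - \<epsilon> * exp (- \<epsilon> * r) * Q r - exp ((w - \<epsilon>) * r) * g r))
      (at r within {0..t})" if "r \<in> {0..t}" for r
    unfolding Z_def by (rule derivative_eq_intros Qd[OF that] Rd[OF that] refl | simp)+
  have "((\<lambda>r. exp (- \<epsilon> * r) * (exp (w * r) * b r) - \<epsilon> * exp (- \<epsilon> * r) * Q r - exp ((w - \<epsilon>) * r) * g r)
      has_integral (Z t - Z 0)) {0..t}"
    by (rule fundamental_theorem_of_calculus[OF t])
      (use Zd in \<open>simp add: has_real_derivative_iff_has_vector_derivative[symmetric]\<close>)
  moreover have "exp (- \<epsilon> * r) * (exp (w * r) * b r) - \<epsilon> * exp (- \<epsilon> * r) * Q r - exp ((w - \<epsilon>) * r) * g r \<le> 0"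
    if r: "r \<in> {0..t}" for r
  proof -
    have "exp ((w - \<epsilon>) * r) = exp (- \<epsilon> * r) * exp (w * r)"
      by (simp add: exp_add[symmetric] algebra_simps)
    then have "exp (- \<epsilon> * r) * (exp (w * r) * b r) - \<epsilon> * exp (- \<epsilon> * r) * Q r - exp ((w - \<epsilon>) * r) * g r
      = \<epsilon> * exp (- \<epsilon> * r) * (exp (w * r) * norm (U r) - Q r)"
      by (simp add: b_def algebra_simps)
    also have "\<dots> \<le> 0"
      using UQ[OF r] eps by (intro mult_nonneg_nonpos) auto
    finally show ?thesis .
  qed
  ultimately have "Z t - Z 0 \<le> 0" by (rule has_integral_le[OF _ has_integral_0])
  then have "exp (- \<epsilon> * t) * Q t \<le> norm (U 0) + R t" by (simp add: Z_def Q_def R_def)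
  then have "exp (\<epsilon> * t) * (exp (- \<epsilon> * t) * Q t) \<le> exp (\<epsilon> * t) * (norm (U 0) + R t)"
    by (intro mult_left_mono) auto
  then have Q: "Q t \<le> exp (\<epsilon> * t) * (norm (U 0) + R t)"
    by (simp add: mult.assoc[symmetric] exp_add[symmetric])
  have "exp (- w * t) * (exp (w * t) * norm (U t)) \<le> exp (- w * t) * (exp (\<epsilon> * t) * (norm (U 0) + R t))"
    using order_trans[OF UQ[of t] Q] t by (intro mult_left_mono) auto
  then have "norm (U t) \<le> exp (- (w - \<epsilon>) * t) * (norm (U 0) + R t)"
    by (simp add: exp_minus exp_diff exp_add algebra_simps divide_simps)
  also have "exp (- (w - \<epsilon>) * t) * R t = integral {0..t} (\<lambda>s. exp (- (w - \<epsilon>) * t) * (exp ((w - \<epsilon>) * s) * g s))"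
    by (simp add: R_def)
  then have "exp (- (w - \<epsilon>) * t) * (norm (U 0) + R t) = exp (- (w - \<epsilon>) * t) * norm (U 0) +
      integral {0..t} (\<lambda>s. exp (- (w - \<epsilon>) * t) * (exp ((w - \<epsilon>) * s) * g s))"
    by (simp only: distrib_left)
  also have "(\<lambda>s. exp (- (w - \<epsilon>) * t) * (exp ((w - \<epsilon>) * s) * g s)) = (\<lambda>s. exp (- (w - \<epsilon>) * (t - s)) * g s)"
    by (simp add: mult.assoc[symmetric] exp_add[symmetric] fun_eq_iff) (simp add: algebra_simps)
  finally show ?thesis .
qed

text \<open>\<open>C\<close> may exceed \<open>w\<close>: the exponential in Gronwall's bound then
  grows, but it multiplies a vanishing initial difference.\<close>

lemma modal_solution_unique:
  assumes "modal_solution {0..t} U H" "modal_solution {0..t} U' H'" "0 \<le> t" "U 0 = U' 0"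
    and H: "\<And>s. s \<in> {0..t} \<Longrightarrow> norm (H s - H' s) \<le> C * norm (U s - U' s)" and C: "0 \<le> C"
  shows "U t = U' t"
  using modal_solution_gronwall[OF modal_solution_diff[OF assms(1,2)] assms(3), of "\<lambda>_. 0" C] assms by simp

text \<open>Duhamel's integral of a forcing bounded by \<open>b\<close> is bounded by
  \<open>b / w\<close>, so the solution map contracts with factor \<open>c / w\<close> in the space
  of bounded continuous functions. The fixed point lives on the whole half-line at once, without
  continuation.\<close>

lemma semilinear_solution_exists:
  assumes F: "\<And>x y. norm (F x - F y) \<le> c * norm (x - y)" and c: "0 \<le> c" "c < w"
    and G: "continuous_on {0..} G" "\<And>t. 0 \<le> t \<Longrightarrow> norm (G t) \<le> B"
  shows "\<exists>U. modal_solution {0..} U (\<lambda>t. F (U t) + G t) \<and> U 0 = x0"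
proof -
  define S where "S = (\<lambda>H t. E t x0 + duhamel H t)"
  have Fc: "continuous_on X (\<lambda>s. F (u s))" if "continuous_on X u" for X :: "real set" and u
  proof (rule continuous_on_compose2[OF _ that])
    have "c-lipschitz_on UNIV F" using F c by (intro lipschitz_onI) (auto simp: dist_norm)
    then show "continuous_on UNIV F" by (rule lipschitz_on_continuous_on)
  qed simp
  have Hc: "continuous_on {0..} (\<lambda>s. F (apply_bcontfun u s) + G s)" for u
    by (intro continuous_intros Fc G) (rule continuous_on_apply_bcontfun)
  have sol: "modal_solution {0..} (S (\<lambda>s. F (apply_bcontfun u s) + G s)) (\<lambda>s. F (apply_bcontfun u s) + G s)"
    and S0: "S (\<lambda>s. F (apply_bcontfun u s) + G s) 0 = x0" for u
    unfolding S_def by (rule modal_solution_exists[OF Hc])+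
  \<comment> \<open>Bounded continuous functions live on the whole line here; for negative times the
    value at \<open>0\<close> is repeated.\<close>
  define \<Phi> where "\<Phi> = (\<lambda>u. Bcontfun (\<lambda>t. S (\<lambda>s. F (apply_bcontfun u s) + G s) (max 0 t)))"
  have decay: "integral {0..t} (\<lambda>s. exp (- w * (t - s)) * b) \<le> b / w" if "0 \<le> t" "0 \<le> b" for t b
  proof -
    have "integral {0..t} (\<lambda>s. exp (- w * (t - s)) * b) = (1 - exp (- w * t)) / w * b"
      by (rule integral_unique[OF has_integral_mult_left[OF has_integral_exp_decay]]) (use w_pos that in auto)
    also have "\<dots> \<le> 1 / w * b"
      using w_pos that by (intro mult_right_mono divide_right_mono) auto
    finally show ?thesis by simp
  qed
  have app: "apply_bcontfun (\<Phi> u) t = S (\<lambda>s. F (apply_bcontfun u s) + G s) (max 0 t)" for u t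
  proof -
    have "(\<lambda>t. S (\<lambda>s. F (apply_bcontfun u s) + G s) (max 0 t)) \<in> bcontfun"
    proof (rule bcontfun_normI)
      show "continuous_on UNIV (\<lambda>t. S (\<lambda>s. F (apply_bcontfun u s) + G s) (max 0 t))"
        by (rule continuous_on_compose2[of "{0..}" "S (\<lambda>s. F (apply_bcontfun u s) + G s)"])
          (use sol[of u] in \<open>auto simp: modal_solution_def intro!: continuous_intros\<close>)
      define b where "b = norm (F 0) + c * norm u + \<bar>B\<bar>"
      have b0: "0 \<le> b" using c by (simp add: b_def)
      have b: "norm (F (apply_bcontfun u s) + G s) \<le> b" if "0 \<le> s" for s
      proof -
        have "norm (F (apply_bcontfun u s)) \<le> norm (F 0) + c * norm (apply_bcontfun u s)"
          using F[of "apply_bcontfun u s" 0] norm_triangle_sub[of "F (apply_bcontfun u s)" "F 0"] by simp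
        moreover have "c * norm (apply_bcontfun u s) \<le> c * norm u"
          by (intro mult_left_mono norm_bounded c)
        ultimately show ?thesis
          using G(2)[OF that] norm_triangle_ineq[of "F (apply_bcontfun u s)" "G s"] by (simp add: b_def)
      qed
      fix t :: real
      have "norm (S (\<lambda>s. F (apply_bcontfun u s) + G s) (max 0 t)) \<le>
          exp (- w * (max 0 t)) * norm (S (\<lambda>s. F (apply_bcontfun u s) + G s) 0) +
          integral {0..max 0 t} (\<lambda>s. exp (- w * (max 0 t - s)) * b)"
        by (rule modal_solution_norm_le[OF modal_solution_subset[OF sol]]) (use b in auto)
      also have "\<dots> \<le> 1 * norm x0 + b / w"
        unfolding S0 using w_pos by (intro add_mono mult_right_mono decay b0) auto
      finally show "norm (S (\<lambda>s. F (apply_bcontfun u s) + G s) (max 0 t)) \<le> norm x0 + b / w" by simp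
    qed
    then show ?thesis by (simp add: \<Phi>_def Bcontfun_inverse)
  qed
  have "dist (\<Phi> u) (\<Phi> v) \<le> c / w * dist u v" for u v
  proof (rule dist_bound)
    fix t :: real
    have "norm (F (apply_bcontfun u s) + G s - (F (apply_bcontfun v s) + G s)) \<le> c * dist u v" for s
      using F[of "apply_bcontfun u s" "apply_bcontfun v s"] mult_left_mono[OF dist_bounded[of u s v] c(1)]
      by (simp add: dist_norm)
    then have "norm (S (\<lambda>s. F (apply_bcontfun u s) + G s) (max 0 t) - S (\<lambda>s. F (apply_bcontfun v s) + G s) (max 0 t)) \<le>
      exp (- w * (max 0 t)) * norm (S (\<lambda>s. F (apply_bcontfun u s) + G s) 0 - S (\<lambda>s. F (apply_bcontfun v s) + G s) 0) +
      integral {0..max 0 t} (\<lambda>s. exp (- w * (max 0 t - s)) * (c * dist u v))"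
      by (intro modal_solution_norm_le[OF modal_solution_subset[OF modal_solution_diff[OF sol sol]]]) auto
    also have "\<dots> \<le> c * dist u v / w"
      unfolding S0 using decay[of "max 0 t" "c * dist u v"] c by simp
    finally show "dist (apply_bcontfun (\<Phi> u) t) (apply_bcontfun (\<Phi> v) t) \<le> c / w * dist u v"
      by (simp add: app dist_norm)
  qed
  then obtain u where u: "\<Phi> u = u"
    using banach_fix_type[of "c / w" \<Phi>] c w_pos by auto
  define U where "U = S (\<lambda>s. F (apply_bcontfun u s) + G s)"
  have "apply_bcontfun u t = U t" if "0 \<le> t" for t
    using app[of u t] u that by (simp add: U_def)
  then have "modal_solution {0..} U (\<lambda>t. F (U t) + G t)"
    using sol[of u] unfolding U_def[symmetric] modal_solution_def
    by (auto cong: continuous_on_cong_simp)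
  then show ?thesis using S0[of u] by (auto simp: U_def)
qed

text \<open>\<open>V\<close> solves the differentiated equation \<open>V' = m V + H'\<close> with
  initial value \<open>m U + H\<close> at time 0, which is square-summable by the assumption on
  \<open>U 0\<close>. Each component of \<open>m U + H - V\<close> solves \<open>y' = m y\<close>
  from zero, hence vanishes; thus \<open>U\<close> is an integral of \<open>V\<close>.\<close>

lemma modal_solution_C1:
  assumes sol: "modal_solution {0..} U H"
    and H: "\<And>t. 0 \<le> t \<Longrightarrow> (H has_vector_derivative H' t) (at t within {0..})" "continuous_on {0..} H'"
    and U0: "in_ell2 (\<lambda>i. m i * ec (U 0) i)"
  shows "\<exists>V. continuous_on {0..} V \<and> (\<forall>t\<ge>0. \<forall>i. ec (V t) i = m i * ec (U t) i + ec (H t) i) \<and>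
    (\<forall>t\<ge>0. (U has_vector_derivative V t) (at t within {0..}))"
proof -
  define x where "x = mk_ell2 (\<lambda>i. m i * ec (U 0) i) + H 0"
  define V where "V = (\<lambda>t. E t x + duhamel H' t)"
  have V: "modal_solution {0..} V H'" and V0: "V 0 = x"
    unfolding V_def by (rule modal_solution_exists[OF H(2)])+
  have Vi: "ec (V t) i = m i * ec (U t) i + ec (H t) i" if t: "0 \<le> t" for t i
  proof -
    define y where "y = (\<lambda>t. m i * ec (U t) i + ec (H t) i - ec (V t) i)"
    have "(y has_vector_derivative m i * y s + 0) (at s within {0..})" if s: "s \<in> {0..}" for s
    proof -
      have "((\<lambda>t. ec (H t) i) has_vector_derivative ec (H' s) i) (at s within {0..})"
        using bounded_linear.has_vector_derivative[OF bounded_linear_ec H(1)] s by auto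
      moreover have "((\<lambda>t. m i * ec (U t) i) has_vector_derivative m i * (m i * ec (U s) i + ec (H s) i)) (at s within {0..})"
        using sol s by (intro has_vector_derivative_mult_right) (auto simp: modal_solution_def)
      moreover have "((\<lambda>t. ec (V t) i) has_vector_derivative m i * ec (V s) i + ec (H' s) i) (at s within {0..})"
        using V s by (auto simp: modal_solution_def)
      ultimately show ?thesis unfolding y_def
        by (intro has_vector_derivative_eq_rhs[OF has_vector_derivative_diff[OF has_vector_derivative_add]])
          (auto simp: algebra_simps)
    qed
    then have "((\<lambda>s. exp (of_real (t - s) * m i) * 0) has_integral (y t - exp (of_real t * m i) * y 0)) {0..t}"
      using t by (intro scalar_variation_of_constants, simp)
        (rule has_vector_derivative_within_subset[of y _ _ "{0..}"], auto)
    then have "y t = exp (of_real t * m i) * y 0" by (simp add: has_integral_0_eq)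
    moreover have "y 0 = 0" by (simp add: y_def V0 x_def ec_mk[OF U0])
    ultimately show ?thesis by (simp add: y_def)
  qed
  have Vc: "continuous_on {0..} V" using V by (simp add: modal_solution_def)
  have UV: "U t = U 0 + integral {0..t} V" if t: "t \<in> {0..}" for t
  proof (rule ell2_eqI)
    fix i
    have "((\<lambda>s. ec (V s) i) has_integral (ec (U t) i - ec (U 0) i)) {0..t}"
    proof (rule fundamental_theorem_of_calculus)
      fix s assume "s \<in> {0..t}"
      then show "((\<lambda>t. ec (U t) i) has_vector_derivative ec (V s) i) (at s within {0..t})"
        using sol by - (rule has_vector_derivative_within_subset[of _ _ s "{0..}" "{0..t}"],
          auto simp: modal_solution_def Vi)
    qed (use t in simp)
    moreover have "ec (integral {0..t} V) i = integral {0..t} (\<lambda>s. ec (V s) i)"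
      using integral_linear[OF _ bounded_linear_ec, of V "{0..t}" i]
      by (simp add: o_def integrable_continuous_interval continuous_on_subset[OF Vc])
    ultimately show "ec (U t) i = ec (U 0 + integral {0..t} V) i" by (simp add: integral_unique)
  qed
  have D: "((\<lambda>t. U 0 + integral {0..t} V) has_vector_derivative V t) (at t within {0..})" if "0 \<le> t" for t
    using has_vector_derivative_add[OF has_vector_derivative_const
        has_vector_derivative_integral_atLeast[OF Vc that]] by simp
  have "(U has_vector_derivative V t) (at t within {0..})" if "0 \<le> t" for t
    by (rule has_vector_derivative_transform[OF _ UV D[OF that]]) (use that in auto)
  then show ?thesis using Vc Vi by blast
qed

end

section \<open>Triangularization of Hurwitz matrices\<close>

lemma sum_mat_mult_eq:
  assumes "A \<in> carrier_mat n n" "B \<in> carrier_mat n n" "i < n" "j < n"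
  shows "(A * B) $$ (i, j) = (\<Sum>k<n. A $$ (i, k) * B $$ (k, j))"
  using assms by (auto simp: times_mat_def scalar_prod_def lessThan_atLeast0 intro!: sum.cong)

lemma schur_triangularization:
  fixes A :: "complex mat"
  assumes A: "A \<in> carrier_mat n n"
  obtains B P Q where "similar_mat_wit A B P Q" "upper_triangular B"
    "\<And>i. i < n \<Longrightarrow> eigenvalue A (B $$ (i, i))"
proof -
  obtain as where as: "char_poly A = (\<Prod>a\<leftarrow>as. [:- a, 1:])"
    using char_poly_factorized[OF A] by blast
  obtain B P Q where BPQ: "schur_decomposition A as = (B, P, Q)" by (cases "schur_decomposition A as") auto
  have s: "similar_mat_wit A B P Q" "upper_triangular B" "diag_mat B = as"
    using schur_decomposition[OF A as BPQ] by auto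
  have B: "B \<in> carrier_mat n n" using similar_mat_witD2[OF A s(1)] by auto
  have "eigenvalue A (B $$ (i, i))" if "i < n" for i
  proof -
    have "B $$ (i, i) \<in> set as"
      using s(3) that B by (auto simp: diag_mat_def)
    then have "poly (char_poly A) (B $$ (i, i)) = 0"
      unfolding as by (auto simp: poly_prod_list prod_list_zero_iff o_def)
    then show ?thesis using eigenvalue_root_char_poly[OF A] by simp
  qed
  with s show thesis by (intro that)
qed

text \<open>
  Rescaling the vectors of a Schur basis by \<open>s \<delta>\<^sup>k\<close> shrinks both the off-diagonal part of the triangular
  form and the basis itself.
\<close>

lemma hurwitz_triangularization:
  fixes A :: "real mat"
  assumes A: "A \<in> carrier_mat n n" and hur: "hurwitz A"
  obtains \<mu> :: "nat \<Rightarrow> complex" and w :: real where "w > 0" "\<And>i. i < n \<Longrightarrow> Re (\<mu> i) \<le> - w"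
    "\<And>\<epsilon> \<sigma>. \<epsilon> > 0 \<Longrightarrow> \<sigma> > 0 \<Longrightarrow> \<exists>P Q N :: nat \<Rightarrow> nat \<Rightarrow> complex.
       (\<forall>i<n. \<forall>k<n. (\<Sum>j<n. of_real (A $$ (i, j)) * P j k) = P i k * \<mu> k + (\<Sum>j<n. P i j * N j k)) \<and>
       (\<forall>i<n. \<forall>k<n. (\<Sum>j<n. P i j * Q j k) = of_bool (i = k) \<and> (\<Sum>j<n. Q i j * P j k) = of_bool (i = k)) \<and>
       (\<forall>i<n. \<forall>k<n. cmod (N i k) \<le> \<epsilon> \<and> cmod (P i k) \<le> \<sigma>)"
proof -
  define C where "C = map_mat complex_of_real A"
  have C: "C \<in> carrier_mat n n" using A by (simp add: C_def)
  obtain B P Q where s: "similar_mat_wit C B P Q" "upper_triangular B"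
    and ev: "\<And>i. i < n \<Longrightarrow> eigenvalue C (B $$ (i, i))"
    using schur_triangularization[OF C] by blast
  note D = similar_mat_witD2[OF C s(1)]
  have B: "B \<in> carrier_mat n n" and P: "P \<in> carrier_mat n n" and Q: "Q \<in> carrier_mat n n"
    and PQ: "P * Q = 1\<^sub>m n" "Q * P = 1\<^sub>m n" and CPB: "C = P * B * Q" using D by auto
  have "C * P = P * B * (Q * P)" unfolding CPB using P B Q by (simp add: assoc_mult_mat[of _ n n _ n _ n])
  then have CP: "C * P = P * B" using P B by (simp add: PQ)
  \<comment> \<open>The inserted \<open>1\<close> makes the set nonempty for every
    \<open>n\<close>.\<close>
  define w where "w = Min (insert 1 ((\<lambda>i. - Re (B $$ (i, i))) ` {..<n}))"
  have "w > 0" unfolding w_def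
    using ev hur by (subst Min_gr_iff) (auto simp: hurwitz_def C_def)
  moreover have "Re (B $$ (i, i)) \<le> - w" if "i < n" for i
  proof -
    have "w \<le> - Re (B $$ (i, i))" unfolding w_def using that by (intro Min_le) auto
    then show ?thesis by simp
  qed
  \<comment> \<open>The diagonal of \<open>B\<close>, and with it \<open>w\<close>, is fixed before
    \<open>\<epsilon>\<close> and \<open>\<sigma>\<close>. This order matters: these will be chosen
    small relative to \<open>w\<close>.\<close>
  moreover have "\<exists>P' Q' N :: nat \<Rightarrow> nat \<Rightarrow> complex.
       (\<forall>i<n. \<forall>k<n. (\<Sum>j<n. of_real (A $$ (i, j)) * P' j k) = P' i k * B $$ (k, k) + (\<Sum>j<n. P' i j * N j k)) \<and>
       (\<forall>i<n. \<forall>k<n. (\<Sum>j<n. P' i j * Q' j k) = of_bool (i = k) \<and> (\<Sum>j<n. Q' i j * P' j k) = of_bool (i = k)) \<and>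
       (\<forall>i<n. \<forall>k<n. cmod (N i k) \<le> \<epsilon> \<and> cmod (P' i k) \<le> \<sigma>)" if eps: "\<epsilon> > 0" "\<sigma> > 0" for \<epsilon> \<sigma> :: real
  proof -
    define M where "M = 1 + (\<Sum>i<n. \<Sum>k<n. cmod (B $$ (i, k)) + cmod (P $$ (i, k)))"
    have BM: "cmod (B $$ (i, k)) + cmod (P $$ (i, k)) \<le> M" if "i < n" "k < n" for i k
    proof -
      have "cmod (B $$ (i, k)) + cmod (P $$ (i, k)) \<le> (\<Sum>k<n. cmod (B $$ (i, k)) + cmod (P $$ (i, k)))"
        using that by (intro member_le_sum) auto
      also have "\<dots> \<le> (\<Sum>i<n. \<Sum>k<n. cmod (B $$ (i, k)) + cmod (P $$ (i, k)))"
        using that by (intro member_le_sum[of i]) (auto intro!: sum_nonneg add_nonneg_nonneg simp: sum.distrib)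
      finally show ?thesis by (simp add: M_def)
    qed
    have M: "M > 0" unfolding M_def by (intro add_pos_nonneg sum_nonneg) auto
    \<comment> \<open>Rescaling multiplies an entry above the diagonal by a power of
      \<open>\<delta>\<close> with exponent at least 1, so
      \<open>\<delta> * M \<le> \<epsilon>\<close> suffices for \<open>N\<close>. The common factor
      \<open>s\<close>, which cancels in \<open>N\<close>, then makes the basis itself
      small.\<close>
    define \<delta> where "\<delta> = min 1 (\<epsilon> / M)"
    have \<delta>: "0 < \<delta>" "\<delta> \<le> 1" "\<delta> * M \<le> \<epsilon>"
      using eps M by (auto simp: \<delta>_def min_def field_simps)
    define s where "s = \<sigma> / M"
    have s0: "s > 0" "s * M = \<sigma>" using eps M by (auto simp: s_def)
    define d where "d = (\<lambda>k. complex_of_real (s * \<delta> ^ k))"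
    have d0: "d k \<noteq> 0" for k using s0 \<delta> by (simp add: d_def)
    \<comment> \<open>Only the strictly upper part: the diagonal stays in the exponents, and the
      entries below it vanish.\<close>
    define N where "N = (\<lambda>j k. if j < k then B $$ (j, k) * d k / d j else 0)"
    show ?thesis
    proof (rule exI[of _ "\<lambda>i k. P $$ (i, k) * d k"], rule exI[of _ "\<lambda>i k. Q $$ (i, k) / d i"],
        rule exI[of _ N], intro conjI allI impI)
      fix i k assume ik: "i < n" "k < n"
      have "(\<Sum>j<n. of_real (A $$ (i, j)) * (P $$ (j, k) * d k)) = (\<Sum>j<n. C $$ (i, j) * P $$ (j, k)) * d k"
        using A ik by (simp add: C_def sum_distrib_right mult.assoc)
      also have "\<dots> = (\<Sum>j<n. P $$ (i, j) * B $$ (j, k)) * d k"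
        using CP by (simp add: sum_mat_mult_eq[OF C P ik, symmetric] sum_mat_mult_eq[OF P B ik, symmetric])
      also have "\<dots> = (\<Sum>j<n. (if j = k then P $$ (i, k) * d k * B $$ (k, k) else 0) + P $$ (i, j) * d j * N j k)"
      proof (unfold sum_distrib_right, rule sum.cong[OF refl])
        fix j assume "j \<in> {..<n}"
        then have "B $$ (j, k) = 0" if "k < j"
          using s(2) that B by (auto simp: upper_triangular_def)
        then show "P $$ (i, j) * B $$ (j, k) * d k =
            (if j = k then P $$ (i, k) * d k * B $$ (k, k) else 0) + P $$ (i, j) * d j * N j k"
          using d0[of j] by (cases j k rule: linorder_cases) (auto simp: N_def)
      qed
      also have "\<dots> = P $$ (i, k) * d k * B $$ (k, k) + (\<Sum>j<n. P $$ (i, j) * d j * N j k)"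
        using ik by (simp add: sum.distrib sum.delta)
      finally show "(\<Sum>j<n. of_real (A $$ (i, j)) * (P $$ (j, k) * d k)) =
        P $$ (i, k) * d k * B $$ (k, k) + (\<Sum>j<n. P $$ (i, j) * d j * N j k)" .
      have "(\<Sum>j<n. P $$ (i, j) * d j * (Q $$ (j, k) / d j)) = (P * Q) $$ (i, k)"
        unfolding sum_mat_mult_eq[OF P Q ik] using d0 by (intro sum.cong) auto
      then show "(\<Sum>j<n. P $$ (i, j) * d j * (Q $$ (j, k) / d j)) = of_bool (i = k)"
        using ik by (simp add: PQ)
      have "(\<Sum>j<n. Q $$ (i, j) / d i * (P $$ (j, k) * d k)) = (Q * P) $$ (i, k) * d k / d i"
        unfolding sum_mat_mult_eq[OF Q P ik] by (simp add: sum_distrib_right sum_divide_distrib mult.assoc)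
      then show "(\<Sum>j<n. Q $$ (i, j) / d i * (P $$ (j, k) * d k)) = of_bool (i = k)"
        using ik d0 by (simp add: PQ)
      show "cmod (N i k) \<le> \<epsilon>"
      proof (cases "i < k")
        case True
        have "d k / d i = of_real (\<delta> ^ (k - i))"
          using True s0 \<delta> by (simp add: d_def power_diff)
        then have "cmod (N i k) = cmod (B $$ (i, k)) * \<delta> ^ (k - i)"
          using True \<delta> by (simp add: N_def norm_mult norm_power times_divide_eq_right[symmetric] del: times_divide_eq_right)
        also have "\<dots> \<le> M * \<delta> ^ 1"
          using BM[OF ik] \<delta> True M
          by (intro mult_mono power_decreasing) (auto intro: order_trans[rotated])
        finally show ?thesis using \<delta> by (simp add: mult.commute)
      qed (use eps in \<open>simp add: N_def\<close>)
      have "cmod (P $$ (i, k) * d k) = cmod (P $$ (i, k)) * (s * \<delta> ^ k)"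
        using s0 \<delta> by (simp add: d_def norm_mult norm_power)
      also have "\<dots> \<le> M * (s * 1)"
        using BM[OF ik] \<delta> s0 M by (intro mult_mono power_le_one) (auto intro: order_trans[rotated])
      finally show "cmod (P $$ (i, k) * d k) \<le> \<sigma>" using s0 by (simp add: mult.commute)
    qed
  qed
  ultimately show thesis by (intro that[of w "\<lambda>i. B $$ (i, i)"]) auto
qed

section \<open>Square-integrable functions and Sobolev functions on an interval\<close>

text \<open>The integral vanishes over all half-lines, which are stable under intersection and
  generate the Borel sets. Dynkin's argument extends this to Borel sets, then, modulo null sets, to
  all Lebesgue measurable sets, where the density must vanish. This is the source of uniqueness of
  weak derivatives.\<close>

lemma integrable_zero_AE:
  fixes h :: "real \<Rightarrow> complex"
  assumes h: "integrable (lebesgue_on {0..L}) h"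
    and z: "\<And>x. x \<in> {0..L} \<Longrightarrow> integral\<^sup>L (lebesgue_on {0..x}) h = 0"
  shows "AE x in lebesgue_on {0..L}. h x = 0"
proof -
  define f where "f = (\<lambda>x. indicator {0..L} x *\<^sub>R h x)"
  have f: "integrable lebesgue f"
    using h by (simp add: f_def integrable_restrict_space)
  have basic: "(LINT x:{..a}|lebesgue. f x) = 0" for a :: real
  proof (cases "0 \<le> min a L")
    case True
    have "(LINT x:{..a}|lebesgue. f x) = integral\<^sup>L lebesgue (\<lambda>x. indicator {0..min a L} x *\<^sub>R h x)"
      unfolding set_lebesgue_integral_def f_def
      by (rule Bochner_Integration.integral_cong) (auto simp: indicator_def)
    also have "\<dots> = integral\<^sup>L (lebesgue_on {0..min a L}) h"
      by (simp add: integral_restrict_space)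
    finally show ?thesis using z[of "min a L"] True by simp
  next
    case False
    then have "(\<lambda>x. indicator {..a} x *\<^sub>R f x) = (\<lambda>_. 0)"
      by (auto simp: indicator_def f_def)
    then show ?thesis by (simp add: set_lebesgue_integral_def)
  qed
  \<comment> \<open>Needed for complements in the induction; \<open>f\<close> vanishes beyond
    \<open>L\<close>, so a half-line already carries the full integral.\<close>
  have tot: "integral\<^sup>L lebesgue f = 0"
  proof -
    have "(LINT x:{..L}|lebesgue. f x) = integral\<^sup>L lebesgue f"
      unfolding set_lebesgue_integral_def f_def
      by (rule Bochner_Integration.integral_cong) (auto simp: indicator_def)
    then show ?thesis using basic by simp
  qed
  have setint: "set_integrable lebesgue A f" if "A \<in> sets lebesgue" for A
    unfolding set_integrable_def using f that by (rule integrable_mult_indicator[rotated])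
  have sig: "sigma_sets UNIV (range (\<lambda>a. {..a::real})) = sets borel"
    using arg_cong[OF borel_eq_atMost[where 'a = real], of sets] by simp
  have leb: "A \<in> sets lebesgue" if "A \<in> sets borel" for A :: "real set"
    using that by (intro sets_completionI_sets) simp
  have int: "Int_stable (range (\<lambda>a. {..a::real}))" by (auto simp: Int_stable_def)
  have subset_Pow_UNIV: "range (\<lambda>a. {..a::real}) \<subseteq> Pow UNIV" by simp
  have borel: "(LINT x:A|lebesgue. f x) = 0" if "A \<in> sigma_sets UNIV (range (\<lambda>a. {..a::real}))" for A
    using int subset_Pow_UNIV that
  proof (induct rule: sigma_sets_induct_disjoint)
    case (compl A)
    then have A: "A \<in> sets lebesgue" unfolding sig by (intro leb) simp
    have "indicator (UNIV - A) x *\<^sub>R f x = f x - indicator A x *\<^sub>R f x" for x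
      by (auto simp: indicator_def)
    then have "(LINT x:(UNIV - A)|lebesgue. f x) = integral\<^sup>L lebesgue f - (LINT x:A|lebesgue. f x)"
      unfolding set_lebesgue_integral_def
      using setint[OF A] f by (simp add: set_integrable_def)
    then show ?case using compl tot by simp
  next
    case (union A)
    then have A: "A i \<in> sets lebesgue" for i unfolding sig by (intro leb) auto
    have "(LINT x:(\<Union>i. A i)|lebesgue. f x) = (\<Sum>i. (LINT x:(A i)|lebesgue. f x))"
      by (rule lebesgue_integral_countable_add)
        (use A union(1) in \<open>auto simp: disjoint_family_on_def intro!: setint\<close>)
    then show ?case using union by simp
  qed (use basic in \<open>auto simp: set_lebesgue_integral_def\<close>)
  have all: "(LINT x:A|lebesgue. f x) = 0" if A: "A \<in> sets lebesgue" for A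
  proof -
    obtain S N N' where S: "A = S \<union> N" "N \<subseteq> N'" "N' \<in> null_sets lborel" "S \<in> sets lborel"
      by (rule sets_completionE[OF A])
    have S': "S \<in> sigma_sets UNIV (range (\<lambda>a. {..a::real}))"
      using S(4) by (simp add: sig)
    have "(LINT x:A|lebesgue. f x) = (LINT x:S|lebesgue. f x)"
      unfolding set_lebesgue_integral_def
    proof (rule integral_cong_AE)
      show "AE x in lebesgue. indicator A x *\<^sub>R f x = indicator S x *\<^sub>R f x"
        using AE_not_in[OF null_sets_completionI[OF S(3)]] by eventually_elim (use S in \<open>auto simp: indicator_def\<close>)
    qed (use setint[OF A] setint[OF leb, of S] S(4) in \<open>auto simp: set_integrable_def\<close>)
    then show ?thesis using borel[OF S'] by simp
  qed
  interpret finite_measure "lebesgue_on {0..L}" by (rule finite_measure_lebesgue_on) simp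
  show ?thesis
  proof (rule density_zero[OF h])
    fix A assume A: "A \<in> sets (lebesgue_on {0..L})"
    then have A': "A \<in> sets lebesgue" "A \<subseteq> {0..L}" by (auto simp: sets_restrict_space_iff)
    have "set_lebesgue_integral (lebesgue_on {0..L}) A h = (LINT x:A|lebesgue. f x)"
      unfolding set_lebesgue_integral_def f_def
      by (subst integral_restrict_space) (auto simp: indicator_def intro!: Bochner_Integration.integral_cong)
    then show "set_lebesgue_integral (lebesgue_on {0..L}) A h = 0" using all[OF A'(1)] by simp
  qed
qed

text \<open>The value \<open>t = b / c\<close> minimizes the quadratic. The degenerate case
  \<open>c = 0\<close> is included because the second function in Cauchy-Schwarz may vanish almost
  everywhere.\<close>

lemma discriminant_le:
  fixes a b c :: real
  assumes "\<And>t. 0 \<le> a - 2 * t * b + t\<^sup>2 * c" "0 \<le> c"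
  shows "b\<^sup>2 \<le> a * c"
proof (cases "c = 0")
  case True
  have "b = 0"
  proof (rule ccontr)
    assume "b \<noteq> 0"
    \<comment> \<open>For \<open>c = 0\<close> this choice of \<open>t\<close> makes the affine
      expression equal to \<open>-1\<close>.\<close>
    then show False using assms(1)[of "(a + 1) / (2 * b)"] True by (simp add: field_simps)
  qed
  then show ?thesis using True by simp
next
  case False
  with assms(2) have "c > 0" by simp
  moreover have "a - 2 * (b / c) * b + (b / c)\<^sup>2 * c = a - b\<^sup>2 / c"
    using False by (simp add: field_simps power2_eq_square)
  ultimately have "b\<^sup>2 / c \<le> a" using assms(1)[of "b / c"] by linarith
  then show ?thesis using \<open>c > 0\<close> by (simp add: pos_divide_le_eq)
qed

section \<open>The norm of L^2(0,L) and its completeness\<close>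

definition L2norm :: "real \<Rightarrow> (real \<Rightarrow> complex) \<Rightarrow> real" where
  "L2norm L u = sqrt (LINT x|lebesgue_on {0..L}. (norm (u x))\<^sup>2)"

lemma L2norm_nonneg [simp]: "0 \<le> L2norm L u"
  by (simp add: L2norm_def)

lemma L2norm_sq: "(L2norm L u)\<^sup>2 = (LINT x|lebesgue_on {0..L}. (norm (u x))\<^sup>2)"
  by (simp add: L2norm_def)

lemma L2_meas: "L2 L u \<Longrightarrow> u \<in> borel_measurable (lebesgue_on {0..L})"
  and L2_sq: "L2 L u \<Longrightarrow> integrable (lebesgue_on {0..L}) (\<lambda>x. (norm (u x))\<^sup>2)"
  by (auto simp: L2_def)

lemma integrable_L2_mult:
  assumes "L2 L u" "L2 L v"
  shows "integrable (lebesgue_on {0..L}) (\<lambda>x. u x * cnj (v x))"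
    and "integrable (lebesgue_on {0..L}) (\<lambda>x. norm (u x) * norm (v x))"
proof -
  have i: "integrable (lebesgue_on {0..L}) (\<lambda>x. (norm (u x))\<^sup>2 + (norm (v x))\<^sup>2)"
    using assms by (intro Bochner_Integration.integrable_add) (auto simp: L2_def)
  have [measurable]: "u \<in> borel_measurable (lebesgue_on {0..L})" "v \<in> borel_measurable (lebesgue_on {0..L})"
    using assms by (auto simp: L2_def)
  have b: "norm (u x) * norm (v x) \<le> (norm (u x))\<^sup>2 + (norm (v x))\<^sup>2" for x
    using sum_squares_bound[of "norm (u x)" "norm (v x)"]
      mult_nonneg_nonneg[OF norm_ge_zero norm_ge_zero, of "u x" "v x"] by linarith
  have [measurable]: "(\<lambda>x. cnj (v x)) \<in> borel_measurable (lebesgue_on {0..L})"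
    by (intro borel_measurable_continuous_on[OF continuous_on_cnj[OF continuous_on_id, of UNIV]]) simp
  show "integrable (lebesgue_on {0..L}) (\<lambda>x. u x * cnj (v x))"
    by (rule Bochner_Integration.integrable_bound[OF i]) (use b in \<open>auto simp: norm_mult\<close>)
  show "integrable (lebesgue_on {0..L}) (\<lambda>x. norm (u x) * norm (v x))"
    by (rule Bochner_Integration.integrable_bound[OF i]) (use b in \<open>auto simp: norm_mult\<close>)
qed

lemma L2_bound:
  assumes "L2 L u" "v \<in> borel_measurable (lebesgue_on {0..L})"
    and "\<And>x. x \<in> {0..L} \<Longrightarrow> norm (v x) \<le> c * norm (u x)"
  shows "L2 L v"
  unfolding L2_def
proof
  show "integrable (lebesgue_on {0..L}) (\<lambda>x. (norm (v x))\<^sup>2)"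
  proof (rule Bochner_Integration.integrable_bound)
    show "integrable (lebesgue_on {0..L}) (\<lambda>x. c\<^sup>2 * (norm (u x))\<^sup>2)"
      using assms by (simp add: L2_def)
    show "AE x in lebesgue_on {0..L}. norm ((norm (v x))\<^sup>2) \<le> norm (c\<^sup>2 * (norm (u x))\<^sup>2)"
      using power_mono[OF assms(3) norm_ge_zero, of _ 2] by (auto simp: power_mult_distrib)
  qed (use assms(2) in measurable)
qed (rule assms(2))

lemma L2_add: "L2 L u \<Longrightarrow> L2 L v \<Longrightarrow> L2 L (\<lambda>x. u x + v x)"
  unfolding L2_def
proof (elim conjE, intro conjI)
  assume m [measurable]: "u \<in> borel_measurable (lebesgue_on {0..L})" "v \<in> borel_measurable (lebesgue_on {0..L})"
  assume i: "integrable (lebesgue_on {0..L}) (\<lambda>x. (norm (u x))\<^sup>2)" "integrable (lebesgue_on {0..L}) (\<lambda>x. (norm (v x))\<^sup>2)"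
  show "(\<lambda>x. u x + v x) \<in> borel_measurable (lebesgue_on {0..L})" by measurable
  have j: "integrable (lebesgue_on {0..L}) (\<lambda>x. 2 * (norm (u x))\<^sup>2 + 2 * (norm (v x))\<^sup>2)"
    using i by simp
  have b: "(norm (u x + v x))\<^sup>2 \<le> 2 * (norm (u x))\<^sup>2 + 2 * (norm (v x))\<^sup>2" for x
  proof -
    have "(norm (u x + v x))\<^sup>2 \<le> (norm (u x) + norm (v x))\<^sup>2"
      by (intro power_mono norm_triangle_ineq) auto
    then show ?thesis
      using sum_squares_bound[of "norm (u x)" "norm (v x)"] by (simp add: power2_sum)
  qed
  show "integrable (lebesgue_on {0..L}) (\<lambda>x. (norm (u x + v x))\<^sup>2)"
    by (rule Bochner_Integration.integrable_bound[OF j]) (use b in auto)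
qed

lemma L2_scale: "L2 L u \<Longrightarrow> L2 L (\<lambda>x. c * u x)"
  by (rule L2_bound[of L u _ "norm c"]) (auto simp: norm_mult L2_def)

lemma L2_cnj: "L2 L u \<Longrightarrow> L2 L (\<lambda>x. cnj (u x))"
  by (rule L2_bound[of L u _ 1])
    (auto simp: L2_def intro!: borel_measurable_continuous_on[OF continuous_on_cnj[OF continuous_on_id, of UNIV]])

lemma L2_diff: "L2 L u \<Longrightarrow> L2 L v \<Longrightarrow> L2 L (\<lambda>x. u x - v x)"
  using L2_add[of L u "\<lambda>x. - 1 * v x"] L2_scale[of L v "- 1"] by simp

lemma L2_zero: "L2 L (\<lambda>_. 0)"
  by (simp add: L2_def)

lemma L2_continuous:
  assumes "continuous_on {0..L} u"
  shows "L2 L u"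
proof -
  have "continuous_on {0..L} (\<lambda>x. (norm (u x))\<^sup>2)" by (intro continuous_intros assms)
  then show ?thesis
    unfolding L2_def using assms
    by (auto intro!: continuous_imp_integrable_real continuous_imp_measurable_on_sets_lebesgue)
qed

lemma L2_integrable: "L2 L u \<Longrightarrow> integrable (lebesgue_on {0..L}) u"
  using integrable_L2_mult(1)[of L u "\<lambda>_. 1"] L2_continuous[of L "\<lambda>_. 1"] by simp

lemma L2norm_cauchy_schwarz:
  assumes "L2 L u" "L2 L v"
  shows "(LINT x|lebesgue_on {0..L}. norm (u x) * norm (v x)) \<le> L2norm L u * L2norm L v"
proof -
  note I = L2_sq[OF assms(1)] L2_sq[OF assms(2)] integrable_L2_mult(2)[OF assms]
  let ?M = "lebesgue_on {0..L}"
  have "(LINT x|?M. norm (u x) * norm (v x))\<^sup>2 \<le> (LINT x|?M. (norm (u x))\<^sup>2) * (LINT x|?M. (norm (v x))\<^sup>2)"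
  proof (rule discriminant_le)
    fix t :: real
    have "0 \<le> (LINT x|?M. (norm (u x) - t * norm (v x))\<^sup>2)"
      by (rule Bochner_Integration.integral_nonneg) simp
    also have "\<dots> = (LINT x|?M. (norm (u x))\<^sup>2 - 2 * t * (norm (u x) * norm (v x)) + t\<^sup>2 * (norm (v x))\<^sup>2)"
      by (rule Bochner_Integration.integral_cong) (auto simp: power2_diff power_mult_distrib)
    also have "\<dots> = (LINT x|?M. (norm (u x))\<^sup>2) - 2 * t * (LINT x|?M. norm (u x) * norm (v x)) + t\<^sup>2 * (LINT x|?M. (norm (v x))\<^sup>2)"
      using I by simp
    finally show "0 \<le> \<dots>" .
  qed simp
  then show ?thesis unfolding L2norm_def real_sqrt_mult[symmetric] by (rule real_le_rsqrt)
qed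

lemma L2norm_add_le:
  assumes "L2 L u" "L2 L v"
  shows "L2norm L (\<lambda>x. u x + v x) \<le> L2norm L u + L2norm L v"
proof (rule power2_le_imp_le)
  let ?M = "lebesgue_on {0..L}"
  note I = L2_sq[OF assms(1)] L2_sq[OF assms(2)] integrable_L2_mult(2)[OF assms]
  have "(L2norm L (\<lambda>x. u x + v x))\<^sup>2 \<le> (LINT x|?M. (norm (u x))\<^sup>2 + 2 * (norm (u x) * norm (v x)) + (norm (v x))\<^sup>2)"
    unfolding L2norm_sq
  proof (rule Bochner_Integration.integral_mono)
    fix x
    have "(norm (u x + v x))\<^sup>2 \<le> (norm (u x) + norm (v x))\<^sup>2"
      by (intro power_mono norm_triangle_ineq) auto
    then show "(norm (u x + v x))\<^sup>2 \<le> (norm (u x))\<^sup>2 + 2 * (norm (u x) * norm (v x)) + (norm (v x))\<^sup>2"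
      by (simp add: power2_sum)
  qed (use I L2_sq[OF L2_add[OF assms]] in auto)
  also have "\<dots> = (L2norm L u)\<^sup>2 + 2 * (LINT x|?M. norm (u x) * norm (v x)) + (L2norm L v)\<^sup>2"
    using I by (simp add: L2norm_sq)
  also have "\<dots> \<le> (L2norm L u + L2norm L v)\<^sup>2"
    using L2norm_cauchy_schwarz[OF assms] by (simp add: power2_sum)
  finally show "(L2norm L (\<lambda>x. u x + v x))\<^sup>2 \<le> (L2norm L u + L2norm L v)\<^sup>2" .
qed simp

lemma L2norm_mono:
  assumes "L2 L u" "L2 L v" "\<And>x. x \<in> {0..L} \<Longrightarrow> norm (v x) \<le> c * norm (u x)" "0 \<le> c"
  shows "L2norm L v \<le> c * L2norm L u"
proof (rule power2_le_imp_le)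
  have "(L2norm L v)\<^sup>2 \<le> (LINT x|lebesgue_on {0..L}. c\<^sup>2 * (norm (u x))\<^sup>2)"
    unfolding L2norm_sq
    by (rule Bochner_Integration.integral_mono)
      (use assms power_mono[OF assms(3) norm_ge_zero, of _ 2] in \<open>auto simp: L2_def power_mult_distrib\<close>)
  then show "(L2norm L v)\<^sup>2 \<le> (c * L2norm L u)\<^sup>2"
    by (simp add: power_mult_distrib L2norm_sq)
qed (use assms in simp)

lemma L2norm_minus: "L2norm L (\<lambda>x. u x - v x) = L2norm L (\<lambda>x. v x - u x)"
  by (simp add: L2norm_def norm_minus_commute)

lemma L2norm_zero_AE:
  assumes "L2 L u" "L2norm L u = 0"
  shows "AE x in lebesgue_on {0..L}. u x = 0"
proof -
  have "AE x in lebesgue_on {0..L}. (norm (u x))\<^sup>2 = 0"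
    using assms by (subst integral_nonneg_eq_0_iff_AE[symmetric]) (auto simp: L2_def L2norm_def)
  then show ?thesis by simp
qed

lemma L2norm_cong_AE:
  assumes "AE x in lebesgue_on {0..L}. u x = v x" "u \<in> borel_measurable (lebesgue_on {0..L})"
    "v \<in> borel_measurable (lebesgue_on {0..L})"
  shows "L2norm L u = L2norm L v"
  unfolding L2norm_def by (intro arg_cong[of _ _ sqrt] integral_cong_AE) (use assms in \<open>auto elim: eventually_mono\<close>)

text \<open>Riesz-Fischer: along a subsequence with geometrically small increments, the sum of the
  increments is integrable because the interval is bounded, so the subsequence converges almost
  everywhere. Fatou's lemma then bounds the distance of the limit to the full sequence.\<close>

lemma L2_cauchy_convergent:
  assumes u: "\<And>n. L2 L (u n)"
    and cauchy: "\<And>\<epsilon>. \<epsilon> > 0 \<Longrightarrow> \<exists>N. \<forall>m\<ge>N. \<forall>n\<ge>N. L2norm L (\<lambda>x. u m x - u n x) \<le> \<epsilon>"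
  obtains v where "L2 L v" "(\<lambda>n. L2norm L (\<lambda>x. u n x - v x)) \<longlonglongrightarrow> 0"
proof -
  let ?M = "lebesgue_on {0..L}"
  have "\<exists>N. \<forall>m\<ge>N. \<forall>n\<ge>N. L2norm L (\<lambda>x. u m x - u n x) \<le> (1 / 2) ^ k" for k :: nat
    by (rule cauchy) simp
  then obtain N where N: "\<And>k m n. N k \<le> m \<Longrightarrow> N k \<le> n \<Longrightarrow> L2norm L (\<lambda>x. u m x - u n x) \<le> (1 / 2) ^ k"
    by metis
  \<comment> \<open>The maximum puts \<open>r k\<close> beyond all thresholds up to
    \<open>k\<close>; the summand \<open>k\<close> forces \<open>r k\<close> to infinity.\<close>
  define r where "r = (\<lambda>k. Max (N ` {..k}) + k)"
  have rN: "N j \<le> r k" if "j \<le> k" for j k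
    unfolding r_def using that by (intro trans_le_add1 Max_ge) auto
  define w where "w = (\<lambda>k. u (r k))"
  have wL2: "L2 L (w k)" for k by (simp add: w_def u)
  have [measurable]: "w k \<in> borel_measurable ?M" for k using wL2 by (simp add: L2_def)
  have wd: "L2norm L (\<lambda>x. w (Suc k) x - w k x) \<le> (1 / 2) ^ k" for k
    unfolding w_def by (rule N) (auto intro: rN)
  have one: "L2 L (\<lambda>_. 1)" by (rule L2_continuous) simp
  have "(\<integral>\<^sup>+x. (\<Sum>k. ennreal (norm (w (Suc k) x - w k x))) \<partial>?M) < \<infinity>"
  proof -
    have e: "(\<integral>\<^sup>+x. ennreal (norm (w (Suc k) x - w k x)) \<partial>?M) \<le> ennreal ((1 / 2) ^ k * L2norm L (\<lambda>_. 1))" for k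
    proof -
      have d: "L2 L (\<lambda>x. w (Suc k) x - w k x)" by (intro L2_diff wL2)
      have "(\<integral>\<^sup>+x. ennreal (norm (w (Suc k) x - w k x)) \<partial>?M) = ennreal (LINT x|?M. norm (w (Suc k) x - w k x))"
        using L2_integrable[OF d] by (intro nn_integral_eq_integral) auto
      also have "(LINT x|?M. norm (w (Suc k) x - w k x)) \<le> L2norm L (\<lambda>x. w (Suc k) x - w k x) * L2norm L (\<lambda>_. 1)"
        using L2norm_cauchy_schwarz[OF d one] by simp
      also have "\<dots> \<le> (1 / 2) ^ k * L2norm L (\<lambda>_. 1)"
        by (intro mult_right_mono wd) simp
      finally show ?thesis by (simp add: ennreal_leI)
    qed
    have "(\<integral>\<^sup>+x. (\<Sum>k. ennreal (norm (w (Suc k) x - w k x))) \<partial>?M) = (\<Sum>k. \<integral>\<^sup>+x. ennreal (norm (w (Suc k) x - w k x)) \<partial>?M)"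
      by (rule nn_integral_suminf) simp
    also have "\<dots> \<le> (\<Sum>k. ennreal ((1 / 2) ^ k * L2norm L (\<lambda>_. 1)))"
      by (intro suminf_le e) auto
    also have "\<dots> = ennreal (\<Sum>k. (1 / 2) ^ k * L2norm L (\<lambda>_. 1))"
      by (intro suminf_ennreal2) (auto intro: summable_mult2 summable_geometric)
    also have "\<dots> < \<infinity>" by simp
    finally show ?thesis .
  qed
  then have "AE x in ?M. (\<Sum>k. ennreal (norm (w (Suc k) x - w k x))) \<noteq> \<infinity>"
    by (intro nn_integral_PInf_AE) auto
  then have conv: "AE x in ?M. convergent (\<lambda>k. w k x)"
  proof eventually_elim
    case (elim x)
    then have "summable (\<lambda>k. norm (w (Suc k) x - w k x))"
      by (intro summable_suminf_not_top) auto
    then have "summable (\<lambda>k. w (Suc k) x - w k x)" by (rule summable_norm_cancel)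
    then have "convergent (\<lambda>n. \<Sum>k<n. w (Suc k) x - w k x)" by (simp add: summable_iff_convergent)
    then have "convergent (\<lambda>n. w n x - w 0 x)" by (simp add: sum_lessThan_telescope[of "\<lambda>k. w k x"])
    from convergent_add[OF this convergent_const[of "w 0 x"]] show ?case by simp
  qed
  define v where "v = (\<lambda>x. lim (\<lambda>k. w k x))"
  have [measurable]: "v \<in> borel_measurable ?M" unfolding v_def by measurable
  have lim: "AE x in ?M. (\<lambda>k. w k x) \<longlonglongrightarrow> v x"
    using conv by eventually_elim (simp add: v_def convergent_LIMSEQ_iff)
  \<comment> \<open>\<open>n\<close> runs over the original indices and only the approximating terms
    \<open>w k\<close> come from the subsequence; hence no later comparison between the two is
    required.\<close>
  have fatou: "(\<integral>\<^sup>+x. ennreal ((norm (v x - u n x))\<^sup>2) \<partial>?M) \<le> ennreal (\<epsilon>\<^sup>2)"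
    if n: "\<And>m. m \<ge> K \<Longrightarrow> L2norm L (\<lambda>x. u m x - u n x) \<le> \<epsilon>" for n K \<epsilon>
  proof -
    have [measurable]: "u n \<in> borel_measurable ?M" using u by (simp add: L2_def)
    have "(\<integral>\<^sup>+x. ennreal ((norm (v x - u n x))\<^sup>2) \<partial>?M) = (\<integral>\<^sup>+x. liminf (\<lambda>k. ennreal ((norm (w k x - u n x))\<^sup>2)) \<partial>?M)"
    proof (rule nn_integral_cong_AE, use lim in eventually_elim)
      case (elim x)
      then have "(\<lambda>k. ennreal ((norm (w k x - u n x))\<^sup>2)) \<longlonglongrightarrow> ennreal ((norm (v x - u n x))\<^sup>2)"
        by (intro tendsto_intros)
      from lim_imp_Liminf[OF trivial_limit_sequentially this] show ?case by simp
    qed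
    also have "\<dots> \<le> liminf (\<lambda>k. \<integral>\<^sup>+x. ennreal ((norm (w k x - u n x))\<^sup>2) \<partial>?M)"
      by (rule nn_integral_liminf) simp
    also have "\<dots> \<le> ennreal (\<epsilon>\<^sup>2)"
    proof (rule Liminf_le)
      have "(\<integral>\<^sup>+x. ennreal ((norm (w k x - u n x))\<^sup>2) \<partial>?M) \<le> ennreal (\<epsilon>\<^sup>2)" if "k \<ge> K" for k
      proof -
        have "r k \<ge> K" using that by (simp add: r_def)
        then have "L2norm L (\<lambda>x. w k x - u n x) \<le> \<epsilon>" using n by (simp add: w_def)
        from power_mono[OF this L2norm_nonneg, of 2]
        have "(LINT x|?M. (norm (w k x - u n x))\<^sup>2) \<le> \<epsilon>\<^sup>2" by (simp add: L2norm_sq)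
        then show ?thesis
          using L2_sq[OF L2_diff[OF wL2 u]] by (subst nn_integral_eq_integral) (auto intro: ennreal_leI)
      qed
      then show "\<forall>\<^sub>F k in sequentially. (\<integral>\<^sup>+x. ennreal ((norm (w k x - u n x))\<^sup>2) \<partial>?M) \<le> ennreal (\<epsilon>\<^sup>2)"
        by (auto simp: eventually_sequentially)
    qed simp
    finally show ?thesis .
  qed
  have vu: "L2 L (\<lambda>x. v x - u n x) \<and> L2norm L (\<lambda>x. v x - u n x) \<le> \<epsilon>"
    if n: "\<And>m. m \<ge> K \<Longrightarrow> L2norm L (\<lambda>x. u m x - u n x) \<le> \<epsilon>" and e: "0 \<le> \<epsilon>" for n K \<epsilon>
  proof -
    have [measurable]: "u n \<in> borel_measurable ?M" using u by (simp add: L2_def)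
    have F: "(\<integral>\<^sup>+x. ennreal ((norm (v x - u n x))\<^sup>2) \<partial>?M) \<le> ennreal (\<epsilon>\<^sup>2)"
      by (rule fatou[OF n])
    have i: "integrable ?M (\<lambda>x. (norm (v x - u n x))\<^sup>2)"
      by (rule integrableI_bounded) (use F in \<open>auto intro: le_less_trans\<close>)
    have "ennreal (LINT x|?M. (norm (v x - u n x))\<^sup>2) \<le> ennreal (\<epsilon>\<^sup>2)"
      using F i by (subst (asm) nn_integral_eq_integral) auto
    then have "(L2norm L (\<lambda>x. v x - u n x))\<^sup>2 \<le> \<epsilon>\<^sup>2" by (simp add: L2norm_sq)
    then show ?thesis using i e by (auto simp: L2_def intro: power2_le_imp_le)
  qed
  show thesis
  proof
    obtain K where K: "\<And>m n. K \<le> m \<Longrightarrow> K \<le> n \<Longrightarrow> L2norm L (\<lambda>x. u m x - u n x) \<le> 1"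
      using cauchy[of 1] by auto
    have "L2 L (\<lambda>x. v x - u K x)" using vu[of K K 1] K by auto
    from L2_add[OF this u[of K]] show "L2 L v" by simp
    show "(\<lambda>n. L2norm L (\<lambda>x. u n x - v x)) \<longlonglongrightarrow> 0"
    proof (rule LIMSEQ_I)
      fix e :: real assume e: "e > 0"
      then obtain K where K: "\<And>m n. K \<le> m \<Longrightarrow> K \<le> n \<Longrightarrow> L2norm L (\<lambda>x. u m x - u n x) \<le> e / 2"
        using cauchy[of "e / 2"] by auto
      have "L2norm L (\<lambda>x. u n x - v x) < e" if "n \<ge> K" for n
      proof -
        have "L2norm L (\<lambda>x. v x - u n x) \<le> e / 2" using vu[of K n "e / 2"] K that e by auto
        then show ?thesis using e L2norm_minus[of L "u n" v] by simp
      qed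
      then show "\<exists>K. \<forall>n\<ge>K. norm (L2norm L (\<lambda>x. u n x - v x) - 0) < e" by auto
    qed
  qed
qed

section \<open>Weak derivatives and H^1(0,L), with the Lebesgue integral traded for the gauge
  integral\<close>

lemma L2_subinterval:
  assumes "L2 L g" "x \<in> {0..L}"
  shows "g integrable_on {0..x}" "integral\<^sup>L (lebesgue_on {0..x}) g = integral {0..x} g"
    "(\<lambda>s. norm (g s)) integrable_on {0..x}"
proof -
  have i: "integrable (lebesgue_on {0..x}) g"
    by (rule Equivalence_Lebesgue_Henstock_Integration.integrable_subinterval[OF L2_integrable[OF assms(1)]])
      (use assms(2) in auto)
  show "g integrable_on {0..x}" "integral\<^sup>L (lebesgue_on {0..x}) g = integral {0..x} g"
    by (auto intro: integrable_on_lebesgue_on[OF i] lebesgue_integral_eq_integral[OF i])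
  have "integrable (lebesgue_on {0..x}) (\<lambda>s. norm (g s))" using i by simp
  then show "(\<lambda>s. norm (g s)) integrable_on {0..x}" by (rule integrable_on_lebesgue_on) simp
qed

lemma has_wderiv_iff:
  "has_wderiv L u g \<longleftrightarrow> L2 L g \<and> (\<forall>x\<in>{0..L}. u x - u 0 = integral {0..x} g)"
  unfolding has_wderiv_def diff_eq_eq using L2_subinterval(2)[of L g]
  by (simp add: add.commute cong: conj_cong)

lemma has_wderivD: "has_wderiv L u g \<Longrightarrow> x \<in> {0..L} \<Longrightarrow> integral {0..x} g = u x - u 0"
  unfolding has_wderiv_iff by (elim conjE) (drule (1) bspec, simp)

lemma has_wderivI:
  "L2 L g \<Longrightarrow> (\<And>x. x \<in> {0..L} \<Longrightarrow> u x - u 0 = integral {0..x} g) \<Longrightarrow> has_wderiv L u g"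
  unfolding has_wderiv_iff by blast

lemma L2norm_one: "0 \<le> L \<Longrightarrow> L2norm L (\<lambda>_. 1) = sqrt L"
  unfolding L2norm_def by (simp add: measure_restrict_space)

text \<open>Cauchy-Schwarz against the constant function \<open>1\<close>; the embedding of H^1 into
  L^\<infinity> rests on this.\<close>

lemma norm_integral_le_L2norm:
  assumes "L2 L g" "x \<in> {0..L}"
  shows "norm (integral {0..x} g) \<le> sqrt L * L2norm L g"
proof -
  have L: "0 \<le> L" using assms(2) by simp
  have L2one: "L2 L (\<lambda>_. 1)" by (rule L2_continuous) simp
  have "norm (integral {0..x} g) \<le> integral {0..x} (\<lambda>s. norm (g s))"
    by (rule integral_norm_bound_integral) (use L2_subinterval[OF assms] in auto)
  also have "\<dots> \<le> integral {0..L} (\<lambda>s. norm (g s))"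
    by (rule integral_subset_le) (use assms L2_subinterval[of L g L] L2_subinterval[of L g x] in auto)
  also have "\<dots> = (LINT s|lebesgue_on {0..L}. norm (g s) * norm (1::complex))"
    using L2_integrable[OF assms(1)] by (subst lebesgue_integral_eq_integral) auto
  also have "\<dots> \<le> L2norm L g * sqrt L"
    using L2norm_cauchy_schwarz[OF assms(1) L2one] L2norm_one[OF L] by simp
  finally show ?thesis by (simp add: mult.commute)
qed

lemma has_wderiv_L2: "has_wderiv L u g \<Longrightarrow> L2 L g"
  by (simp only: has_wderiv_def)

text \<open>Since \<open>wderiv\<close> is a choice, every identity about it must pass through this
  almost everywhere uniqueness.\<close>

lemma has_wderiv_unique:
  assumes "has_wderiv L u g" "has_wderiv L u h"
  shows "AE x in lebesgue_on {0..L}. g x = h x"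
proof -
  have L2: "L2 L (\<lambda>x. g x - h x)" by (intro L2_diff has_wderiv_L2[OF assms(1)] has_wderiv_L2[OF assms(2)])
  have z: "integral\<^sup>L (lebesgue_on {0..x}) (\<lambda>x. g x - h x) = 0" if x: "x \<in> {0..L}" for x
  proof -
    have "integral {0..x} (\<lambda>x. g x - h x) = integral {0..x} g - integral {0..x} h"
      using L2_subinterval(1)[of L g x] L2_subinterval(1)[of L h x] assms x 
      by (intro Henstock_Kurzweil_Integration.integral_diff) (simp_all only: has_wderiv_iff)
    also have "\<dots> = 0"
    proof -
      have "u x - u 0 = integral {0..x} g" "u x - u 0 = integral {0..x} h"
        using assms x unfolding has_wderiv_iff by blast+
      then show ?thesis by simp
    qed
    finally show ?thesis
      using L2_subinterval(2)[OF L2 x] by simp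
  qed
  show ?thesis using integrable_zero_AE[OF L2_integrable[OF L2] z] by simp
qed

lemma has_wderiv_wderiv: "H1 L u \<Longrightarrow> has_wderiv L u (wderiv L u)"
  unfolding H1_def wderiv_def by (rule someI_ex[of "has_wderiv L u"])

lemma L2_wderiv: "H1 L u \<Longrightarrow> L2 L (wderiv L u)"
  by (rule has_wderiv_L2[OF has_wderiv_wderiv])

lemma H1_I: "has_wderiv L u g \<Longrightarrow> H1 L u"
  by (auto simp: H1_def)

lemma wderiv_AE: "has_wderiv L u g \<Longrightarrow> AE x in lebesgue_on {0..L}. wderiv L u x = g x"
  using has_wderiv_unique[OF has_wderiv_wderiv[OF H1_I]] by blast

lemma H1_integral: "H1 L u \<Longrightarrow> x \<in> {0..L} \<Longrightarrow> u x = u 0 + integral {0..x} (wderiv L u)"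
  by (subst has_wderivD[OF has_wderiv_wderiv]) auto

lemma continuous_on_L2_integral:
  assumes "L2 L g"
  shows "continuous_on {0..L} (\<lambda>x. integral {0..x} g)"
proof (cases "0 \<le> L")
  case True
  then show ?thesis using L2_subinterval(1)[OF assms, of L] by (intro indefinite_integral_continuous_1) auto
qed simp

lemma H1_continuous: "H1 L u \<Longrightarrow> continuous_on {0..L} u"
  by (subst continuous_on_cong[OF refl H1_integral[of L u]])
    (auto intro!: continuous_intros continuous_on_L2_integral L2_wderiv)

lemma H1_cong: "(\<And>x. x \<in> {0..L} \<Longrightarrow> u x = v x) \<Longrightarrow> 0 \<le> L \<Longrightarrow> has_wderiv L u = has_wderiv L v"
  by (rule ext) (simp add: has_wderiv_iff)

text \<open>Equality everywhere and not merely almost everywhere, because the choice operator is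
  applied to one and the same predicate.\<close>

lemma wderiv_cong: "(\<And>x. x \<in> {0..L} \<Longrightarrow> u x = v x) \<Longrightarrow> 0 \<le> L \<Longrightarrow> wderiv L u = wderiv L v"
  unfolding wderiv_def using H1_cong[of L u v] by simp

lemma has_wderiv_add:
  assumes "has_wderiv L u g" "has_wderiv L v h"
  shows "has_wderiv L (\<lambda>x. u x + v x) (\<lambda>x. g x + h x)"
proof (rule has_wderivI)
  note L2 = has_wderiv_L2[OF assms(1)] has_wderiv_L2[OF assms(2)]
  show "L2 L (\<lambda>x. g x + h x)" by (intro L2_add L2)
  fix x assume x: "x \<in> {0..L}"
  have "integral {0..x} (\<lambda>x. g x + h x) = integral {0..x} g + integral {0..x} h"
    by (intro Henstock_Kurzweil_Integration.integral_add L2_subinterval(1)[OF L2(1) x] L2_subinterval(1)[OF L2(2) x])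
  then show "u x + v x - (u 0 + v 0) = integral {0..x} (\<lambda>x. g x + h x)"
    by (simp add: has_wderivD[OF assms(1) x] has_wderivD[OF assms(2) x])
qed

lemma has_wderiv_scale:
  assumes "has_wderiv L u g"
  shows "has_wderiv L (\<lambda>x. c * u x) (\<lambda>x. c * g x)"
proof (rule has_wderivI)
  show "L2 L (\<lambda>x. c * g x)" by (intro L2_scale has_wderiv_L2[OF assms])
qed (simp add: has_wderivD[OF assms] right_diff_distrib)

lemma has_wderiv_cnj:
  assumes "has_wderiv L u g"
  shows "has_wderiv L (\<lambda>x. cnj (u x)) (\<lambda>x. cnj (g x))"
proof (rule has_wderivI)
  show "L2 L (\<lambda>x. cnj (g x))" by (intro L2_cnj has_wderiv_L2[OF assms])
qed (simp add: integral_cnj[symmetric] has_wderivD[OF assms])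

lemma has_wderiv_zero: "has_wderiv L (\<lambda>_. 0) (\<lambda>_. 0)"
  by (simp add: has_wderiv_iff L2_zero)

lemma has_wderiv_integral:
  assumes "L2 L g"
  shows "has_wderiv L (\<lambda>x. c + integral {0..x} g) g"
  using assms by (simp add: has_wderiv_iff)

lemma has_wderiv_vector_derivative:
  assumes "has_wderiv L u g" "continuous_on {0..L} g" "x \<in> {0..L}"
  shows "(u has_vector_derivative g x) (at x within {0..L})"
proof -
  have "((\<lambda>x. u 0 + integral {0..x} g) has_vector_derivative g x) (at x within {0..L})"
    using has_vector_derivative_add[OF has_vector_derivative_const integral_has_vector_derivative[OF assms(2,3)]]
    by simp
  then show ?thesis
    by (rule has_vector_derivative_transform[OF assms(3), rotated])
      (simp add: has_wderivD[OF assms(1)])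
qed

lemma has_wderiv_of_C1:
  assumes "\<And>x. x \<in> {0..L} \<Longrightarrow> (u has_vector_derivative g x) (at x within {0..L})" "continuous_on {0..L} g"
  shows "has_wderiv L u g"
  unfolding has_wderiv_iff
proof (intro conjI ballI L2_continuous assms)
  fix x assume x: "x \<in> {0..L}"
  have "(g has_integral u x - u 0) {0..x}"
    by (rule fundamental_theorem_of_calculus)
      (use x in \<open>auto intro: has_vector_derivative_within_subset[OF assms(1)]\<close>)
  then show "u x - u 0 = integral {0..x} g" by (simp add: integral_unique)
qed

section \<open>The energy space and its inner product\<close>

lemma hspace_add:
  assumes "w \<in> hspace L" "z \<in> hspace L"
  shows "w + z \<in> hspace L"
proof -
  have "fst (w + z) = (\<lambda>x. fst w x + fst z x)" "snd (w + z) = (\<lambda>x. snd w x + snd z x)" by (auto simp: fun_eq_iff)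
  then show ?thesis
    using assms unfolding hspace_def H1_def by (auto intro: has_wderiv_add L2_add)
qed

lemma hspace_scale: "w \<in> hspace L \<Longrightarrow> hscale c w \<in> hspace L"
  unfolding hspace_def H1_def hscale_def by (auto intro: has_wderiv_scale L2_scale)

lemma diff_eq_scale: "w - z = w + hscale (- 1) z"
  by (auto simp: hscale_def plus_prod_def minus_prod_def fun_eq_iff)

lemma hspace_diff: "w \<in> hspace L \<Longrightarrow> z \<in> hspace L \<Longrightarrow> w - z \<in> hspace L"
  unfolding diff_eq_scale by (intro hspace_add hspace_scale)

lemma hspace_cnj: "w \<in> hspace L \<Longrightarrow> hcnj w \<in> hspace L"
  unfolding hspace_def H1_def hcnj_def by (auto intro: has_wderiv_cnj L2_cnj)

lemma hspace_zero: "0 \<in> hspace L"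
  using has_wderiv_zero[of L] L2_zero[of L] by (auto simp: hspace_def H1_def zero_prod_def zero_fun_def)

lemma hspace_sum: "(\<And>k. k \<in> F \<Longrightarrow> w k \<in> hspace L) \<Longrightarrow> (\<Sum>k\<in>F. w k) \<in> hspace L"
  by (induction F rule: infinite_finite_induct) (auto intro: hspace_add hspace_zero)

lemma hspaceD:
  "w \<in> hspace L \<Longrightarrow> H1 L (fst w)" "w \<in> hspace L \<Longrightarrow> fst w 0 = 0" "w \<in> hspace L \<Longrightarrow> L2 L (snd w)"
  "w \<in> hspace L \<Longrightarrow> L2 L (wderiv L (fst w))"
  by (auto simp: hspace_def L2_wderiv)

lemma hspace_snd: "L2 L u \<Longrightarrow> (\<lambda>_. 0, u) \<in> hspace L"
  using has_wderiv_zero by (auto simp: hspace_def H1_def)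

lemma wderiv_add_AE:
  "H1 L u \<Longrightarrow> H1 L v \<Longrightarrow> AE x in lebesgue_on {0..L}. wderiv L (u + v) x = wderiv L u x + wderiv L v x"
  unfolding plus_fun_def by (intro wderiv_AE has_wderiv_add has_wderiv_wderiv)

lemma wderiv_scale_AE:
  "H1 L u \<Longrightarrow> AE x in lebesgue_on {0..L}. wderiv L (\<lambda>x. c * u x) x = c * wderiv L u x"
  by (intro wderiv_AE has_wderiv_scale has_wderiv_wderiv)

lemma wderiv_cnj_AE:
  "H1 L u \<Longrightarrow> AE x in lebesgue_on {0..L}. wderiv L (\<lambda>x. cnj (u x)) x = cnj (wderiv L u x)"
  by (intro wderiv_AE has_wderiv_cnj has_wderiv_wderiv)

lemma integrable_hinner:
  assumes "w \<in> hspace L" "z \<in> hspace L"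
  shows "integrable (lebesgue_on {0..L})
    (\<lambda>x. wderiv L (fst w) x * cnj (wderiv L (fst z) x) + snd w x * cnj (snd z x))"
  by (intro Bochner_Integration.integrable_add integrable_L2_mult hspaceD assms)

lemma hinner_sym: "hinner L w z = cnj (hinner L z w)"
  unfolding hinner_def Bochner_Integration.integral_cnj[symmetric] by (simp add: mult.commute)

text \<open>\<open>wderiv\<close> is additive, homogeneous and compatible with conjugation only
  almost everywhere. The algebraic rules for \<open>hinner\<close> are therefore obtained by
  exchanging the integrand for one that agrees with it outside a null set.\<close>

lemma hinner_AE:
  assumes "w \<in> hspace L" "z \<in> hspace L" "integrable (lebesgue_on {0..L}) F"
    and "AE x in lebesgue_on {0..L}. F x = wderiv L (fst w) x * cnj (wderiv L (fst z) x) + snd w x * cnj (snd z x)"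
  shows "hinner L w z = integral\<^sup>L (lebesgue_on {0..L}) F"
  unfolding hinner_def
  by (rule integral_cong_AE) (use assms integrable_hinner[OF assms(1,2)] in \<open>auto elim: eventually_mono\<close>)

lemma hinner_add_left:
  assumes "w \<in> hspace L" "w' \<in> hspace L" "z \<in> hspace L"
  shows "hinner L (w + w') z = hinner L w z + hinner L w' z"
proof -
  have "hinner L (w + w') z = (LINT x|lebesgue_on {0..L}.
    (wderiv L (fst w) x * cnj (wderiv L (fst z) x) + snd w x * cnj (snd z x)) +
    (wderiv L (fst w') x * cnj (wderiv L (fst z) x) + snd w' x * cnj (snd z x)))"
  proof (rule hinner_AE)
    show "AE x in lebesgue_on {0..L}. (wderiv L (fst w) x * cnj (wderiv L (fst z) x) + snd w x * cnj (snd z x)) +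
      (wderiv L (fst w') x * cnj (wderiv L (fst z) x) + snd w' x * cnj (snd z x)) =
      wderiv L (fst (w + w')) x * cnj (wderiv L (fst z) x) + snd (w + w') x * cnj (snd z x)"
      using wderiv_add_AE[OF hspaceD(1)[OF assms(1)] hspaceD(1)[OF assms(2)]]
      by eventually_elim (simp add: algebra_simps)
  qed (intro assms hspace_add Bochner_Integration.integrable_add integrable_hinner integrable_L2_mult hspaceD)+
  also have "\<dots> = hinner L w z + hinner L w' z"
    unfolding hinner_def by (intro Bochner_Integration.integral_add integrable_hinner assms)
  finally show ?thesis .
qed

lemma hinner_scale_left:
  assumes "w \<in> hspace L" "z \<in> hspace L"
  shows "hinner L (hscale c w) z = c * hinner L w z"
proof -
  have "hinner L (hscale c w) z = (LINT x|lebesgue_on {0..L}.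
    c * (wderiv L (fst w) x * cnj (wderiv L (fst z) x) + snd w x * cnj (snd z x)))"
  proof (rule hinner_AE)
    show "AE x in lebesgue_on {0..L}. c * (wderiv L (fst w) x * cnj (wderiv L (fst z) x) + snd w x * cnj (snd z x)) =
      wderiv L (fst (hscale c w)) x * cnj (wderiv L (fst z) x) + snd (hscale c w) x * cnj (snd z x)"
      using wderiv_scale_AE[OF hspaceD(1)[OF assms(1)], of c]
      by eventually_elim (simp add: hscale_def algebra_simps)
  qed (use assms in \<open>auto intro!: hspace_scale integrable_mult_right integrable_hinner
      simp: distrib_left[symmetric] simp del: distrib_left\<close>)
  then show ?thesis unfolding hinner_def by simp
qed

lemma hinner_diff_left:
  assumes "w \<in> hspace L" "w' \<in> hspace L" "z \<in> hspace L"
  shows "hinner L (w - w') z = hinner L w z - hinner L w' z"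
  unfolding diff_eq_scale using assms by (simp add: hinner_add_left hinner_scale_left hspace_scale)

lemma hinner_zero_left: "z \<in> hspace L \<Longrightarrow> hinner L 0 z = 0"
  using hinner_diff_left[OF hspace_zero hspace_zero, of z L] by simp

lemma hinner_sum_left:
  assumes "\<And>k. k \<in> F \<Longrightarrow> w k \<in> hspace L" "z \<in> hspace L"
  shows "hinner L (\<Sum>k\<in>F. w k) z = (\<Sum>k\<in>F. hinner L (w k) z)"
  using assms(1)
  by (induction F rule: infinite_finite_induct)
    (simp_all add: hinner_zero_left assms(2) hinner_add_left hspace_sum)

lemma hinner_add_right:
  "w \<in> hspace L \<Longrightarrow> z \<in> hspace L \<Longrightarrow> z' \<in> hspace L \<Longrightarrow> hinner L w (z + z') = hinner L w z + hinner L w z'"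
  unfolding hinner_sym[of L w z] hinner_sym[of L w z'] hinner_sym[of L w "z + z'"] by (simp add: hinner_add_left)

lemma hinner_scale_right:
  "w \<in> hspace L \<Longrightarrow> z \<in> hspace L \<Longrightarrow> hinner L w (hscale c z) = cnj c * hinner L w z"
  unfolding hinner_sym[of L w z] hinner_sym[of L w "hscale c z"] by (simp add: hinner_scale_left)

lemma hinner_sum_right:
  assumes "\<And>k. k \<in> F \<Longrightarrow> z k \<in> hspace L" "w \<in> hspace L"
  shows "hinner L w (\<Sum>k\<in>F. z k) = (\<Sum>k\<in>F. hinner L w (z k))"
proof -
  have "hinner L w (\<Sum>k\<in>F. z k) = (\<Sum>k\<in>F. cnj (hinner L (z k) w))"
    by (subst hinner_sym) (simp add: hinner_sum_left assms)
  then show ?thesis by (simp flip: hinner_sym)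
qed

lemma hinner_hcnj:
  assumes "w \<in> hspace L" "z \<in> hspace L"
  shows "hinner L (hcnj w) (hcnj z) = cnj (hinner L w z)"
proof -
  have "hinner L (hcnj w) (hcnj z) = (LINT x|lebesgue_on {0..L}.
    cnj (wderiv L (fst w) x * cnj (wderiv L (fst z) x) + snd w x * cnj (snd z x)))"
  proof (rule hinner_AE)
    show "AE x in lebesgue_on {0..L}. cnj (wderiv L (fst w) x * cnj (wderiv L (fst z) x) + snd w x * cnj (snd z x)) =
      wderiv L (fst (hcnj w)) x * cnj (wderiv L (fst (hcnj z)) x) + snd (hcnj w) x * cnj (snd (hcnj z) x)"
      using wderiv_cnj_AE[OF hspaceD(1)[OF assms(1)]] wderiv_cnj_AE[OF hspaceD(1)[OF assms(2)]]
      by eventually_elim (simp add: hcnj_def)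
    show "integrable (lebesgue_on {0..L}) (\<lambda>x. cnj (wderiv L (fst w) x * cnj (wderiv L (fst z) x) + snd w x * cnj (snd z x)))"
      using integrable_hinner[OF assms] by (simp only: integrable_cnj)
  qed (intro assms hspace_cnj)+
  then show ?thesis unfolding hinner_def Bochner_Integration.integral_cnj .
qed

lemma heq_refl: "heq L w w" by (simp add: heq_def)

lemma heq_sym: "heq L w z \<Longrightarrow> heq L z w" by (auto simp: heq_def elim: eventually_mono)

lemma heq_trans: "heq L w z \<Longrightarrow> heq L z y \<Longrightarrow> heq L w y"
  unfolding heq_def by (auto elim: eventually_elim2)

lemma heq_add: "heq L w w' \<Longrightarrow> heq L z z' \<Longrightarrow> heq L (w + z) (w' + z')"
  unfolding heq_def by (auto elim: eventually_elim2)

lemma hinner_heq_left: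
  assumes "heq L w w'" "w \<in> hspace L" "w' \<in> hspace L" "z \<in> hspace L" "0 \<le> L"
  shows "hinner L w z = hinner L w' z"
proof -
  have "wderiv L (fst w) = wderiv L (fst w')"
    using assms by (intro wderiv_cong) (auto simp: heq_def)
  then have "hinner L w z = (LINT x|lebesgue_on {0..L}.
      wderiv L (fst w') x * cnj (wderiv L (fst z) x) + snd w' x * cnj (snd z x))"
    using assms by (intro hinner_AE integrable_hinner) (auto simp: heq_def elim: eventually_mono)
  then show ?thesis by (simp add: hinner_def)
qed

lemma hinner_heq:
  assumes "heq L w w'" "heq L z z'" "w \<in> hspace L" "w' \<in> hspace L" "z \<in> hspace L" "z' \<in> hspace L" "0 \<le> L"
  shows "hinner L w z = hinner L w' z'"
proof -
  have "hinner L w' z = cnj (hinner L z w')" by (rule hinner_sym)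
  also have "\<dots> = cnj (hinner L z' w')" using hinner_heq_left[OF assms(2,5,6,4,7)] by simp
  also have "\<dots> = hinner L w' z'" by (rule hinner_sym[symmetric])
  finally show ?thesis using hinner_heq_left[OF assms(1,3,4,5,7)] by simp
qed

lemma hinner_self:
  assumes "w \<in> hspace L"
  shows "hinner L w w = of_real ((L2norm L (wderiv L (fst w)))\<^sup>2 + (L2norm L (snd w))\<^sup>2)"
proof -
  have "hinner L w w = (LINT x|lebesgue_on {0..L}. of_real ((norm (wderiv L (fst w) x))\<^sup>2 + (norm (snd w x))\<^sup>2))"
    unfolding hinner_def by (simp add: complex_norm_square[symmetric])
  also have "\<dots> = of_real (LINT x|lebesgue_on {0..L}. (norm (wderiv L (fst w) x))\<^sup>2 + (norm (snd w x))\<^sup>2)"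
    by (rule integral_complex_of_real)
  also have "(LINT x|lebesgue_on {0..L}. (norm (wderiv L (fst w) x))\<^sup>2 + (norm (snd w x))\<^sup>2) =
      (L2norm L (wderiv L (fst w)))\<^sup>2 + (L2norm L (snd w))\<^sup>2"
    unfolding L2norm_sq using assms by (intro Bochner_Integration.integral_add L2_sq hspaceD)
  finally show ?thesis .
qed

lemma hnorm_eq:
  "w \<in> hspace L \<Longrightarrow> hnorm L w = sqrt ((L2norm L (wderiv L (fst w)))\<^sup>2 + (L2norm L (snd w))\<^sup>2)"
  unfolding hnorm_def by (simp add: hinner_self)

lemma hinner_self_hnorm: "w \<in> hspace L \<Longrightarrow> hinner L w w = of_real ((hnorm L w)\<^sup>2)"
  by (simp add: hinner_self hnorm_eq)

lemma hnorm_nonneg: "w \<in> hspace L \<Longrightarrow> 0 \<le> hnorm L w"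
  by (simp add: hnorm_eq)

lemma L2norm_le_hnorm:
  assumes "w \<in> hspace L"
  shows "L2norm L (wderiv L (fst w)) \<le> hnorm L w" "L2norm L (snd w) \<le> hnorm L w"
  using assms by (auto simp: hnorm_eq intro!: real_le_rsqrt)

lemma hnorm_le_L2norm: "w \<in> hspace L \<Longrightarrow> hnorm L w \<le> L2norm L (wderiv L (fst w)) + L2norm L (snd w)"
  by (simp add: hnorm_eq sqrt_sum_squares_le_sum)

lemma hnorm_cong:
  "heq L w w' \<Longrightarrow> w \<in> hspace L \<Longrightarrow> w' \<in> hspace L \<Longrightarrow> 0 \<le> L \<Longrightarrow> hnorm L w = hnorm L w'"
  unfolding hnorm_def by (simp add: hinner_heq[of L w w' w w'])

lemma hinner_cauchy_schwarz:
  assumes "w \<in> hspace L" "z \<in> hspace L"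
  shows "cmod (hinner L w z) \<le> hnorm L w * hnorm L z"
proof -
  let ?M = "lebesgue_on {0..L}"
  let ?a = "L2norm L (wderiv L (fst w))" and ?b = "L2norm L (snd w)"
  let ?c = "L2norm L (wderiv L (fst z))" and ?d = "L2norm L (snd z)"
  note I = integrable_L2_mult(2)[OF hspaceD(4)[OF assms(1)] hspaceD(4)[OF assms(2)]]
    integrable_L2_mult(2)[OF hspaceD(3)[OF assms(1)] hspaceD(3)[OF assms(2)]]
  have "cmod (hinner L w z) \<le> (LINT x|?M. norm (wderiv L (fst w) x * cnj (wderiv L (fst z) x) + snd w x * cnj (snd z x)))"
    unfolding hinner_def by (rule integral_norm_bound)
  also have "\<dots> \<le> (LINT x|?M. norm (wderiv L (fst w) x) * norm (wderiv L (fst z) x) + norm (snd w x) * norm (snd z x))"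
    by (rule Bochner_Integration.integral_mono)
      (use integrable_hinner[OF assms] I in \<open>auto intro!: norm_triangle_le simp: norm_mult\<close>)
  also have "\<dots> \<le> ?a * ?c + ?b * ?d"
    using I L2norm_cauchy_schwarz[OF hspaceD(4)[OF assms(1)] hspaceD(4)[OF assms(2)]]
      L2norm_cauchy_schwarz[OF hspaceD(3)[OF assms(1)] hspaceD(3)[OF assms(2)]] by simp
  \<comment> \<open>Cauchy-Schwarz in the plane, with \<open>bool\<close> as the index set of two
    elements.\<close>
  also have "\<dots> \<le> sqrt (?a\<^sup>2 + ?b\<^sup>2) * sqrt (?c\<^sup>2 + ?d\<^sup>2)"
    using L2_set_mult_ineq[of "\<lambda>i. if i then ?a else ?b" "\<lambda>i. if i then ?c else ?d" UNIV]
    by (simp add: L2_set_def UNIV_bool add.commute)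
  finally show ?thesis using assms by (simp add: hnorm_eq)
qed

lemma hnorm_triangle:
  assumes "w \<in> hspace L" "z \<in> hspace L"
  shows "hnorm L (w + z) \<le> hnorm L w + hnorm L z"
proof (rule power2_le_imp_le)
  have "(hnorm L (w + z))\<^sup>2 = Re (hinner L (w + z) (w + z))"
    using assms by (simp add: hinner_self_hnorm hspace_add)
  also have "\<dots> = (hnorm L w)\<^sup>2 + 2 * Re (hinner L w z) + (hnorm L z)\<^sup>2"
    using assms hinner_sym[of L z w] hinner_self_hnorm[OF assms(1)] hinner_self_hnorm[OF assms(2)]
    by (simp add: hinner_add_left hinner_add_right hspace_add)
  also have "\<dots> \<le> (hnorm L w)\<^sup>2 + 2 * (hnorm L w * hnorm L z) + (hnorm L z)\<^sup>2"
    using hinner_cauchy_schwarz[OF assms] complex_Re_le_cmod[of "hinner L w z"] by simp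
  finally show "(hnorm L (w + z))\<^sup>2 \<le> (hnorm L w + hnorm L z)\<^sup>2" by (simp add: power2_sum)
qed (use assms hnorm_nonneg in auto)

lemma hnorm_zero: "hnorm L 0 = 0"
  using hinner_zero_left[OF hspace_zero] by (simp add: hnorm_def)

text \<open>The first component vanishes at 0, so it is the integral of its weak derivative and its
  size is controlled by the energy norm alone.\<close>

lemma fst_le_hnorm:
  assumes "w \<in> hspace L" "x \<in> {0..L}"
  shows "cmod (fst w x) \<le> sqrt L * hnorm L w"
proof -
  have "cmod (fst w x) \<le> sqrt L * L2norm L (wderiv L (fst w))"
    using H1_integral[OF hspaceD(1)[OF assms(1)] assms(2)] hspaceD(2)[OF assms(1)]
      norm_integral_le_L2norm[OF hspaceD(4)[OF assms(1)] assms(2)] by simp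
  also have "\<dots> \<le> sqrt L * hnorm L w"
    using assms L2norm_le_hnorm[OF assms(1)] by (intro mult_left_mono) auto
  finally show ?thesis .
qed

lemma hnorm_zero_heq:
  assumes "w \<in> hspace L" "hnorm L w = 0"
  shows "heq L w 0"
proof -
  have "AE x in lebesgue_on {0..L}. snd w x = 0"
    using L2norm_le_hnorm(2)[OF assms(1)] assms L2norm_nonneg[of L "snd w"]
    by (intro L2norm_zero_AE hspaceD) auto
  then show ?thesis using fst_le_hnorm[OF assms(1)] assms(2) by (auto simp: heq_def)
qed

lemma hnorm_snd: "L2 L u \<Longrightarrow> hnorm L (\<lambda>_. 0, u) = L2norm L u"
proof -
  assume u: "L2 L u"
  have "AE x in lebesgue_on {0..L}. wderiv L (\<lambda>_. 0) x = 0" by (rule wderiv_AE[OF has_wderiv_zero])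
  then have "L2norm L (wderiv L (\<lambda>_. 0)) = L2norm L (\<lambda>_. 0)"
    by (rule L2norm_cong_AE) (auto intro!: L2_meas L2_wderiv H1_I has_wderiv_zero)
  then show ?thesis using hnorm_eq[OF hspace_snd[OF u]] by (simp add: L2norm_def)
qed

text \<open>The limit is taken in L^2 for the weak derivatives and for the second components.
  Integrating the first limit from 0 restores a function in H^1 with the right boundary
  value.\<close>

lemma hspace_cauchy_convergent:
  assumes w: "\<And>n. w n \<in> hspace L" and L: "0 \<le> L"
    and cauchy: "\<And>\<epsilon>. \<epsilon> > 0 \<Longrightarrow> \<exists>N. \<forall>m\<ge>N. \<forall>n\<ge>N. hnorm L (w m - w n) \<le> \<epsilon>"
  obtains z where "z \<in> hspace L" "(\<lambda>n. hnorm L (w n - z)) \<longlonglongrightarrow> 0"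
proof -
  have d: "L2norm L (\<lambda>x. wderiv L (fst z) x - wderiv L (fst z') x) = L2norm L (wderiv L (fst (z - z')))"
    if "z \<in> hspace L" "z' \<in> hspace L" for z z'
  proof (rule L2norm_cong_AE)
    have "has_wderiv L (\<lambda>x. fst z x + - 1 * fst z' x) (\<lambda>x. wderiv L (fst z) x + - 1 * wderiv L (fst z') x)"
      by (intro has_wderiv_add has_wderiv_scale has_wderiv_wderiv hspaceD that)
    moreover have "fst (z - z') = (\<lambda>x. fst z x + - 1 * fst z' x)" by (auto simp: fun_eq_iff)
    ultimately have "AE x in lebesgue_on {0..L}. wderiv L (fst (z - z')) x = wderiv L (fst z) x + - 1 * wderiv L (fst z') x"
      by (simp only: wderiv_AE)
    then show "AE x in lebesgue_on {0..L}. wderiv L (fst z) x - wderiv L (fst z') x = wderiv L (fst (z - z')) x"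
      by eventually_elim simp
  qed (intro L2_meas L2_diff hspaceD hspace_diff that)+
  have c1: "\<exists>N. \<forall>m\<ge>N. \<forall>n\<ge>N. L2norm L (\<lambda>x. wderiv L (fst (w m)) x - wderiv L (fst (w n)) x) \<le> \<epsilon>"
    and c2: "\<exists>N. \<forall>m\<ge>N. \<forall>n\<ge>N. L2norm L (\<lambda>x. snd (w m) x - snd (w n) x) \<le> \<epsilon>" if "\<epsilon> > 0" for \<epsilon>
  proof -
    obtain N where N: "\<And>m n. m \<ge> N \<Longrightarrow> n \<ge> N \<Longrightarrow> hnorm L (w m - w n) \<le> \<epsilon>" using cauchy[OF \<open>\<epsilon> > 0\<close>] by blast
    show "\<exists>N. \<forall>m\<ge>N. \<forall>n\<ge>N. L2norm L (\<lambda>x. wderiv L (fst (w m)) x - wderiv L (fst (w n)) x) \<le> \<epsilon>"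
      unfolding d[OF w w] using N L2norm_le_hnorm(1)[OF hspace_diff[OF w w]] by (blast intro: order_trans)
    have "snd (w m - w n) = (\<lambda>x. snd (w m) x - snd (w n) x)" for m n by (auto simp: fun_eq_iff)
    then show "\<exists>N. \<forall>m\<ge>N. \<forall>n\<ge>N. L2norm L (\<lambda>x. snd (w m) x - snd (w n) x) \<le> \<epsilon>"
      using N L2norm_le_hnorm(2)[OF hspace_diff[OF w w]] by (metis order_trans)
  qed
  obtain g where g: "L2 L g" "(\<lambda>n. L2norm L (\<lambda>x. wderiv L (fst (w n)) x - g x)) \<longlonglongrightarrow> 0"
    using L2_cauchy_convergent[OF hspaceD(4)[OF w] c1] by blast
  obtain v where v: "L2 L v" "(\<lambda>n. L2norm L (\<lambda>x. snd (w n) x - v x)) \<longlonglongrightarrow> 0"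
    using L2_cauchy_convergent[OF hspaceD(3)[OF w] c2] by blast
  define z where "z = ((\<lambda>x. integral {0..x} g), v)"
  have wd: "has_wderiv L (fst z) g" using has_wderiv_integral[OF g(1), of 0] by (simp add: z_def)
  have z: "z \<in> hspace L" using wd v by (auto simp: hspace_def z_def H1_def)
  show thesis
  proof
    show "z \<in> hspace L" by fact
    have le: "hnorm L (w n - z) \<le> L2norm L (\<lambda>x. wderiv L (fst (w n)) x - g x) + L2norm L (\<lambda>x. snd (w n) x - v x)" for n
    proof -
      have "L2norm L (wderiv L (fst (w n - z))) = L2norm L (\<lambda>x. wderiv L (fst (w n)) x - wderiv L (fst z) x)"
        by (rule d[OF w z, symmetric])
      also have "\<dots> = L2norm L (\<lambda>x. wderiv L (fst (w n)) x - g x)"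
      proof (rule L2norm_cong_AE)
        show "AE x in lebesgue_on {0..L}. wderiv L (fst (w n)) x - wderiv L (fst z) x = wderiv L (fst (w n)) x - g x"
          using wderiv_AE[OF wd] by eventually_elim simp
      qed (intro L2_meas L2_diff hspaceD z w g(1))+
      finally have 1: "L2norm L (wderiv L (fst (w n - z))) = L2norm L (\<lambda>x. wderiv L (fst (w n)) x - g x)" .
      have "snd (w n - z) = (\<lambda>x. snd (w n) x - v x)" by (auto simp: fun_eq_iff z_def)
      then show ?thesis using hnorm_le_L2norm[OF hspace_diff[OF w z], of n] 1 by simp
    qed
    show "(\<lambda>n. hnorm L (w n - z)) \<longlonglongrightarrow> 0"
    proof (rule tendsto_sandwich[OF _ _ tendsto_const])
      show "(\<lambda>n. L2norm L (\<lambda>x. wderiv L (fst (w n)) x - g x) + L2norm L (\<lambda>x. snd (w n) x - v x)) \<longlonglongrightarrow> 0"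
        using tendsto_add[OF g(2) v(2)] by simp
    qed (auto intro!: always_eventually le hnorm_nonneg hspace_diff w z)
  qed
qed

section \<open>The wave operator\<close>

locale wave_equation =
  fixes L \<alpha> :: real and f ye :: "real \<Rightarrow> real"
  assumes L_pos: "L > 0" and f_C2: "C2_on UNIV f" and ye_steady: "steady_state L f ye"
begin

lemma f_deriv: "(f has_real_derivative deriv f x) (at x)"
  and f_deriv2: "(deriv f has_real_derivative deriv (deriv f) x) (at x)"
  and f_deriv2_cont: "continuous_on UNIV (deriv (deriv f))"
proof -
  obtain g h where g: "\<And>x. (f has_real_derivative g x) (at x)" and h: "\<And>x. (g has_real_derivative h x) (at x)"
    and c: "continuous_on UNIV h"
    using f_C2 by (auto simp: C2_on_def C1_on_def)
  have "deriv f = g" using DERIV_imp_deriv[OF g] by auto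
  moreover have "deriv g = h" using DERIV_imp_deriv[OF h] by auto
  ultimately show "(f has_real_derivative deriv f x) (at x)" "(deriv f has_real_derivative deriv (deriv f) x) (at x)"
    "continuous_on UNIV (deriv (deriv f))" using g h c by auto
qed

lemma f_cont: "continuous_on UNIV f" and f_deriv_cont: "continuous_on UNIV (deriv f)"
  by (auto intro!: continuous_at_imp_continuous_on DERIV_isCont f_deriv f_deriv2)

lemma ye_cont: "continuous_on {0..L} ye"
proof -
  obtain g where "\<forall>t\<in>{0..L}. (ye has_real_derivative g t) (at t within {0..L})"
    using ye_steady unfolding steady_state_def C2_on_def by blast
  then show ?thesis using DERIV_continuous_on[of "{0..L}" ye g] by blast
qed

definition pot :: "real \<Rightarrow> complex" where "pot x = of_real (deriv f (ye x))"

lemma pot_cont: "continuous_on {0..L} pot"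
  unfolding pot_def by (intro continuous_intros continuous_on_compose2[OF f_deriv_cont ye_cont]) auto

text \<open>For \<open>h\<close> equal to \<A> \<open>w\<close>, this is the second derivative of
  the first component of \<open>w\<close>.\<close>

definition rhs :: "state \<Rightarrow> state \<Rightarrow> real \<Rightarrow> complex" where
  "rhs w h s = snd h s - pot s * fst w s"

text \<open>The trace w1'(0) as determined by \<open>(w, h)\<close>: it is w1'(L) minus the integral
  of w1'', and the boundary condition gives w1'(L) = -\<alpha> w2(L), where w2 is the first
  component of \<open>h\<close>.\<close>

definition D0 :: "state \<Rightarrow> state \<Rightarrow> complex" where
  "D0 w h = - of_real \<alpha> * fst h L - integral {0..L} (rhs w h)"

text \<open>The defect in the identity obtained by integrating the second order equation twice from
  0, with slope \<open>D0\<close> there.\<close>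

definition Zd :: "state \<Rightarrow> state \<Rightarrow> real \<Rightarrow> complex" where
  "Zd w h x = fst w x - (of_real x * D0 w h + integral {0..x} (\<lambda>y. integral {0..y} (rhs w h)))"

text \<open>
  The relation \<open>h = \<A> w\<close> (up to the choice of representatives), with the second order equation and
  its boundary conditions integrated twice, so that both sides depend continuously on \<open>(w, h)\<close>.
\<close>

definition graph_rel :: "state \<Rightarrow> state \<Rightarrow> bool" where
  "graph_rel w h \<longleftrightarrow> L2norm L (\<lambda>x. snd w x - fst h x) = 0 \<and> (\<forall>x\<in>{0..L}. Zd w h x = 0)"

lemma L2_fst: "w \<in> hspace L \<Longrightarrow> L2 L (fst w)"
  by (intro L2_continuous H1_continuous hspaceD)

lemma L2_pot: "w \<in> hspace L \<Longrightarrow> L2 L (\<lambda>x. pot x * fst w x)"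
  by (intro L2_continuous continuous_intros H1_continuous hspaceD pot_cont)

lemma L2_rhs: "w \<in> hspace L \<Longrightarrow> h \<in> hspace L \<Longrightarrow> L2 L (rhs w h)"
  unfolding rhs_def[abs_def] by (intro L2_diff L2_pot hspaceD)

lemma pot_bounded: obtains M where "M \<ge> 0" "\<And>x. x \<in> {0..L} \<Longrightarrow> cmod (pot x) \<le> M"
proof -
  have "bounded (pot ` {0..L})" by (intro compact_imp_bounded compact_continuous_image pot_cont) simp
  then obtain M where "\<forall>x\<in>{0..L}. cmod (pot x) \<le> M" by (auto simp: bounded_iff)
  then have M: "\<And>x. x \<in> {0..L} \<Longrightarrow> cmod (pot x) \<le> M" by blast
  show thesis
  proof (rule that)
    show "M \<ge> 0" using M[of 0] L_pos by (auto intro: order_trans[OF norm_ge_zero])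
  qed (rule M)
qed

lemma continuous_on_integral_rhs:
  "w \<in> hspace L \<Longrightarrow> h \<in> hspace L \<Longrightarrow> continuous_on {0..L} (\<lambda>y. integral {0..y} (rhs w h))"
  by (intro continuous_on_L2_integral L2_rhs)

lemma integrable_integral_rhs:
  "w \<in> hspace L \<Longrightarrow> h \<in> hspace L \<Longrightarrow> x \<in> {0..L} \<Longrightarrow> (\<lambda>y. integral {0..y} (rhs w h)) integrable_on {0..x}"
  by (rule integrable_continuous_interval[OF continuous_on_subset[OF continuous_on_integral_rhs]]) auto

lemma integral_rhs_add:
  assumes "w \<in> hspace L" "h \<in> hspace L" "w' \<in> hspace L" "h' \<in> hspace L" "y \<in> {0..L}"
  shows "integral {0..y} (rhs (w + w') (h + h')) = integral {0..y} (rhs w h) + integral {0..y} (rhs w' h')"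
proof -
  have "rhs (w + w') (h + h') = (\<lambda>s. rhs w h s + rhs w' h' s)"
    by (auto simp: rhs_def fun_eq_iff algebra_simps)
  then show ?thesis
    using assms by (auto intro!: Henstock_Kurzweil_Integration.integral_add L2_subinterval(1)[OF L2_rhs])
qed

lemma integral_rhs_scale: "integral S (rhs (hscale c w) (hscale c h)) = c * integral S (rhs w h)"
proof -
  have "rhs (hscale c w) (hscale c h) = (\<lambda>s. c * rhs w h s)"
    by (auto simp: rhs_def fun_eq_iff hscale_def algebra_simps)
  then show ?thesis by simp
qed

lemma D0_add:
  assumes "w \<in> hspace L" "h \<in> hspace L" "w' \<in> hspace L" "h' \<in> hspace L"
  shows "D0 (w + w') (h + h') = D0 w h + D0 w' h'"
  unfolding D0_def using integral_rhs_add[OF assms, of L] L_pos by (simp add: algebra_simps)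

lemma D0_scale: "D0 (hscale c w) (hscale c h) = c * D0 w h"
  unfolding D0_def integral_rhs_scale by (simp add: hscale_def algebra_simps)

lemma Zd_add:
  assumes "w \<in> hspace L" "h \<in> hspace L" "w' \<in> hspace L" "h' \<in> hspace L" "x \<in> {0..L}"
  shows "Zd (w + w') (h + h') x = Zd w h x + Zd w' h' x"
proof -
  have "integral {0..x} (\<lambda>y. integral {0..y} (rhs (w + w') (h + h'))) =
      integral {0..x} (\<lambda>y. integral {0..y} (rhs w h) + integral {0..y} (rhs w' h'))"
    by (rule Henstock_Kurzweil_Integration.integral_cong) (use assms in \<open>auto intro!: integral_rhs_add\<close>)
  also have "\<dots> = integral {0..x} (\<lambda>y. integral {0..y} (rhs w h)) + integral {0..x} (\<lambda>y. integral {0..y} (rhs w' h'))"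
    by (intro Henstock_Kurzweil_Integration.integral_add integrable_integral_rhs assms)
  finally show ?thesis unfolding Zd_def D0_add[OF assms(1-4)] by (simp add: algebra_simps)
qed

lemma Zd_scale: "Zd (hscale c w) (hscale c h) x = c * Zd w h x"
  unfolding Zd_def D0_scale integral_rhs_scale by (simp add: hscale_def algebra_simps)

lemma graph_rel_add:
  assumes "w \<in> hspace L" "h \<in> hspace L" "w' \<in> hspace L" "h' \<in> hspace L" "graph_rel w h" "graph_rel w' h'"
  shows "graph_rel (w + w') (h + h')"
proof -
  have "L2norm L (\<lambda>x. snd (w + w') x - fst (h + h') x) = L2norm L (\<lambda>x. (snd w x - fst h x) + (snd w' x - fst h' x))"
    by (simp add: algebra_simps)
  also have "\<dots> \<le> L2norm L (\<lambda>x. snd w x - fst h x) + L2norm L (\<lambda>x. snd w' x - fst h' x)"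
    by (intro L2norm_add_le L2_diff hspaceD L2_fst assms)
  also have "\<dots> = 0" using assms by (simp add: graph_rel_def)
  finally have "L2norm L (\<lambda>x. snd (w + w') x - fst (h + h') x) = 0"
    using L2norm_nonneg by (metis antisym)
  then show ?thesis using assms Zd_add[OF assms(1-4)] unfolding graph_rel_def by simp
qed

lemma graph_rel_scale:
  assumes "w \<in> hspace L" "h \<in> hspace L" "graph_rel w h"
  shows "graph_rel (hscale c w) (hscale c h)"
proof -
  have "(\<lambda>x. snd (hscale c w) x - fst (hscale c h) x) = (\<lambda>x. c * (snd w x - fst h x))"
    by (auto simp: hscale_def algebra_simps)
  then have "L2norm L (\<lambda>x. snd (hscale c w) x - fst (hscale c h) x) \<le> cmod c * L2norm L (\<lambda>x. snd w x - fst h x)"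
    by (simp only:) (intro L2norm_mono L2_scale L2_diff hspaceD L2_fst assms, auto simp: norm_mult)
  then have "L2norm L (\<lambda>x. snd (hscale c w) x - fst (hscale c h) x) = 0"
    using assms L2norm_nonneg by (metis antisym graph_rel_def mult_zero_right)
  then show ?thesis using assms unfolding graph_rel_def Zd_scale by simp
qed

lemma integral_rhs_zero: "integral S (rhs 0 0) = 0"
proof -
  have "rhs 0 0 = (\<lambda>_. 0)" by (auto simp: rhs_def fun_eq_iff)
  then show ?thesis by (simp only: Henstock_Kurzweil_Integration.integral_0)
qed

lemma graph_rel_zero: "graph_rel 0 0"
  by (simp add: graph_rel_def Zd_def D0_def integral_rhs_zero L2norm_def)

lemma D0_zero: "D0 0 0 = 0"
  by (simp add: D0_def integral_rhs_zero)

lemma graph_rel_sum: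
  assumes "\<And>k. k \<in> F \<Longrightarrow> w k \<in> hspace L" "\<And>k. k \<in> F \<Longrightarrow> h k \<in> hspace L" "\<And>k. k \<in> F \<Longrightarrow> graph_rel (w k) (h k)"
  shows "graph_rel (\<Sum>k\<in>F. hscale (c k) (w k)) (\<Sum>k\<in>F. hscale (c k) (h k)) \<and>
    D0 (\<Sum>k\<in>F. hscale (c k) (w k)) (\<Sum>k\<in>F. hscale (c k) (h k)) = (\<Sum>k\<in>F. c k * D0 (w k) (h k))"
  using assms
  by (induction F rule: infinite_finite_induct)
    (simp_all add: graph_rel_zero D0_zero graph_rel_add graph_rel_scale hspace_sum hspace_scale D0_add D0_scale)

text \<open>Double integration leaves only integrals and point values of first components, all
  controlled by the two energy norms. For \<open>D0\<close> this says that the trace w1'(0) is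
  continuous in the graph norm of \<A>.\<close>

lemma D0_Zd_bound:
  obtains C where "C \<ge> 0"
    "\<And>w h. w \<in> hspace L \<Longrightarrow> h \<in> hspace L \<Longrightarrow> cmod (D0 w h) \<le> C * (hnorm L w + hnorm L h)"
    "\<And>w h x. w \<in> hspace L \<Longrightarrow> h \<in> hspace L \<Longrightarrow> x \<in> {0..L} \<Longrightarrow> cmod (Zd w h x) \<le> C * (hnorm L w + hnorm L h)"
    "\<And>w h. w \<in> hspace L \<Longrightarrow> h \<in> hspace L \<Longrightarrow> L2norm L (\<lambda>x. snd w x - fst h x) \<le> C * (hnorm L w + hnorm L h)"
proof -
  obtain M where M: "M \<ge> 0" "\<And>x. x \<in> {0..L} \<Longrightarrow> cmod (pot x) \<le> M"
    using pot_bounded by blast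
  define S where "S = sqrt L"
  have S: "S \<ge> 0" using L_pos by (simp add: S_def)
  have one: "L2 L (\<lambda>_. 1)" by (rule L2_continuous) simp
  have L2fst: "L2norm L (fst w) \<le> S * hnorm L w * S" if w: "w \<in> hspace L" for w
    using L2norm_mono[OF one L2_fst[OF w], of "S * hnorm L w"] fst_le_hnorm[OF w] L2norm_one[of L] L_pos
      hnorm_nonneg[OF w] by (simp add: S_def)
  define c1 where "c1 = S * (1 + M * S * S)"
  have c1: "c1 \<ge> 0" using S M by (simp add: c1_def)
  have rhs: "cmod (integral {0..y} (rhs w h)) \<le> c1 * (hnorm L w + hnorm L h)"
    if w: "w \<in> hspace L" and h: "h \<in> hspace L" and y: "y \<in> {0..L}" for w h y
  proof -
    have n: "0 \<le> hnorm L w" "0 \<le> hnorm L h" using w h by (auto intro: hnorm_nonneg)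
    have p: "L2norm L (\<lambda>x. - 1 * (pot x * fst w x)) \<le> M * L2norm L (fst w)"
      by (intro L2norm_mono L2_fst L2_scale L2_pot w M) (auto simp: norm_mult intro!: mult_right_mono M)
    have "L2norm L (rhs w h) \<le> L2norm L (snd h) + L2norm L (\<lambda>x. - 1 * (pot x * fst w x))"
      using L2norm_add_le[OF hspaceD(3)[OF h] L2_scale[OF L2_pot[OF w], of "- 1"]]
      by (simp add: rhs_def[abs_def])
    also have "\<dots> \<le> hnorm L h + M * (S * hnorm L w * S)"
      using p mult_left_mono[OF L2fst[OF w] M(1)] L2norm_le_hnorm(2)[OF h] by linarith
    also have "\<dots> \<le> (1 + M * S * S) * (hnorm L w + hnorm L h)"
      using n M S by (simp add: algebra_simps)
    finally have "S * L2norm L (rhs w h) \<le> S * ((1 + M * S * S) * (hnorm L w + hnorm L h))"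
      using S by (rule mult_left_mono)
    then show ?thesis
      using norm_integral_le_L2norm[OF L2_rhs[OF w h] y] by (simp add: S_def[symmetric] c1_def mult.assoc)
  qed
  define c2 where "c2 = \<bar>\<alpha>\<bar> * S + c1"
  have c2: "c2 \<ge> 0" using S c1 by (simp add: c2_def)
  have D: "cmod (D0 w h) \<le> c2 * (hnorm L w + hnorm L h)" if w: "w \<in> hspace L" and h: "h \<in> hspace L" for w h
  proof -
    have n: "0 \<le> hnorm L w" using w by (rule hnorm_nonneg)
    have "cmod (D0 w h) \<le> \<bar>\<alpha>\<bar> * cmod (fst h L) + cmod (integral {0..L} (rhs w h))"
      unfolding D0_def using norm_triangle_ineq4[of "- of_real \<alpha> * fst h L" "integral {0..L} (rhs w h)"]
      by (simp add: norm_mult)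
    also have "\<dots> \<le> \<bar>\<alpha>\<bar> * (S * (hnorm L w + hnorm L h)) + c1 * (hnorm L w + hnorm L h)"
    proof (intro add_mono mult_left_mono rhs w h)
      have "cmod (fst h L) \<le> S * hnorm L h" using fst_le_hnorm[OF h, of L] L_pos by (simp add: S_def)
      also have "\<dots> \<le> S * (hnorm L w + hnorm L h)" using n S by (intro mult_left_mono) auto
      finally show "cmod (fst h L) \<le> S * (hnorm L w + hnorm L h)" .
    qed (use L_pos in auto)
    finally show ?thesis by (simp add: c2_def algebra_simps)
  qed
  define c3 where "c3 = S + L * c2 + c1 * L"
  have Z: "cmod (Zd w h x) \<le> c3 * (hnorm L w + hnorm L h)"
    if w: "w \<in> hspace L" and h: "h \<in> hspace L" and x: "x \<in> {0..L}" for w h x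
  proof -
    define N where "N = hnorm L w + hnorm L h"
    have n: "0 \<le> hnorm L w" "0 \<le> hnorm L h" "N \<ge> 0" using w h by (auto simp: N_def intro: hnorm_nonneg add_nonneg_nonneg)
    have 1: "cmod (fst w x) \<le> S * N"
      using fst_le_hnorm[OF w x] n S mult_left_mono[of "hnorm L w" N S] by (simp add: N_def S_def)
    have 2: "cmod (of_real x * D0 w h) \<le> L * (c2 * N)"
      using x D[OF w h] L_pos by (simp only: norm_mult N_def) (intro mult_mono, auto)
    have 3: "cmod (integral {0..x} (\<lambda>y. integral {0..y} (rhs w h))) \<le> L * (c1 * N)"
    proof -
      have "cmod (integral {0..x} (\<lambda>y. integral {0..y} (rhs w h))) \<le> integral {0..x} (\<lambda>_. c1 * N)"
        by (rule integral_norm_bound_integral)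
          (use x integrable_integral_rhs[OF w h x] rhs[OF w h] in \<open>auto simp: N_def\<close>)
      also have "\<dots> = x * (c1 * N)" using x by simp
      also have "\<dots> \<le> L * (c1 * N)" using x c1 n by (intro mult_right_mono) auto
      finally show ?thesis .
    qed
    have "cmod (Zd w h x) \<le> cmod (fst w x) + (cmod (of_real x * D0 w h) + cmod (integral {0..x} (\<lambda>y. integral {0..y} (rhs w h))))"
      unfolding Zd_def by (rule order_trans[OF norm_triangle_ineq4 add_left_mono[OF norm_triangle_ineq]])
    also have "\<dots> \<le> c3 * N" using 1 2 3 by (simp add: c3_def algebra_simps)
    finally show ?thesis by (simp add: N_def)
  qed
  have A: "L2norm L (\<lambda>x. snd w x - fst h x) \<le> (1 + S * S) * (hnorm L w + hnorm L h)"
    if w: "w \<in> hspace L" and h: "h \<in> hspace L" for w h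
  proof -
    have n: "0 \<le> hnorm L w" "0 \<le> hnorm L h" using w h by (auto intro: hnorm_nonneg)
    have m: "L2norm L (\<lambda>x. - 1 * fst h x) \<le> 1 * L2norm L (fst h)"
      by (intro L2norm_mono L2_fst L2_scale h) auto
    have "L2norm L (\<lambda>x. snd w x - fst h x) \<le> L2norm L (snd w) + L2norm L (\<lambda>x. - 1 * fst h x)"
      using L2norm_add_le[OF hspaceD(3)[OF w] L2_scale[OF L2_fst[OF h], of "- 1"]] by simp
    also have "\<dots> \<le> hnorm L w + S * hnorm L h * S" using L2norm_le_hnorm(2)[OF w] L2fst[OF h] m by simp
    also have "\<dots> \<le> (1 + S * S) * (hnorm L w + hnorm L h)" using n S by (simp add: algebra_simps)
    finally show ?thesis .
  qed
  define C where "C = c2 + c3 + (1 + S * S)"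
  have c3: "c3 \<ge> 0" using c1 c2 S L_pos by (simp add: c3_def)
  have mono: "k * (hnorm L w + hnorm L h) \<le> C * (hnorm L w + hnorm L h)"
    if "k \<le> C" "w \<in> hspace L" "h \<in> hspace L" for k w h
    using that by (intro mult_right_mono add_nonneg_nonneg hnorm_nonneg)
  have k: "c2 \<le> C" "c3 \<le> C" "1 + S * S \<le> C" "0 \<le> C" using c2 c3 S by (auto simp: C_def)
  show thesis
    by (rule that[OF k(4)]) (auto intro: order_trans[OF D mono] order_trans[OF Z mono] order_trans[OF A mono] k)
qed

text \<open>Closedness of \<A>, together with convergence of the traces w1'(0). The filter is
  arbitrary so that limits along finite sets of indices are covered.\<close>

lemma graph_rel_closed:
  assumes F: "F \<noteq> bot" and w: "w \<in> hspace L" and h: "h \<in> hspace L"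
    and wn: "\<And>n. wn n \<in> hspace L" and hn: "\<And>n. hn n \<in> hspace L"
    and rel: "\<forall>\<^sub>F n in F. graph_rel (wn n) (hn n)"
    and lim: "((\<lambda>n. hnorm L (wn n - w)) \<longlongrightarrow> 0) F" "((\<lambda>n. hnorm L (hn n - h)) \<longlongrightarrow> 0) F"
  shows "graph_rel w h" "((\<lambda>n. D0 (wn n) (hn n)) \<longlongrightarrow> D0 w h) F"
proof -
  obtain C where C: "C \<ge> 0"
    "\<And>w h. w \<in> hspace L \<Longrightarrow> h \<in> hspace L \<Longrightarrow> cmod (D0 w h) \<le> C * (hnorm L w + hnorm L h)"
    "\<And>w h x. w \<in> hspace L \<Longrightarrow> h \<in> hspace L \<Longrightarrow> x \<in> {0..L} \<Longrightarrow> cmod (Zd w h x) \<le> C * (hnorm L w + hnorm L h)"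
    "\<And>w h. w \<in> hspace L \<Longrightarrow> h \<in> hspace L \<Longrightarrow> L2norm L (\<lambda>x. snd w x - fst h x) \<le> C * (hnorm L w + hnorm L h)"
    by (rule D0_Zd_bound) blast
  let ?u = "\<lambda>n. wn n - w" and ?v = "\<lambda>n. hn n - h"
  have uv: "?u n \<in> hspace L" "?v n \<in> hspace L" for n by (auto intro: hspace_diff w h wn hn)
  have sp: "w + ?u n = wn n" "h + ?v n = hn n" for n by simp_all
  have b0: "((\<lambda>n. C * (hnorm L (?u n) + hnorm L (?v n))) \<longlongrightarrow> 0) F"
    using tendsto_mult_right_zero[OF tendsto_add_zero[OF lim]] .
  have "((\<lambda>n. D0 (?u n) (?v n)) \<longlongrightarrow> 0) F"
    by (rule Lim_null_comparison[OF _ b0]) (auto intro!: always_eventually C uv)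
  then have "((\<lambda>n. D0 w h + D0 (?u n) (?v n)) \<longlongrightarrow> D0 w h + 0) F" by (intro tendsto_intros)
  then show "((\<lambda>n. D0 (wn n) (hn n)) \<longlongrightarrow> D0 w h) F"
    by (simp add: D0_add[OF w h uv, symmetric])
  have Z: "Zd w h x = 0" if x: "x \<in> {0..L}" for x
  proof -
    have "((\<lambda>n. Zd (?u n) (?v n) x) \<longlongrightarrow> 0) F"
      by (rule Lim_null_comparison[OF _ b0]) (auto intro!: always_eventually C uv x)
    then have "((\<lambda>n. Zd w h x + Zd (?u n) (?v n) x) \<longlongrightarrow> Zd w h x + 0) F" by (intro tendsto_intros)
    then have "((\<lambda>n. Zd (wn n) (hn n) x) \<longlongrightarrow> Zd w h x) F"
      by (simp add: Zd_add[OF w h uv x, symmetric])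
    moreover have "((\<lambda>n. Zd (wn n) (hn n) x) \<longlongrightarrow> 0) F"
      using rel x by (intro tendsto_eventually) (auto elim!: eventually_mono simp: graph_rel_def)
    ultimately show ?thesis using tendsto_unique[OF F] by blast
  qed
  have "\<forall>\<^sub>F n in F. L2norm L (\<lambda>x. snd w x - fst h x) \<le> C * (hnorm L (?u n) + hnorm L (?v n))"
    using rel
  proof eventually_elim
    case (elim n)
    have "L2norm L (\<lambda>x. snd w x - fst h x) =
        L2norm L (\<lambda>x. (snd (wn n) x - fst (hn n) x) + (- 1) * (snd (?u n) x - fst (?v n) x))"
      by (simp add: algebra_simps)
    also have "\<dots> \<le> L2norm L (\<lambda>x. snd (wn n) x - fst (hn n) x) + L2norm L (\<lambda>x. - 1 * (snd (?u n) x - fst (?v n) x))"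
      by (intro L2norm_add_le L2_scale L2_diff hspaceD L2_fst uv wn hn)
    also have "L2norm L (\<lambda>x. snd (wn n) x - fst (hn n) x) = 0" using elim by (simp add: graph_rel_def)
    also have "L2norm L (\<lambda>x. - 1 * (snd (?u n) x - fst (?v n) x)) = L2norm L (\<lambda>x. snd (?u n) x - fst (?v n) x)"
      by (simp add: L2norm_def norm_minus_commute)
    finally show ?case using C(4)[OF uv(1)[of n] uv(2)[of n]] by simp
  qed
  then have "L2norm L (\<lambda>x. snd w x - fst h x) \<le> 0"
    by (intro tendsto_lowerbound[OF b0 _ F])
  then have "L2norm L (\<lambda>x. snd w x - fst h x) = 0" using L2norm_nonneg by (metis antisym)
  then show "graph_rel w h" using Z by (simp add: graph_rel_def)
qed

lemma pointwise_deriv_eq: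
  assumes "has_wderiv L u g" "continuous_on {0..L} g" "x \<in> {0..L}"
  shows "pointwise_deriv L u x = g x"
  unfolding pointwise_deriv_def
  by (rule vector_derivative_within_cbox[of 0 L, unfolded cbox_interval])
    (use has_wderiv_vector_derivative[OF assms] L_pos assms(3) in auto)

lemma domA_hspace: "w \<in> domA L \<alpha> \<Longrightarrow> w \<in> hspace L"
  by (simp add: domA_def)

lemma domA_pointwise_deriv:
  assumes "w \<in> domA L \<alpha>"
  shows "has_wderiv L (fst w) (pointwise_deriv L (fst w))" "H1 L (pointwise_deriv L (fst w))"
proof -
  obtain g where g: "has_wderiv L (fst w) g" "H1 L g" using assms by (auto simp: domA_def H2_def)
  have eq: "pointwise_deriv L (fst w) x = g x" if "x \<in> {0..L}" for x
    by (rule pointwise_deriv_eq[OF g(1) H1_continuous[OF g(2)] that])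
  show h1: "H1 L (pointwise_deriv L (fst w))"
    using g(2) H1_cong[of L "pointwise_deriv L (fst w)" g] eq L_pos by (simp add: H1_def)
  show "has_wderiv L (fst w) (pointwise_deriv L (fst w))"
  proof (rule has_wderivI)
    fix x assume x: "x \<in> {0..L}"
    have "integral {0..x} (pointwise_deriv L (fst w)) = integral {0..x} g"
      by (rule Henstock_Kurzweil_Integration.integral_cong) (use eq x in auto)
    then show "fst w x - fst w 0 = integral {0..x} (pointwise_deriv L (fst w))"
      using has_wderivD[OF g(1) x] by simp
  qed (intro L2_continuous H1_continuous h1)
qed

lemma opA_hspace:
  assumes "w \<in> domA L \<alpha>"
  shows "opA L f ye w \<in> hspace L"
proof -
  have "L2 L (\<lambda>x. wderiv L (pointwise_deriv L (fst w)) x + pot x * fst w x)"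
    by (intro L2_add L2_wderiv domA_pointwise_deriv assms L2_pot domA_hspace)
  then show ?thesis using assms by (auto simp: hspace_def opA_def domA_def pot_def)
qed

lemma graph_rel_opA:
  assumes "w \<in> domA L \<alpha>"
  shows "graph_rel w (opA L f ye w)" "D0 w (opA L f ye w) = pointwise_deriv L (fst w) 0"
proof -
  let ?p = "pointwise_deriv L (fst w)"
  note P = domA_pointwise_deriv[OF assms]
  have r: "rhs w (opA L f ye w) = wderiv L ?p" by (auto simp: rhs_def opA_def pot_def)
  have p: "?p y = ?p 0 + integral {0..y} (wderiv L ?p)" if "y \<in> {0..L}" for y
    by (rule H1_integral[OF P(2) that])
  have "?p L + of_real \<alpha> * snd w L = 0" using assms by (simp add: domA_def)
  then show D: "D0 w (opA L f ye w) = ?p 0"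
  proof -
    assume "?p L + of_real \<alpha> * snd w L = 0"
    then have "- (of_real \<alpha> * snd w L) = ?p L" by (simp add: neg_eq_iff_add_eq_0 add.commute)
    then show ?thesis unfolding D0_def r using p[of L] L_pos by (simp add: opA_def)
  qed
  have "Zd w (opA L f ye w) x = 0" if x: "x \<in> {0..L}" for x
  proof -
    have "fst w x = integral {0..x} ?p"
      using has_wderivD[OF P(1) x] domA_hspace[OF assms] by (simp add: hspaceD)
    also have "\<dots> = integral {0..x} (\<lambda>y. ?p 0 + integral {0..y} (wderiv L ?p))"
      by (rule Henstock_Kurzweil_Integration.integral_cong) (rule p, use x in auto)
    also have "\<dots> = integral {0..x} (\<lambda>y. ?p 0) + integral {0..x} (\<lambda>y. integral {0..y} (wderiv L ?p))"
      using integrable_integral_rhs[OF domA_hspace[OF assms] opA_hspace[OF assms] x]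
      by (intro Henstock_Kurzweil_Integration.integral_add) (auto simp: r)
    finally show ?thesis using x unfolding Zd_def D r by (simp add: scaleR_conv_of_real)
  qed
  moreover have "L2norm L (\<lambda>x. snd w x - fst (opA L f ye w) x) = 0" by (simp add: opA_def L2norm_def)
  ultimately show "graph_rel w (opA L f ye w)" by (simp add: graph_rel_def)
qed

text \<open>The domain of \<A> prescribes point values of the second component, whereas
  \<open>snd w\<close> is known only almost everywhere. Its continuous representative is
  \<open>fst h\<close>, so the pair \<open>(fst w, fst h)\<close> is the representative that belongs
  to the domain.\<close>

lemma graph_rel_domA:
  assumes w: "w \<in> hspace L" and h: "h \<in> hspace L" and rel: "graph_rel w h"
  shows "(fst w, fst h) \<in> domA L \<alpha>" "heq L (fst w, fst h) w" "heq L (opA L f ye (fst w, fst h)) h"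
    "pointwise_deriv L (fst w) 0 = D0 w h"
proof -
  define P where "P = (\<lambda>y. D0 w h + integral {0..y} (rhs w h))"
  have P: "has_wderiv L P (rhs w h)" unfolding P_def by (rule has_wderiv_integral[OF L2_rhs[OF w h]])
  have PH: "H1 L P" by (rule H1_I[OF P])
  have wP: "has_wderiv L (fst w) P"
  proof (rule has_wderivI[OF L2_continuous[OF H1_continuous[OF PH]]])
    fix x assume x: "x \<in> {0..L}"
    have "integral {0..x} P = of_real x * D0 w h + integral {0..x} (\<lambda>y. integral {0..y} (rhs w h))"
      unfolding P_def using x integrable_integral_rhs[OF w h x]
      by (subst Henstock_Kurzweil_Integration.integral_add) (auto simp: scaleR_conv_of_real)
    then show "fst w x - fst w 0 = integral {0..x} P"
      using rel x w by (simp add: graph_rel_def Zd_def hspaceD)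
  qed
  have pd: "pointwise_deriv L (fst w) x = P x" if "x \<in> {0..L}" for x
    by (rule pointwise_deriv_eq[OF wP H1_continuous[OF PH] that])
  show "pointwise_deriv L (fst w) 0 = D0 w h" using pd[of 0] L_pos by (simp add: P_def)
  have "pointwise_deriv L (fst w) L + of_real \<alpha> * fst h L = 0"
    using pd[of L] L_pos by (simp add: P_def D0_def)
  then show "(fst w, fst h) \<in> domA L \<alpha>"
    using w h wP PH by (auto simp: domA_def hspace_def H2_def L2_fst[OF h])
  have "AE x in lebesgue_on {0..L}. snd w x - fst h x = 0"
    using L2norm_zero_AE[OF L2_diff[OF hspaceD(3)[OF w] L2_fst[OF h]]] rel by (simp add: graph_rel_def)
  then have "AE x in lebesgue_on {0..L}. fst h x = snd w x" by eventually_elim simp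
  then show "heq L (fst w, fst h) w" by (simp add: heq_def)
  have wd: "wderiv L (pointwise_deriv L (fst w)) = wderiv L P"
    by (rule wderiv_cong) (use pd L_pos in auto)
  have "AE x in lebesgue_on {0..L}. snd (opA L f ye (fst w, fst h)) x = snd h x"
    using wderiv_AE[OF P] by eventually_elim (simp add: opA_def wd rhs_def pot_def)
  then show "heq L (opA L f ye (fst w, fst h)) h" by (simp add: heq_def opA_def)
qed

end

section \<open>Coordinates with respect to the Riesz basis\<close>

locale wave_spectral = wave_equation +
  fixes n0 :: nat and e d :: "int \<Rightarrow> state" and lam :: "int \<Rightarrow> complex"
  assumes alpha_gt: "\<alpha> > 1" and spectral: "spectral_family L \<alpha> f ye n0 e d lam"
begin

abbreviation Low :: "int set" where "Low \<equiv> low_modes n0"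
abbreviation High :: "int set" where "High \<equiv> high_modes n0"

lemma Low_High: "k \<notin> Low \<longleftrightarrow> k \<in> High" "k \<notin> High \<longleftrightarrow> k \<in> Low"
  by (auto simp: low_modes_def high_modes_def)

lemma finite_Low: "finite Low"
proof -
  have "Low = {- int n0..int n0}" by (auto simp: low_modes_def)
  then show ?thesis by simp
qed

lemma L_nonneg: "0 \<le> L" using L_pos by simp

lemmas spectralD =
  spectral[unfolded spectral_family_def, THEN conjunct1]
  spectral[unfolded spectral_family_def, THEN conjunct2, THEN conjunct1]
  spectral[unfolded spectral_family_def, THEN conjunct2, THEN conjunct2, THEN conjunct1]
  spectral[unfolded spectral_family_def, THEN conjunct2, THEN conjunct2, THEN conjunct2, THEN conjunct1]
  spectral[unfolded spectral_family_def, THEN conjunct2, THEN conjunct2, THEN conjunct2, THEN conjunct2, THEN conjunct1]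
  spectral[unfolded spectral_family_def, THEN conjunct2, THEN conjunct2, THEN conjunct2, THEN conjunct2, THEN conjunct2, THEN conjunct1]
  spectral[unfolded spectral_family_def, THEN conjunct2, THEN conjunct2, THEN conjunct2, THEN conjunct2, THEN conjunct2, THEN conjunct2, THEN conjunct1]
  spectral[unfolded spectral_family_def, THEN conjunct2, THEN conjunct2, THEN conjunct2, THEN conjunct2, THEN conjunct2, THEN conjunct2, THEN conjunct2, THEN conjunct1]

lemma riesz: "riesz_basis L e" "riesz_basis L d"
  by (fact spectralD(1), fact spectralD(2))

lemma e_domA: "e k \<in> domA L \<alpha>"
  using spectralD(3) by simp

lemma e_hspace: "e k \<in> hspace L"
  by (rule domA_hspace[OF e_domA])

lemma d_hspace: "d k \<in> hspace L"
  using riesz(2) by (simp add: riesz_basis_def)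

lemma biorthogonal: "hinner L (e k) (d l) = (if k = l then 1 else 0)"
  using spectralD(4) by simp

lemma high: "k \<in> High \<Longrightarrow> heq L (opA L f ye (e k)) (hscale (lam k) (e k))"
    "k \<in> High \<Longrightarrow> adjA_eq L \<alpha> f ye (d k) (hscale (cnj (lam k)) (d k))"
    "k \<in> High \<Longrightarrow> Re (lam k) < -1" "k \<in> High \<Longrightarrow> heq L (e (- k)) (hcnj (e k))"
    "k \<in> High \<Longrightarrow> heq L (d (- k)) (hcnj (d k))"
  using spectralD(5) by simp_all

lemma low: "k \<in> Low \<Longrightarrow> heq L (hcnj (e k)) (e k)" "k \<in> Low \<Longrightarrow> heq L (hcnj (d k)) (d k)"
    "k \<in> Low \<Longrightarrow> \<exists>c. adjA_eq L \<alpha> f ye (d k) (\<Sum>p\<in>Low. hscale (c p) (d p))"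
  using spectralD(8) by simp_all

definition coef :: "state \<Rightarrow> int \<Rightarrow> complex" where "coef w k = hinner L w (d k)"
definition cf :: "state \<Rightarrow> int ell2" where "cf w = mk_ell2 (coef w)"

lemma coef_add: "w \<in> hspace L \<Longrightarrow> z \<in> hspace L \<Longrightarrow> coef (w + z) k = coef w k + coef z k"
  and coef_diff: "w \<in> hspace L \<Longrightarrow> z \<in> hspace L \<Longrightarrow> coef (w - z) k = coef w k - coef z k"
  and coef_scale: "w \<in> hspace L \<Longrightarrow> coef (hscale c w) k = c * coef w k"
  and coef_sum: "(\<And>j. j \<in> F \<Longrightarrow> g j \<in> hspace L) \<Longrightarrow> coef (\<Sum>j\<in>F. g j) k = (\<Sum>j\<in>F. coef (g j) k)"
  by (simp_all add: coef_def hinner_add_left hinner_diff_left hinner_scale_left hinner_sum_left d_hspace)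

lemma coef_heq: "heq L w z \<Longrightarrow> w \<in> hspace L \<Longrightarrow> z \<in> hspace L \<Longrightarrow> coef w k = coef z k"
  unfolding coef_def by (rule hinner_heq_left) (auto intro: d_hspace L_nonneg)

text \<open>Square root of an upper Riesz bound of the dual basis; it bounds the coordinates by the
  energy norm.\<close>

definition Cd :: real where
  "Cd = sqrt (SOME M. M > 0 \<and> (\<forall>F c. finite F \<longrightarrow>
     (hnorm L (\<Sum>k\<in>F. hscale (c k) (d k)))\<^sup>2 \<le> M * (\<Sum>k\<in>F. (cmod (c k))\<^sup>2)))"

lemma Cd: "Cd > 0" "finite F \<Longrightarrow> (hnorm L (\<Sum>k\<in>F. hscale (c k) (d k)))\<^sup>2 \<le> Cd\<^sup>2 * (\<Sum>k\<in>F. (cmod (c k))\<^sup>2)"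
proof -
  have "\<exists>M. M > 0 \<and> (\<forall>F c. finite F \<longrightarrow>
     (hnorm L (\<Sum>k\<in>F. hscale (c k) (d k)))\<^sup>2 \<le> M * (\<Sum>k\<in>F. (cmod (c k))\<^sup>2))"
    using riesz(2) unfolding riesz_basis_def by blast
  from someI_ex[OF this] show "Cd > 0"
    "finite F \<Longrightarrow> (hnorm L (\<Sum>k\<in>F. hscale (c k) (d k)))\<^sup>2 \<le> Cd\<^sup>2 * (\<Sum>k\<in>F. (cmod (c k))\<^sup>2)"
    unfolding Cd_def by auto
qed

text \<open>Duality: the sum \<open>S\<close> is the inner product of \<open>w\<close> with the
  combination \<open>z\<close> of dual vectors, whose norm is at most \<open>Cd * sqrt S\<close>.
  One factor \<open>sqrt S\<close> cancels.\<close>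

lemma bessel:
  assumes w: "w \<in> hspace L" and F: "finite F"
  shows "(\<Sum>k\<in>F. (cmod (coef w k))\<^sup>2) \<le> (Cd * hnorm L w)\<^sup>2"
proof -
  define S where "S = (\<Sum>k\<in>F. (cmod (coef w k))\<^sup>2)"
  define z where "z = (\<Sum>k\<in>F. hscale (coef w k) (d k))"
  have S: "S \<ge> 0" by (simp add: S_def sum_nonneg)
  have z: "z \<in> hspace L" unfolding z_def by (intro hspace_sum hspace_scale d_hspace)
  have "hinner L w z = (\<Sum>k\<in>F. cnj (coef w k) * coef w k)"
    unfolding z_def using w
    by (simp add: hinner_sum_right hinner_scale_right hspace_scale d_hspace coef_def)
  also have "\<dots> = of_real S" by (simp only: S_def of_real_sum complex_norm_square mult.commute)
  finally have "S = cmod (hinner L w z)" using S by simp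
  also have "\<dots> \<le> hnorm L w * hnorm L z" by (rule hinner_cauchy_schwarz[OF w z])
  also have "\<dots> \<le> hnorm L w * (Cd * sqrt S)"
  proof (rule mult_left_mono[OF _ hnorm_nonneg[OF w]])
    have "(hnorm L z)\<^sup>2 \<le> (Cd * sqrt S)\<^sup>2"
      using Cd(2)[OF F, of "coef w"] S by (simp add: z_def S_def power_mult_distrib)
    then show "hnorm L z \<le> Cd * sqrt S" by (rule power2_le_imp_le) (use Cd S in simp)
  qed
  finally have "sqrt S * sqrt S \<le> (Cd * hnorm L w) * sqrt S" using S by (simp add: mult_ac)
  then have "sqrt S \<le> Cd * hnorm L w"
  proof (cases "S = 0")
    case False
    with S have "sqrt S > 0" by simp
    then show ?thesis using \<open>sqrt S * sqrt S \<le> _\<close> by (rule mult_right_le_imp_le[rotated])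
  qed (use Cd(1) hnorm_nonneg[OF w] in simp)
  then have "(sqrt S)\<^sup>2 \<le> (Cd * hnorm L w)\<^sup>2" using S by (intro power_mono) auto
  then show ?thesis using S by (simp add: S_def)
qed

lemma ec_cf: "w \<in> hspace L \<Longrightarrow> ec (cf w) k = coef w k"
  unfolding cf_def by (subst ec_mk) (auto intro: in_ell2_sqI bessel)

lemma norm_cf_le: "w \<in> hspace L \<Longrightarrow> norm (cf w) \<le> Cd * hnorm L w"
  by (rule norm_ell2_sq_le) (auto simp: ec_cf hnorm_nonneg Cd(1) less_imp_le intro: bessel)

lemma cf_add: "w \<in> hspace L \<Longrightarrow> z \<in> hspace L \<Longrightarrow> cf (w + z) = cf w + cf z"
  and cf_diff: "w \<in> hspace L \<Longrightarrow> z \<in> hspace L \<Longrightarrow> cf (w - z) = cf w - cf z"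
  and cf_scaleR: "w \<in> hspace L \<Longrightarrow> cf (hscale (of_real r) w) = r *\<^sub>R cf w"
  by (auto intro!: ell2_eqI simp: ec_cf hspace_add hspace_diff hspace_scale coef_add coef_diff coef_scale scaleR_conv_of_real)

text \<open>Square root of an upper Riesz bound of the basis itself, for the reverse comparison of
  norms.\<close>

definition Ce :: real where
  "Ce = sqrt (SOME M. M > 0 \<and> (\<forall>F c. finite F \<longrightarrow>
     (hnorm L (\<Sum>k\<in>F. hscale (c k) (e k)))\<^sup>2 \<le> M * (\<Sum>k\<in>F. (cmod (c k))\<^sup>2)))"

lemma Ce: "Ce > 0" "finite F \<Longrightarrow> (hnorm L (\<Sum>k\<in>F. hscale (c k) (e k)))\<^sup>2 \<le> Ce\<^sup>2 * (\<Sum>k\<in>F. (cmod (c k))\<^sup>2)"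
proof -
  have "\<exists>M. M > 0 \<and> (\<forall>F c. finite F \<longrightarrow>
     (hnorm L (\<Sum>k\<in>F. hscale (c k) (e k)))\<^sup>2 \<le> M * (\<Sum>k\<in>F. (cmod (c k))\<^sup>2))"
    using riesz(1) unfolding riesz_basis_def by blast
  from someI_ex[OF this] show "Ce > 0"
    "finite F \<Longrightarrow> (hnorm L (\<Sum>k\<in>F. hscale (c k) (e k)))\<^sup>2 \<le> Ce\<^sup>2 * (\<Sum>k\<in>F. (cmod (c k))\<^sup>2)"
    unfolding Ce_def by auto
qed

definition esum :: "int set \<Rightarrow> (int \<Rightarrow> complex) \<Rightarrow> state" where
  "esum F c = (\<Sum>k\<in>F. hscale (c k) (e k))"

lemma esum_hspace: "esum F c \<in> hspace L"
  unfolding esum_def by (intro hspace_sum hspace_scale e_hspace)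

lemma coef_esum: "finite F \<Longrightarrow> coef (esum F c) k = (if k \<in> F then c k else 0)"
  unfolding esum_def coef_def
  by (simp add: hinner_sum_left hinner_scale_left hspace_scale e_hspace d_hspace biorthogonal
      if_distrib[of "(*) _"] sum.delta cong: if_cong)

text \<open>Immediate for finite combinations of the basis; these are dense and \<open>cf\<close> is
  continuous.\<close>

lemma hnorm_le_norm_cf:
  assumes w: "w \<in> hspace L"
  shows "hnorm L w \<le> Ce * norm (cf w)"
proof (rule field_le_epsilon)
  fix \<epsilon> :: real assume "\<epsilon> > 0"
  \<comment> \<open>An approximation error \<open>\<epsilon>'\<close> enters twice: directly, and
    through the coordinates with factor \<open>Ce * Cd\<close>.\<close>
  define \<epsilon>' where "\<epsilon>' = \<epsilon> / (1 + Ce * Cd)"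
  have p: "1 + Ce * Cd > 0" using Ce(1) Cd(1) by (simp add: add_pos_pos)
  have e': "\<epsilon>' > 0" using \<open>\<epsilon> > 0\<close> p by (simp add: \<epsilon>'_def)
  obtain F c where F: "finite F" "hnorm L (w - esum F c) < \<epsilon>'"
    using riesz(1) w e' unfolding riesz_basis_def esum_def by meson
  let ?s = "esum F c"
  have s: "?s \<in> hspace L" by (rule esum_hspace)
  have "(hnorm L ?s)\<^sup>2 \<le> Ce\<^sup>2 * (\<Sum>k\<in>F. (cmod (ec (cf ?s) k))\<^sup>2)"
    using Ce(2)[OF F(1), of c] F(1) by (simp add: esum_def[symmetric] ec_cf s coef_esum)
  also have "\<dots> \<le> Ce\<^sup>2 * (norm (cf ?s))\<^sup>2"
    by (intro mult_left_mono sum_cmod_sq_le_norm F) auto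
  finally have 1: "hnorm L ?s \<le> Ce * norm (cf ?s)"
    using Ce(1) by - (rule power2_le_imp_le, auto simp: power_mult_distrib)
  have "norm (cf ?s) \<le> norm (cf w) + norm (cf (w - ?s))"
    using norm_triangle_ineq4[of "cf w" "cf (w - ?s)"] by (simp add: cf_diff w s)
  also have "norm (cf (w - ?s)) \<le> Cd * \<epsilon>'"
    by (rule order_trans[OF norm_cf_le[OF hspace_diff[OF w s]] mult_left_mono]) (use F(2) Cd(1) in auto)
  finally have "Ce * norm (cf ?s) \<le> Ce * (norm (cf w) + Cd * \<epsilon>')" using Ce(1) by simp
  moreover have "hnorm L w \<le> hnorm L (w - ?s) + hnorm L ?s"
    using hnorm_triangle[OF hspace_diff[OF w s] s] by simp
  ultimately have "hnorm L w \<le> \<epsilon>' + Ce * (norm (cf w) + Cd * \<epsilon>')" using 1 F(2) by linarith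
  also have "\<dots> = Ce * norm (cf w) + (1 + Ce * Cd) * \<epsilon>'" by (simp add: algebra_simps)
  also have "\<dots> = Ce * norm (cf w) + \<epsilon>" using p by (simp add: \<epsilon>'_def)
  finally show "hnorm L w \<le> Ce * norm (cf w) + \<epsilon>" .
qed

lemma heq_of_cf_eq:
  assumes "w \<in> hspace L" "z \<in> hspace L" "cf w = cf z"
  shows "heq L w z"
proof -
  have "hnorm L (w - z) = 0"
    using hnorm_le_norm_cf[OF hspace_diff[OF assms(1,2)]] hnorm_nonneg[OF hspace_diff[OF assms(1,2)]] assms
    by (simp add: cf_diff)
  from heq_add[OF hnorm_zero_heq[OF hspace_diff[OF assms(1,2)] this] heq_refl[of L z]]
  show ?thesis by simp
qed

lemma tendsto_hnorm_of_cf: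
  assumes "w \<in> hspace L" "\<And>n. g n \<in> hspace L" "((\<lambda>n. cf (g n)) \<longlongrightarrow> cf w) F"
  shows "((\<lambda>n. hnorm L (g n - w)) \<longlongrightarrow> 0) F"
proof (rule Lim_null_comparison)
  show "\<forall>\<^sub>F n in F. norm (hnorm L (g n - w)) \<le> Ce * norm (cf (g n) - cf w)"
    using assms hnorm_le_norm_cf[OF hspace_diff[OF assms(2,1)]] hnorm_nonneg[OF hspace_diff[OF assms(2,1)]]
    by (intro always_eventually allI) (simp add: cf_diff)
  show "((\<lambda>n. Ce * norm (cf (g n) - cf w)) \<longlongrightarrow> 0) F"
    using tendsto_mult_right_zero[OF tendsto_norm_zero[OF LIM_zero[OF assms(3)]]] .
qed

lemma cf_esum: "finite F \<Longrightarrow> cf (esum F (ec c)) = ell2_trunc F c"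
  by (rule ell2_eqI) (simp add: ec_cf esum_hspace coef_esum)

text \<open>The partial sums over \<open>{- n..n}\<close> are Cauchy because their coordinates are;
  completeness supplies the state.\<close>

lemma cf_surj: "\<exists>w\<in>hspace L. cf w = c"
proof -
  let ?F = "\<lambda>n. {- int n..int n}"
  define w where "w = (\<lambda>n. esum (?F n) (ec c))"
  have w: "w n \<in> hspace L" for n by (simp add: w_def esum_hspace)
  have "filterlim ?F (finite_subsets_at_top UNIV) sequentially"
  proof (rule filterlim_finite_subsets_at_top[THEN iffD2], intro allI impI)
    fix X :: "int set" assume "finite X \<and> X \<subseteq> UNIV"
    then obtain N where N: "\<And>x. x \<in> X \<Longrightarrow> nat \<bar>x\<bar> \<le> N"
      using finite_nat_set_iff_bounded_le[of "(\<lambda>x. nat \<bar>x\<bar>) ` X"] by auto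
    show "\<forall>\<^sub>F n in sequentially. finite (?F n) \<and> X \<subseteq> ?F n \<and> ?F n \<subseteq> UNIV"
      unfolding eventually_sequentially
    proof (intro exI[of _ N] allI impI conjI subsetI)
      fix n x assume "N \<le> n" "x \<in> X"
      with N[of x] show "x \<in> ?F n" by auto
    qed auto
  qed
  from filterlim_compose[OF tendsto_ell2_trunc this]
  have lim: "(\<lambda>n. cf (w n)) \<longlonglongrightarrow> c" by (simp add: w_def cf_esum)
  then have "Cauchy (\<lambda>n. cf (w n))" by (rule LIMSEQ_imp_Cauchy)
  have cau: "\<exists>N. \<forall>m\<ge>N. \<forall>n\<ge>N. hnorm L (w m - w n) \<le> \<epsilon>" if "\<epsilon> > 0" for \<epsilon>
  proof -
    obtain N where N: "\<And>m n. m \<ge> N \<Longrightarrow> n \<ge> N \<Longrightarrow> norm (cf (w m) - cf (w n)) < \<epsilon> / Ce"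
      using \<open>Cauchy _\<close> \<open>\<epsilon> > 0\<close> Ce(1) unfolding Cauchy_iff by (meson divide_pos_pos)
    have "hnorm L (w m - w n) \<le> \<epsilon>" if "m \<ge> N" "n \<ge> N" for m n
    proof -
      have "hnorm L (w m - w n) \<le> Ce * norm (cf (w m) - cf (w n))"
        using hnorm_le_norm_cf[OF hspace_diff[OF w w]] by (simp add: cf_diff w)
      also have "\<dots> \<le> \<epsilon>" using N[OF that] Ce(1) by (simp add: field_simps)
      finally show ?thesis .
    qed
    then show ?thesis by blast
  qed
  obtain z where z: "z \<in> hspace L" "(\<lambda>n. hnorm L (w n - z)) \<longlonglongrightarrow> 0"
    using hspace_cauchy_convergent[OF w L_nonneg cau] by blast
  have "(\<lambda>n. cf (w n) - cf z) \<longlonglongrightarrow> 0"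
  proof (rule Lim_null_comparison)
    show "\<forall>\<^sub>F n in sequentially. norm (cf (w n) - cf z) \<le> Cd * hnorm L (w n - z)"
      using norm_cf_le[OF hspace_diff[OF w z(1)]] by (simp add: cf_diff w z)
    show "(\<lambda>n. Cd * hnorm L (w n - z)) \<longlonglongrightarrow> 0" by (rule tendsto_mult_right_zero[OF z(2)])
  qed
  then have "(\<lambda>n. cf (w n)) \<longlonglongrightarrow> cf z" by (rule LIM_zero_cancel)
  then have "cf z = c" using lim LIMSEQ_unique by blast
  then show ?thesis using z(1) by blast
qed

text \<open>A chosen representative, so \<open>rec\<close> is linear only up to
  \<open>heq\<close>.\<close>

definition rec :: "int ell2 \<Rightarrow> state" where "rec c = (SOME w. w \<in> hspace L \<and> cf w = c)"

lemma rec: "rec c \<in> hspace L" "cf (rec c) = c"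
proof -
  have "\<exists>w. w \<in> hspace L \<and> cf w = c" using cf_surj by blast
  from someI_ex[OF this] show "rec c \<in> hspace L" "cf (rec c) = c" by (auto simp: rec_def)
qed

lemma coef_rec: "coef (rec c) k = ec c k"
  using ec_cf[OF rec(1), of c k] by (simp add: rec(2))

definition A0 :: "int \<Rightarrow> int \<Rightarrow> complex" where "A0 j k = coef (opA L f ye (e k)) j"

text \<open>The operator \<open>\<A>\<close> in the coordinates of the basis.\<close>

definition gen :: "(int \<Rightarrow> complex) \<Rightarrow> int \<Rightarrow> complex" where
  "gen c j = (if j \<in> High then lam j * c j else \<Sum>k\<in>Low. A0 j k * c k)"

text \<open>Pairing with \<open>d k\<close> moves \<A> onto an eigenvector of the adjoint.\<close>

lemma coef_opA_high:
  assumes "w \<in> domA L \<alpha>" "k \<in> High"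
  shows "coef (opA L f ye w) k = lam k * coef w k"
  using high(2)[OF assms(2)] assms(1) domA_hspace[OF assms(1)]
  by (simp add: adjA_eq_def coef_def hinner_scale_right d_hspace)

lemma coef_opA_low:
  assumes "w \<in> domA L \<alpha>" "j \<in> Low"
  shows "coef (opA L f ye w) j = (\<Sum>k\<in>Low. A0 j k * coef w k)"
proof -
  obtain c where c: "adjA_eq L \<alpha> f ye (d j) (\<Sum>p\<in>Low. hscale (c p) (d p))" using low(3)[OF assms(2)] by blast
  have *: "coef (opA L f ye w) j = (\<Sum>p\<in>Low. cnj (c p) * coef w p)" if "w \<in> domA L \<alpha>" for w
    using c that domA_hspace[OF that]
    by (simp add: adjA_eq_def coef_def hinner_sum_right hinner_scale_right d_hspace hspace_scale)
  \<comment> \<open>Testing the adjoint expansion on \<open>e k\<close> identifies its coefficients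
    with the entries of \<open>A0\<close>.\<close>
  have "A0 j k = cnj (c k)" if "k \<in> Low" for k
    unfolding A0_def *[OF e_domA] using that finite_Low
    by (simp add: coef_def biorthogonal if_distrib[of "(*) _"] sum.delta' cong: if_cong)
  then show ?thesis using *[OF assms(1)] by simp
qed

lemma coef_opA: "w \<in> domA L \<alpha> \<Longrightarrow> coef (opA L f ye w) k = gen (coef w) k"
  using coef_opA_high[of w k] coef_opA_low[of w k] by (auto simp: gen_def Low_High)

text \<open>On finite sections \<A> may be applied term by term, and the coordinates of the image
  are a truncation of those of \<open>h\<close>. Both sides converge along the finite sets of
  indices; closedness gives \<A> \<open>w\<close> = \<open>h\<close>, and convergence of the traces
  gives the expansion of w1'(0).\<close>

lemma graph_rel_of_coef:
  assumes w: "w \<in> hspace L" and h: "h \<in> hspace L" and gen: "\<And>k. coef h k = gen (coef w) k"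
  shows "graph_rel w h" "((\<lambda>k. coef w k * pointwise_deriv L (fst (e k)) 0) has_sum D0 w h) UNIV"
proof -
  define hF where "hF = (\<lambda>F. \<Sum>k\<in>F. hscale (coef w k) (opA L f ye (e k)))"
  have eA: "opA L f ye (e k) \<in> hspace L" for k by (rule opA_hspace[OF e_domA])
  have hF: "hF F \<in> hspace L" for F unfolding hF_def by (intro hspace_sum hspace_scale eA)
  have g: "graph_rel (esum F (coef w)) (hF F) \<and> D0 (esum F (coef w)) (hF F) =
      (\<Sum>k\<in>F. coef w k * pointwise_deriv L (fst (e k)) 0)" for F
    unfolding esum_def hF_def
    using graph_rel_sum[of F e "\<lambda>k. opA L f ye (e k)" "coef w"] graph_rel_opA[OF e_domA]
    by (simp add: e_hspace eA)
  \<comment> \<open>Since \<A> mixes the low modes among themselves, a section is compatible with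
    truncation only once it contains all of \<open>Low\<close>.\<close>
  have cfh: "cf (hF F) = ell2_trunc F (cf h)" if F: "finite F" "Low \<subseteq> F" for F
  proof (rule ell2_eqI)
    fix j
    have "ec (cf (hF F)) j = (\<Sum>k\<in>F. coef w k * gen (coef (e k)) j)"
      by (simp add: ec_cf hF) (simp add: hF_def coef_sum hspace_scale eA coef_scale coef_opA[OF e_domA])
    also have "\<dots> = (if j \<in> F then gen (coef w) j else 0)"
    proof (cases "j \<in> High")
      case True
      then have "(\<Sum>k\<in>F. coef w k * gen (coef (e k)) j) = (\<Sum>k\<in>F. if k = j then lam j * coef w j else 0)"
        by (intro sum.cong) (auto simp: gen_def coef_def biorthogonal)
      then show ?thesis using True F by (simp add: gen_def)
    next
      case False
      then have j: "j \<in> Low" "j \<in> F" using F Low_High by auto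
      have "gen (coef (e k)) j = (if k \<in> Low then A0 j k else 0)" for k
        using False finite_Low
        by (simp add: gen_def coef_def biorthogonal if_distrib[of "(*) _"] sum.delta' cong: if_cong)
      then have "(\<Sum>k\<in>F. coef w k * gen (coef (e k)) j) = (\<Sum>k\<in>F. if k \<in> Low then A0 j k * coef w k else 0)"
        by (intro sum.cong) auto
      also have "\<dots> = (\<Sum>k\<in>Low. A0 j k * coef w k)"
        using F by (simp add: sum.inter_restrict[symmetric] Int_absorb1)
      finally show ?thesis using False j by (simp add: gen_def)
    qed
    also have "\<dots> = ec (ell2_trunc F (cf h)) j" by (simp add: ec_cf[OF h] gen)
    finally show "ec (cf (hF F)) j = ec (ell2_trunc F (cf h)) j" .
  qed
  have fin: "\<forall>\<^sub>F F in finite_subsets_at_top UNIV. finite F"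
    by (rule eventually_finite_subsets_at_top_weakI)
  have "\<forall>\<^sub>F F in finite_subsets_at_top UNIV. finite F \<and> Low \<subseteq> F"
    unfolding eventually_finite_subsets_at_top using finite_Low by (intro exI[of _ Low]) auto
  then have "\<forall>\<^sub>F F in finite_subsets_at_top UNIV. ell2_trunc F (cf h) = cf (hF F)"
    by eventually_elim (simp add: cfh)
  then have l1: "((\<lambda>F. cf (hF F)) \<longlongrightarrow> cf h) (finite_subsets_at_top UNIV)"
    by (rule Lim_transform_eventually[OF tendsto_ell2_trunc])
  have "\<forall>\<^sub>F F in finite_subsets_at_top UNIV. ell2_trunc F (cf w) = cf (esum F (coef w))"
    using fin by eventually_elim (auto intro!: ell2_eqI simp: ec_cf esum_hspace coef_esum w)
  then have l2: "((\<lambda>F. cf (esum F (coef w))) \<longlongrightarrow> cf w) (finite_subsets_at_top UNIV)"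
    by (rule Lim_transform_eventually[OF tendsto_ell2_trunc])
  have gg: "\<forall>\<^sub>F F in finite_subsets_at_top UNIV. graph_rel (esum F (coef w)) (hF F)"
    using g by simp
  note C = graph_rel_closed[OF finite_subsets_at_top_neq_bot w h esum_hspace hF gg
      tendsto_hnorm_of_cf[OF w esum_hspace l2] tendsto_hnorm_of_cf[OF h hF l1]]
  show "graph_rel w h" by (fact C(1))
  have "((\<lambda>F. D0 (esum F (coef w)) (hF F)) \<longlongrightarrow> D0 w h) (finite_subsets_at_top UNIV)"
    by (fact C(2))
  then show "((\<lambda>k. coef w k * pointwise_deriv L (fst (e k)) 0) has_sum D0 w h) UNIV"
    unfolding has_sum_def using g by simp
qed

lemma domA_deriv_has_sum:
  assumes "w \<in> domA L \<alpha>"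
  shows "((\<lambda>k. coef w k * pointwise_deriv L (fst (e k)) 0) has_sum pointwise_deriv L (fst w) 0) UNIV"
  using graph_rel_of_coef(2)[OF domA_hspace[OF assms] opA_hspace[OF assms]] coef_opA[OF assms]
    graph_rel_opA(2)[OF assms] by simp

text \<open>The domain of \<A> in coordinates: square-summability of the formal image suffices. The
  change of representative to \<open>w'\<close> comes from the point values required in the
  domain.\<close>

lemma domA_of_gen:
  assumes w: "w \<in> hspace L" and gen: "in_ell2 (gen (coef w))"
  obtains w' where "w' \<in> domA L \<alpha>" "heq L w' w" "cf (opA L f ye w') = mk_ell2 (gen (coef w))"
    "heq L (opA L f ye w') (rec (mk_ell2 (gen (coef w))))"
proof -
  let ?h = "rec (mk_ell2 (gen (coef w)))"
  have h: "?h \<in> hspace L" "\<And>k. coef ?h k = gen (coef w) k" using gen by (auto simp: rec coef_rec ec_mk)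
  note D = graph_rel_domA[OF w h(1) graph_rel_of_coef(1)[OF w h]]
  have "cf (opA L f ye (fst w, fst ?h)) = cf ?h"
    using coef_heq[OF D(3) opA_hspace[OF D(1)] h(1)]
    by (intro ell2_eqI) (simp add: ec_cf opA_hspace[OF D(1)] h(1))
  then show thesis using D that by (simp add: rec)
qed

text \<open>The first component of \<A> W is w2. Read in coordinates, this turns information on
  second components into information on first ones, which have an L^\<infinity> bound and a time
  derivative.\<close>

lemma snd_rec_eq_fst_rec_gen:
  assumes "in_ell2 (gen (ec c))"
  shows "AE x in lebesgue_on {0..L}. snd (rec c) x = fst (rec (mk_ell2 (gen (ec c)))) x"
proof -
  have co: "coef (rec c) = ec c" by (rule ext) (rule coef_rec)
  let ?h = "rec (mk_ell2 (gen (ec c)))"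
  have h: "\<And>k. coef ?h k = gen (coef (rec c)) k" using assms by (auto simp: co coef_rec ec_mk)
  have "graph_rel (rec c) ?h" by (rule graph_rel_of_coef(1)[OF rec(1) rec(1) h])
  then have "AE x in lebesgue_on {0..L}. snd (rec c) x - fst ?h x = 0"
    by (intro L2norm_zero_AE L2_diff hspaceD rec L2_fst) (simp add: graph_rel_def)
  then show ?thesis by eventually_elim simp
qed

end

section \<open>The residual and the integral component\<close>

context wave_equation
begin

text \<open>The first order Taylor remainder of \<open>f\<close> at the steady state, in closed
  form; mean value estimates are easier on it than on the integral formula.\<close>

definition rho :: "real \<Rightarrow> real \<Rightarrow> real" where
  "rho x y = f (ye x + y) - f (ye x) - deriv f (ye x) * y"

lemma residual_eq_rho: "residual f ye w x = rho x (w x)"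
proof -
  define y where "y = w x"
  \<comment> \<open>An antiderivative of the Taylor integrand: the two terms in the first derivative
    of \<open>f\<close> cancel.\<close>
  let ?G = "\<lambda>s. (1 - s) * (y * deriv f (ye x + s * y)) + f (ye x + s * y)"
  have "((\<lambda>s. y\<^sup>2 * ((1 - s) * deriv (deriv f) (ye x + s * y))) has_integral ?G 1 - ?G 0) {0..1}"
  proof (rule fundamental_theorem_of_calculus)
    fix s :: real
    have i: "((\<lambda>s. ye x + s * y) has_real_derivative y) (at s within {0..1})"
      by (auto intro!: derivative_eq_intros)
    have "(?G has_real_derivative ((0 - 1) * (y * deriv f (ye x + s * y)) +
        (y * (deriv (deriv f) (ye x + s * y) * y)) * (1 - s) + deriv f (ye x + s * y) * y)) (at s within {0..1})"
      by (intro DERIV_add DERIV_mult DERIV_cmult DERIV_chain2[OF f_deriv i] DERIV_chain2[OF f_deriv2 i] DERIV_diff DERIV_const DERIV_ident)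
    then show "(?G has_vector_derivative y\<^sup>2 * ((1 - s) * deriv (deriv f) (ye x + s * y))) (at s within {0..1})"
      unfolding has_real_derivative_iff_has_vector_derivative
      by (rule has_vector_derivative_eq_rhs) (simp add: power2_eq_square algebra_simps)
  qed simp
  then have "integral {0..1} (\<lambda>s. y\<^sup>2 * ((1 - s) * deriv (deriv f) (ye x + s * y))) = ?G 1 - ?G 0"
    by (rule integral_unique)
  then show ?thesis by (simp add: residual_def rho_def y_def mult.commute)
qed

text \<open>One constant for all levels \<open>R \<le> R0\<close>. The factor \<open>R\<close> in
  the first bound expresses the quadratic smallness of the residual; the other two bounds serve its
  differentiation in time.\<close>

lemma rho_estimates:
  obtains M where "M \<ge> 0"
    "\<And>x y z R. x \<in> {0..L} \<Longrightarrow> R \<le> R0 \<Longrightarrow> \<bar>y\<bar> \<le> R \<Longrightarrow> \<bar>z\<bar> \<le> R \<Longrightarrow> \<bar>rho x y - rho x z\<bar> \<le> M * R * \<bar>y - z\<bar>"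
    "\<And>x y z. x \<in> {0..L} \<Longrightarrow> \<bar>y\<bar> \<le> R0 \<Longrightarrow> \<bar>z\<bar> \<le> R0 \<Longrightarrow>
       \<bar>rho x y - rho x z - (deriv f (ye x + z) - deriv f (ye x)) * (y - z)\<bar> \<le> M * \<bar>y - z\<bar>\<^sup>2"
    "\<And>x y z. x \<in> {0..L} \<Longrightarrow> \<bar>y\<bar> \<le> R0 \<Longrightarrow> \<bar>z\<bar> \<le> R0 \<Longrightarrow> \<bar>deriv f (ye x + y) - deriv f (ye x + z)\<bar> \<le> M * \<bar>y - z\<bar>"
proof -
  have "bounded (ye ` {0..L})" by (intro compact_imp_bounded compact_continuous_image ye_cont) simp
  then obtain B where B: "\<forall>x\<in>{0..L}. \<bar>ye x\<bar> \<le> B" by (auto simp: bounded_iff)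
  define I where "I = {- (B + R0)..B + R0}"
  have "bounded (deriv (deriv f) ` I)"
    by (intro compact_imp_bounded compact_continuous_image continuous_on_subset[OF f_deriv2_cont]) (auto simp: I_def)
  then obtain M0 where M0: "\<forall>x\<in>I. \<bar>deriv (deriv f) x\<bar> \<le> M0" by (auto simp: bounded_iff)
  define M where "M = max 0 M0"
  have M: "M \<ge> 0" "\<And>x. x \<in> I \<Longrightarrow> \<bar>deriv (deriv f) x\<bar> \<le> M" using M0 by (auto simp: M_def)
  have f1: "\<bar>deriv f a - deriv f b\<bar> \<le> M * \<bar>a - b\<bar>" if "a \<in> I" "b \<in> I" for a b
    using field_differentiable_bound[of I "deriv f" "deriv (deriv f)" M a b] that M
    by (auto simp: I_def intro: DERIV_subset[OF f_deriv2])
  \<comment> \<open>The mean value inequality for \<open>f\<close> minus its linear part at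
    \<open>c\<close>, near \<open>c\<close>. Taking \<open>c\<close> at the steady state gives the
    Lipschitz bound, and taking \<open>c\<close> at the second point gives the second order
    remainder.\<close>
  have key: "\<bar>f a - f b - deriv f c * (a - b)\<bar> \<le> M * D * \<bar>a - b\<bar>"
    if abc: "a \<in> I" "b \<in> I" "c \<in> I" and D: "\<bar>a - c\<bar> \<le> D" "\<bar>b - c\<bar> \<le> D" for a b c D
  proof -
    define S where "S = I \<inter> {c - D..c + D}"
    have "norm ((f a - deriv f c * a) - (f b - deriv f c * b)) \<le> M * D * norm (a - b)"
    proof (rule field_differentiable_bound[of S])
      show "convex S" by (auto simp: S_def I_def intro: convex_Int)
      show "a \<in> S" "b \<in> S" using abc D by (auto simp: S_def)
      fix z assume z: "z \<in> S"
      show "((\<lambda>t. f t - deriv f c * t) has_field_derivative (deriv f z - deriv f c * 1)) (at z within S)"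
        by (intro DERIV_diff DERIV_cmult DERIV_ident DERIV_subset[OF f_deriv]) simp
      have "\<bar>deriv f z - deriv f c\<bar> \<le> M * \<bar>z - c\<bar>" using z abc by (intro f1) (auto simp: S_def)
      also have "\<dots> \<le> M * D" using z M by (intro mult_left_mono) (auto simp: S_def)
      finally show "norm (deriv f z - deriv f c * 1) \<le> M * D" by simp
    qed
    then show ?thesis by (simp add: algebra_simps)
  qed
  have I: "ye x + y \<in> I" if "x \<in> {0..L}" "\<bar>y\<bar> \<le> R0" for x y
    using B[rule_format, OF that(1)] that(2) by (auto simp: I_def)
  show thesis
  proof (rule that[OF M(1)])
    fix x y z R assume x: "x \<in> {0..L}" and R: "R \<le> R0" and y: "\<bar>y\<bar> \<le> R" and z: "\<bar>z\<bar> \<le> R"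
    show "\<bar>rho x y - rho x z\<bar> \<le> M * R * \<bar>y - z\<bar>"
      using key[OF I[OF x, of y] I[OF x, of z] I[OF x, of 0], of R] R y z
      by (simp add: rho_def algebra_simps)
  next
    fix x y z assume x: "x \<in> {0..L}" and y: "\<bar>y\<bar> \<le> R0" and z: "\<bar>z\<bar> \<le> R0"
    show "\<bar>rho x y - rho x z - (deriv f (ye x + z) - deriv f (ye x)) * (y - z)\<bar> \<le> M * \<bar>y - z\<bar>\<^sup>2"
      using key[OF I[OF x y] I[OF x z] I[OF x z], of "\<bar>y - z\<bar>"]
      by (simp add: rho_def algebra_simps power2_eq_square)
    show "\<bar>deriv f (ye x + y) - deriv f (ye x + z)\<bar> \<le> M * \<bar>y - z\<bar>"
      using f1[OF I[OF x y] I[OF x z]] by simp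
  qed
qed

definition clamp :: "real \<Rightarrow> real \<Rightarrow> real" where "clamp R y = max (- R) (min R y)"

lemma clamp_abs: "0 \<le> R \<Longrightarrow> \<bar>clamp R y\<bar> \<le> R" and clamp_diff: "\<bar>clamp R y - clamp R z\<bar> \<le> \<bar>y - z\<bar>"
  and clamp_id: "\<bar>y\<bar> \<le> R \<Longrightarrow> clamp R y = y"
  by (auto simp: clamp_def)

lemma rho_zero: "rho x 0 = 0" by (simp add: rho_def)

lemma rho_clamp_cont:
  assumes "continuous_on {0..L} u"
  shows "continuous_on {0..L} (\<lambda>x. rho x (clamp R (u x)))"
  unfolding rho_def clamp_def
  by (intro continuous_intros assms ye_cont continuous_on_compose2[OF f_cont] continuous_on_compose2[OF f_deriv_cont]) auto

end

text \<open>Each positive integer occurs at most twice as an absolute value, and the term for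
  \<open>k = 0\<close> is 0 since division by zero gives 0.\<close>

lemma sum_inverse_squares_int_le:
  fixes F :: "int set"
  assumes "finite F"
  shows "(\<Sum>k\<in>F. (1 / of_int \<bar>k\<bar> :: real)\<^sup>2) \<le> 2 * (\<Sum>n. 1 / (real n)\<^sup>2)"
proof -
  have s: "summable (\<lambda>n. 1 / (real n)\<^sup>2)"
    using inverse_power_summable[of 2, where 'a = real] by (simp add: inverse_eq_divide)
  obtain N where N: "\<And>k. k \<in> F \<Longrightarrow> nat \<bar>k\<bar> \<le> N"
    using finite_nat_set_iff_bounded_le[of "(\<lambda>k. nat \<bar>k\<bar>) ` F"] assms by auto
  have "F \<subseteq> int ` {..N} \<union> (\<lambda>n. - int n) ` {..N}"
  proof
    fix k assume "k \<in> F"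
    with N[of k] have "nat \<bar>k\<bar> \<in> {..N}" by simp
    moreover have "k = int (nat \<bar>k\<bar>) \<or> k = - int (nat \<bar>k\<bar>)" by auto
    ultimately show "k \<in> int ` {..N} \<union> (\<lambda>n. - int n) ` {..N}" by blast
  qed
  then have "(\<Sum>k\<in>F. (1 / of_int \<bar>k\<bar> :: real)\<^sup>2) \<le>
      (\<Sum>k\<in>int ` {..N} \<union> (\<lambda>n. - int n) ` {..N}. (1 / of_int \<bar>k\<bar> :: real)\<^sup>2)"
    by (intro sum_mono2) auto
  also have "\<dots> \<le> (\<Sum>k\<in>int ` {..N}. (1 / of_int \<bar>k\<bar> :: real)\<^sup>2) + (\<Sum>k\<in>(\<lambda>n. - int n) ` {..N}. (1 / of_int \<bar>k\<bar> :: real)\<^sup>2)"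
    by (subst sum.union_inter[symmetric]) (auto intro!: sum_nonneg)
  also have "\<dots> = 2 * (\<Sum>n\<le>N. 1 / (real n)\<^sup>2)"
    by (simp add: sum.reindex inj_on_def power_divide)
  also have "(\<Sum>n\<le>N. 1 / (real n)\<^sup>2) \<le> (\<Sum>n. 1 / (real n)\<^sup>2)"
    by (intro sum_le_suminf s) auto
  finally show ?thesis by simp
qed

section \<open>The series in the definition of \<xi> as a bounded functional\<close>

context wave_spectral
begin

definition pd :: "int \<Rightarrow> complex" where "pd k = pointwise_deriv L (fst (e k)) 0"

lemma lam_nonzero: "k \<in> High \<Longrightarrow> lam k \<noteq> 0"
  using high(3)[of k] by auto

text \<open>The traces \<open>pd k\<close> are bounded and \<open>cmod (lam k)\<close> grows
  linearly in \<open>\<bar>k\<bar>\<close>, so the quotients are of order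
  \<open>1 / \<bar>k\<bar>\<close>.\<close>

lemma beta_ell2: "in_ell2 (\<lambda>k. if k \<in> High then pd k / lam k else 0)"
proof -
  define l where "l = complex_of_real (1 / (2 * L) * ln ((\<alpha> - 1) / (\<alpha> + 1)))"
  obtain c1 where c1: "\<forall>\<^sub>F k in cofinite. cmod (pd k) \<le> c1"
    using landau_o.bigE[OF spectralD(7)] by (auto simp: pd_def)
  obtain c2 where c2: "c2 > 0" "\<forall>\<^sub>F k in cofinite. cmod (lam k - (l + \<i> * of_real (of_int k * pi / L))) \<le> c2 * cmod (of_real (1 / of_int \<bar>k\<bar>))"
    using landau_o.bigE[OF spectralD(6)] unfolding l_def by blast
  define c where "c = \<bar>c1\<bar> * 2 * L / pi"
  \<comment> \<open>Beyond \<open>N\<close>, the real offset and the asymptotic error amount to at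
    most half of the leading term \<open>\<bar>k\<bar> * pi / L\<close>; the added \<open>1\<close>
    also ensures \<open>\<bar>k\<bar> \<ge> 1\<close>.\<close>
  define N where "N = \<lceil>2 * L * (cmod l + c2) / pi\<rceil> + 1"
  have fin: "finite {k::int. \<not> \<bar>k\<bar> > N}"
  proof (rule finite_subset)
    show "{k::int. \<not> \<bar>k\<bar> > N} \<subseteq> {- N..N}" by auto
  qed simp
  have "\<forall>\<^sub>F k in cofinite. \<bar>k\<bar> > \<bar>N\<bar>"
    unfolding eventually_cofinite by (rule finite_subset[of _ "{- \<bar>N\<bar>..\<bar>N\<bar>}"]) auto
  with c1 c2(2) have "\<forall>\<^sub>F k in cofinite. k \<in> High \<longrightarrow> cmod (pd k / lam k) \<le> c * (1 / of_int \<bar>k\<bar>)"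
  proof eventually_elim
    case (elim k)
    have k: "real_of_int \<bar>k\<bar> \<ge> 1" "real_of_int \<bar>k\<bar> \<ge> 2 * L * (cmod l + c2) / pi"
      using elim(3) by (auto simp: N_def) linarith+
    have "cmod (of_real (1 / of_int \<bar>k\<bar>)) \<le> 1" using k by (simp add: norm_divide divide_le_eq)
    define A where "A = \<i> * complex_of_real (of_int k * pi / L)"
    have "cmod (lam k - (l + A)) \<le> c2"
      by (rule order_trans[OF elim(2)[folded A_def] mult_left_le])
        (use c2(1) \<open>cmod (of_real (1 / of_int \<bar>k\<bar>)) \<le> 1\<close> in auto)
    moreover have "cmod A = of_int \<bar>k\<bar> * pi / L"
      using L_pos by (simp add: A_def norm_mult norm_divide)
    moreover have "cmod A \<le> cmod (lam k) + cmod (lam k - (l + A)) + cmod l"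
      using norm_triangle_ineq4[of "lam k - (lam k - (l + A))" l] norm_triangle_ineq4[of "lam k" "lam k - (l + A)"]
      by simp
    ultimately have "cmod (lam k) \<ge> of_int \<bar>k\<bar> * pi / L - (cmod l + c2)" by linarith
    moreover have "cmod l + c2 \<le> of_int \<bar>k\<bar> * pi / (2 * L)"
      using k(2) L_pos pi_gt_zero by (simp add: field_simps)
    ultimately have lamk: "cmod (lam k) \<ge> of_int \<bar>k\<bar> * pi / (2 * L)" by (simp add: field_simps)
    have p: "of_int \<bar>k\<bar> * pi / (2 * L) > 0" using k(1) L_pos pi_gt_zero by simp
    have "cmod (pd k / lam k) \<le> \<bar>c1\<bar> / (of_int \<bar>k\<bar> * pi / (2 * L))"
      unfolding norm_divide using elim(1) lamk p by (intro frac_le) auto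
    then show ?case by (simp add: c_def mult_ac)
  qed
  \<comment> \<open>The estimate fails for finitely many indices at most, which merely add a
    constant to the bound.\<close>
  then have fin: "finite {k. \<not> (k \<in> High \<longrightarrow> cmod (pd k / lam k) \<le> c * (1 / of_int \<bar>k\<bar>))}" (is "finite ?E")
    by (simp add: eventually_cofinite)
  show ?thesis
  proof (rule in_ell2_sqI)
    fix F :: "int set" assume F: "finite F"
    let ?b = "\<lambda>k. (cmod (if k \<in> High then pd k / lam k else 0))\<^sup>2"
    have "(\<Sum>k\<in>F. ?b k) = (\<Sum>k\<in>F \<inter> ?E. ?b k) + (\<Sum>k\<in>F - ?E. ?b k)"
      using F by (rule sum.Int_Diff)
    also have "(\<Sum>k\<in>F \<inter> ?E. ?b k) \<le> (\<Sum>k\<in>?E. ?b k)"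
      using fin by (intro sum_mono2) auto
    also have "(\<Sum>k\<in>F - ?E. ?b k) \<le> (\<Sum>k\<in>F - ?E. c\<^sup>2 * (1 / of_int \<bar>k\<bar>)\<^sup>2)"
    proof (rule sum_mono)
      fix k assume "k \<in> F - ?E"
      then have "k \<in> High \<Longrightarrow> cmod (pd k / lam k) \<le> c * (1 / of_int \<bar>k\<bar>)" by blast
      from power_mono[OF this norm_ge_zero, of 2] show "?b k \<le> c\<^sup>2 * (1 / of_int \<bar>k\<bar>)\<^sup>2"
        by (cases "k \<in> High") (simp_all only: power_mult_distrib if_True if_False, auto)
    qed
    also have "\<dots> = c\<^sup>2 * (\<Sum>k\<in>F - ?E. (1 / of_int \<bar>k\<bar>)\<^sup>2)" by (simp only: sum_distrib_left)
    also have "\<dots> \<le> c\<^sup>2 * (2 * (\<Sum>n. 1 / (real n)\<^sup>2))"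
      using F by (intro mult_left_mono sum_inverse_squares_int_le) auto
    finally show "(\<Sum>k\<in>F. ?b k) \<le> (\<Sum>k\<in>?E. ?b k) + c\<^sup>2 * (2 * (\<Sum>n. 1 / (real n)\<^sup>2))" by simp
  qed
qed

definition beta :: "int ell2" where "beta = mk_ell2 (\<lambda>k. if k \<in> High then pd k / lam k else 0)"

lemma ec_beta: "ec beta k = (if k \<in> High then pd k / lam k else 0)"
  by (simp add: beta_def ec_mk[OF beta_ell2])

text \<open>Bounded because \<open>beta\<close> is square-summable; the trace coefficients
  \<open>pd k\<close> themselves are only bounded. The real part is harmless for real-valued
  states.\<close>

definition tail :: "int ell2 \<Rightarrow> real" where "tail r = Re (\<Sum>\<^sub>\<infinity>k. ec beta k * ec r k)"

lemma bounded_linear_tail: "bounded_linear tail"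
proof (rule bounded_linear_intro)
  note S = abs_summable_summable[OF ell2_pairing_summable(1), of beta]
  show "tail (x + y) = tail x + tail y" for x y
    by (simp add: tail_def distrib_left infsum_add[OF S S])
  show "tail (r *\<^sub>R x) = r *\<^sub>R tail x" for r x
  proof -
    have "(\<Sum>\<^sub>\<infinity>k. ec beta k * ec (r *\<^sub>R x) k) = (\<Sum>\<^sub>\<infinity>k. of_real r * (ec beta k * ec x k))"
      by (simp add: scaleR_conv_of_real mult_ac)
    also have "\<dots> = of_real r * (\<Sum>\<^sub>\<infinity>k. ec beta k * ec x k)" by (rule infsum_cmult_right[OF S])
    finally show ?thesis by (simp add: tail_def)
  qed
  show "norm (tail x) \<le> norm x * norm beta" for x
    using ell2_pairing_summable(2)[of beta x] abs_Re_le_cmod[of "\<Sum>\<^sub>\<infinity>k. ec beta k * ec x k"]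
    by (simp add: tail_def mult.commute)
qed

lemma tail_eq_infsum_High: "(\<Sum>\<^sub>\<infinity>k. ec beta k * c k) = (\<Sum>\<^sub>\<infinity>k\<in>High. pd k / lam k * c k)"
  by (rule infsum_cong_neutral) (auto simp: ec_beta)

lemma tail_sum_eq: "w \<in> hspace L \<Longrightarrow> tail_sum L n0 e d lam w = tail (cf w)"
  unfolding tail_sum_def tail_def tail_eq_infsum_High by (simp add: ec_cf coef_def pd_def)

text \<open>The cancellation behind \<xi>: on high modes, \<open>pd k * coef w k\<close> equals
  \<open>pd k / lam k\<close> times the coordinate of \<A> \<open>w\<close>. The high part of the
  unbounded trace thus becomes the bounded functional \<open>tail\<close> applied to \<A>
  \<open>w\<close>.\<close>

lemma Re_deriv_eq_tail:
  assumes w: "w \<in> domA L \<alpha>"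
  shows "Re (pointwise_deriv L (fst w) 0) = Re (\<Sum>k\<in>Low. pd k * coef w k) + tail (cf (opA L f ye w))"
proof -
  have hs: "((\<lambda>k. coef w k * pd k) has_sum pointwise_deriv L (fst w) 0) UNIV"
    using domA_deriv_has_sum[OF w] by (simp add: pd_def)
  have hl: "((\<lambda>k. if k \<in> Low then coef w k * pd k else 0) has_sum (\<Sum>k\<in>Low. coef w k * pd k)) UNIV"
    using has_sum_finite[OF finite_Low, of "\<lambda>k. coef w k * pd k"]
    by (rule has_sum_cong_neutral[THEN iffD1, rotated -1]) auto
  have "(\<lambda>k. ec beta k * ec (cf (opA L f ye w)) k) = (\<lambda>k. coef w k * pd k - (if k \<in> Low then coef w k * pd k else 0))"
    using Low_High lam_nonzero by (auto simp: ec_beta ec_cf opA_hspace[OF w] coef_opA_high[OF w] fun_eq_iff)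
  then have "((\<lambda>k. ec beta k * ec (cf (opA L f ye w)) k) has_sum
      (pointwise_deriv L (fst w) 0 - (\<Sum>k\<in>Low. coef w k * pd k))) UNIV"
    using has_sum_add[OF hs has_sum_uminusI[OF hl]] by simp
  then have "tail (cf (opA L f ye w)) = Re (pointwise_deriv L (fst w) 0 - (\<Sum>k\<in>Low. coef w k * pd k))"
    unfolding tail_def by (simp add: infsumI)
  then show ?thesis by (simp add: mult.commute)
qed

section \<open>Real-valued states in coordinates\<close>

lemma coef_hcnj_Low:
  assumes "w \<in> hspace L" "k \<in> Low"
  shows "coef (hcnj w) k = cnj (coef w k)"
  using hinner_heq[OF heq_refl low(2)[OF assms(2)], of "hcnj w"] hinner_hcnj[OF assms(1) d_hspace, of k]
  by (simp add: coef_def hspace_cnj assms d_hspace L_nonneg)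

lemma coef_hcnj_High:
  assumes "w \<in> hspace L" "k \<in> High"
  shows "coef (hcnj w) (- k) = cnj (coef w k)"
  using hinner_heq[OF heq_refl high(5)[OF assms(2)], of "hcnj w"] hinner_hcnj[OF assms(1) d_hspace, of k]
  by (simp add: coef_def hspace_cnj assms d_hspace L_nonneg)

lemma hcnj_cstate: "hcnj (cstate w) = cstate w"
  by (simp add: hcnj_def cstate_def)

lemma coef_real_Low: "cstate w \<in> hspace L \<Longrightarrow> k \<in> Low \<Longrightarrow> cnj (coef (cstate w) k) = coef (cstate w) k"
  using coef_hcnj_Low[of "cstate w" k] by (simp add: hcnj_cstate)

lemma coef_real_High: "cstate w \<in> hspace L \<Longrightarrow> k \<in> High \<Longrightarrow> cnj (coef (cstate w) k) = coef (cstate w) (- k)"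
  using coef_hcnj_High[of "cstate w" k] by (simp add: hcnj_cstate)

lemma High_uminus: "- k \<in> High \<longleftrightarrow> k \<in> High"
  by (auto simp: high_modes_def)

text \<open>The spectral data conjugate the eigenvectors, and the eigenvalues follow. The eigenvalue
  equation makes the second component of \<open>e k\<close> equal to \<open>lam k\<close> times the
  first. If \<open>lam (- k)\<close> differed from the conjugate of \<open>lam k\<close>, then
  \<open>fst (e k)\<close> would vanish almost everywhere, by continuity everywhere, and so would
  \<open>e k\<close>, against its norm 1.\<close>

lemma lam_uminus:
  assumes k: "k \<in> High"
  shows "lam (- k) = cnj (lam k)"
proof (rule ccontr)
  assume ne: "lam (- k) \<noteq> cnj (lam k)"
  have s: "snd (e k) x = lam k * fst (e k) x" "snd (e (- k)) x = lam (- k) * fst (e (- k)) x"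
    "fst (e (- k)) x = cnj (fst (e k) x)" if "x \<in> {0..L}" for x
    using high(1)[OF k] high(1)[of "- k"] high(4)[OF k] k that
    by (auto simp: heq_def opA_def hscale_def hcnj_def High_uminus)
  have "AE x in lebesgue_on {0..L}. snd (e (- k)) x = cnj (snd (e k) x)"
    using high(4)[OF k] by (simp add: heq_def hcnj_def)
  moreover have "AE x in lebesgue_on {0..L}. x \<in> {0..L}" using AE_space[of "lebesgue_on {0..L}"] by simp
  ultimately have "AE x in lebesgue_on {0..L}. fst (e k) x = 0"
  proof eventually_elim
    case (elim x)
    have "lam (- k) * cnj (fst (e k) x) = cnj (lam k * fst (e k) x)"
      using elim(1) s[OF elim(2)] by metis
    then have "(lam (- k) - cnj (lam k)) * cnj (fst (e k) x) = 0" by (simp add: left_diff_distrib)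
    then show ?case using ne by simp
  qed
  then have "L2norm L (fst (e k)) = L2norm L (\<lambda>_. 0)"
    by (rule L2norm_cong_AE) (auto intro!: L2_meas L2_fst e_hspace)
  then have z: "L2norm L (fst (e k)) = 0" by (simp add: L2norm_def)
  have "has_wderiv L (fst (e k)) (pointwise_deriv L (fst (e k)))" by (rule domA_pointwise_deriv(1)[OF e_domA])
  have "fst (e k) x = 0" if x: "x \<in> {0..L}" for x
  proof (rule ccontr)
    assume nz: "fst (e k) x \<noteq> 0"
    have "continuous_on {0..L} (\<lambda>x. (norm (fst (e k) x))\<^sup>2)"
      by (intro continuous_intros H1_continuous hspaceD e_hspace)
    moreover have "integral {0..L} (\<lambda>x. (norm (fst (e k) x))\<^sup>2) = 0"
      using z L2_sq[OF L2_fst[OF e_hspace]] by (simp add: L2norm_def lebesgue_integral_eq_integral)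
    ultimately have "\<forall>x\<in>{0..L}. (norm (fst (e k) x))\<^sup>2 = 0"
      using integral_eq_0_iff[of 0 L "\<lambda>x. (norm (fst (e k) x))\<^sup>2"] L_pos by simp
    then show False using nz x by simp
  qed
  then have "heq L (e k) 0" using s(1) by (auto simp: heq_def intro!: AE_I2)
  then have "hnorm L (e k) = 0"
    using hnorm_cong[OF _ e_hspace hspace_zero L_nonneg] by (simp add: hnorm_zero)
  then show False using spectralD(3) by simp
qed

end

section \<open>The closed loop in modal coordinates\<close>

context wave_spectral
begin

text \<open>The real part gives the residual a meaning for arbitrary coordinates, as the fixed point
  argument requires; that solutions are real-valued is shown only afterwards.\<close>

definition w1 :: "int ell2 \<Rightarrow> real \<Rightarrow> real" where "w1 c x = Re (fst (rec c) x)"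

definition Cw :: real where "Cw = sqrt L * Ce"

lemma Cw_nonneg: "0 \<le> Cw" using L_nonneg Ce(1) by (simp add: Cw_def)

lemma w1_diff:
  assumes x: "x \<in> {0..L}"
  shows "\<bar>w1 c x - w1 c' x\<bar> \<le> Cw * norm (c - c')"
proof -
  have "w1 c x - w1 c' x = Re (fst (rec c - rec c') x)" by (simp add: w1_def)
  also have "\<bar>\<dots>\<bar> \<le> cmod (fst (rec c - rec c') x)" by (rule abs_Re_le_cmod)
  also have "\<dots> \<le> sqrt L * hnorm L (rec c - rec c')"
    by (rule fst_le_hnorm[OF hspace_diff[OF rec(1) rec(1)] x])
  also have "\<dots> \<le> sqrt L * (Ce * norm (cf (rec c - rec c')))"
    by (intro mult_left_mono hnorm_le_norm_cf hspace_diff rec) (simp add: L_nonneg)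
  finally show ?thesis by (simp add: Cw_def cf_diff rec mult.assoc)
qed

lemma w1_zero: "x \<in> {0..L} \<Longrightarrow> w1 0 x = 0"
proof -
  assume x: "x \<in> {0..L}"
  have "heq L (rec 0) 0"
    by (rule heq_of_cf_eq[OF rec(1) hspace_zero])
      (auto intro!: ell2_eqI simp: rec ec_cf hspace_zero coef_def hinner_zero_left d_hspace)
  then show ?thesis using x by (simp add: heq_def w1_def)
qed

lemma w1_le: "x \<in> {0..L} \<Longrightarrow> \<bar>w1 c x\<bar> \<le> Cw * norm c"
  using w1_diff[of x c 0] w1_zero[of x] by simp

lemma w1_cont: "continuous_on {0..L} (w1 c)"
  unfolding w1_def[abs_def] by (intro continuous_intros H1_continuous hspaceD rec)

definition res_state :: "(real \<Rightarrow> real) \<Rightarrow> state" where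
  "res_state r = (\<lambda>_. 0, \<lambda>x. of_real (r x))"

lemma res_state_hspace: "continuous_on {0..L} r \<Longrightarrow> res_state r \<in> hspace L"
  unfolding res_state_def by (intro hspace_snd L2_continuous continuous_intros)

text \<open>
  Clamping the argument of the residual to \<open>[-R, R]\<close> makes it globally Lipschitz with a constant of
  order \<open>R\<close>, and changes nothing along solutions whose first component stays below \<open>R\<close>.
\<close>

definition Nres :: "real \<Rightarrow> int ell2 \<Rightarrow> int ell2" where
  "Nres R c = cf (res_state (\<lambda>x. rho x (clamp R (w1 c x))))"

lemma norm_cf_res_state_diff:
  assumes "continuous_on {0..L} r" "continuous_on {0..L} r'"
    and D: "\<And>x. x \<in> {0..L} \<Longrightarrow> \<bar>r x - r' x\<bar> \<le> D"
  shows "norm (cf (res_state r) - cf (res_state r')) \<le> Cd * (D * sqrt L)"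
proof -
  have D0: "0 \<le> D" using D[of 0] L_nonneg by (auto intro: order_trans[OF abs_ge_zero])
  have d: "res_state r - res_state r' = res_state (\<lambda>x. r x - r' x)"
    by (simp add: res_state_def minus_prod_def fun_eq_iff)
  have c: "continuous_on {0..L} (\<lambda>x. complex_of_real (r x - r' x))" by (intro continuous_intros assms)
  have "norm (cf (res_state r) - cf (res_state r')) \<le> Cd * hnorm L (res_state r - res_state r')"
    using norm_cf_le[OF hspace_diff[OF res_state_hspace res_state_hspace]] assms by (simp add: cf_diff res_state_hspace)
  also have "hnorm L (res_state r - res_state r') = L2norm L (\<lambda>x. of_real (r x - r' x))"
    unfolding d unfolding res_state_def by (rule hnorm_snd[OF L2_continuous[OF c]])
  also have "\<dots> \<le> D * L2norm L (\<lambda>_. 1)"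
    by (intro L2norm_mono L2_continuous c continuous_intros D0) (use D in \<open>simp flip: of_real_diff\<close>)
  finally show ?thesis using Cd(1) L2norm_one[OF L_nonneg] by simp
qed

text \<open>The factor \<open>R\<close> is inherited from \<open>rho\<close>, and \<open>C\<close>
  is uniform over \<open>R \<le> R0\<close>: shrinking \<open>R\<close> later shrinks the
  nonlinearity without affecting other constants.\<close>

lemma Nres_lipschitz:
  obtains C where "C \<ge> 0" "\<And>R c c'. 0 \<le> R \<Longrightarrow> R \<le> R0 \<Longrightarrow> norm (Nres R c - Nres R c') \<le> C * R * norm (c - c')"
proof -
  obtain M where M: "M \<ge> 0"
    "\<And>x y z R. x \<in> {0..L} \<Longrightarrow> R \<le> R0 \<Longrightarrow> \<bar>y\<bar> \<le> R \<Longrightarrow> \<bar>z\<bar> \<le> R \<Longrightarrow> \<bar>rho x y - rho x z\<bar> \<le> M * R * \<bar>y - z\<bar>"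
    using rho_estimates[of R0] by metis
  show thesis
  proof (rule that[of "Cd * (M * Cw * sqrt L)"])
    show "0 \<le> Cd * (M * Cw * sqrt L)"
      using Cd(1) M Cw_nonneg L_nonneg by (intro mult_nonneg_nonneg) auto
    fix R c c' assume R: "0 \<le> R" "R \<le> R0"
    have "norm (Nres R c - Nres R c') \<le> Cd * ((M * R * (Cw * norm (c - c'))) * sqrt L)"
      unfolding Nres_def
    proof (rule norm_cf_res_state_diff)
      fix x assume x: "x \<in> {0..L}"
      have "\<bar>rho x (clamp R (w1 c x)) - rho x (clamp R (w1 c' x))\<bar> \<le> M * R * \<bar>clamp R (w1 c x) - clamp R (w1 c' x)\<bar>"
        by (rule M(2)[OF x R(2)]) (auto intro: clamp_abs R)
      also have "\<dots> \<le> M * R * (Cw * norm (c - c'))"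
        using clamp_diff[of R "w1 c x" "w1 c' x"] w1_diff[OF x, of c c'] M(1) R by (intro mult_left_mono) auto
      finally show "\<bar>rho x (clamp R (w1 c x)) - rho x (clamp R (w1 c' x))\<bar> \<le> M * R * (Cw * norm (c - c'))" .
    qed (intro rho_clamp_cont w1_cont)+
    then show "norm (Nres R c - Nres R c') \<le> Cd * (M * Cw * sqrt L) * R * norm (c - c')"
      by (simp add: mult_ac)
  qed
qed

lemma Nres_zero: "Nres R 0 = 0" if "0 \<le> R"
proof -
  have "clamp R 0 = 0" using that by (simp add: clamp_def)
  then have "norm (cf (res_state (\<lambda>x. rho x (clamp R (w1 0 x)))) - cf (res_state (\<lambda>x. 0))) \<le> Cd * (0 * sqrt L)"
    by (intro norm_cf_res_state_diff rho_clamp_cont w1_cont) (auto simp: w1_zero rho_zero)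
  moreover have "cf (res_state (\<lambda>x. 0)) = 0"
  proof -
    have "res_state (\<lambda>x. 0) = 0" by (simp add: res_state_def zero_prod_def zero_fun_def)
    then show ?thesis
      by (auto intro!: ell2_eqI simp: ec_cf hspace_zero coef_def hinner_zero_left d_hspace)
  qed
  ultimately show ?thesis by (simp add: Nres_def)
qed

lemma vec_a_hspace: "vec_a L \<alpha> \<in> hspace L" and vec_b_hspace: "vec_b L \<alpha> \<in> hspace L"
proof -
  have "has_wderiv L (\<lambda>x. of_real (x / (\<alpha> * L))) (\<lambda>x. of_real (1 / (\<alpha> * L)))"
    by (intro has_wderiv_of_C1) (use alpha_gt L_pos in \<open>auto intro!: derivative_eq_intros simp: has_vector_derivative_def scaleR_conv_of_real\<close>)
  then show "vec_a L \<alpha> \<in> hspace L"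
    using L2_zero[of L] by (auto simp: hspace_def vec_a_def H1_def)
  have "L2 L (\<lambda>x. of_real (- x / (\<alpha> * L)))" by (intro L2_continuous continuous_intros) (use alpha_gt L_pos in auto)
  from hspace_snd[OF this] show "vec_b L \<alpha> \<in> hspace L" by (simp add: vec_b_def)
qed

definition av :: "int ell2" where "av = cf (vec_a L \<alpha>)"
definition bv :: "int ell2" where "bv = cf (vec_b L \<alpha>)"

abbreviation dim :: nat where "dim \<equiv> 2 * n0 + 3"

text \<open>Position of a low mode in X: entry 0 is \<open>v\<close>, the modes from
  \<open>-n0\<close> to \<open>n0\<close> occupy entries 1 to \<open>2 * n0 + 1\<close>, and entry
  \<open>2 * n0 + 2\<close> is \<xi>.\<close>

definition ix :: "int \<Rightarrow> nat" where "ix k = nat (k + int n0 + 1)"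

lemma ix_bij: "bij_betw ix Low {1..2 * n0 + 1}"
  by (rule bij_betw_byWitness[of _ "\<lambda>i. int i - int n0 - 1"]) (auto simp: ix_def low_modes_def)

lemma ix_less: "k \<in> Low \<Longrightarrow> ix k < dim" "k \<in> Low \<Longrightarrow> ix k \<noteq> 0" "k \<in> Low \<Longrightarrow> ix k \<noteq> 2 * n0 + 2"
  by (auto simp: ix_def low_modes_def)

lemma ix_inv: "k \<in> Low \<Longrightarrow> int (ix k) - 1 - int n0 = k"
  by (auto simp: ix_def low_modes_def)

lemma sum_dim_split:
  fixes g :: "nat \<Rightarrow> 'a::comm_monoid_add"
  shows "(\<Sum>j<dim. g j) = g 0 + (\<Sum>k\<in>Low. g (ix k)) + g (2 * n0 + 2)"
proof -
  have "{..<dim} = insert 0 (insert (2 * n0 + 2) {1..2 * n0 + 1})" by auto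
  then have "(\<Sum>j<dim. g j) = g 0 + (g (2 * n0 + 2) + (\<Sum>j\<in>{1..2 * n0 + 1}. g j))" by simp
  also have "(\<Sum>j\<in>{1..2 * n0 + 1}. g j) = (\<Sum>k\<in>Low. g (ix k))"
    by (rule sum.reindex_bij_betw[OF ix_bij, symmetric])
  finally show ?thesis by (simp add: add_ac)
qed

lemma less_dim_cases:
  assumes "i < dim"
  obtains "i = 0" | k where "k \<in> Low" "i = ix k" | "i = 2 * n0 + 2"
proof -
  consider "i = 0" | "i = 2 * n0 + 2" | "i \<in> {1..2 * n0 + 1}" using assms by fastforce
  then show thesis
  proof cases
    case 3
    then have "i \<in> ix ` Low" using bij_betw_imp_surj_on[OF ix_bij] by simp
    then show thesis using that(2) by blast
  qed (fact that)+
qed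

end

section \<open>The closed-loop matrix and the joint coordinate space\<close>

locale wave_loop = wave_spectral +
  fixes K :: "real mat"
  assumes K_dim: "K \<in> carrier_mat 1 (2 * n0 + 3)"
begin

definition AK :: "real mat" where "AK = mat_A L \<alpha> f ye n0 e d lam + mat_B L \<alpha> n0 e d lam * K"

definition KX :: "(nat \<Rightarrow> real) \<Rightarrow> real" where "KX x = (\<Sum>i<dim. K $$ (0, i) * x i)"

lemma mat_A_dim: "mat_A L \<alpha> f ye n0 e d lam \<in> carrier_mat dim dim"
  and mat_B_dim: "mat_B L \<alpha> n0 e d lam \<in> carrier_mat dim 1"
  by (intro carrier_matI;
      simp add: mat_A_def mat_A1_def mat_L1_def mat_A0_def mat_B0_def mat_B_def mat_B1_def append_rows_def)+

lemma AK_dim: "AK \<in> carrier_mat dim dim"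
  unfolding AK_def using mat_A_dim mat_B_dim K_dim by auto

lemma mat_A_row0: "j < dim \<Longrightarrow> mat_A L \<alpha> f ye n0 e d lam $$ (0, j) = 0"
  by (simp add: mat_A_def mat_A1_def mat_L1_def mat_A0_def mat_B0_def)

lemma mat_A_mid:
  assumes "k \<in> Low"
  shows "mat_A L \<alpha> f ye n0 e d lam $$ (ix k, 0) = Re (ec av k)"
    "p \<in> Low \<Longrightarrow> mat_A L \<alpha> f ye n0 e d lam $$ (ix k, ix p) = Re (A0 k p)"
    "mat_A L \<alpha> f ye n0 e d lam $$ (ix k, 2 * n0 + 2) = 0"
proof -
  have i: "int (ix k - 1) - int n0 = k" "ix k - Suc 0 < 2 * n0 + 1" "0 < ix k" "ix k < 2 * n0 + 2" "int (ix k - Suc 0) - int n0 = k"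
    if "k \<in> Low" for k using that by (auto simp: ix_def low_modes_def)
  show "mat_A L \<alpha> f ye n0 e d lam $$ (ix k, 0) = Re (ec av k)"
    "p \<in> Low \<Longrightarrow> mat_A L \<alpha> f ye n0 e d lam $$ (ix k, ix p) = Re (A0 k p)"
    "mat_A L \<alpha> f ye n0 e d lam $$ (ix k, 2 * n0 + 2) = 0"
    using i[OF assms] i[of p]
    by (auto simp: mat_A_def mat_A1_def mat_L1_def mat_A0_def mat_B0_def mode_def av_def ec_cf vec_a_hspace coef_def A0_def)
qed

lemma mat_A_last:
  "mat_A L \<alpha> f ye n0 e d lam $$ (2 * n0 + 2, 0) = - tail av"
  "p \<in> Low \<Longrightarrow> mat_A L \<alpha> f ye n0 e d lam $$ (2 * n0 + 2, ix p) = Re (pd p)"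
  "mat_A L \<alpha> f ye n0 e d lam $$ (2 * n0 + 2, 2 * n0 + 2) = 0"
  using tail_sum_eq[OF vec_a_hspace] ix_less(2)[of p] ix_inv[of p]
  by (auto simp: mat_A_def mat_A1_def mat_L1_def mat_A0_def mat_B0_def av_def pd_def ix_def low_modes_def)

lemma mat_B_entries:
  "mat_B L \<alpha> n0 e d lam $$ (0, 0) = 1"
  "k \<in> Low \<Longrightarrow> mat_B L \<alpha> n0 e d lam $$ (ix k, 0) = Re (ec bv k)"
  "mat_B L \<alpha> n0 e d lam $$ (2 * n0 + 2, 0) = - tail bv"
proof -
  show "mat_B L \<alpha> n0 e d lam $$ (0, 0) = 1" "mat_B L \<alpha> n0 e d lam $$ (2 * n0 + 2, 0) = - tail bv"
    using tail_sum_eq[OF vec_b_hspace] by (simp_all add: mat_B_def mat_B1_def mat_B0_def append_rows_def bv_def)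
  assume "k \<in> Low"
  then have "int (ix k - Suc 0) - int n0 = k" "ix k - Suc 0 < 2 * n0 + 1" "0 < ix k" "ix k < 2 * n0 + 2"
    by (auto simp: ix_def low_modes_def)
  then show "mat_B L \<alpha> n0 e d lam $$ (ix k, 0) = Re (ec bv k)"
    by (simp add: mat_B_def mat_B1_def mat_B0_def append_rows_def bv_def mode_def ec_cf vec_b_hspace coef_def)
qed

lemma AK_row:
  assumes "i < dim"
  shows "(\<Sum>j<dim. AK $$ (i, j) * x j) =
    (\<Sum>j<dim. mat_A L \<alpha> f ye n0 e d lam $$ (i, j) * x j) + mat_B L \<alpha> n0 e d lam $$ (i, 0) * KX x"
proof -
  have "AK $$ (i, j) = mat_A L \<alpha> f ye n0 e d lam $$ (i, j) + mat_B L \<alpha> n0 e d lam $$ (i, 0) * K $$ (0, j)" if "j < dim" for j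
    using assms that mat_A_dim mat_B_dim K_dim unfolding AK_def
    by (subst index_add_mat) (auto simp: scalar_prod_def)
  then show ?thesis
    by (simp add: KX_def distrib_right sum.distrib sum_distrib_left mult.assoc)
qed

text \<open>The rows of the matrix read as the equations for v, the low modes and \<xi>. The block
  definitions of the matrices are not unfolded again after this.\<close>

lemma AK_rows:
  "(\<Sum>j<dim. AK $$ (0, j) * x j) = KX x"
  "k \<in> Low \<Longrightarrow> (\<Sum>j<dim. AK $$ (ix k, j) * x j) =
     Re (ec av k) * x 0 + (\<Sum>p\<in>Low. Re (A0 k p) * x (ix p)) + Re (ec bv k) * KX x"
  "(\<Sum>j<dim. AK $$ (2 * n0 + 2, j) * x j) =
     - tail av * x 0 + (\<Sum>p\<in>Low. Re (pd p) * x (ix p)) - tail bv * KX x"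
proof -
  show "(\<Sum>j<dim. AK $$ (0, j) * x j) = KX x"
    by (subst AK_row) (auto simp: mat_A_row0 mat_B_entries)
  show "(\<Sum>j<dim. AK $$ (2 * n0 + 2, j) * x j) = - tail av * x 0 + (\<Sum>p\<in>Low. Re (pd p) * x (ix p)) - tail bv * KX x"
  proof -
    have l: "2 * n0 + 2 < dim" by simp
    have s: "(\<Sum>p\<in>Low. mat_A L \<alpha> f ye n0 e d lam $$ (2 * n0 + 2, ix p) * x (ix p)) = (\<Sum>p\<in>Low. Re (pd p) * x (ix p))"
      by (rule sum.cong[OF refl]) (simp only: mat_A_last(2))
    show ?thesis
      by (simp only: AK_row[OF l] sum_dim_split mat_A_last(1,3) mat_B_entries(3) s)
  qed
  assume k: "k \<in> Low"
  have s: "(\<Sum>p\<in>Low. mat_A L \<alpha> f ye n0 e d lam $$ (ix k, ix p) * x (ix p)) = (\<Sum>p\<in>Low. Re (A0 k p) * x (ix p))"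
    by (rule sum.cong[OF refl]) (simp only: mat_A_mid(2)[OF k])
  show "(\<Sum>j<dim. AK $$ (ix k, j) * x j) =
     Re (ec av k) * x 0 + (\<Sum>p\<in>Low. Re (A0 k p) * x (ix p)) + Re (ec bv k) * KX x"
    by (simp only: AK_row[OF ix_less(1)[OF k]] sum_dim_split mat_A_mid(1,3)[OF k] mat_B_entries(2)[OF k] s
        mult_zero_left add_0_right)
qed

lemma KX_vec_X:
  "(K * vec_X L n0 e d lam w \<zeta> v) $$ (0, 0) = KX (\<lambda>i. vec_X L n0 e d lam w \<zeta> v $$ (i, 0))"
  using K_dim by (auto simp: KX_def vec_X_def scalar_prod_def lessThan_atLeast0 intro!: sum.cong)

text \<open>The finite vector is stored in an infinite index type, with zeros from
  \<open>dim\<close> on.\<close>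

definition join :: "(nat \<Rightarrow> complex) \<Rightarrow> int ell2 \<Rightarrow> (nat + int) ell2" where
  "join y c = mk_ell2 (case_sum (\<lambda>j. if j < dim then y j else 0) (ec c))"

lemma join_in_ell2:
  fixes c :: "int ell2"
  assumes F: "finite F"
  shows "L2_set (\<lambda>i. cmod (case_sum (\<lambda>j. if j < dim then y j else 0) (ec c) i)) F \<le> (\<Sum>j<dim. cmod (y j)) + norm c"
proof -
  let ?g = "case_sum (\<lambda>j. if j < dim then y j else 0) (ec c)"
  let ?a = "case_sum (\<lambda>j. if j < dim then y j else 0) (\<lambda>_ :: int. 0)" and ?b = "case_sum (\<lambda>_ :: nat. 0) (ec c)"
  have "L2_set (\<lambda>i. cmod (?g i)) F = L2_set (\<lambda>i. cmod (?a i + ?b i)) F"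
    by (intro L2_set_cong refl) (auto split: sum.split)
  also have "\<dots> \<le> L2_set (\<lambda>i. cmod (?a i)) F + L2_set (\<lambda>i. cmod (?b i)) F" by (rule L2_set_cmod_add)
  also have "L2_set (\<lambda>i. cmod (?a i)) F \<le> (\<Sum>i\<in>F. cmod (?a i))" by (rule L2_set_le_sum) auto
  also have "(\<Sum>i\<in>F. cmod (?a i)) = (\<Sum>i\<in>F \<inter> Inl ` {..<dim}. cmod (?a i))"
    using F by (intro sum.mono_neutral_right) (auto split: sum.split)
  also have "\<dots> \<le> (\<Sum>i\<in>Inl ` {..<dim}. cmod (?a i))" by (intro sum_mono2) auto
  also have "\<dots> = (\<Sum>j<dim. cmod (y j))" by (subst sum.reindex) (auto simp: inj_on_def)
  also have "L2_set (\<lambda>i. cmod (?b i)) F = L2_set (\<lambda>k. cmod (ec c k)) (Inr -` F)"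
  proof -
    have "(\<Sum>i\<in>F. (cmod (?b i))\<^sup>2) = (\<Sum>i\<in>Inr ` (Inr -` F). (cmod (?b i))\<^sup>2)"
      using F by (intro sum.mono_neutral_right) (auto split: sum.split)
    also have "\<dots> = (\<Sum>k\<in>Inr -` F. (cmod (ec c k))\<^sup>2)" by (subst sum.reindex) (auto simp: inj_on_def)
    finally show ?thesis by (simp add: L2_set_def)
  qed
  also have "\<dots> \<le> norm c" using F by (intro L2_set_le_norm_ell2 finite_vimageI) auto
  finally show ?thesis by simp
qed

lemma ec_join: "ec (join y c) (Inl j) = (if j < dim then y j else 0)" "ec (join y c) (Inr k) = ec c k"
  unfolding join_def by (subst ec_mk[OF in_ell2I[OF join_in_ell2]], simp_all)+

lemma norm_join: "norm (join y c) \<le> (\<Sum>j<dim. cmod (y j)) + norm c"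
  unfolding join_def by (rule norm_ell2_le) (subst ec_mk[OF in_ell2I[OF join_in_ell2]], simp_all add: join_in_ell2)

lemma ell2_sum_eqI: "(\<And>j. ec x (Inl j) = ec y (Inl j)) \<Longrightarrow> (\<And>k. ec x (Inr k) = ec y (Inr k)) \<Longrightarrow> x = y"
  by (rule ell2_eqI, rename_tac i) (case_tac i, auto)

lemma join_diff: "join y c - join y' c' = join (\<lambda>j. y j - y' j) (c - c')"
  by (rule ell2_sum_eqI) (simp_all add: ec_join)

lemma norm_ell2_trunc: "norm (ell2_trunc S c) \<le> norm c"
proof (rule norm_ell2_sq_le)
  fix F :: "'a set" assume F: "finite F"
  have "(\<Sum>i\<in>F. (cmod (ec (ell2_trunc S c) i))\<^sup>2) \<le> (\<Sum>i\<in>F. (cmod (ec c i))\<^sup>2)" by (intro sum_mono) auto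
  also have "\<dots> \<le> (norm c)\<^sup>2" by (rule sum_cmod_sq_le_norm[OF F])
  finally show "(\<Sum>i\<in>F. (cmod (ec (ell2_trunc S c) i))\<^sup>2) \<le> (norm c)\<^sup>2" .
qed simp

lemma ell2_trunc_diff: "ell2_trunc S c - ell2_trunc S c' = ell2_trunc S (c - c')"
  by (rule ell2_eqI) simp

text \<open>
  The contribution to \<open>X'\<close> of a forcing term with coordinates \<open>r\<close>; the last entry comes from the sum
  over the high modes in the definition of \<open>\<xi>\<close>.
\<close>

definition qv :: "int ell2 \<Rightarrow> nat \<Rightarrow> real" where
  "qv r i = (if i = 0 then 0 else if i = 2 * n0 + 2 then - tail r else Re (ec r (int i - 1 - int n0)))"

lemma qv_diff: "qv r i - qv r' i = qv (r - r') i"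
  using linear_diff[OF bounded_linear.linear[OF bounded_linear_tail], of r r'] by (simp add: qv_def)

lemma qv_le: "\<bar>qv r i\<bar> \<le> (1 + onorm tail) * norm r"
proof -
  have o: "\<bar>tail r\<bar> \<le> onorm tail * norm r" using onorm[OF bounded_linear_tail, of r] by simp
  have p: "0 \<le> onorm tail" by (rule onorm_pos_le[OF bounded_linear_tail])
  have "\<bar>Re (ec r k)\<bar> \<le> norm r" for k
    by (rule order_trans[OF abs_Re_le_cmod cmod_ec_le])
  then show ?thesis using o p by (auto simp: qv_def distrib_right intro: add_increasing add_increasing2 order_trans)
qed

end

text \<open>
  \<open>A\<^sub>K P = P (diag \<mu> + N)\<close> and \<open>Q = P\<^sup>-\<^sup>1\<close>. The state is the family \<open>U\<close> with \<open>X = P Y\<close>, where \<open>Y\<close> is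
  stored at the indices \<open>Inl j\<close>, \<open>j < 2 n\<^sub>0 + 3\<close>, and with the high modes of \<open>W\<close> at the indices \<open>Inr k\<close>,
  \<open>k \<in> High\<close>. The remaining components vanish; their exponents are set to \<open>-1\<close>. Small \<open>N\<close> and \<open>P\<close> make
  the coupling terms small, in particular the action of \<open>v\<close> and \<open>v'\<close> on the high modes.
\<close>

locale wave_modal = wave_loop +
  fixes \<mu> :: "nat \<Rightarrow> complex" and P Q N :: "nat \<Rightarrow> nat \<Rightarrow> complex" and w \<epsilon> \<sigma> :: real
  assumes w: "w > 0" "w \<le> 1" and Re_mu: "i < 2 * n0 + 3 \<Longrightarrow> Re (\<mu> i) \<le> - w"
    and AP: "i < 2 * n0 + 3 \<Longrightarrow> k < 2 * n0 + 3 \<Longrightarrow>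
      (\<Sum>j<2 * n0 + 3. of_real (AK $$ (i, j)) * P j k) = P i k * \<mu> k + (\<Sum>j<2 * n0 + 3. P i j * N j k)"
    and PQ: "i < 2 * n0 + 3 \<Longrightarrow> k < 2 * n0 + 3 \<Longrightarrow> (\<Sum>j<2 * n0 + 3. P i j * Q j k) = of_bool (i = k)"
    and QP: "i < 2 * n0 + 3 \<Longrightarrow> k < 2 * n0 + 3 \<Longrightarrow> (\<Sum>j<2 * n0 + 3. Q i j * P j k) = of_bool (i = k)"
    and N_le: "i < 2 * n0 + 3 \<Longrightarrow> k < 2 * n0 + 3 \<Longrightarrow> cmod (N i k) \<le> \<epsilon>"
    and P_le: "i < 2 * n0 + 3 \<Longrightarrow> k < 2 * n0 + 3 \<Longrightarrow> cmod (P i k) \<le> \<sigma>"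
begin

definition m :: "nat + int \<Rightarrow> complex" where
  "m = case_sum (\<lambda>j. if j < dim then \<mu> j else -1) (\<lambda>k. if k \<in> High then lam k else -1)"

text \<open>The bound \<open>w \<le> 1\<close> serves the high eigenvalues, with real part below
  \<open>-1\<close>, and the components with exponent \<open>-1\<close>.\<close>

sublocale decaying_spectrum m w
proof
  fix i show "Re (m i) \<le> - w"
  proof (cases i)
    case (Inr k)
    then show ?thesis using w high(3)[of k] by (cases "k \<in> High") (auto simp: m_def)
  qed (use w Re_mu in \<open>auto simp: m_def\<close>)
qed (rule w)

text \<open>X recovered as P Y. The basis P is complex; taking the real part keeps X real for every
  \<open>U\<close> and loses nothing when Y comes from a real X.\<close>

definition Xr :: "(nat + int) ell2 \<Rightarrow> nat \<Rightarrow> real" where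
  "Xr U i = Re (\<Sum>j<dim. P i j * ec U (Inl j))"

text \<open>The coordinates of W: low ones are read off X, hence real by construction, and high ones
  are stored as they are.\<close>

definition cU :: "(nat + int) ell2 \<Rightarrow> int ell2" where
  "cU U = mk_ell2 (\<lambda>k. if k \<in> Low then of_real (Xr U (ix k)) else ec U (Inr k))"

lemma Xr_diff: "Xr (U - U') i = Xr U i - Xr U' i"
  by (simp add: Xr_def right_diff_distrib sum_subtractf)

lemma Xr_scaleR: "Xr (r *\<^sub>R U) i = r * Xr U i"
  by (simp add: Xr_def sum_distrib_left scaleR_conv_of_real mult_ac flip: Re_complex_of_real)
    (simp add: sum_distrib_left[symmetric] mult.left_commute[of _ "of_real r"])

lemma \<sigma>_nonneg: "0 \<le> \<sigma>" using order_trans[OF norm_ge_zero P_le[of 0 0]] by simp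
lemma \<epsilon>_nonneg: "0 \<le> \<epsilon>" using order_trans[OF norm_ge_zero N_le[of 0 0]] by simp

lemma Xr_le:
  assumes "i < dim"
  shows "\<bar>Xr U i\<bar> \<le> dim * \<sigma> * norm U"
proof -
  have "\<bar>Xr U i\<bar> \<le> cmod (\<Sum>j<dim. P i j * ec U (Inl j))" unfolding Xr_def by (rule abs_Re_le_cmod)
  also have "\<dots> \<le> (\<Sum>j<dim. \<sigma> * norm U)"
    by (rule order_trans[OF norm_sum sum_mono])
      (use assms in \<open>auto simp: norm_mult intro!: mult_mono P_le cmod_ec_le \<sigma>_nonneg\<close>)
  finally show ?thesis by (simp add: mult.assoc)
qed

lemma cU_in_ell2: "in_ell2 (\<lambda>k. if k \<in> Low then of_real (Xr U (ix k)) else ec U (Inr k))"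
    (is "in_ell2 ?f")
  and norm_cU: "norm (cU U) \<le> (card Low * (dim * \<sigma>) + 1) * norm U"
proof -
  have b: "L2_set (\<lambda>k. cmod (?f k)) F \<le> (card Low * (dim * \<sigma>) + 1) * norm U" if F: "finite F" for F
  proof -
    let ?a = "\<lambda>k. if k \<in> Low then complex_of_real (Xr U (ix k)) else 0" and ?b = "\<lambda>k. if k \<in> Low then 0 else ec U (Inr k)"
    have "L2_set (\<lambda>k. cmod (?f k)) F = L2_set (\<lambda>k. cmod (?a k + ?b k)) F"
      by (intro L2_set_cong) auto
    also have "\<dots> \<le> L2_set (\<lambda>k. cmod (?a k)) F + L2_set (\<lambda>k. cmod (?b k)) F" by (rule L2_set_cmod_add)
    also have "L2_set (\<lambda>k. cmod (?a k)) F \<le> (\<Sum>k\<in>F. cmod (?a k))" by (rule L2_set_le_sum) auto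
    also have "\<dots> = (\<Sum>k\<in>F \<inter> Low. \<bar>Xr U (ix k)\<bar>)"
      using F by (intro sum.mono_neutral_cong_right) auto
    also have "\<dots> \<le> (\<Sum>k\<in>Low. \<bar>Xr U (ix k)\<bar>)" by (intro sum_mono2 finite_Low) auto
    also have "\<dots> \<le> (\<Sum>k\<in>Low. dim * \<sigma> * norm U)" by (intro sum_mono Xr_le ix_less)
    also have "L2_set (\<lambda>k. cmod (?b k)) F \<le> L2_set (\<lambda>k. cmod (ec U (Inr k))) F" by (rule L2_set_mono) auto
    also have "\<dots> = L2_set (\<lambda>i. cmod (ec U i)) (Inr ` F)"
      by (simp add: L2_set_def sum.reindex)
    also have "\<dots> \<le> norm U" using F by (intro L2_set_le_norm_ell2) auto
    finally show ?thesis by (simp add: algebra_simps)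
  qed
  show f: "in_ell2 ?f" by (rule in_ell2I[OF b])
  have c: "ec (cU U) = ?f" unfolding cU_def by (rule ec_mk[OF f])
  show "norm (cU U) \<le> (card Low * (dim * \<sigma>) + 1) * norm U"
    by (rule norm_ell2_le, unfold c, rule b)
qed

lemma ec_cU: "ec (cU U) k = (if k \<in> Low then of_real (Xr U (ix k)) else ec U (Inr k))"
  unfolding cU_def by (simp add: ec_mk[OF cU_in_ell2])

lemma cU_diff: "cU (U - U') = cU U - cU U'"
  by (rule ell2_eqI) (simp add: ec_cU Xr_diff)

lemma cU_scaleR: "cU (r *\<^sub>R U) = r *\<^sub>R cU U"
  by (rule ell2_eqI) (simp add: ec_cU Xr_scaleR scaleR_conv_of_real)

lemma bounded_linear_cU: "bounded_linear cU"
proof (rule bounded_linear_intro)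
  show "cU (x + y) = cU x + cU y" for x y
    using cU_diff[of "x + y" y] by (simp add: algebra_simps)
  show "norm (cU x) \<le> norm x * (card Low * (dim * \<sigma>) + 1)" for x
    using norm_cU[of x] by (simp add: mult.commute)
qed (rule cU_scaleR)

lemma bounded_linear_Xr: "bounded_linear (\<lambda>U. Xr U i)"
  unfolding Xr_def
  by (intro bounded_linear_intros bounded_linear_compose[OF bounded_linear_Re] bounded_linear_sum
      bounded_linear_const_mult bounded_linear_ec)

text \<open>What remains of Y' = Q X' once the diagonal part \<open>\<mu>\<close> is split off,
  apart from the reference signal.\<close>

definition lowF :: "real \<Rightarrow> (nat + int) ell2 \<Rightarrow> nat \<Rightarrow> complex" where
  "lowF R U j = (\<Sum>l<dim. N j l * ec U (Inl l)) + (\<Sum>i<dim. Q j i * of_real (qv (Nres R (cU U)) i))"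

definition highF :: "real \<Rightarrow> (nat + int) ell2 \<Rightarrow> int ell2" where
  "highF R U = Xr U 0 *\<^sub>R av + KX (Xr U) *\<^sub>R bv + Nres R (cU U)"

definition F :: "real \<Rightarrow> (nat + int) ell2 \<Rightarrow> (nat + int) ell2" where
  "F R U = join (lowF R U) (ell2_trunc High (highF R U))"

text \<open>The reference signal enters X' only in the last entry, with coefficient
  \<open>-1\<close>; in the variable Y = Q X this selects the last column of
  \<open>Q\<close>.\<close>

definition Gz :: "(nat + int) ell2" where "Gz = join (\<lambda>j. - Q j (2 * n0 + 2)) 0"

lemma KX_diff: "KX (\<lambda>i. x i - y i) = KX x - KX y"
  by (simp add: KX_def right_diff_distrib sum_subtractf)

text \<open>Lipschitz constant of the linear coupling: the first summand comes from
  \<open>N\<close>, the second from v and v' = K X acting on the high modes through the small basis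
  \<open>P\<close>.\<close>

definition LA :: real where
  "LA = dim * (dim * \<epsilon>) + dim * \<sigma> * (norm av + (\<Sum>i<dim. \<bar>K $$ (0, i)\<bar>) * norm bv)"

lemma F_lipschitz:
  obtains LB where "LB \<ge> 0"
    "\<And>R U U'. 0 \<le> R \<Longrightarrow> R \<le> R0 \<Longrightarrow> norm (F R U - F R U') \<le> (LA + LB * R) * norm (U - U')"
proof -
  obtain C where C: "C \<ge> 0"
    "\<And>R c c'. 0 \<le> R \<Longrightarrow> R \<le> R0 \<Longrightarrow> norm (Nres R c - Nres R c') \<le> C * R * norm (c - c')"
    using Nres_lipschitz[of R0] by metis
  define CU where "CU = card Low * (dim * \<sigma>) + 1"
  define CQ where "CQ = (\<Sum>j<dim. \<Sum>i<dim. cmod (Q j i))"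
  define ct where "ct = 1 + onorm tail"
  have nn: "CU \<ge> 0" "CQ \<ge> 0" "ct \<ge> 0"
    using \<sigma>_nonneg onorm_pos_le[OF bounded_linear_tail] by (auto simp: CU_def CQ_def ct_def intro!: sum_nonneg add_nonneg_nonneg)
  show thesis
  \<comment> \<open>The residual acts twice: on Y, through \<open>Q\<close> and the functionals
    \<open>qv\<close>, and directly on the high modes.\<close>
  proof (rule that[of "CQ * ct * C * CU + C * CU"])
    show "0 \<le> CQ * ct * C * CU + C * CU" using nn C by simp
    fix R and U U' :: "(nat + int) ell2" assume R: "0 \<le> R" "R \<le> R0"
    define D where "D = U - U'"
    define r where "r = Nres R (cU U) - Nres R (cU U')"
    have r: "norm r \<le> C * R * (CU * norm D)"
    proof -
      have "norm r \<le> C * R * norm (cU D)" using C(2)[OF R, of "cU U" "cU U'"] by (simp add: r_def D_def cU_diff)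
      also have "\<dots> \<le> C * R * (CU * norm D)"
        using norm_cU[of D] C R by (intro mult_left_mono) (auto simp: CU_def)
      finally show ?thesis .
    qed
    have lowd: "lowF R U j - lowF R U' j = (\<Sum>l<dim. N j l * ec D (Inl l)) + (\<Sum>i<dim. Q j i * of_real (qv r i))" for j
      by (simp add: lowF_def D_def r_def qv_diff[symmetric] right_diff_distrib sum_subtractf)
    have "(\<Sum>j<dim. cmod (lowF R U j - lowF R U' j)) \<le> (\<Sum>j<dim. dim * \<epsilon> * norm D + (\<Sum>i<dim. cmod (Q j i)) * (ct * norm r))"
    proof (rule sum_mono)
      fix j assume j: "j \<in> {..<dim}"
      have "cmod (\<Sum>l<dim. N j l * ec D (Inl l)) \<le> (\<Sum>l<dim. \<epsilon> * norm D)"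
        by (rule order_trans[OF norm_sum sum_mono])
          (use j in \<open>auto simp: norm_mult intro!: mult_mono N_le cmod_ec_le \<epsilon>_nonneg\<close>)
      moreover have "cmod (\<Sum>i<dim. Q j i * of_real (qv r i)) \<le> (\<Sum>i<dim. cmod (Q j i) * (ct * norm r))"
        by (rule order_trans[OF norm_sum sum_mono])
          (auto simp: norm_mult ct_def intro!: mult_left_mono qv_le)
      ultimately show "cmod (lowF R U j - lowF R U' j) \<le> dim * \<epsilon> * norm D + (\<Sum>i<dim. cmod (Q j i)) * (ct * norm r)"
        unfolding lowd by (intro norm_triangle_le) (simp add: sum_distrib_right)
    qed
    also have "\<dots> = dim * (dim * \<epsilon>) * norm D + CQ * ct * norm r"
      by (simp add: sum.distrib CQ_def sum_distrib_right mult.assoc)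
    finally have 1: "(\<Sum>j<dim. cmod (lowF R U j - lowF R U' j)) \<le> dim * (dim * \<epsilon>) * norm D + CQ * ct * norm r" .
    have hd: "highF R U - highF R U' = Xr D 0 *\<^sub>R av + KX (Xr D) *\<^sub>R bv + r"
    proof -
      have "Xr D = (\<lambda>i. Xr U i - Xr U' i)" by (auto simp: D_def Xr_diff)
      then show ?thesis by (simp add: highF_def r_def KX_diff algebra_simps)
    qed
    have "\<bar>KX (Xr D)\<bar> \<le> (\<Sum>i<dim. \<bar>K $$ (0, i)\<bar> * (dim * \<sigma> * norm D))"
      unfolding KX_def
      by (rule order_trans[OF sum_abs sum_mono], unfold abs_mult, rule mult_left_mono[OF Xr_le], auto)
    then have kx: "\<bar>KX (Xr D)\<bar> \<le> (\<Sum>i<dim. \<bar>K $$ (0, i)\<bar>) * (dim * \<sigma> * norm D)" by (simp add: sum_distrib_right)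
    have "norm (highF R U - highF R U') \<le> norm (Xr D 0 *\<^sub>R av) + norm (KX (Xr D) *\<^sub>R bv) + norm r"
      unfolding hd by (intro norm_triangle_le add_mono norm_triangle_ineq order_refl)
    also have "\<dots> \<le> (dim * \<sigma> * norm D) * norm av + ((\<Sum>i<dim. \<bar>K $$ (0, i)\<bar>) * (dim * \<sigma> * norm D)) * norm bv + norm r"
      using Xr_le[of 0 D] kx by (intro add_mono order_refl) (auto intro!: mult_right_mono)
    finally have 2: "norm (highF R U - highF R U') \<le> \<dots>" .
    have "norm (F R U - F R U') \<le> (\<Sum>j<dim. cmod (lowF R U j - lowF R U' j)) + norm (highF R U - highF R U')"
      unfolding F_def join_diff ell2_trunc_diff
      by (rule order_trans[OF norm_join add_left_mono[OF norm_ell2_trunc]])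
    also have "\<dots> \<le> LA * norm D + (CQ * ct + 1) * norm r"
      using 1 2 by (simp add: LA_def algebra_simps)
    also have "\<dots> \<le> LA * norm D + (CQ * ct + 1) * (C * R * (CU * norm D))"
      using r nn by (intro add_left_mono mult_left_mono) auto
    also have "\<dots> = (LA + (CQ * ct * C * CU + C * CU) * R) * norm D" by (simp add: algebra_simps)
    finally show "norm (F R U - F R U') \<le> (LA + (CQ * ct * C * CU + C * CU) * R) * norm (U - U')" by (simp add: D_def)
  qed
qed

lemma F_zero: "0 \<le> R \<Longrightarrow> F R 0 = 0"
proof -
  assume R: "0 \<le> R"
  have c0: "cU 0 = 0" using cU_diff[of 0 0] by simp
  have x0: "Xr 0 i = 0" for i by (simp add: Xr_def)
  have q0: "qv 0 i = 0" for i using qv_diff[of 0 i 0] by simp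
  show ?thesis
    by (rule ell2_sum_eqI)
      (simp_all add: F_def ec_join lowF_def highF_def c0 Nres_zero[OF R] x0 q0 KX_def)
qed

text \<open>The relation Q A_K = (diag \<mu> + N) Q, obtained from A_K P = P (diag \<mu> + N) by
  inserting P Q = 1 on the right.\<close>

lemma sum_Q_AK:
  assumes "j < dim" "l < dim"
  shows "(\<Sum>i<dim. Q j i * of_real (AK $$ (i, l))) = \<mu> j * Q j l + (\<Sum>k<dim. N j k * Q k l)"
proof -
  let ?A = "\<lambda>i r. complex_of_real (AK $$ (i, r))"
  have "(\<Sum>i<dim. Q j i * ?A i l) = (\<Sum>i<dim. Q j i * (\<Sum>r<dim. ?A i r * (\<Sum>s<dim. P r s * Q s l)))"
    using assms by (intro sum.cong refl) (simp add: PQ if_distrib[of "(*) _"] sum.delta' of_bool_def cong: if_cong)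
  also have "\<dots> = (\<Sum>i<dim. \<Sum>r<dim. \<Sum>s<dim. Q j i * (?A i r * (P r s * Q s l)))"
    by (simp add: sum_distrib_left)
  also have "\<dots> = (\<Sum>i<dim. \<Sum>s<dim. \<Sum>r<dim. Q j i * (?A i r * (P r s * Q s l)))"
    by (intro sum.cong refl sum.swap)
  also have "\<dots> = (\<Sum>s<dim. \<Sum>i<dim. \<Sum>r<dim. Q j i * (?A i r * (P r s * Q s l)))"
    by (rule sum.swap)
  also have "\<dots> = (\<Sum>s<dim. (\<Sum>i<dim. Q j i * (\<Sum>r<dim. ?A i r * P r s)) * Q s l)"
    by (simp add: sum_distrib_left sum_distrib_right mult.assoc)
  also have "\<dots> = (\<Sum>s<dim. (of_bool (j = s) * \<mu> s + N j s) * Q s l)"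
  proof (rule sum.cong[OF refl])
    fix s assume s: "s \<in> {..<dim}"
    have "(\<Sum>i<dim. Q j i * (\<Sum>r<dim. ?A i r * P r s)) = (\<Sum>i<dim. Q j i * (P i s * \<mu> s) + Q j i * (\<Sum>k<dim. P i k * N k s))"
      using s by (intro sum.cong refl) (simp add: AP distrib_left)
    also have "\<dots> = (\<Sum>i<dim. Q j i * P i s) * \<mu> s + (\<Sum>i<dim. \<Sum>k<dim. Q j i * P i k * N k s)"
      by (simp add: sum.distrib sum_distrib_left sum_distrib_right mult.assoc)
    also have "(\<Sum>i<dim. \<Sum>k<dim. Q j i * P i k * N k s) = (\<Sum>k<dim. (\<Sum>i<dim. Q j i * P i k) * N k s)"
      by (subst sum.swap) (simp add: sum_distrib_right)
    also have "\<dots> = (\<Sum>k<dim. of_bool (j = k) * N k s)" using assms by (intro sum.cong refl) (simp add: QP)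
    also have "\<dots> = N j s" using assms by (simp add: of_bool_def if_distrib[of "\<lambda>x. x * _"] sum.delta cong: if_cong)
    finally show "(\<Sum>i<dim. Q j i * (\<Sum>r<dim. ?A i r * P r s)) * Q s l = (of_bool (j = s) * \<mu> s + N j s) * Q s l"
      using s assms by (simp add: QP)
  qed
  also have "\<dots> = \<mu> j * Q j l + (\<Sum>s<dim. N j s * Q s l)"
    using assms by (simp add: distrib_right sum.distrib of_bool_def if_distrib[of "\<lambda>x. x * _"] sum.delta cong: if_cong)
  finally show ?thesis .
qed

end

section \<open>Differentiability of the residual in time\<close>

text \<open>With the error written as an explicit function \<open>e\<close>, remainders of several
  expansions can be added and multiplied without difference quotients.\<close>

lemma has_vector_derivative_o:
  fixes f :: "real \<Rightarrow> 'a::real_normed_vector"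
  assumes b: "\<And>t. t \<in> S \<Longrightarrow> norm (f t - f s - (t - s) *\<^sub>R D) \<le> e t * \<bar>t - s\<bar>"
    and e: "(e \<longlongrightarrow> 0) (at s within S)"
  shows "(f has_vector_derivative D) (at s within S)"
  unfolding has_vector_derivative_def has_derivative_within
proof (intro conjI bounded_linear_scaleR_left)
  show "((\<lambda>t. (1 / norm (t - s)) *\<^sub>R (f t - (f s + (t - s) *\<^sub>R D))) \<longlongrightarrow> 0) (at s within S)"
  proof (rule Lim_null_comparison[OF _ e])
    show "\<forall>\<^sub>F t in at s within S. norm ((1 / norm (t - s)) *\<^sub>R (f t - (f s + (t - s) *\<^sub>R D))) \<le> e t"
      unfolding eventually_at_filter
    proof (intro always_eventually allI impI)
      fix t assume t: "t \<noteq> s" "t \<in> S"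
      have "f t - (f s + (t - s) *\<^sub>R D) = f t - f s - (t - s) *\<^sub>R D" by simp
      then show "norm ((1 / norm (t - s)) *\<^sub>R (f t - (f s + (t - s) *\<^sub>R D))) \<le> e t"
        using b[OF t(2)] t by (simp only: norm_scaleR) (simp add: divide_le_eq)
    qed
  qed
qed

lemma has_vector_derivative_oE:
  fixes f :: "real \<Rightarrow> 'a::real_normed_vector"
  assumes "(f has_vector_derivative D) (at s within S)"
  obtains e where "\<And>t. norm (f t - f s - (t - s) *\<^sub>R D) \<le> e t * \<bar>t - s\<bar>" "(e \<longlongrightarrow> 0) (at s within S)" "\<And>t. 0 \<le> e t"
proof -
  define e where "e = (\<lambda>t. norm ((1 / norm (t - s)) *\<^sub>R (f t - (f s + (t - s) *\<^sub>R D))))"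
  show thesis
  proof
    show "norm (f t - f s - (t - s) *\<^sub>R D) \<le> e t * \<bar>t - s\<bar>" for t
      by (cases "t = s") (simp_all add: e_def diff_diff_eq)
    show "(e \<longlongrightarrow> 0) (at s within S)"
      unfolding e_def using assms
      by (intro tendsto_norm_zero) (simp add: has_vector_derivative_def has_derivative_within)
  qed (simp add: e_def)
qed

context wave_spectral
begin

definition w2 :: "int ell2 \<Rightarrow> real \<Rightarrow> complex" where "w2 c x = of_real (Re (snd (rec c) x))"

lemma L2_Re: "L2 L u \<Longrightarrow> L2 L (\<lambda>x. of_real (Re (u x)))"
  by (rule L2_bound[of L u _ 1]) (auto simp: L2_def abs_Re_le_cmod)

lemma L2_w2: "L2 L (w2 c)"
  unfolding w2_def[abs_def] by (intro L2_Re hspaceD rec)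

lemma L2_w1: "L2 L (\<lambda>x. of_real (w1 c x))"
  by (intro L2_continuous continuous_intros w1_cont)

lemma L2norm_w2_le: "L2norm L (w2 c) \<le> Ce * norm c"
proof -
  have "L2norm L (w2 c) \<le> 1 * L2norm L (snd (rec c))"
    by (intro L2norm_mono L2_w2 hspaceD rec) (auto simp: w2_def abs_Re_le_cmod)
  then show ?thesis
    using L2norm_le_hnorm(2)[OF rec(1)[of c]] hnorm_le_norm_cf[OF rec(1)[of c]] by (simp add: rec)
qed

lemma L2norm_w1_le: "L2norm L (\<lambda>x. of_real (w1 c x)) \<le> Cw * norm c * sqrt L"
proof -
  have "L2norm L (\<lambda>x. of_real (w1 c x)) \<le> (Cw * norm c) * L2norm L (\<lambda>_. 1)"
    by (intro L2norm_mono L2_w1 L2_continuous continuous_intros mult_nonneg_nonneg Cw_nonneg) (auto simp: w1_le)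
  then show ?thesis by (simp add: L2norm_one[OF L_nonneg])
qed

lemma heq_rec_lin: "heq L (rec (c - a *\<^sub>R c')) (rec c - hscale (of_real a) (rec c'))"
  by (rule heq_of_cf_eq) (simp_all add: rec hspace_diff hspace_scale cf_diff cf_scaleR)

lemma w1_lin: "x \<in> {0..L} \<Longrightarrow> w1 (c - a *\<^sub>R c') x = w1 c x - a * w1 c' x"
  using heq_rec_lin[of c a c'] by (simp add: heq_def w1_def hscale_def)

lemma w1_sub: "x \<in> {0..L} \<Longrightarrow> w1 (c - c') x = w1 c x - w1 c' x"
  using w1_lin[of x c 1 c'] by simp

lemma w2_lin: "AE x in lebesgue_on {0..L}. w2 (c - a *\<^sub>R c') x = w2 c x - of_real a * w2 c' x"
proof -
  have "AE x in lebesgue_on {0..L}. snd (rec (c - a *\<^sub>R c')) x = snd (rec c) x - of_real a * snd (rec c') x"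
    using heq_rec_lin[of c a c'] by (simp add: heq_def hscale_def)
  then show ?thesis by eventually_elim (simp add: w2_def)
qed

text \<open>The modal equations integrated in time: \<A> applied to the integral of W is the
  increment of W minus the integral of the forcing. The image is square-summable, although that of W
  itself is not yet known to be.\<close>

lemma gen_add_integral:
  fixes c g :: "real \<Rightarrow> int ell2"
  assumes c: "continuous_on {0..} c" and g: "continuous_on {0..} g"
    and ode: "\<And>t k. 0 \<le> t \<Longrightarrow> ((\<lambda>t. ec (c t) k) has_vector_derivative gen (ec (c t)) k + ec (g t) k) (at t within {0..})"
    and t: "0 \<le> t"
  shows "gen (ec (integral {0..t} c)) k = ec (c t - c 0 - integral {0..t} g) k"
proof -
  have ci: "ec (integral {0..t} h) k = integral {0..t} (\<lambda>s. ec (h s) k)" if "continuous_on {0..} h" for h k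
  proof -
    have "h integrable_on {0..t}"
      by (rule integrable_continuous_interval[OF continuous_on_subset[OF that]]) auto
    from integral_linear[OF this bounded_linear_ec, of k] show ?thesis by (simp add: o_def)
  qed
  have ii: "(\<lambda>s. ec (h s) k) integrable_on {0..t}" if "continuous_on {0..} h" for h k
    by (rule integrable_continuous_interval[OF continuous_on_ec[OF continuous_on_subset[OF that]]]) auto
  have gc: "gen (ec (integral {0..t} c)) k = integral {0..t} (\<lambda>s. gen (ec (c s)) k)"
  proof (cases "k \<in> High")
    case False
    have "integral {0..t} (\<lambda>s. \<Sum>p\<in>Low. A0 k p * ec (c s) p) = (\<Sum>p\<in>Low. integral {0..t} (\<lambda>s. A0 k p * ec (c s) p))"
      by (intro integral_sum finite_Low integrable_on_mult_right ii[OF c])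
    then show ?thesis using False by (simp add: gen_def ci[OF c])
  qed (simp add: gen_def ci[OF c])
  have gi: "(\<lambda>s. gen (ec (c s)) k) integrable_on {0..t}"
    unfolding gen_def
    by (cases "k \<in> High") (auto intro!: integrable_sum[OF finite_Low] integrable_on_mult_right ii[OF c])
  have "((\<lambda>s. gen (ec (c s)) k + ec (g s) k) has_integral ec (c t) k - ec (c 0) k) {0..t}"
    by (rule fundamental_theorem_of_calculus[OF t])
      (rule has_vector_derivative_within_subset[OF ode], auto)
  then have "integral {0..t} (\<lambda>s. gen (ec (c s)) k + ec (g s) k) = ec (c t) k - ec (c 0) k"
    by (rule integral_unique)
  then have "integral {0..t} (\<lambda>s. gen (ec (c s)) k) + integral {0..t} (\<lambda>s. ec (g s) k) = ec (c t) k - ec (c 0) k"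
    by (simp only: Henstock_Kurzweil_Integration.integral_add[OF gi ii[OF g]])
  then show ?thesis by (simp add: gc ci[OF g] algebra_simps)
qed

lemma gen_diff: "gen (ec (c - c')) k = gen (ec c) k - gen (ec c') k"
  by (simp add: gen_def right_diff_distrib sum_subtractf)

text \<open>
  In \<open>L\<^sup>2\<close>, the first component is continuously differentiable in time. Only its integrated form
  is available, because \<open>\<A> W\<close> is not yet known to exist: \<open>\<integral> W\<close> belongs to the domain of \<open>\<A>\<close>.
\<close>

lemma w1_derivative_L2:
  fixes c g :: "real \<Rightarrow> int ell2"
  assumes c: "continuous_on {0..} c" and g: "continuous_on {0..} g"
    and ode: "\<And>t k. 0 \<le> t \<Longrightarrow> ((\<lambda>t. ec (c t) k) has_vector_derivative gen (ec (c t)) k + ec (g t) k) (at t within {0..})"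
    and s: "0 \<le> s"
  obtains E where "(E \<longlongrightarrow> 0) (at s within {0..})" "\<And>t. 0 \<le> E t"
    "\<And>t. 0 \<le> t \<Longrightarrow> L2norm L (\<lambda>x. of_real (w1 (c t) x - w1 (c s) x) - of_real (t - s) * (w2 (c s) x + of_real (w1 (g s) x))) \<le> E t * \<bar>t - s\<bar>"
proof -
  define Ic where "Ic = (\<lambda>t. integral {0..t} c)"
  define Ig where "Ig = (\<lambda>t. integral {0..t} g)"
  obtain e1 where e1: "\<And>t. norm (Ic t - Ic s - (t - s) *\<^sub>R c s) \<le> e1 t * \<bar>t - s\<bar>" "(e1 \<longlongrightarrow> 0) (at s within {0..})" "\<And>t. 0 \<le> e1 t"
    using has_vector_derivative_oE[OF has_vector_derivative_integral_atLeast[OF c s]] unfolding Ic_def by blast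
  obtain e2 where e2: "\<And>t. norm (Ig t - Ig s - (t - s) *\<^sub>R g s) \<le> e2 t * \<bar>t - s\<bar>" "(e2 \<longlongrightarrow> 0) (at s within {0..})" "\<And>t. 0 \<le> e2 t"
    using has_vector_derivative_oE[OF has_vector_derivative_integral_atLeast[OF g s]] unfolding Ig_def by blast
  define E where "E = (\<lambda>t. Ce * e1 t + Cw * e2 t * sqrt L)"
  show thesis
  proof (rule that[of E])
    show "(E \<longlongrightarrow> 0) (at s within {0..})"
      unfolding E_def by (rule tendsto_eq_intros e1 e2 refl | simp)+
    show "0 \<le> E t" for t
      unfolding E_def using Ce(1) Cw_nonneg e1(3) e2(3) L_nonneg by (auto intro!: add_nonneg_nonneg mult_nonneg_nonneg)
    fix t :: real assume t: "0 \<le> t"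
    \<comment> \<open>\<open>J\<close> gives the coordinates of \<A> applied to the increment of the
      integral of \<open>c\<close>, so its first component is the second component of that
      increment. Thus the increment of w1 equals w2 of one integral plus w1 of the other, and both
      integrals are differentiable in norm.\<close>
    define J where "J = c t - c s - (Ig t - Ig s)"
    have genJ: "gen (ec (Ic t - Ic s)) k = ec J k" for k
      using gen_add_integral[OF c g ode t, of k] gen_add_integral[OF c g ode s, of k]
      unfolding gen_diff by (simp add: Ic_def Ig_def J_def)
    then have J: "gen (ec (Ic t - Ic s)) = ec J" by (rule ext)
    have mk: "mk_ell2 (ec J) = J" by (rule ec_inverse)
    have 1: "AE x in lebesgue_on {0..L}. snd (rec (Ic t - Ic s)) x = fst (rec J) x"
      using snd_rec_eq_fst_rec_gen[of "Ic t - Ic s"] in_ell2_ec[of J] unfolding J mk by simp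
    have sp: "AE x in lebesgue_on {0..L}. x \<in> {0..L}" using AE_space[of "lebesgue_on {0..L}"] by simp
    define u where "u = (\<lambda>x. complex_of_real (w1 (c t) x - w1 (c s) x) - of_real (t - s) * (w2 (c s) x + of_real (w1 (g s) x)))"
    define v where "v = (\<lambda>x. w2 (Ic t - Ic s - (t - s) *\<^sub>R c s) x + of_real (w1 (Ig t - Ig s - (t - s) *\<^sub>R g s) x))"
    have "AE x in lebesgue_on {0..L}. u x = v x"
      using 1 sp w2_lin[of "Ic t - Ic s" "t - s" "c s"]
    proof eventually_elim
      case (elim x)
      have a: "w1 (c t) x - w1 (c s) x = w1 J x + w1 (Ig t - Ig s) x"
        unfolding J_def using w1_sub[OF elim(2)] by simp
      have b: "w2 (Ic t - Ic s) x = of_real (w1 J x)" using elim(1) by (simp add: w2_def w1_def)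
      show ?case
        unfolding u_def v_def elim(3) w1_lin[OF elim(2), of "Ig t - Ig s" "t - s" "g s"] a b
        by (simp add: algebra_simps)
    qed
    moreover have u: "L2 L u"
      unfolding u_def by (intro L2_diff L2_scale L2_add L2_w1 L2_w2 L2_continuous continuous_intros w1_cont)
    moreover have v: "L2 L v" unfolding v_def by (intro L2_add L2_w1 L2_w2)
    ultimately have "L2norm L u = L2norm L v" by (intro L2norm_cong_AE L2_meas)
    also have "\<dots> \<le> Ce * norm (Ic t - Ic s - (t - s) *\<^sub>R c s) + Cw * norm (Ig t - Ig s - (t - s) *\<^sub>R g s) * sqrt L"
      unfolding v_def by (rule order_trans[OF L2norm_add_le[OF L2_w2 L2_w1] add_mono[OF L2norm_w2_le L2norm_w1_le]])
    also have "\<dots> \<le> Ce * (e1 t * \<bar>t - s\<bar>) + Cw * (e2 t * \<bar>t - s\<bar>) * sqrt L"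
      using Ce(1) Cw_nonneg L_nonneg e1(1)[of t] e2(1)[of t] by (intro add_mono mult_left_mono mult_right_mono) auto
    also have "\<dots> = E t * \<bar>t - s\<bar>" by (simp add: E_def algebra_simps)
    finally show "L2norm L (\<lambda>x. of_real (w1 (c t) x - w1 (c s) x) - of_real (t - s) * (w2 (c s) x + of_real (w1 (g s) x))) \<le> E t * \<bar>t - s\<bar>"
      by (simp add: u_def)
  qed
qed

definition rho' :: "real \<Rightarrow> real \<Rightarrow> real" where "rho' x y = deriv f (ye x + y) - deriv f (ye x)"

lemma rho'_cont: "continuous_on {0..L} (\<lambda>x. rho' x (w1 c x))"
  unfolding rho'_def by (intro continuous_intros ye_cont w1_cont continuous_on_compose2[OF f_deriv_cont]) auto

lemma rho_cont: "continuous_on {0..L} (\<lambda>x. rho x (w1 c x))"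
  unfolding rho_def by (intro continuous_intros ye_cont w1_cont continuous_on_compose2[OF f_cont] continuous_on_compose2[OF f_deriv_cont]) auto

lemma L2_mult_cont:
  assumes q: "continuous_on {0..L} q" and u: "L2 L u"
  shows "L2 L (\<lambda>x. of_real (q x) * u x)"
proof -
  have "bounded (q ` {0..L})" by (intro compact_imp_bounded compact_continuous_image q) simp
  then obtain B where "\<forall>x\<in>{0..L}. \<bar>q x\<bar> \<le> B" by (auto simp: bounded_iff)
  then show ?thesis
    using continuous_imp_measurable_on_sets_lebesgue[of "{0..L}" "\<lambda>x. complex_of_real (q x)"] q L2_meas[OF u]
    by (intro L2_bound[OF u, of _ B]) (auto simp: norm_mult intro!: mult_right_mono continuous_intros borel_measurable_times)
qed

text \<open>The chain rule: w1 has time derivative w2 plus the first component of the forcing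
  \<open>g\<close>.\<close>

definition Nres' :: "int ell2 \<Rightarrow> int ell2 \<Rightarrow> int ell2" where
  "Nres' c g = cf (\<lambda>_. 0, \<lambda>x. of_real (rho' x (w1 c x)) * (w2 c x + of_real (w1 g x)))"

lemma norm_cf_snd: "L2 L u \<Longrightarrow> norm (cf (\<lambda>_. 0, u)) \<le> Cd * L2norm L u"
  using norm_cf_le[OF hspace_snd] hnorm_snd by simp

lemma cf_snd_diff:
  assumes "L2 L u" "L2 L v"
  shows "cf (\<lambda>_. 0, u) - cf (\<lambda>_. 0, v) = cf (\<lambda>_. 0, \<lambda>x. u x - v x)"
proof -
  have "((\<lambda>_. 0, u) :: state) - (\<lambda>_. 0, v) = (\<lambda>_. 0, \<lambda>x. u x - v x)" by (intro prod_eqI ext) simp_all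
  then show ?thesis using cf_diff[OF hspace_snd hspace_snd, of u v] assms by simp
qed

lemma cf_snd_scale: "L2 L u \<Longrightarrow> a *\<^sub>R cf (\<lambda>_. 0, u) = cf (\<lambda>_. 0, \<lambda>x. of_real a * u x)"
  using cf_scaleR[OF hspace_snd, of u a] by (simp add: hscale_def)

text \<open>The clamp has corners, so the bound by \<open>R\<close> is assumed along the trajectory.
  In the quadratic remainder one factor is estimated in L^\<infinity>, through the energy norm, and
  only the other in L^2; this is why the expansion of w1 in L^2 is enough.\<close>

lemma Nres_has_derivative:
  fixes c g :: "real \<Rightarrow> int ell2"
  assumes c: "continuous_on {0..} c" and g: "continuous_on {0..} g"
    and ode: "\<And>t k. 0 \<le> t \<Longrightarrow> ((\<lambda>t. ec (c t) k) has_vector_derivative gen (ec (c t)) k + ec (g t) k) (at t within {0..})"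
    and R: "0 \<le> R" "\<And>t x. 0 \<le> t \<Longrightarrow> x \<in> {0..L} \<Longrightarrow> \<bar>w1 (c t) x\<bar> \<le> R"
  shows "0 \<le> s \<Longrightarrow> ((\<lambda>t. Nres R (c t)) has_vector_derivative Nres' (c s) (g s)) (at s within {0..})"
    and "continuous_on {0..} (\<lambda>t. Nres' (c t) (g t))"
proof -
  obtain M where M1: "M \<ge> 0" and
    M2: "\<And>x y z. x \<in> {0..L} \<Longrightarrow> \<bar>y\<bar> \<le> R \<Longrightarrow> \<bar>z\<bar> \<le> R \<Longrightarrow>
       \<bar>rho x y - rho x z - (deriv f (ye x + z) - deriv f (ye x)) * (y - z)\<bar> \<le> M * \<bar>y - z\<bar>\<^sup>2" and
    M3: "\<And>x y z. x \<in> {0..L} \<Longrightarrow> \<bar>y\<bar> \<le> R \<Longrightarrow> \<bar>z\<bar> \<le> R \<Longrightarrow> \<bar>deriv f (ye x + y) - deriv f (ye x + z)\<bar> \<le> M * \<bar>y - z\<bar>"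
    using rho_estimates[of R] by metis
  have M4: "\<bar>rho' x y - rho' x z\<bar> \<le> M * \<bar>y - z\<bar>" if "x \<in> {0..L}" "\<bar>y\<bar> \<le> R" "\<bar>z\<bar> \<le> R" for x y z
    using M3[OF that] by (simp add: rho'_def)
  note M = M1 M2[folded rho'_def] M4
  have Nres: "Nres R (c t) = cf (\<lambda>_. 0, \<lambda>x. of_real (rho x (w1 (c t) x)))" if "0 \<le> t" for t
  proof -
    have "AE x in lebesgue_on {0..L}. x \<in> {0..L}" using AE_space[of "lebesgue_on {0..L}"] by simp
    then have "AE x in lebesgue_on {0..L}. rho x (clamp R (w1 (c t) x)) = rho x (w1 (c t) x)"
      by eventually_elim (simp add: clamp_id R(2)[OF that])
    then have "heq L (res_state (\<lambda>x. rho x (clamp R (w1 (c t) x)))) (\<lambda>_. 0, \<lambda>x. of_real (rho x (w1 (c t) x)))"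
      by (simp add: heq_def res_state_def)
    then show ?thesis
      unfolding Nres_def
      by (intro ell2_eqI) (simp add: ec_cf res_state_hspace rho_clamp_cont w1_cont hspace_snd L2_continuous continuous_on_of_real rho_cont
          coef_heq[OF _ res_state_hspace[OF rho_clamp_cont[OF w1_cont]] hspace_snd[OF L2_continuous[OF continuous_on_of_real[OF rho_cont]]]])
  qed
  define D where "D = (\<lambda>t x. w2 (c t) x + of_real (w1 (g t) x))"
  have LD: "L2 L (D t)" for t unfolding D_def by (intro L2_add L2_w1 L2_w2)
  have LrD: "L2 L (\<lambda>x. of_real (rho' x (w1 (c t) x)) * D s x)" for t s
    by (intro L2_mult_cont rho'_cont LD)
  have Lrho: "L2 L (\<lambda>x. of_real (rho x (w1 (c t) x)))" for t
    by (intro L2_continuous continuous_intros rho_cont)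
  have rho'_le: "\<bar>rho' x (w1 (c t) x)\<bar> \<le> M * R" if "0 \<le> t" "x \<in> {0..L}" for t x
    using M(3)[OF that(2), of "w1 (c t) x" 0] R that mult_left_mono[OF R(2)[OF that] M(1)] by (simp add: rho'_def)
  show "((\<lambda>t. Nres R (c t)) has_vector_derivative Nres' (c s) (g s)) (at s within {0..})" if s: "0 \<le> s"
  proof -
    obtain E where E: "(E \<longlongrightarrow> 0) (at s within {0..})" "\<And>t. 0 \<le> E t"
      "\<And>t. 0 \<le> t \<Longrightarrow> L2norm L (\<lambda>x. of_real (w1 (c t) x - w1 (c s) x) - of_real (t - s) * D s x) \<le> E t * \<bar>t - s\<bar>"
      unfolding D_def using w1_derivative_L2[OF c g ode s] by blast
    define B where "B = L2norm L (D s)"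
    define e where "e = (\<lambda>t. Cd * (M * (Cw * norm (c t - c s)) * (E t + B) + M * R * E t))"
    show ?thesis
    proof (rule has_vector_derivative_o[where e = e])
      have ct: "((\<lambda>t. norm (c t - c s)) \<longlongrightarrow> 0) (at s within {0..})"
        using c s by (intro tendsto_norm_zero LIM_zero) (simp add: continuous_on_def)
      show "(e \<longlongrightarrow> 0) (at s within {0..})"
        unfolding e_def by (rule tendsto_eq_intros E ct refl | simp)+
      fix t :: real assume "t \<in> {0..}"
      then have t: "0 \<le> t" by simp
      define d where "d = (\<lambda>x. complex_of_real (w1 (c t) x - w1 (c s) x))"
      \<comment> \<open>\<open>h\<close> is the remainder in the expansion of w1 in time;
        \<open>q\<close>, further below, is the remainder of \<open>rho\<close> in its argument.
        Together they make up the remainder of the residual.\<close>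
      define h where "h = (\<lambda>x. d x - of_real (t - s) * D s x)"
      have Ld: "L2 L d" unfolding d_def by (intro L2_continuous continuous_intros w1_cont)
      have Lh: "L2 L h" unfolding h_def by (intro L2_diff L2_scale Ld LD)
      have hE: "L2norm L h \<le> E t * \<bar>t - s\<bar>" using E(3)[OF t] by (simp add: h_def d_def)
      have dE: "L2norm L d \<le> (E t + B) * \<bar>t - s\<bar>"
      proof -
        have "L2norm L d = L2norm L (\<lambda>x. h x + of_real (t - s) * D s x)" by (simp add: h_def)
        also have "\<dots> \<le> L2norm L h + L2norm L (\<lambda>x. of_real (t - s) * D s x)" by (intro L2norm_add_le Lh L2_scale LD)
        also have "L2norm L (\<lambda>x. of_real (t - s) * D s x) \<le> \<bar>t - s\<bar> * B"
          unfolding B_def by (intro L2norm_mono L2_scale LD) (auto simp: norm_mult simp flip: of_real_diff)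
        finally show ?thesis using hE by (simp add: algebra_simps)
      qed
      define q where "q = (\<lambda>x. complex_of_real (rho x (w1 (c t) x) - rho x (w1 (c s) x) - rho' x (w1 (c s) x) * (w1 (c t) x - w1 (c s) x)))"
      have Lq: "L2 L q" unfolding q_def by (intro L2_continuous continuous_intros rho_cont rho'_cont w1_cont)
      have qE: "L2norm L q \<le> M * (Cw * norm (c t - c s)) * L2norm L d"
      proof (rule L2norm_mono[OF Ld Lq])
        fix x assume x: "x \<in> {0..L}"
        have "norm (q x) \<le> M * \<bar>w1 (c t) x - w1 (c s) x\<bar>\<^sup>2"
          unfolding q_def norm_of_real by (rule M(2)[OF x R(2)[OF t x] R(2)[OF s x]])
        also have "\<dots> \<le> M * (Cw * norm (c t - c s) * \<bar>w1 (c t) x - w1 (c s) x\<bar>)"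
          unfolding power2_eq_square by (intro mult_left_mono mult_right_mono w1_diff x M) auto
        finally show "norm (q x) \<le> M * (Cw * norm (c t - c s)) * norm (d x)"
          unfolding d_def norm_of_real by (simp add: mult.assoc)
      qed (use M Cw_nonneg in simp)
      have pE: "L2norm L (\<lambda>x. of_real (rho' x (w1 (c s) x)) * h x) \<le> M * R * L2norm L h"
        by (intro L2norm_mono L2_mult_cont rho'_cont Lh)
          (use rho'_le[OF s] M R in \<open>auto simp: norm_mult intro!: mult_right_mono\<close>)
      have "Nres R (c t) - Nres R (c s) - (t - s) *\<^sub>R Nres' (c s) (g s) =
          cf (\<lambda>_. 0, \<lambda>x. q x + of_real (rho' x (w1 (c s) x)) * h x)"
        unfolding Nres[OF t] Nres[OF s] Nres'_def D_def[symmetric, THEN fun_cong, THEN fun_cong]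
        by (subst cf_snd_scale[OF LrD], subst cf_snd_diff[OF Lrho Lrho],
            subst cf_snd_diff[OF L2_diff[OF Lrho Lrho] L2_scale[OF LrD]])
          (simp add: q_def h_def d_def algebra_simps)
      then have "norm (Nres R (c t) - Nres R (c s) - (t - s) *\<^sub>R Nres' (c s) (g s)) \<le>
          Cd * L2norm L (\<lambda>x. q x + of_real (rho' x (w1 (c s) x)) * h x)"
        using norm_cf_snd[OF L2_add[OF Lq L2_mult_cont[OF rho'_cont Lh]]] by simp
      also have "\<dots> \<le> Cd * (L2norm L q + L2norm L (\<lambda>x. of_real (rho' x (w1 (c s) x)) * h x))"
        using Cd(1) by (intro mult_left_mono L2norm_add_le Lq L2_mult_cont rho'_cont Lh) auto
      also have "\<dots> \<le> Cd * (M * (Cw * norm (c t - c s)) * ((E t + B) * \<bar>t - s\<bar>) + M * R * (E t * \<bar>t - s\<bar>))"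
      proof (intro mult_left_mono add_mono)
        show "L2norm L q \<le> M * (Cw * norm (c t - c s)) * ((E t + B) * \<bar>t - s\<bar>)"
          by (rule order_trans[OF qE mult_left_mono[OF dE]]) (use M Cw_nonneg in simp)
        show "L2norm L (\<lambda>x. of_real (rho' x (w1 (c s) x)) * h x) \<le> M * R * (E t * \<bar>t - s\<bar>)"
          by (rule order_trans[OF pE mult_left_mono[OF hE]]) (use M R in simp)
      qed (use Cd(1) in simp)
      also have "\<dots> = e t * \<bar>t - s\<bar>" by (simp add: e_def algebra_simps)
      finally show "norm (Nres R (c t) - Nres R (c s) - (t - s) *\<^sub>R Nres' (c s) (g s)) \<le> e t * \<bar>t - s\<bar>" .
    qed
  qed
  show "continuous_on {0..} (\<lambda>t. Nres' (c t) (g t))"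
    unfolding continuous_on_def
  proof
    fix s :: real assume "s \<in> {0..}"
    then have s: "0 \<le> s" by simp
    define B where "B = L2norm L (D s)"
    define e where "e = (\<lambda>t. Cd * (M * (Cw * norm (c t - c s)) * B + M * R * (Ce * norm (c t - c s) + Cw * norm (g t - g s) * sqrt L)))"
    have cs: "((\<lambda>t. norm (c t - c s)) \<longlongrightarrow> 0) (at s within {0..})" "((\<lambda>t. norm (g t - g s)) \<longlongrightarrow> 0) (at s within {0..})"
      using c g s by (auto intro!: tendsto_norm_zero LIM_zero simp: continuous_on_def)
    have e0: "(e \<longlongrightarrow> 0) (at s within {0..})"
      unfolding e_def by (rule tendsto_eq_intros cs refl | simp)+
    have "norm (Nres' (c t) (g t) - Nres' (c s) (g s)) \<le> e t" if "t \<in> {0..}" for t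
    proof -
      have t: "0 \<le> t" using that by simp
      define p where "p = (\<lambda>x. complex_of_real (rho' x (w1 (c t) x) - rho' x (w1 (c s) x)) * D s x)"
      define h where "h = (\<lambda>x. D t x - D s x)"
      have Lp: "L2 L p" unfolding p_def by (intro L2_mult_cont continuous_intros rho'_cont LD)
      have Lh: "L2 L h" unfolding h_def by (intro L2_diff LD)
      have pE: "L2norm L p \<le> M * (Cw * norm (c t - c s)) * B"
        unfolding B_def
      proof (rule L2norm_mono[OF LD Lp])
        fix x assume x: "x \<in> {0..L}"
        have "\<bar>rho' x (w1 (c t) x) - rho' x (w1 (c s) x)\<bar> \<le> M * \<bar>w1 (c t) x - w1 (c s) x\<bar>"
          by (rule M(3)[OF x R(2)[OF t x] R(2)[OF s x]])
        also have "\<dots> \<le> M * (Cw * norm (c t - c s))" by (intro mult_left_mono w1_diff x M)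
        finally show "norm (p x) \<le> M * (Cw * norm (c t - c s)) * norm (D s x)"
          unfolding p_def norm_mult norm_of_real by (intro mult_right_mono) auto
      qed (use M Cw_nonneg in simp)
      have hE: "L2norm L h \<le> Ce * norm (c t - c s) + Cw * norm (g t - g s) * sqrt L"
      proof -
        have "AE x in lebesgue_on {0..L}. x \<in> {0..L}" using AE_space[of "lebesgue_on {0..L}"] by simp
        with w2_lin[of "c t" 1 "c s"] have "AE x in lebesgue_on {0..L}. h x = w2 (c t - c s) x + of_real (w1 (g t - g s) x)"
          by eventually_elim (simp add: h_def D_def w1_sub)
        then have "L2norm L h = L2norm L (\<lambda>x. w2 (c t - c s) x + of_real (w1 (g t - g s) x))"
          by (intro L2norm_cong_AE L2_meas Lh L2_add L2_w1 L2_w2)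
        also have "\<dots> \<le> Ce * norm (c t - c s) + Cw * norm (g t - g s) * sqrt L"
          by (rule order_trans[OF L2norm_add_le[OF L2_w2 L2_w1] add_mono[OF L2norm_w2_le L2norm_w1_le]])
        finally show ?thesis .
      qed
      have rE: "L2norm L (\<lambda>x. of_real (rho' x (w1 (c t) x)) * h x) \<le> M * R * L2norm L h"
        by (intro L2norm_mono L2_mult_cont rho'_cont Lh)
          (use rho'_le[OF t] M R in \<open>auto simp: norm_mult intro!: mult_right_mono\<close>)
      have "Nres' (c t) (g t) - Nres' (c s) (g s) = cf (\<lambda>_. 0, \<lambda>x. p x + of_real (rho' x (w1 (c t) x)) * h x)"
        unfolding Nres'_def
        by (subst cf_snd_diff[OF LrD[unfolded D_def] LrD[unfolded D_def]]) (simp add: p_def h_def D_def algebra_simps)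
      then have "norm (Nres' (c t) (g t) - Nres' (c s) (g s)) \<le> Cd * L2norm L (\<lambda>x. p x + of_real (rho' x (w1 (c t) x)) * h x)"
        using norm_cf_snd[OF L2_add[OF Lp L2_mult_cont[OF rho'_cont Lh]]] by simp
      also have "\<dots> \<le> Cd * (L2norm L p + L2norm L (\<lambda>x. of_real (rho' x (w1 (c t) x)) * h x))"
        using Cd(1) by (intro mult_left_mono L2norm_add_le Lp L2_mult_cont rho'_cont Lh) auto
      also have "\<dots> \<le> e t"
        unfolding e_def using Cd(1) M R
        by (intro mult_left_mono add_mono pE order_trans[OF rE mult_left_mono[OF hE]]) auto
      finally show ?thesis .
    qed
    then have "((\<lambda>t. Nres' (c t) (g t) - Nres' (c s) (g s)) \<longlongrightarrow> 0) (at s within {0..})"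
      by (intro Lim_null_comparison[OF _ e0]) (simp add: eventually_at_filter)
    then show "((\<lambda>t. Nres' (c t) (g t)) \<longlongrightarrow> Nres' (c s) (g s)) (at s within {0..})"
      by (rule LIM_zero_cancel)
  qed
qed

end

section \<open>Classical solutions from modal solutions\<close>

context wave_spectral
begin

lemma graph_rel_hcnj: "graph_rel w h \<Longrightarrow> graph_rel (hcnj w) (hcnj h)"
proof -
  assume g: "graph_rel w h"
  have r: "rhs (hcnj w) (hcnj h) = (\<lambda>s. cnj (rhs w h s))" by (auto simp: rhs_def hcnj_def pot_def)
  have D: "D0 (hcnj w) (hcnj h) = cnj (D0 w h)" by (simp add: D0_def r integral_cnj[symmetric]) (simp add: hcnj_def)
  have "Zd (hcnj w) (hcnj h) x = cnj (Zd w h x)" for x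
    by (simp add: Zd_def D r integral_cnj[symmetric]) (simp add: hcnj_def)
  moreover have "L2norm L (\<lambda>x. snd (hcnj w) x - fst (hcnj h) x) = L2norm L (\<lambda>x. snd w x - fst h x)"
    by (simp add: L2norm_def hcnj_def flip: complex_cnj_diff)
  ultimately show ?thesis using g by (simp add: graph_rel_def)
qed

text \<open>\<A> has real coefficients. The graph relation is stable under conjugation and supplies
  an element of the domain that represents the conjugate, so no rule for derivatives of conjugates
  is needed.\<close>

lemma coef_opA_real:
  assumes w: "w \<in> domA L \<alpha>" "heq L (hcnj w) w"
  shows "coef (hcnj (opA L f ye w)) k = coef (opA L f ye w) k"
proof -
  let ?h = "opA L f ye w"
  have hs: "hcnj w \<in> hspace L" "hcnj ?h \<in> hspace L"
    by (auto intro: hspace_cnj domA_hspace opA_hspace w)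
  note D = graph_rel_domA[OF hs graph_rel_hcnj[OF graph_rel_opA(1)[OF w(1)]]]
  let ?z = "(fst (hcnj w), fst (hcnj ?h))"
  have "coef (hcnj ?h) k = coef (opA L f ye ?z) k"
    by (rule coef_heq[OF heq_sym[OF D(3)] hs(2) opA_hspace[OF D(1)]])
  also have "\<dots> = gen (coef ?z) k" by (rule coef_opA[OF D(1)])
  also have "coef ?z = coef w"
    by (rule ext, rule coef_heq[OF heq_trans[OF D(2) w(2)] domA_hspace[OF D(1)] domA_hspace[OF w(1)]])
  finally show ?thesis using coef_opA[OF w(1)] by simp
qed

text \<open>The closed-loop matrix contains the real parts of these entries; nothing is lost by
  that.\<close>

lemma A0_real: "k \<in> Low \<Longrightarrow> p \<in> Low \<Longrightarrow> cnj (A0 k p) = A0 k p"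
  unfolding A0_def
  using coef_opA_real[OF e_domA low(1)[of p], of k] coef_hcnj_Low[OF opA_hspace[OF e_domA], of k p] by simp

text \<open>
  The symmetry that characterizes the coordinates of real-valued states.
\<close>

definition symc :: "(int \<Rightarrow> complex) \<Rightarrow> bool" where
  "symc c \<longleftrightarrow> (\<forall>k\<in>Low. cnj (c k) = c k) \<and> (\<forall>k\<in>High. cnj (c k) = c (- k))"

lemma symc_real: "cstate w \<in> hspace L \<Longrightarrow> symc (coef (cstate w))"
  by (simp add: symc_def coef_real_Low coef_real_High)

lemma symc_gen: "symc c \<Longrightarrow> symc (gen c)"
  using Low_High by (auto simp: symc_def gen_def lam_uminus High_uminus A0_real)

lemma symc_add: "symc c \<Longrightarrow> symc c' \<Longrightarrow> symc (\<lambda>k. c k + c' k)"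
  and symc_scale: "symc c \<Longrightarrow> symc (\<lambda>k. r *\<^sub>R c k)"
  by (auto simp: symc_def)

lemma real_of_symc:
  assumes w: "w \<in> hspace L" and s: "symc (coef w)"
  shows "heq L (hcnj w) w"
proof (rule heq_of_cf_eq[OF hspace_cnj[OF w] w], rule ell2_eqI)
  fix k
  show "ec (cf (hcnj w)) k = ec (cf w) k"
  proof (cases "k \<in> High")
    case True
    then show ?thesis using coef_hcnj_High[OF w, of "- k"] s by (auto simp: symc_def ec_cf w hspace_cnj High_uminus)
  next
    case False
    then show ?thesis using coef_hcnj_Low[OF w, of k] s Low_High by (auto simp: symc_def ec_cf w hspace_cnj)
  qed
qed

lemma vec_a_real: "vec_a L \<alpha> = cstate (\<lambda>x. x / (\<alpha> * L), \<lambda>_. 0)" "vec_b L \<alpha> = cstate (\<lambda>_. 0, \<lambda>x. - x / (\<alpha> * L))"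
  by (simp_all add: vec_a_def vec_b_def cstate_def)

lemma symc_av: "symc (ec av)" and symc_bv: "symc (ec bv)"
proof -
  have "ec av = coef (vec_a L \<alpha>)" "ec bv = coef (vec_b L \<alpha>)"
    by (auto simp: av_def bv_def ec_cf vec_a_hspace vec_b_hspace)
  then show "symc (ec av)" "symc (ec bv)"
    using symc_real vec_a_hspace vec_b_hspace unfolding vec_a_real by auto
qed

lemma symc_Nres: "symc (ec (Nres R c))"
proof -
  have r: "res_state u = cstate (\<lambda>_. 0, u)" for u by (simp add: res_state_def cstate_def)
  have h: "res_state (\<lambda>x. rho x (clamp R (w1 c x))) \<in> hspace L"
    by (intro res_state_hspace rho_clamp_cont w1_cont)
  have "ec (Nres R c) = coef (res_state (\<lambda>x. rho x (clamp R (w1 c x))))"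
    by (auto simp: Nres_def ec_cf[OF h])
  then show ?thesis using symc_real h unfolding r by simp
qed

text \<open>Membership in the domain involves the values of both components at the endpoints, so
  agreement is required at every point of \<open>{0..L}\<close> and \<open>heq\<close> would be too
  weak.\<close>

lemma domA_cong:
  assumes w: "w \<in> domA L \<alpha>" and eq: "\<And>x. x \<in> {0..L} \<Longrightarrow> fst z x = fst w x" "\<And>x. x \<in> {0..L} \<Longrightarrow> snd z x = snd w x"
  shows "z \<in> domA L \<alpha>" "heq L z w"
    "pointwise_deriv L (fst z) 0 = pointwise_deriv L (fst w) 0"
proof -
  have W: "w \<in> hspace L" by (rule domA_hspace[OF w])
  have h1: "has_wderiv L (fst z) = has_wderiv L (fst w)" "has_wderiv L (snd z) = has_wderiv L (snd w)"
    using H1_cong[OF eq(1) L_nonneg] H1_cong[OF eq(2) L_nonneg] by simp_all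
  have m: "snd z \<in> borel_measurable (lebesgue_on {0..L})"
    using L2_meas[OF hspaceD(3)[OF W]] eq(2) by (subst measurable_cong[of _ _ "snd w"]) auto
  have L2z: "L2 L (snd z)" by (rule L2_bound[OF hspaceD(3)[OF W] m, of 1]) (simp add: eq)
  have p: "pointwise_deriv L (fst z) x = pointwise_deriv L (fst w) x" if "x \<in> {0..L}" for x
    using pointwise_deriv_eq[OF _ H1_continuous[OF domA_pointwise_deriv(2)[OF w]] that, of "fst z"]
      domA_pointwise_deriv(1)[OF w] h1 by simp
  show "pointwise_deriv L (fst z) 0 = pointwise_deriv L (fst w) 0" using p[of 0] L_nonneg by simp
  show "z \<in> domA L \<alpha>"
    using w L2z p[of L] eq[of 0] eq[of L] L_nonneg
    by (auto simp: domA_def hspace_def H1_def H2_def h1)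
  have "AE x in lebesgue_on {0..L}. x \<in> {0..L}" using AE_space[of "lebesgue_on {0..L}"] by simp
  then have "AE x in lebesgue_on {0..L}. snd z x = snd w x" by eventually_elim (rule eq(2))
  then show "heq L z w" using eq(1) by (simp add: heq_def)
qed

lemma domA_diff:
  assumes w: "w \<in> domA L \<alpha>" and z: "z \<in> domA L \<alpha>"
  shows "w - z \<in> domA L \<alpha>"
proof -
  have sub: "has_wderiv L (\<lambda>x. u x - v x) (\<lambda>x. g x - h x)" if "has_wderiv L u g" "has_wderiv L v h" for u v g h
    using has_wderiv_add[OF that(1) has_wderiv_scale[OF that(2), of "- 1"]] by simp
  have fs: "fst (w - z) = (\<lambda>x. fst w x - fst z x)" "snd (w - z) = (\<lambda>x. snd w x - snd z x)" by (auto simp: fun_eq_iff)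
  note P = domA_pointwise_deriv[OF w] domA_pointwise_deriv[OF z]
  let ?p = "\<lambda>x. pointwise_deriv L (fst w) x - pointwise_deriv L (fst z) x"
  have d: "has_wderiv L (fst (w - z)) ?p" unfolding fs by (rule sub[OF P(1,3)])
  have pH: "H1 L ?p" using sub[OF has_wderiv_wderiv[OF P(2)] has_wderiv_wderiv[OF P(4)]] by (rule H1_I)
  have s: "H1 L (snd (w - z))"
    using w z sub[OF has_wderiv_wderiv has_wderiv_wderiv, of "snd w" "snd z"] unfolding fs by (auto simp: domA_def intro: H1_I)
  have "pointwise_deriv L (fst (w - z)) L = ?p L"
    by (rule pointwise_deriv_eq[OF d H1_continuous[OF pH]]) (simp add: L_nonneg)
  moreover have "?p L + of_real \<alpha> * (snd w L - snd z L) = 0"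
    using w z by (simp add: domA_def algebra_simps add_eq_0_iff)
  ultimately have bc: "pointwise_deriv L (fst (w - z)) L + of_real \<alpha> * snd (w - z) L = 0" by simp
  have "H2 L (fst (w - z))" unfolding H2_def using d pH by blast
  then show ?thesis
    using w z s bc hspace_diff[OF domA_hspace[OF w] domA_hspace[OF z]] unfolding domA_def by simp
qed

text \<open>\<open>opA\<close> contains a chosen weak derivative and is linear only almost
  everywhere; in coordinates it is exactly linear.\<close>

lemma cf_opA_diff:
  assumes "w \<in> domA L \<alpha>" "z \<in> domA L \<alpha>"
  shows "cf (opA L f ye (w - z)) = cf (opA L f ye w) - cf (opA L f ye z)"
proof (rule ell2_eqI)
  fix k
  have co: "coef (w - z) = (\<lambda>k. coef w k - coef z k)"
    by (rule ext) (simp add: coef_diff domA_hspace assms)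
  show "ec (cf (opA L f ye (w - z))) k = ec (cf (opA L f ye w) - cf (opA L f ye z)) k"
    by (simp add: ec_cf opA_hspace domA_diff assms coef_opA co)
      (simp add: gen_def right_diff_distrib sum_subtractf)
qed

lemma pointwise_deriv_real:
  assumes "cstate w \<in> domA L \<alpha>"
  shows "pointwise_deriv L (fst w) 0 = Re (pointwise_deriv L (fst (cstate w)) 0)"
proof -
  note P = domA_pointwise_deriv[OF assms]
  have "(fst (cstate w) has_vector_derivative pointwise_deriv L (fst (cstate w)) 0) (at 0 within {0..L})"
    by (rule has_wderiv_vector_derivative[OF P(1) H1_continuous[OF P(2)]]) (simp add: L_nonneg)
  from bounded_linear.has_vector_derivative[OF bounded_linear_Re this]
  have "(fst w has_vector_derivative Re (pointwise_deriv L (fst (cstate w)) 0)) (at 0 within {0..L})"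
    by (simp add: cstate_def)
  then show ?thesis
    unfolding pointwise_deriv_def[of L "fst w"]
    by (intro vector_derivative_within_cbox[of 0 L, unfolded cbox_interval]) (use L_pos in auto)
qed

end

context wave_modal
begin

lemma Inl_ode:
  assumes "modal_solution S U (\<lambda>t. F R (U t) + zr t *\<^sub>R Gz)" "t \<in> S" "j < dim"
  shows "((\<lambda>t. ec (U t) (Inl j)) has_vector_derivative
    (\<mu> j * ec (U t) (Inl j) + (lowF R (U t) j - of_real (zr t) * Q j (2 * n0 + 2)))) (at t within S)"
  using assms unfolding modal_solution_def
  by (elim conjE) (drule spec[of _ "Inl j"], drule (1) bspec, simp add: m_def F_def Gz_def ec_join scaleR_conv_of_real)

lemma Inr_ode:
  assumes "modal_solution S U (\<lambda>t. F R (U t) + zr t *\<^sub>R Gz)" "t \<in> S" "k \<in> High"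
  shows "((\<lambda>t. ec (U t) (Inr k)) has_vector_derivative
    (lam k * ec (U t) (Inr k) + ec (highF R (U t)) k)) (at t within S)"
  using assms unfolding modal_solution_def
  by (elim conjE) (drule spec[of _ "Inr k"], drule (1) bspec, simp add: m_def F_def Gz_def ec_join)

definition Xd :: "real \<Rightarrow> (nat + int) ell2 \<Rightarrow> real \<Rightarrow> nat \<Rightarrow> real" where
  "Xd R U z i = (\<Sum>j<dim. AK $$ (i, j) * Xr U j) + qv (Nres R (cU U)) i - (if i = 2 * n0 + 2 then z else 0)"

text \<open>Multiplying the equation for Y by \<open>P\<close> turns \<open>\<mu>\<close> and
  \<open>N\<close> back into A_K X, and P Q = 1 frees the forcing and the reference signal.\<close>

lemma Xr_ode:
  assumes sol: "modal_solution S U (\<lambda>t. F R (U t) + zr t *\<^sub>R Gz)" and t: "t \<in> S" and i: "i < dim"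
  shows "((\<lambda>t. Xr (U t) i) has_vector_derivative Xd R (U t) (zr t) i) (at t within S)"
proof -
  let ?Y = "\<lambda>j. ec (U t) (Inl j)" and ?q = "\<lambda>j. complex_of_real (qv (Nres R (cU (U t))) j)"
  let ?z = "complex_of_real (zr t)"
  have "((\<lambda>t. \<Sum>j<dim. P i j * ec (U t) (Inl j)) has_vector_derivative
      (\<Sum>j<dim. P i j * (\<mu> j * ?Y j + (lowF R (U t) j - ?z * Q j (2 * n0 + 2))))) (at t within S)"
    by (intro has_vector_derivative_sum has_vector_derivative_mult_right Inl_ode[OF sol t]) auto
  from bounded_linear.has_vector_derivative[OF bounded_linear_Re this]
  have d: "((\<lambda>t. Xr (U t) i) has_vector_derivative
      Re (\<Sum>j<dim. P i j * (\<mu> j * ?Y j + (lowF R (U t) j - ?z * Q j (2 * n0 + 2))))) (at t within S)"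
    by (simp add: Xr_def)
  have "(\<Sum>j<dim. P i j * (\<mu> j * ?Y j + (lowF R (U t) j - ?z * Q j (2 * n0 + 2)))) =
      (\<Sum>j<dim. P i j * \<mu> j * ?Y j) + (\<Sum>j<dim. \<Sum>l<dim. P i j * N j l * ?Y l) +
      (\<Sum>j<dim. \<Sum>l<dim. P i j * Q j l * ?q l) - ?z * (\<Sum>j<dim. P i j * Q j (2 * n0 + 2))"
    by (simp add: lowF_def sum.distrib sum_subtractf sum_distrib_left algebra_simps)
  also have "(\<Sum>j<dim. \<Sum>l<dim. P i j * Q j l * ?q l) = (\<Sum>l<dim. (\<Sum>j<dim. P i j * Q j l) * ?q l)"
    by (subst sum.swap) (simp add: sum_distrib_right)
  also have "\<dots> = (\<Sum>l<dim. if l = i then ?q l else 0)"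
    using i by (intro sum.cong) (auto simp: PQ)
  also have "\<dots> = ?q i" using i by simp
  also have "(\<Sum>j<dim. P i j * Q j (2 * n0 + 2)) = of_bool (i = 2 * n0 + 2)" using i by (intro PQ) auto
  also have "(\<Sum>j<dim. \<Sum>l<dim. P i j * N j l * ?Y l) = (\<Sum>l<dim. (\<Sum>j<dim. P i j * N j l) * ?Y l)"
    by (subst sum.swap) (simp add: sum_distrib_right)
  also have "(\<Sum>j<dim. P i j * \<mu> j * ?Y j) + (\<Sum>l<dim. (\<Sum>j<dim. P i j * N j l) * ?Y l) =
      (\<Sum>l<dim. (\<Sum>j<dim. of_real (AK $$ (i, j)) * P j l) * ?Y l)"
    using i by (subst sum.distrib[symmetric]) (intro sum.cong, auto simp: AP distrib_right)
  also have "\<dots> = (\<Sum>j<dim. of_real (AK $$ (i, j)) * (\<Sum>l<dim. P j l * ?Y l))"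
    by (simp add: sum_distrib_left sum_distrib_right mult.assoc) (rule sum.swap)
  finally have "Re (\<Sum>j<dim. P i j * (\<mu> j * ?Y j + (lowF R (U t) j - ?z * Q j (2 * n0 + 2)))) = Xd R (U t) (zr t) i"
    by (simp add: Xd_def Xr_def)
  then show ?thesis using d by simp
qed

lemma symc_highF: "symc (ec (highF R U))"
  using symc_add[OF symc_add[OF symc_scale[OF symc_av] symc_scale[OF symc_bv]] symc_Nres]
  by (simp add: highF_def)

lemma of_real_Re_symc: "symc c \<Longrightarrow> k \<in> Low \<Longrightarrow> complex_of_real (Re (c k)) = c k"
  by (auto simp: symc_def complex_eq_iff)

text \<open>The two halves of \<open>U\<close> recombine into the modal form of the wave equation.
  On low modes the matrix row already contains the action of v and v'; on high modes it is part of
  \<open>highF\<close>.\<close>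

lemma cU_ode:
  assumes sol: "modal_solution S U (\<lambda>t. F R (U t) + zr t *\<^sub>R Gz)" and t: "t \<in> S"
  shows "((\<lambda>t. ec (cU (U t)) k) has_vector_derivative gen (ec (cU (U t))) k + ec (highF R (U t)) k) (at t within S)"
proof (cases "k \<in> High")
  case True
  then have k: "k \<notin> Low" using Low_High by blast
  then show ?thesis using Inr_ode[OF sol t True] True by (simp add: ec_cU gen_def)
next
  case False
  then have k: "k \<in> Low" using Low_High by blast
  note l = ix_less[OF k]
  have "((\<lambda>t. complex_of_real (Xr (U t) (ix k))) has_vector_derivative of_real (Xd R (U t) (zr t) (ix k))) (at t within S)"
    by (rule bounded_linear.has_vector_derivative[OF bounded_linear_of_real Xr_ode[OF sol t l(1)]])
  moreover have "of_real (Xd R (U t) (zr t) (ix k)) = gen (ec (cU (U t))) k + ec (highF R (U t)) k"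
  proof -
    have "Xd R (U t) (zr t) (ix k) = Re (ec av k) * Xr (U t) 0 + (\<Sum>p\<in>Low. Re (A0 k p) * Xr (U t) (ix p)) +
        Re (ec bv k) * KX (Xr (U t)) + Re (ec (Nres R (cU (U t))) k)"
      using l(2,3) unfolding Xd_def AK_rows(2)[OF k] by (simp add: qv_def ix_inv[OF k])
    moreover have "complex_of_real (Re (A0 k p)) = A0 k p" if "p \<in> Low" for p
      using A0_real[OF k that] by (auto simp: complex_eq_iff)
    then have "(\<Sum>p\<in>Low. A0 k p * ec (cU (U t)) p) = (\<Sum>p\<in>Low. of_real (Re (A0 k p) * Xr (U t) (ix p)))"
      by (intro sum.cong) (auto simp: ec_cU)
    ultimately show ?thesis
      using False of_real_Re_symc[OF symc_av k] of_real_Re_symc[OF symc_bv k] of_real_Re_symc[OF symc_Nres k, of R "cU (U t)"]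
      by (simp add: gen_def highF_def scaleR_conv_of_real algebra_simps)
  qed
  ultimately show ?thesis using k by (simp add: ec_cU)
qed

text \<open>Reality propagates: the discrepancy \<open>y\<close> between a high coordinate and the
  conjugate of its mirror image solves a homogeneous equation because the forcing is symmetric and
  \<open>lam (- k)\<close> is the conjugate of \<open>lam k\<close>.\<close>

lemma symc_cU:
  assumes sol: "modal_solution {0..} U (\<lambda>t. F R (U t) + zr t *\<^sub>R Gz)" and t: "0 \<le> t"
    and s0: "symc (ec (cU (U 0)))"
  shows "symc (ec (cU (U t)))"
  unfolding symc_def
proof (intro conjI ballI)
  fix k assume k: "k \<in> High"
  define y where "y = (\<lambda>t. ec (cU (U t)) (- k) - cnj (ec (cU (U t)) k))"
  have mk: "- k \<in> High" using k by (simp add: High_uminus)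
  have "(y has_vector_derivative lam (- k) * y s + 0) (at s within {0..t})" if s: "s \<in> {0..t}" for s
  proof -
    have "(y has_vector_derivative (gen (ec (cU (U s))) (- k) + ec (highF R (U s)) (- k)) -
        cnj (gen (ec (cU (U s))) k + ec (highF R (U s)) k)) (at s within {0..})"
      unfolding y_def using s
      by (intro has_vector_derivative_diff bounded_linear.has_vector_derivative[OF bounded_linear_cnj] cU_ode[OF sol]) auto
    moreover have "cnj (ec (highF R (U s)) k) = ec (highF R (U s)) (- k)" using symc_highF k by (simp add: symc_def)
    ultimately have "(y has_vector_derivative lam (- k) * y s + 0) (at s within {0..})"
      using k mk lam_uminus[OF k] by (simp add: gen_def y_def algebra_simps)
    then show ?thesis by (rule has_vector_derivative_within_subset) auto
  qed
  then have "((\<lambda>s. exp (of_real (t - s) * lam (- k)) * 0) has_integral (y t - exp (of_real t * lam (- k)) * y 0)) {0..t}"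
    using t by (intro scalar_variation_of_constants) auto
  then have "y t = exp (of_real t * lam (- k)) * y 0" by (simp add: has_integral_0_eq)
  moreover have "y 0 = 0" using s0 k by (simp add: y_def symc_def)
  ultimately show "cnj (ec (cU (U t)) k) = ec (cU (U t)) (- k)" by (simp add: y_def)
qed (simp add: ec_cU)

lemma bounded_linear_qv: "bounded_linear (\<lambda>r. qv r i)"
proof (rule bounded_linear_intro)
  show "qv (x + y) i = qv x i + qv y i" for x y using qv_diff[of "x + y" i y] by simp
  show "qv (r *\<^sub>R x) i = r *\<^sub>R qv x i" for r x
    using linear_scale[OF bounded_linear.linear[OF bounded_linear_tail], of r x] by (simp add: qv_def)
  show "norm (qv x i) \<le> norm x * (1 + onorm tail)" for x using qv_le[of x i] by (simp add: mult.commute)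
qed

lemma bounded_linear_ell2_trunc: "bounded_linear (ell2_trunc T)"
  by (rule bounded_linear_intro[of _ 1]) (auto intro!: ell2_eqI simp: norm_ell2_trunc)

lemma has_vector_derivative_join:
  assumes y: "\<And>j. j < dim \<Longrightarrow> ((\<lambda>t. y t j) has_vector_derivative y' j) (at s within S)"
    and c: "(c has_vector_derivative c') (at s within S)"
  shows "((\<lambda>t. join (y t) (c t)) has_vector_derivative join y' c') (at s within S)"
proof -
  have "\<forall>j. \<exists>e. j < dim \<longrightarrow> (\<forall>t. norm (y t j - y s j - (t - s) *\<^sub>R y' j) \<le> e t * \<bar>t - s\<bar>) \<and> (e \<longlongrightarrow> 0) (at s within S)"
    using has_vector_derivative_oE[OF y] by metis
  then obtain e where e: "\<And>j t. j < dim \<Longrightarrow> norm (y t j - y s j - (t - s) *\<^sub>R y' j) \<le> e j t * \<bar>t - s\<bar>"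
    "\<And>j. j < dim \<Longrightarrow> (e j \<longlongrightarrow> 0) (at s within S)" by metis
  obtain e' where e': "\<And>t. norm (c t - c s - (t - s) *\<^sub>R c') \<le> e' t * \<bar>t - s\<bar>" "(e' \<longlongrightarrow> 0) (at s within S)"
    using has_vector_derivative_oE[OF c] by metis
  show ?thesis
  proof (rule has_vector_derivative_o[where e = "\<lambda>t. (\<Sum>j<dim. e j t) + e' t"])
    fix t
    have "join (y t) (c t) - join (y s) (c s) - (t - s) *\<^sub>R join y' c' =
        join (\<lambda>j. y t j - y s j - (t - s) *\<^sub>R y' j) (c t - c s - (t - s) *\<^sub>R c')"
      by (rule ell2_sum_eqI) (simp_all add: ec_join)
    then have "norm (join (y t) (c t) - join (y s) (c s) - (t - s) *\<^sub>R join y' c') \<le>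
        (\<Sum>j<dim. cmod (y t j - y s j - (t - s) *\<^sub>R y' j)) + norm (c t - c s - (t - s) *\<^sub>R c')"
      using norm_join by simp
    also have "\<dots> \<le> (\<Sum>j<dim. e j t * \<bar>t - s\<bar>) + e' t * \<bar>t - s\<bar>"
      by (intro add_mono sum_mono e e') auto
    finally show "norm (join (y t) (c t) - join (y s) (c s) - (t - s) *\<^sub>R join y' c') \<le> ((\<Sum>j<dim. e j t) + e' t) * \<bar>t - s\<bar>"
      by (simp add: sum_distrib_right distrib_right)
  next
    have "((\<lambda>t. (\<Sum>j<dim. e j t) + e' t) \<longlongrightarrow> (\<Sum>j<dim. 0) + 0) (at s within S)"
      by (intro tendsto_add tendsto_sum e(2) e'(2)) auto
    then show "((\<lambda>t. (\<Sum>j<dim. e j t) + e' t) \<longlongrightarrow> 0) (at s within S)" by simp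
  qed
qed

lemma continuous_on_join:
  assumes y: "\<And>j. j < dim \<Longrightarrow> continuous_on S (\<lambda>t. y t j)" and c: "continuous_on S c"
  shows "continuous_on S (\<lambda>t. join (y t) (c t))"
  unfolding continuous_on_def
proof
  fix s assume s: "s \<in> S"
  have "((\<lambda>t. (\<Sum>j<dim. cmod (y t j - y s j)) + norm (c t - c s)) \<longlongrightarrow> (\<Sum>j<dim. 0) + 0) (at s within S)"
    using y c s by (intro tendsto_add tendsto_sum tendsto_norm_zero LIM_zero) (auto simp: continuous_on_def)
  then have l: "((\<lambda>t. (\<Sum>j<dim. cmod (y t j - y s j)) + norm (c t - c s)) \<longlongrightarrow> 0) (at s within S)" by simp
  have "((\<lambda>t. join (y t) (c t) - join (y s) (c s)) \<longlongrightarrow> 0) (at s within S)"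
    by (rule Lim_null_comparison[OF _ l]) (auto simp: join_diff intro!: always_eventually norm_join)
  then show "((\<lambda>t. join (y t) (c t)) \<longlongrightarrow> join (y s) (c s)) (at s within S)" by (rule LIM_zero_cancel)
qed

text \<open>\<open>U\<close> is not yet known to be differentiable in norm, but the forcing sees it
  only through the finitely many entries of Y and X, which solve ordinary differential equations,
  and through the residual.\<close>

lemma forcing_C1:
  assumes sol: "modal_solution {0..} U (\<lambda>t. F R (U t) + zr t *\<^sub>R Gz)"
    and R: "0 \<le> R" "\<And>t x. 0 \<le> t \<Longrightarrow> x \<in> {0..L} \<Longrightarrow> \<bar>w1 (cU (U t)) x\<bar> \<le> R"
    and zr: "\<And>t. 0 \<le> t \<Longrightarrow> (zr has_real_derivative zr' t) (at t within {0..})" "continuous_on {0..} zr'"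
  obtains H' where "continuous_on {0..} H'"
    "\<And>t. 0 \<le> t \<Longrightarrow> ((\<lambda>t. F R (U t) + zr t *\<^sub>R Gz) has_vector_derivative H' t) (at t within {0..})"
proof -
  have Uc: "continuous_on {0..} U" using sol by (simp add: modal_solution_def)
  have Hc: "continuous_on {0..} (\<lambda>t. F R (U t) + zr t *\<^sub>R Gz)" using sol by (simp add: modal_solution_def)
  have cc: "continuous_on {0..} (\<lambda>t. cU (U t))" by (rule bounded_linear.continuous_on[OF bounded_linear_cU Uc])
  have Xc: "continuous_on {0..} (\<lambda>t. Xr (U t) i)" for i by (rule bounded_linear.continuous_on[OF bounded_linear_Xr Uc])
  obtain C where C: "\<And>R' c c'. 0 \<le> R' \<Longrightarrow> R' \<le> R \<Longrightarrow> norm (Nres R' c - Nres R' c') \<le> C * R' * norm (c - c')" "C \<ge> 0"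
    using Nres_lipschitz[of R] by metis
  have "(C * R)-lipschitz_on UNIV (Nres R)" using C R by (intro lipschitz_onI) (auto simp: dist_norm)
  then have Nc: "continuous_on {0..} (\<lambda>t. Nres R (cU (U t)))"
    by (intro continuous_on_compose2[OF lipschitz_on_continuous_on cc]) auto
  have gc: "continuous_on {0..} (\<lambda>t. highF R (U t))"
    unfolding highF_def KX_def by (intro continuous_intros Xc Nc)
  define Nd where "Nd = (\<lambda>t. Nres' (cU (U t)) (highF R (U t)))"
  have ode: "((\<lambda>t. ec (cU (U t)) k) has_vector_derivative gen (ec (cU (U t))) k + ec (highF R (U t)) k) (at t within {0..})"
    if "0 \<le> t" for t k using cU_ode[OF sol] that by simp
  have Nd: "0 \<le> s \<Longrightarrow> ((\<lambda>t. Nres R (cU (U t))) has_vector_derivative Nd s) (at s within {0..})"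
    and Ndc: "continuous_on {0..} Nd" for s
    unfolding Nd_def using Nres_has_derivative[OF cc gc ode R] by auto
  have zrc: "continuous_on {0..} zr" using zr(1) by (intro DERIV_continuous_on) auto
  define Yd where "Yd = (\<lambda>t l. \<mu> l * ec (U t) (Inl l) + ec (F R (U t) + zr t *\<^sub>R Gz) (Inl l))"
  have Yd: "((\<lambda>t. ec (U t) (Inl l)) has_vector_derivative Yd t l) (at t within {0..})" if "0 \<le> t" "l < dim" for t l
    using sol that unfolding modal_solution_def Yd_def by (auto simp: m_def dest!: spec[of _ "Inl l"])
  have Ydc: "continuous_on {0..} (\<lambda>t. Yd t l)" for l
    unfolding Yd_def by (intro continuous_intros continuous_on_ec Uc Hc)
  define lowd where "lowd = (\<lambda>t j. (\<Sum>l<dim. N j l * Yd t l) + (\<Sum>i<dim. Q j i * of_real (qv (Nd t) i)))"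
  define highd where "highd = (\<lambda>t. Xd R (U t) (zr t) 0 *\<^sub>R av + KX (Xd R (U t) (zr t)) *\<^sub>R bv + Nd t)"
  have Xdc: "continuous_on {0..} (\<lambda>t. Xd R (U t) (zr t) i)" for i
    unfolding Xd_def by (cases "i = 2 * n0 + 2")
      (auto intro!: continuous_intros Xc bounded_linear.continuous_on[OF bounded_linear_qv Nc] zrc)
  have lowdd: "((\<lambda>t. lowF R (U t) j) has_vector_derivative lowd t j) (at t within {0..})" if "0 \<le> t" for t j
    unfolding lowF_def lowd_def using that
    by (intro has_vector_derivative_add has_vector_derivative_sum has_vector_derivative_mult_right Yd
        bounded_linear.has_vector_derivative[OF bounded_linear_of_real] bounded_linear.has_vector_derivative[OF bounded_linear_qv] Nd) auto
  have lowdc: "continuous_on {0..} (\<lambda>t. lowd t j)" for j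
    unfolding lowd_def by (intro continuous_intros Ydc bounded_linear.continuous_on[OF bounded_linear_qv Ndc])
  have sc: "((\<lambda>t. g t *\<^sub>R v) has_vector_derivative g' *\<^sub>R v) F'" if "(g has_vector_derivative g') F'"
    for g :: "real \<Rightarrow> real" and g' F' and v :: "'b::real_normed_vector"
    by (rule bounded_linear.has_vector_derivative[OF bounded_linear_scaleR_left that])
  have highdd: "((\<lambda>t. highF R (U t)) has_vector_derivative highd t) (at t within {0..})" if t: "0 \<le> t" for t
    unfolding highF_def highd_def
  proof (intro has_vector_derivative_add sc Nd t)
    show "((\<lambda>t. Xr (U t) 0) has_vector_derivative Xd R (U t) (zr t) 0) (at t within {0..})"
      by (rule Xr_ode[OF sol]) (use t in auto)
    show "((\<lambda>t. KX (Xr (U t))) has_vector_derivative KX (Xd R (U t) (zr t))) (at t within {0..})"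
      unfolding KX_def by (intro has_vector_derivative_sum has_vector_derivative_mult_right Xr_ode[OF sol]) (use t in auto)
  qed
  have highdc: "continuous_on {0..} highd"
    unfolding highd_def KX_def by (intro continuous_intros Xdc Ndc)
  show thesis
  proof
    show "continuous_on {0..} (\<lambda>t. join (lowd t) (ell2_trunc High (highd t)) + zr' t *\<^sub>R Gz)"
      by (intro continuous_intros continuous_on_join lowdc bounded_linear.continuous_on[OF bounded_linear_ell2_trunc highdc] zr)
    fix t :: real assume t: "0 \<le> t"
    show "((\<lambda>t. F R (U t) + zr t *\<^sub>R Gz) has_vector_derivative join (lowd t) (ell2_trunc High (highd t)) + zr' t *\<^sub>R Gz) (at t within {0..})"
      unfolding F_def
      by (intro has_vector_derivative_add has_vector_derivative_join sc lowdd
          bounded_linear.has_vector_derivative[OF bounded_linear_ell2_trunc] highdd t)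
        (use zr(1)[OF t] in \<open>simp add: has_real_derivative_iff_has_vector_derivative\<close>)
  qed
qed

end

context wave_modal
begin

text \<open>The real representative must agree with a domain element at every point of
  \<open>{0..L}\<close>, in both components; almost everywhere reality would not suffice.\<close>

lemma real_state_of_coords:
  assumes s: "symc (ec c)" and g: "in_ell2 (gen (ec c))"
  obtains u where "cstate u \<in> domA L \<alpha>" "cf (cstate u) = c" "cf (opA L f ye (cstate u)) = mk_ell2 (gen (ec c))"
proof -
  have co: "coef (rec c) = ec c" by (rule ext) (rule coef_rec)
  have g': "in_ell2 (gen (coef (rec c)))" using g by (simp add: co)
  obtain w' where w': "w' \<in> domA L \<alpha>" "heq L w' (rec c)" "cf (opA L f ye w') = mk_ell2 (gen (coef (rec c)))"
    "heq L (opA L f ye w') (rec (mk_ell2 (gen (coef (rec c)))))"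
    by (rule domA_of_gen[OF rec(1) g'])
  \<comment> \<open>\<open>heq\<close> compares first components pointwise. Applied to \<A>
    \<open>w'\<close> and \<open>h\<close>, it identifies \<open>snd w'\<close> with
    \<open>fst h\<close> at every point, and the symmetry of the coordinates of \<open>h\<close>
    makes that function real there.\<close>
  define h where "h = rec (mk_ell2 (gen (ec c)))"
  have ch: "coef h = gen (ec c)" by (rule ext) (simp add: h_def coef_rec ec_mk[OF g])
  have r1: "heq L (hcnj (rec c)) (rec c)" by (rule real_of_symc[OF rec(1)]) (simp add: co s)
  have hh: "h \<in> hspace L" by (simp add: h_def rec(1))
  have r2: "heq L (hcnj h) h" by (rule real_of_symc[OF hh]) (simp only: ch symc_gen[OF s])
  have f1: "fst w' x = fst (rec c) x" "cnj (fst (rec c) x) = fst (rec c) x" if "x \<in> {0..L}" for x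
    using w'(2) r1 that by (auto simp: heq_def hcnj_def)
  have f2: "snd w' x = fst h x" "cnj (fst h x) = fst h x" if "x \<in> {0..L}" for x
    using w'(4) r2 that by (auto simp: heq_def hcnj_def opA_def h_def co)
  define u where "u = (\<lambda>x. Re (fst w' x), \<lambda>x. Re (snd w' x))"
  have rr: "complex_of_real (Re z) = z" if "cnj z = z" for z using that by (auto simp: complex_eq_iff)
  have e: "fst (cstate u) x = fst w' x" "snd (cstate u) x = snd w' x" if "x \<in> {0..L}" for x
    using f1[OF that] f2[OF that] by (simp_all add: cstate_def u_def rr)
  note D = domA_cong[OF w'(1) e]
  have cw: "coef (cstate u) = ec c"
  proof
    fix k
    have "coef (cstate u) k = coef (rec c) k"
      by (rule coef_heq[OF heq_trans[OF D(2) w'(2)] domA_hspace[OF D(1)] rec(1)])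
    then show "coef (cstate u) k = ec c k" by (simp add: co)
  qed
  show thesis
  proof (rule that[OF D(1)])
    show "cf (cstate u) = c" by (rule ell2_eqI) (simp only: ec_cf[OF domA_hspace[OF D(1)]] cw)
    show "cf (opA L f ye (cstate u)) = mk_ell2 (gen (ec c))"
      by (rule ell2_eqI) (simp only: ec_cf[OF opA_hspace[OF D(1)]] coef_opA[OF D(1)] cw ec_mk[OF g])
  qed
qed

lemma vec_X_entries:
  assumes u: "cstate u \<in> hspace L" and U: "cf (cstate u) = cU U" "xi L n0 e d lam u \<zeta> = Xr U (2 * n0 + 2)" "v = Xr U 0"
  shows "(K * vec_X L n0 e d lam u \<zeta> v) $$ (0, 0) = KX (Xr U)"
proof -
  have "vec_X L n0 e d lam u \<zeta> v $$ (i, 0) = Xr U i" if i: "i < dim" for i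
    using i
  proof (cases rule: less_dim_cases)
    case (2 k)
    have "coef (cstate u) k = ec (cU U) k" using ec_cf[OF u, of k] U(1) by simp
    then have "mode L d (cstate u) k = Xr U i" using 2 by (simp add: mode_def coef_def ec_cU)
    then show ?thesis using i 2(2) ix_less[OF 2(1)] ix_inv[OF 2(1)] by (simp add: vec_X_def)
  qed (use U in \<open>simp_all add: vec_X_def\<close>)
  then show ?thesis unfolding KX_vec_X by (simp add: KX_def)
qed

lemma res_state_heq_residual:
  assumes "\<And>x. x \<in> {0..L} \<Longrightarrow> u x = w1 c x" "\<And>x. x \<in> {0..L} \<Longrightarrow> \<bar>w1 c x\<bar> \<le> R"
  shows "heq L (cstate (\<lambda>x. 0, residual f ye u)) (res_state (\<lambda>x. rho x (clamp R (w1 c x))))"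
    "cstate (\<lambda>x. 0, residual f ye u) \<in> hspace L"
    "cf (cstate (\<lambda>x. 0, residual f ye u)) = Nres R c"
proof -
  have eq: "residual f ye u x = rho x (clamp R (w1 c x))" if "x \<in> {0..L}" for x
    using assms that by (simp add: residual_eq_rho clamp_id)
  have "AE x in lebesgue_on {0..L}. x \<in> {0..L}" using AE_space[of "lebesgue_on {0..L}"] by simp
  then have "AE x in lebesgue_on {0..L}. residual f ye u x = rho x (clamp R (w1 c x))"
    by eventually_elim (rule eq)
  then show h: "heq L (cstate (\<lambda>x. 0, residual f ye u)) (res_state (\<lambda>x. rho x (clamp R (w1 c x))))"
    by (simp add: heq_def cstate_def res_state_def)
  have rs: "res_state (\<lambda>x. rho x (clamp R (w1 c x))) \<in> hspace L"
    by (intro res_state_hspace rho_clamp_cont w1_cont)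
  have "continuous_on {0..L} (\<lambda>x. complex_of_real (rho x (clamp R (w1 c x))))"
    by (intro continuous_on_of_real rho_clamp_cont w1_cont)
  then have "continuous_on {0..L} (\<lambda>x. complex_of_real (residual f ye u x))"
    by (rule continuous_on_eq) (simp add: eq)
  from hspace_snd[OF L2_continuous[OF this]] show hs: "cstate (\<lambda>x. 0, residual f ye u) \<in> hspace L"
    by (simp add: cstate_def)
  show "cf (cstate (\<lambda>x. 0, residual f ye u)) = Nres R c"
    unfolding Nres_def by (rule ell2_eqI) (simp add: ec_cf hs rs coef_heq[OF h hs rs])
qed

lemma fst_cstate_eq_w1:
  assumes "cstate u \<in> hspace L" "cf (cstate u) = c" "x \<in> {0..L}"
  shows "fst u x = w1 c x"
proof -
  have "heq L (cstate u) (rec c)" by (rule heq_of_cf_eq[OF assms(1) rec(1)]) (simp add: assms(2) rec)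
  then have "complex_of_real (fst u x) = fst (rec c) x" using assms(3) by (simp add: heq_def cstate_def)
  from arg_cong[OF this, of Re] show ?thesis by (simp add: w1_def)
qed

lemma in_ell2_m:
  assumes W0: "cstate W0 \<in> domA L \<alpha>" and U0: "cU U = cf (cstate W0)"
  shows "in_ell2 (\<lambda>i. m i * ec U i)"
proof -
  define x where "x = join (\<lambda>j. \<mu> j * ec U (Inl j)) (ell2_trunc High (cf (opA L f ye (cstate W0))))"
  \<comment> \<open>\<open>g\<close> supplies the exponent \<open>-1\<close> on the components that
    \<open>x\<close> leaves at zero.\<close>
  define g where "g = (\<lambda>i. case i of Inl j \<Rightarrow> if j < dim then 0 else (-1::complex) | Inr k \<Rightarrow> if k \<in> High then 0 else -1)"
  have "cmod (g i) \<le> 1" for i by (auto simp: g_def split: sum.split)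
  then have "in_ell2 (\<lambda>i. ec x i + g i * ec U i)" by (intro in_ell2_add in_ell2_mult in_ell2_ec)
  moreover have "ec x i + g i * ec U i = m i * ec U i" for i
  proof (cases i)
    case (Inr k)
    show ?thesis
    proof (cases "k \<in> High")
      case True
      then have "k \<notin> Low" using Low_High by blast
      then have "ec U (Inr k) = coef (cstate W0) k"
        using arg_cong[OF U0, of "\<lambda>c. ec c k"] by (simp add: ec_cU ec_cf domA_hspace[OF W0])
      then show ?thesis
        using Inr True by (simp add: x_def g_def m_def ec_join ec_cf opA_hspace[OF W0] coef_opA_high[OF W0])
    qed (use Inr in \<open>simp add: x_def g_def m_def ec_join\<close>)
  qed (simp add: x_def g_def m_def ec_join)
  ultimately show ?thesis by simp
qed

lemma ex3I: "p a b c \<Longrightarrow> \<exists>x y z. p x y z"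
  by blast

text \<open>The C1 forcing and an initial state in the domain make \<open>U\<close> continuously
  differentiable in norm; all remaining regularity is read off the equation. The bound by
  \<open>R\<close> ensures that the clamped residual is the true one.\<close>

lemma modal_imp_classical:
  assumes sol: "modal_solution {0..} U (\<lambda>t. F R (U t) + zr t *\<^sub>R Gz)"
    and R: "0 \<le> R" "\<And>t x. 0 \<le> t \<Longrightarrow> x \<in> {0..L} \<Longrightarrow> \<bar>w1 (cU (U t)) x\<bar> \<le> R"
    and zr: "C1_on {0..} zr"
    and W0: "cstate W0 \<in> domA L \<alpha>" "cU (U 0) = cf (cstate W0)"
  obtains W \<zeta> v where
    "solution_from L \<alpha> f ye n0 e d lam K zr W0 (Xr (U 0) (2 * n0 + 2)) (Xr (U 0) 0) \<infinity> W \<zeta> v"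
    "\<And>t. 0 \<le> t \<Longrightarrow> cstate (W t) \<in> domA L \<alpha> \<and> cf (cstate (W t)) = cU (U t) \<and>
      xi L n0 e d lam (W t) (\<zeta> t) = Xr (U t) (2 * n0 + 2) \<and> v t = Xr (U t) 0"
proof -
  obtain zr' where zr': "\<And>t. 0 \<le> t \<Longrightarrow> (zr has_real_derivative zr' t) (at t within {0..})" "continuous_on {0..} zr'"
    using zr by (auto simp: C1_on_def)
  obtain H' where H': "continuous_on {0..} H'"
    "\<And>t. 0 \<le> t \<Longrightarrow> ((\<lambda>t. F R (U t) + zr t *\<^sub>R Gz) has_vector_derivative H' t) (at t within {0..})"
    using forcing_C1[OF sol R zr'] by blast
  obtain V where V: "continuous_on {0..} V" "\<And>t. 0 \<le> t \<Longrightarrow> (U has_vector_derivative V t) (at t within {0..})"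
    using modal_solution_C1[OF sol H'(2,1) in_ell2_m[OF W0]] by blast
  define c c' g where "c = (\<lambda>t. cU (U t))" and "c' = (\<lambda>t. cU (V t))" and "g = (\<lambda>t. highF R (U t))"
  have Uc: "continuous_on {0..} U" using sol by (simp add: modal_solution_def)
  have cc: "continuous_on {0..} c" unfolding c_def by (rule bounded_linear.continuous_on[OF bounded_linear_cU Uc])
  have c'c: "continuous_on {0..} c'" unfolding c'_def by (rule bounded_linear.continuous_on[OF bounded_linear_cU V(1)])
  have cd: "(c has_vector_derivative c' t) (at t within {0..})" if "0 \<le> t" for t
    unfolding c_def c'_def by (rule bounded_linear.has_vector_derivative[OF bounded_linear_cU V(2)[OF that]])
  have Xc: "continuous_on {0..} (\<lambda>t. Xr (U t) i)" for i by (rule bounded_linear.continuous_on[OF bounded_linear_Xr Uc])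
  \<comment> \<open>Two derivatives of the same coordinate are compared: the component of the
    derivative in norm and the right-hand side of the modal equation.\<close>
  have c'_eq: "ec (c' t) k = gen (ec (c t)) k + ec (g t) k" if t: "0 \<le> t" for t k
  proof (rule vector_derivative_unique_within[of t "{0..}" "\<lambda>t. ec (c t) k"])
    show "at t within {0..} \<noteq> bot"
    proof -
      have "t islimpt {0..t + 1}" using t by (simp add: islimpt_Icc)
      then have "t islimpt {0..}" by (rule islimpt_subset) auto
      then show ?thesis by (simp add: trivial_limit_within)
    qed
    show "((\<lambda>t. ec (c t) k) has_vector_derivative ec (c' t) k) (at t within {0..})"
      by (rule bounded_linear.has_vector_derivative[OF bounded_linear_ec cd[OF t]])
    show "((\<lambda>t. ec (c t) k) has_vector_derivative gen (ec (c t)) k + ec (g t) k) (at t within {0..})"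
      unfolding c_def g_def by (rule cU_ode[OF sol]) (use t in simp)
  qed
  \<comment> \<open>So \<open>c' t - g t\<close> holds the coordinates of \<A> W. Being
    square-summable it places the state in the domain, and being continuous in time it gives
    continuity in the graph norm.\<close>
  have gen: "gen (ec (c t)) = ec (c' t - g t)" if "0 \<le> t" for t
    by (rule ext) (simp add: c'_eq[OF that])
  have sym: "symc (ec (c t))" if "0 \<le> t" for t
    unfolding c_def
  proof (rule symc_cU[OF sol that])
    have "ec (cU (U 0)) = coef (cstate W0)" by (auto simp: W0 ec_cf domA_hspace)
    then show "symc (ec (cU (U 0)))" using symc_real[OF domA_hspace[OF W0(1)]] by simp
  qed
  have "\<exists>u. cstate u \<in> domA L \<alpha> \<and> cf (cstate u) = c t \<and> cf (opA L f ye (cstate u)) = c' t - g t" if t: "0 \<le> t" for t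
  proof -
    have i: "in_ell2 (gen (ec (c t)))" unfolding gen[OF t] by (rule in_ell2_ec)
    have mk: "mk_ell2 (gen (ec (c t))) = c' t - g t" unfolding gen[OF t] by (rule ec_inverse)
    show ?thesis using real_state_of_coords[OF sym[OF t] i] unfolding mk by blast
  qed
  then obtain W where W: "\<And>t. 0 \<le> t \<Longrightarrow> cstate (W t) \<in> domA L \<alpha>" "\<And>t. 0 \<le> t \<Longrightarrow> cf (cstate (W t)) = c t"
    "\<And>t. 0 \<le> t \<Longrightarrow> cf (opA L f ye (cstate (W t))) = c' t - g t" by metis
  note Wh = domA_hspace[OF W(1)]
  define v where "v = (\<lambda>t. Xr (U t) 0)"
  define v' where "v' = (\<lambda>t. KX (Xr (U t)))"
  \<comment> \<open>The definition of \<xi> is undone.\<close>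
  define \<zeta> where "\<zeta> = (\<lambda>t. Xr (U t) (2 * n0 + 2) + tail (c t))"
  define \<zeta>' where "\<zeta>' = (\<lambda>t. Xd R (U t) (zr t) (2 * n0 + 2) + tail (c' t))"
  have xi: "xi L n0 e d lam (W t) (\<zeta> t) = Xr (U t) (2 * n0 + 2)" if "0 \<le> t" for t
    using tail_sum_eq[OF Wh[OF that]] W(2)[OF that] by (simp add: xi_def \<zeta>_def)
  have J: "{t. 0 \<le> t \<and> ereal t < \<infinity>} = {0..}" by auto
  have zrc: "continuous_on {0..} zr" using zr'(1) by (intro DERIV_continuous_on) auto
  obtain C where C: "\<And>R' c c'. 0 \<le> R' \<Longrightarrow> R' \<le> R \<Longrightarrow> norm (Nres R' c - Nres R' c') \<le> C * R' * norm (c - c')" "C \<ge> 0"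
    using Nres_lipschitz[of R] by metis
  have "(C * R)-lipschitz_on UNIV (Nres R)" using C R by (intro lipschitz_onI) (auto simp: dist_norm)
  then have Nc: "continuous_on {0..} (\<lambda>t. Nres R (c t))"
    by (intro continuous_on_compose2[OF lipschitz_on_continuous_on cc]) auto
  have gc: "continuous_on {0..} g"
    unfolding g_def highF_def KX_def using Nc by (intro continuous_intros Xc) (simp add: c_def)
  have "classical_solution L \<alpha> f ye n0 e d lam K zr \<infinity> W \<zeta> v"
    unfolding classical_solution_def Let_def J
  proof (intro conjI ex3I[of _ "\<lambda>t. rec (c' t)" \<zeta>' v'] ballI impI)
    show "(0::ereal) < \<infinity>" by simp
    show "cstate (W t) \<in> domA L \<alpha>" if "t \<in> {0..}" for t using W that by simp
    show "norm_continuous_on (graph_norm L f ye) {0..} (\<lambda>t. cstate (W t))"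
      unfolding norm_continuous_on_def
    proof
      fix t :: real assume "t \<in> {0..}"
      then have t: "0 \<le> t" by simp
      define b where "b = (\<lambda>s. Ce * norm (c s - c t) + Ce * norm ((c' s - g s) - (c' t - g t)))"
      have "((\<lambda>s. norm (c s - c t)) \<longlongrightarrow> 0) (at t within {0..})"
        "((\<lambda>s. norm ((c' s - g s) - (c' t - g t))) \<longlongrightarrow> 0) (at t within {0..})"
        using t cc continuous_on_diff[OF c'c gc] by (auto intro!: tendsto_norm_zero LIM_zero simp: continuous_on_def)
      from tendsto_add[OF tendsto_mult_right_zero[OF this(1), of Ce] tendsto_mult_right_zero[OF this(2), of Ce]]
      have b0: "(b \<longlongrightarrow> 0) (at t within {0..})" by (simp add: b_def)
      show "((\<lambda>s. graph_norm L f ye (cstate (W s) - cstate (W t))) \<longlongrightarrow> 0) (at t within {0..})"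
      proof (rule Lim_null_comparison[OF _ b0])
        have "norm (graph_norm L f ye (cstate (W s) - cstate (W t))) \<le> b s" if s: "0 \<le> s" for s
        proof -
          let ?w = "cstate (W s) - cstate (W t)"
          have u: "?w \<in> domA L \<alpha>" by (intro domA_diff W s t)
          have "norm (graph_norm L f ye ?w) \<le> hnorm L ?w + hnorm L (opA L f ye ?w)"
            unfolding graph_norm_def using hnorm_nonneg[OF domA_hspace[OF u]] hnorm_nonneg[OF opA_hspace[OF u]]
            by (simp add: sqrt_sum_squares_le_sum)
          also have "\<dots> \<le> Ce * norm (cf ?w) + Ce * norm (cf (opA L f ye ?w))"
            by (intro add_mono hnorm_le_norm_cf domA_hspace opA_hspace u)
          also have "\<dots> = b s"
            unfolding b_def cf_opA_diff[OF W(1)[OF s] W(1)[OF t]] cf_diff[OF Wh[OF s] Wh[OF t]] W(2)[OF s] W(2)[OF t] W(3)[OF s] W(3)[OF t] ..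
          finally show ?thesis .
        qed
        then show "\<forall>\<^sub>F s in at t within {0..}. norm (graph_norm L f ye (cstate (W s) - cstate (W t))) \<le> b s"
          by (simp add: eventually_at_filter)
      qed
    qed
    show "rec (c' t) \<in> hspace L" for t by (rule rec)
    show "has_hderiv L {0..} (\<lambda>t. cstate (W t)) (rec (c' t)) t" if "t \<in> {0..}" for t
    proof -
      have t: "0 \<le> t" using that by simp
      obtain e where e: "\<And>s. norm (c s - c t - (s - t) *\<^sub>R c' t) \<le> e s * \<bar>s - t\<bar>" "(e \<longlongrightarrow> 0) (at t within {0..})"
        using has_vector_derivative_oE[OF cd[OF t]] by metis
      have b0: "((\<lambda>s. Ce * e s) \<longlongrightarrow> 0) (at t within {0..})" by (rule tendsto_mult_right_zero[OF e(2)])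
      show ?thesis
        unfolding has_hderiv_def
      proof (rule Lim_null_comparison[OF _ b0])
        have "norm (hnorm L (hscale (of_real (1 / (s - t))) (cstate (W s) - cstate (W t)) - rec (c' t))) \<le> Ce * e s"
          if s: "0 \<le> s" and st: "s \<noteq> t" for s
        proof -
          let ?w = "hscale (of_real (1 / (s - t))) (cstate (W s) - cstate (W t)) - rec (c' t)"
          have u: "?w \<in> hspace L" by (intro hspace_diff hspace_scale Wh s t rec)
          have "cf ?w = (1 / (s - t)) *\<^sub>R (c s - c t) - c' t"
            using s t by (simp only: cf_diff hspace_diff hspace_scale Wh rec cf_scaleR W)
          also have "\<dots> = (1 / (s - t)) *\<^sub>R (c s - c t - (s - t) *\<^sub>R c' t)"
            using st by (simp add: scaleR_diff_right)
          finally have "norm (cf ?w) = norm (c s - c t - (s - t) *\<^sub>R c' t) / \<bar>s - t\<bar>" by simp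
          also have "\<dots> \<le> e s" using e(1)[of s] st by (simp add: divide_le_eq)
          finally have "Ce * norm (cf ?w) \<le> Ce * e s" using Ce(1) by simp
          then show ?thesis using hnorm_le_norm_cf[OF u] hnorm_nonneg[OF u] by simp
        qed
        then show "\<forall>\<^sub>F s in at t within {0..}. norm (hnorm L (hscale (of_real (1 / (s - t))) (cstate (W s) - cstate (W t)) - rec (c' t))) \<le> Ce * e s"
          by (simp add: eventually_at_filter)
      qed
    qed
    show "norm_continuous_on (hnorm L) {0..} (\<lambda>t. rec (c' t))"
      unfolding norm_continuous_on_def
    proof
      fix t :: real assume t: "t \<in> {0..}"
      show "((\<lambda>s. hnorm L (rec (c' s) - rec (c' t))) \<longlongrightarrow> 0) (at t within {0..})"
        by (rule tendsto_hnorm_of_cf[OF rec(1) rec(1)]) (use c'c t in \<open>simp add: rec continuous_on_def\<close>)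
    qed
    show "(\<zeta> has_real_derivative \<zeta>' t) (at t within {0..})" if "t \<in> {0..}" for t
      unfolding has_real_derivative_iff_has_vector_derivative \<zeta>_def \<zeta>'_def using that
      by (intro has_vector_derivative_add Xr_ode[OF sol] bounded_linear.has_vector_derivative[OF bounded_linear_tail] cd) auto
    show "continuous_on {0..} \<zeta>'"
      unfolding \<zeta>'_def Xd_def c_def[symmetric, THEN fun_cong] using Nc c'c
      by (intro continuous_intros Xc zrc bounded_linear.continuous_on[OF bounded_linear_tail] bounded_linear.continuous_on[OF bounded_linear_qv])
        (auto simp: c_def intro!: continuous_intros zrc)
    show "(v has_real_derivative v' t) (at t within {0..})" if "t \<in> {0..}" for t
    proof -
      have "Xd R (U t) (zr t) 0 = v' t" unfolding Xd_def AK_rows(1) by (simp add: qv_def v'_def)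
      then show ?thesis
        unfolding has_real_derivative_iff_has_vector_derivative v_def using Xr_ode[OF sol that, of 0] by simp
    qed
    show "continuous_on {0..} v'" unfolding v'_def KX_def by (intro continuous_intros Xc)
    fix t :: real assume t': "t \<in> {0..}" "0 < t"
    then have t: "0 \<le> t" by simp
    have fw: "fst (W t) x = w1 (c t) x" if "x \<in> {0..L}" for x
      by (rule fst_cstate_eq_w1[OF Wh[OF t] W(2)[OF t] that])
    have wb: "\<bar>w1 (c t) x\<bar> \<le> R" if "x \<in> {0..L}" for x
      using R(2)[OF t that] by (simp add: c_def)
    note res = res_state_heq_residual[of "fst (W t)" "c t" R, OF fw wb]
    let ?rhs = "opA L f ye (cstate (W t)) + hscale (of_real (v t)) (vec_a L \<alpha>)
                + hscale (of_real (v' t)) (vec_b L \<alpha>) + cstate (\<lambda>x. 0, residual f ye (fst (W t)))"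
    note hs = opA_hspace[OF W(1)[OF t]] hspace_scale[OF vec_a_hspace] hspace_scale[OF vec_b_hspace] res(2)
    show "heq L (rec (c' t)) ?rhs"
    proof (rule heq_of_cf_eq[OF rec(1)])
      show "?rhs \<in> hspace L" by (intro hspace_add hs)
      have "cf ?rhs = (c' t - g t) + v t *\<^sub>R av + v' t *\<^sub>R bv + Nres R (c t)"
        by (simp only: cf_add hspace_add hs cf_scaleR vec_a_hspace vec_b_hspace av_def bv_def res(3) W(3)[OF t])
      also have "\<dots> = c' t" by (simp add: g_def highF_def v_def v'_def c_def)
      finally show "cf (rec (c' t)) = cf ?rhs" by (simp add: rec)
    qed
    show "\<zeta>' t = pointwise_deriv L (fst (W t)) 0 - zr t"
    proof -
      have "(\<Sum>p\<in>Low. Re (pd p) * Xr (U t) (ix p)) = Re (\<Sum>k\<in>Low. pd k * coef (cstate (W t)) k)"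
      proof -
        have "coef (cstate (W t)) k = of_real (Xr (U t) (ix k))" if "k \<in> Low" for k
          using ec_cf[OF Wh[OF t], of k] W(2)[OF t] that by (simp add: c_def ec_cU)
        then show ?thesis by simp
      qed
      \<comment> \<open>Since \<open>c' - g\<close> represents \<A> W, the tails of the input and
        residual terms cancel against those in the last row of the matrix; what remains is the low
        part plus \<open>tail\<close> of \<A> W, that is, the trace.\<close>
      moreover have "tail (c' t - g t) = tail (c' t) - (v t * tail av + v' t * tail bv + tail (Nres R (c t)))"
        using bounded_linear.linear[OF bounded_linear_tail]
        by (simp add: g_def highF_def v_def v'_def c_def linear_diff linear_add linear_scale)
      moreover have "Xd R (U t) (zr t) (2 * n0 + 2) = - tail av * v t + (\<Sum>p\<in>Low. Re (pd p) * Xr (U t) (ix p)) - tail bv * v' t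
          - tail (Nres R (c t)) - zr t"
        unfolding Xd_def AK_rows(3) by (simp add: qv_def v_def v'_def c_def)
      ultimately show ?thesis
        unfolding \<zeta>'_def pointwise_deriv_real[OF W(1)[OF t]] Re_deriv_eq_tail[OF W(1)[OF t]] W(3)[OF t] by simp
    qed
    show "v' t = (K * vec_X L n0 e d lam (W t) (\<zeta> t) (v t)) $$ (0, 0)"
      using vec_X_entries[OF Wh[OF t] W(2)[OF t, unfolded c_def] xi[OF t], of "v t"] by (simp add: v_def v'_def)
  qed
  moreover have "heq L (cstate (W 0)) (cstate W0)"
    by (rule heq_of_cf_eq[OF Wh domA_hspace[OF W0(1)]]) (simp_all add: W(2) W0(2) c_def)
  ultimately have "solution_from L \<alpha> f ye n0 e d lam K zr W0 (Xr (U 0) (2 * n0 + 2)) (Xr (U 0) 0) \<infinity> W \<zeta> v"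
    unfolding solution_from_def using xi[of 0] by (simp add: v_def)
  then show thesis using W(1,2) xi by (intro that[of W \<zeta> v]) (auto simp: c_def v_def)
qed

end

section \<open>Modal solutions from classical solutions\<close>

text \<open>Classical solutions satisfy the equations for positive times only, whereas mild
  solutions also need them at time 0.\<close>

lemma eq_on_Icc_of_eq_pos:
  fixes g h :: "real \<Rightarrow> 'a::t2_space"
  assumes b: "0 < b" and g: "continuous_on {0..b} g" and h: "continuous_on {0..b} h"
    and eq: "\<And>t. t \<in> {0<..b} \<Longrightarrow> g t = h t" and t: "t \<in> {0..b}"
  shows "g t = h t"
proof (cases "t = 0")
  case True
  have "0 islimpt {0..b}" using b by (simp add: islimpt_Icc)
  then have nb: "at (0::real) within {0..b} \<noteq> bot" by (simp add: trivial_limit_within)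
  have l: "(g \<longlongrightarrow> g 0) (at 0 within {0..b})" "(h \<longlongrightarrow> h 0) (at 0 within {0..b})"
    using g h b by (auto simp: continuous_on_def)
  have "\<forall>\<^sub>F x in at 0 within {0..b}. h x = g x"
    unfolding eventually_at_filter using eq by (intro always_eventually) auto
  from tendsto_unique[OF nb l(1) Lim_transform_eventually[OF l(2) this]] show ?thesis by (simp add: True)
qed (use eq t in auto)

context wave_modal
begin

text \<open>Y' = Q X' rewritten with Q A_K = (diag \<mu> + N) Q, for \<open>U\<close> with Y = Q
  X.\<close>

lemma sum_Q_Xd:
  assumes Y: "\<And>j. j < dim \<Longrightarrow> ec U (Inl j) = (\<Sum>l<dim. Q j l * of_real (Xr U l))" and j: "j < dim"
  shows "(\<Sum>i<dim. Q j i * of_real (Xd R U z i)) =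
    \<mu> j * ec U (Inl j) + (lowF R U j - of_real z * Q j (2 * n0 + 2))"
proof -
  let ?x = "\<lambda>l. complex_of_real (Xr U l)" and ?q = "\<lambda>i. complex_of_real (qv (Nres R (cU U)) i)"
  have "(\<Sum>i<dim. Q j i * of_real (Xd R U z i)) =
      (\<Sum>i<dim. (\<Sum>l<dim. Q j i * of_real (AK $$ (i, l)) * ?x l) + Q j i * ?q i - (if i = 2 * n0 + 2 then Q j i * of_real z else 0))"
    unfolding Xd_def by (intro sum.cong refl) (simp add: sum_distrib_left right_diff_distrib distrib_left mult.assoc)
  also have "\<dots> = (\<Sum>i<dim. \<Sum>l<dim. Q j i * of_real (AK $$ (i, l)) * ?x l) + (\<Sum>i<dim. Q j i * ?q i) - of_real z * Q j (2 * n0 + 2)"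
    by (simp add: sum.distrib sum_subtractf sum.delta mult.commute del: sum.lessThan_Suc)
  also have "(\<Sum>i<dim. \<Sum>l<dim. Q j i * of_real (AK $$ (i, l)) * ?x l) = (\<Sum>l<dim. (\<Sum>i<dim. Q j i * of_real (AK $$ (i, l))) * ?x l)"
    by (subst sum.swap) (simp only: sum_distrib_right)
  also have "\<dots> = (\<Sum>l<dim. (\<mu> j * Q j l + (\<Sum>k<dim. N j k * Q k l)) * ?x l)"
    by (intro sum.cong refl) (simp only: sum_Q_AK[OF j] lessThan_iff)
  also have "\<dots> = \<mu> j * (\<Sum>l<dim. Q j l * ?x l) + (\<Sum>l<dim. \<Sum>k<dim. N j k * (Q k l * ?x l))"
    by (simp only: distrib_right sum.distrib sum_distrib_left sum_distrib_right mult.assoc)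
  also have "(\<Sum>l<dim. \<Sum>k<dim. N j k * (Q k l * ?x l)) = (\<Sum>k<dim. N j k * (\<Sum>l<dim. Q k l * ?x l))"
    by (subst sum.swap) (simp only: sum_distrib_left)
  also have "\<dots> = (\<Sum>k<dim. N j k * ec U (Inl k))" by (intro sum.cong refl) (simp only: Y lessThan_iff)
  finally show ?thesis by (simp only: lowF_def Y[OF j, symmetric] add.assoc add_diff_eq)
qed

definition cX :: "rstate \<Rightarrow> real \<Rightarrow> real \<Rightarrow> nat \<Rightarrow> real" where
  "cX u \<xi> v i = (if i = 0 then v else if i = 2 * n0 + 2 then \<xi> else Re (coef (cstate u) (int i - 1 - int n0)))"

text \<open>The modal family attached to a real state: Y = Q X and the high coordinates. It is
  inverted by \<open>Xr\<close> and \<open>cU\<close>.\<close>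

definition coords :: "rstate \<Rightarrow> real \<Rightarrow> real \<Rightarrow> (nat + int) ell2" where
  "coords u \<xi> v = join (\<lambda>j. \<Sum>i<dim. Q j i * of_real (cX u \<xi> v i)) (ell2_trunc High (cf (cstate u)))"

lemma KX_vec_X_cX: "(K * vec_X L n0 e d lam u \<zeta> v) $$ (0, 0) = KX (cX u (xi L n0 e d lam u \<zeta>) v)"
  unfolding KX_vec_X KX_def by (intro sum.cong refl) (auto simp: cX_def vec_X_def mode_def coef_def)

lemma Xr_coords:
  assumes i: "i < dim"
  shows "Xr (coords u \<xi> v) i = cX u \<xi> v i"
proof -
  let ?x = "\<lambda>l. complex_of_real (cX u \<xi> v l)"
  have "(\<Sum>j<dim. P i j * ec (coords u \<xi> v) (Inl j)) = (\<Sum>j<dim. \<Sum>l<dim. P i j * Q j l * ?x l)"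
    by (simp add: coords_def ec_join sum_distrib_left mult.assoc)
  also have "\<dots> = (\<Sum>l<dim. (\<Sum>j<dim. P i j * Q j l) * ?x l)"
    by (subst sum.swap) (simp add: sum_distrib_right)
  also have "\<dots> = (\<Sum>l<dim. if l = i then ?x l else 0)" using i by (intro sum.cong) (auto simp: PQ)
  finally show ?thesis using i by (simp add: Xr_def)
qed

lemma cX_ix: "k \<in> Low \<Longrightarrow> cX u \<xi> v (ix k) = Re (coef (cstate u) k)"
  using ix_less[of k] ix_inv[of k] by (auto simp: cX_def)

lemma cU_coords:
  assumes u: "cstate u \<in> hspace L"
  shows "cU (coords u \<xi> v) = cf (cstate u)"
proof (rule ell2_eqI)
  fix k show "ec (cU (coords u \<xi> v)) k = ec (cf (cstate u)) k"
  proof (cases "k \<in> Low")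
    case True
    then show ?thesis
      using of_real_Re_symc[OF symc_real[OF u] True] by (simp add: ec_cU Xr_coords ix_less cX_ix ec_cf u)
  next
    case False
    then have "k \<in> High" using Low_High by blast
    then show ?thesis using False by (simp add: ec_cU coords_def ec_join)
  qed
qed

text \<open>Continuity of the coordinates is stated separately, before any clamping level: the level
  \<open>R\<close> needed for the second claim is found only from a bound that this continuity
  provides on a compact interval.\<close>

lemma classical_imp_modal:
  assumes cl: "classical_solution L \<alpha> f ye n0 e d lam K zr T W \<zeta> v" and zr: "C1_on {0..} zr"
  defines "J \<equiv> {t. 0 \<le> t \<and> ereal t < T}"
  defines "U \<equiv> \<lambda>t. coords (W t) (xi L n0 e d lam (W t) (\<zeta> t)) (v t)"
  shows "continuous_on J U"
    "\<And>t R. t \<in> J \<Longrightarrow> 0 < t \<Longrightarrow> (\<And>s x. s \<in> {0..t} \<Longrightarrow> x \<in> {0..L} \<Longrightarrow> \<bar>w1 (cU (U s)) x\<bar> \<le> R) \<Longrightarrow> 0 \<le> R \<Longrightarrow>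
       modal_solution {0..t} U (\<lambda>t. F R (U t) + zr t *\<^sub>R Gz)"
proof -
  have T: "0 < T" using cl by (simp add: classical_solution_def)
  note CL = cl[unfolded classical_solution_def Let_def, folded J_def]
  have dom: "cstate (W t) \<in> domA L \<alpha>" if "t \<in> J" for t using CL that by blast
  note Wh = domA_hspace[OF dom]
  have gn: "norm_continuous_on (graph_norm L f ye) J (\<lambda>t. cstate (W t))" using CL by blast
  obtain W' \<zeta>' v' where
    W': "\<forall>t\<in>J. W' t \<in> hspace L \<and> has_hderiv L J (\<lambda>t. cstate (W t)) (W' t) t" "norm_continuous_on (hnorm L) J W'"
    and zd: "\<forall>t\<in>J. (\<zeta> has_real_derivative \<zeta>' t) (at t within J)" "continuous_on J \<zeta>'"
    and vd: "\<forall>t\<in>J. (v has_real_derivative v' t) (at t within J)" "continuous_on J v'"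
    and eqs: "\<forall>t\<in>J. 0 < t \<longrightarrow>
            heq L (W' t)
              (opA L f ye (cstate (W t)) + hscale (of_real (v t)) (vec_a L \<alpha>)
                + hscale (of_real (v' t)) (vec_b L \<alpha>)
                + cstate (\<lambda>x. 0, residual f ye (fst (W t)))) \<and>
            \<zeta>' t = pointwise_deriv L (fst (W t)) 0 - zr t \<and>
            v' t = (K * vec_X L n0 e d lam (W t) (\<zeta> t) (v t)) $$ (0, 0)"
    using CL by blast
  define c c' h where "c = (\<lambda>t. cf (cstate (W t)))" and "c' = (\<lambda>t. cf (W' t))" and "h = (\<lambda>t. cf (opA L f ye (cstate (W t))))"
  have cd: "(c has_vector_derivative c' t) (at t within J)" if t: "t \<in> J" for t
  proof (rule has_vector_derivative_o[where e = "\<lambda>s. Cd * hnorm L (hscale (of_real (1 / (s - t))) (cstate (W s) - cstate (W t)) - W' t)"])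
    have "((\<lambda>s. hnorm L (hscale (of_real (1 / (s - t))) (cstate (W s) - cstate (W t)) - W' t)) \<longlongrightarrow> 0) (at t within J)"
      using W'(1) t by (simp add: has_hderiv_def)
    then show "((\<lambda>s. Cd * hnorm L (hscale (of_real (1 / (s - t))) (cstate (W s) - cstate (W t)) - W' t)) \<longlongrightarrow> 0) (at t within J)"
      by (rule tendsto_mult_right_zero)
    fix s assume s: "s \<in> J"
    let ?w = "hscale (of_real (1 / (s - t))) (cstate (W s) - cstate (W t)) - W' t"
    have W't: "W' t \<in> hspace L" using W'(1) t by blast
    have u: "?w \<in> hspace L" by (intro hspace_diff hspace_scale Wh s t W't)
    show "norm (c s - c t - (s - t) *\<^sub>R c' t) \<le> Cd * hnorm L ?w * \<bar>s - t\<bar>"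
    proof (cases "s = t")
      case False
      have "cf ?w = (1 / (s - t)) *\<^sub>R (c s - c t) - c' t"
        unfolding c_def c'_def by (simp only: cf_diff hspace_diff hspace_scale Wh s t W't cf_scaleR)
      then have "c s - c t - (s - t) *\<^sub>R c' t = (s - t) *\<^sub>R cf ?w"
        using False by (simp add: scaleR_diff_right)
      then show ?thesis
        using mult_right_mono[OF norm_cf_le[OF u], of "\<bar>s - t\<bar>"] by (simp add: mult.commute)
    qed (simp add: hnorm_nonneg)
  qed
  have cc: "continuous_on J c" using cd by (intro continuous_on_vector_derivative) auto
  have c'c: "continuous_on J c'"
    unfolding continuous_on_def
  proof
    fix t assume t: "t \<in> J"
    have "((\<lambda>s. c' s - c' t) \<longlongrightarrow> 0) (at t within J)"
    proof (rule Lim_null_comparison)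
      have "norm (c' s - c' t) \<le> Cd * hnorm L (W' s - W' t)" if "s \<in> J" for s
        using norm_cf_le[OF hspace_diff, of "W' s" "W' t"] W'(1) t that by (simp add: c'_def cf_diff)
      then show "\<forall>\<^sub>F s in at t within J. norm (c' s - c' t) \<le> Cd * hnorm L (W' s - W' t)"
        by (simp add: eventually_at_filter)
      show "((\<lambda>s. Cd * hnorm L (W' s - W' t)) \<longlongrightarrow> 0) (at t within J)"
        using W'(2) t unfolding norm_continuous_on_def by (intro tendsto_mult_right_zero) blast
    qed
    then show "(c' \<longlongrightarrow> c' t) (at t within J)" by (rule LIM_zero_cancel)
  qed
  have hc: "continuous_on J h"
    unfolding continuous_on_def
  proof
    fix t assume t: "t \<in> J"
    have "((\<lambda>s. h s - h t) \<longlongrightarrow> 0) (at t within J)"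
    proof (rule Lim_null_comparison)
      have "norm (h s - h t) \<le> Cd * graph_norm L f ye (cstate (W s) - cstate (W t))" if s: "s \<in> J" for s
      proof -
        note D = domA_diff[OF dom[OF s] dom[OF t]]
        have "h s - h t = cf (opA L f ye (cstate (W s) - cstate (W t)))"
          unfolding h_def by (rule cf_opA_diff[OF dom[OF s] dom[OF t], symmetric])
        then have "norm (h s - h t) \<le> Cd * hnorm L (opA L f ye (cstate (W s) - cstate (W t)))"
          using norm_cf_le[OF opA_hspace[OF D]] by simp
        also have "\<dots> \<le> Cd * graph_norm L f ye (cstate (W s) - cstate (W t))"
          using Cd(1) unfolding graph_norm_def by (intro mult_left_mono real_le_rsqrt) auto
        finally show ?thesis .
      qed
      then show "\<forall>\<^sub>F s in at t within J. norm (h s - h t) \<le> Cd * graph_norm L f ye (cstate (W s) - cstate (W t))"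
        by (simp add: eventually_at_filter)
      show "((\<lambda>s. Cd * graph_norm L f ye (cstate (W s) - cstate (W t))) \<longlongrightarrow> 0) (at t within J)"
        using gn t unfolding norm_continuous_on_def by (intro tendsto_mult_right_zero) blast
    qed
    then show "(h \<longlongrightarrow> h t) (at t within J)" by (rule LIM_zero_cancel)
  qed
  have xi: "xi L n0 e d lam (W t) (\<zeta> t) = \<zeta> t - tail (c t)" if "t \<in> J" for t
    using tail_sum_eq[OF Wh[OF that]] by (simp add: xi_def c_def)
  define X where "X = (\<lambda>t. cX (W t) (xi L n0 e d lam (W t) (\<zeta> t)) (v t))"
  have U: "U t = join (\<lambda>j. \<Sum>i<dim. Q j i * of_real (X t i)) (ell2_trunc High (cf (cstate (W t))))" for t
    by (simp add: U_def coords_def X_def)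
  have X: "X t 0 = v t" "X t (2 * n0 + 2) = xi L n0 e d lam (W t) (\<zeta> t)" "k \<in> Low \<Longrightarrow> X t (ix k) = Re (coef (cstate (W t)) k)" for t k
    by (simp add: X_def cX_def, simp add: X_def cX_def, simp add: X_def cX_ix)
  have Xr: "Xr (U t) i = X t i" if "i < dim" for t i
    unfolding U_def X_def by (rule Xr_coords[OF that])
  have cU: "cU (U t) = cf (cstate (W t))" if "t \<in> J" for t
    unfolding U_def by (rule cU_coords[OF Wh[OF that]])
  \<comment> \<open>The same entries written as bounded linear functionals of the coordinates,
    \<zeta> and v, from which differentiability is evident.\<close>
  define Xt where "Xt = (\<lambda>t i. if i = 0 then v t else if i = 2 * n0 + 2 then \<zeta> t - tail (c t) else Re (ec (c t) (int i - 1 - int n0)))"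
  define X' where "X' = (\<lambda>t i. if i = 0 then v' t else if i = 2 * n0 + 2 then \<zeta>' t - tail (c' t) else Re (ec (c' t) (int i - 1 - int n0)))"
  have XXt: "X t i = Xt t i" if t: "t \<in> J" and i: "i < dim" for t i
    using i
  proof (cases rule: less_dim_cases)
    case (2 k)
    then show ?thesis using ix_less[OF 2(1)] ix_inv[OF 2(1)] X(3)[OF 2(1)] by (simp add: Xt_def c_def ec_cf Wh[OF t])
  qed (use X xi[OF t] in \<open>simp_all add: Xt_def\<close>)
  have Xtd: "((\<lambda>t. Xt t i) has_vector_derivative X' t i) (at t within J)" if t: "t \<in> J" for t i
    using t vd(1) zd(1) unfolding Xt_def X'_def
    by (auto simp: has_real_derivative_iff_has_vector_derivative
        intro!: has_vector_derivative_diff bounded_linear.has_vector_derivative[OF bounded_linear_tail]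
          bounded_linear.has_vector_derivative[OF bounded_linear_Re] bounded_linear.has_vector_derivative[OF bounded_linear_ec] cd)
  have Xd: "((\<lambda>t. X t i) has_vector_derivative X' t i) (at t within J)" if t: "t \<in> J" and i: "i < dim" for t i
    by (rule has_vector_derivative_transform[OF t XXt[OF _ i] Xtd[OF t]])
  have Xc: "continuous_on J (\<lambda>t. X t i)" if "i < dim" for i
    using Xd[OF _ that] by (intro continuous_on_vector_derivative) auto
  have X'c: "continuous_on J (\<lambda>t. X' t i)" for i
  proof -
    have "continuous_on J (\<lambda>t. tail (c' t))" "continuous_on J (\<lambda>t. Re (ec (c' t) k))" for k
      by (intro bounded_linear.continuous_on[OF bounded_linear_tail] bounded_linear.continuous_on[OF bounded_linear_Re]
          bounded_linear.continuous_on[OF bounded_linear_ec] c'c)+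
    then show ?thesis using vd(2) zd(2)
      by (cases "i = 0"; cases "i = 2 * n0 + 2") (auto simp: X'_def intro: continuous_on_diff)
  qed
  show Uc: "continuous_on J U"
    unfolding U
    by (intro continuous_on_join continuous_intros Xc bounded_linear.continuous_on[OF bounded_linear_ell2_trunc cc[unfolded c_def]]) auto
  have zrc: "continuous_on {0..} zr"
  proof -
    obtain zr' where "\<forall>t\<in>{0..}. (zr has_real_derivative zr' t) (at t within {0..})" using zr by (auto simp: C1_on_def)
    then show ?thesis using DERIV_continuous_on[of "{0..}" zr zr'] by blast
  qed
  fix t0 R assume t0: "t0 \<in> J" "0 < t0" and R: "0 \<le> R"
    and wR: "\<And>s x. s \<in> {0..t0} \<Longrightarrow> x \<in> {0..L} \<Longrightarrow> \<bar>w1 (cU (U s)) x\<bar> \<le> R"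
  define S where "S = {0..t0}"
  have sub: "S \<subseteq> J" using t0 by (auto simp: J_def S_def intro: le_less_trans[of "ereal _" "ereal t0"])
  define r where "r = (\<lambda>t. Nres R (c t))"
  obtain C where C: "\<And>R' c c'. 0 \<le> R' \<Longrightarrow> R' \<le> R \<Longrightarrow> norm (Nres R' c - Nres R' c') \<le> C * R' * norm (c - c')" "C \<ge> 0"
    using Nres_lipschitz[of R] by metis
  have "(C * R)-lipschitz_on UNIV (Nres R)" using C R by (intro lipschitz_onI) (auto simp: dist_norm)
  then have rc: "continuous_on J r"
    unfolding r_def by (intro continuous_on_compose2[OF lipschitz_on_continuous_on cc]) auto
  have KXeq: "KX (Xr (U t)) = KX (X t)" for t unfolding KX_def by (intro sum.cong refl) (simp only: Xr lessThan_iff)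
  have v'pos: "v' t = KX (X t)" if "t \<in> S" "0 < t" for t
  proof -
    have "t \<in> J" using that sub by blast
    with eqs that(2) have "v' t = (K * vec_X L n0 e d lam (W t) (\<zeta> t) (v t)) $$ (0, 0)" by blast
    then show ?thesis by (simp only: KX_vec_X_cX X_def)
  qed
  have c'pos: "c' t = h t + v t *\<^sub>R av + v' t *\<^sub>R bv + r t" if t: "t \<in> S" "0 < t" for t
  proof -
    have tJ: "t \<in> J" using t sub by blast
    have fw: "fst (W t) x = w1 (c t) x" if "x \<in> {0..L}" for x
      by (rule fst_cstate_eq_w1[OF Wh[OF tJ] _ that]) (simp add: c_def)
    have wb: "\<bar>w1 (c t) x\<bar> \<le> R" if "x \<in> {0..L}" for x
      using wR[OF t(1)[unfolded S_def] that] cU[OF tJ] by (simp add: c_def)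
    note res = res_state_heq_residual[of "fst (W t)" "c t" R, OF fw wb]
    note hs = opA_hspace[OF dom[OF tJ]] hspace_scale[OF vec_a_hspace] hspace_scale[OF vec_b_hspace] res(2)
    let ?rhs = "opA L f ye (cstate (W t)) + hscale (of_real (v t)) (vec_a L \<alpha>)
                + hscale (of_real (v' t)) (vec_b L \<alpha>) + cstate (\<lambda>x. 0, residual f ye (fst (W t)))"
    have "heq L (W' t) ?rhs" using eqs tJ t(2) by blast
    moreover have "W' t \<in> hspace L" using W'(1) tJ by blast
    moreover have "?rhs \<in> hspace L" by (intro hspace_add hs)
    ultimately have "cf (W' t) = cf ?rhs"
      by (intro ell2_eqI) (simp only: ec_cf coef_heq)
    also have "\<dots> = h t + v t *\<^sub>R av + v' t *\<^sub>R bv + r t"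
      by (simp only: cf_add hspace_add hs cf_scaleR vec_a_hspace vec_b_hspace av_def bv_def res(3) h_def r_def)
    finally show ?thesis by (simp add: c'_def)
  qed
  have coefX: "coef (cstate (W t)) k = of_real (Xr (U t) (ix k))" if "t \<in> J" "k \<in> Low" for t k
    using arg_cong[OF cU[OF that(1)], of "\<lambda>c. ec c k"] that by (simp add: ec_cU ec_cf Wh)
  have eh: "ec (h t) k = gen (coef (cstate (W t))) k" if "t \<in> J" for t k
    using that by (simp add: h_def ec_cf opA_hspace[OF dom] coef_opA[OF dom])
  have X'pos: "X' t i = Xd R (U t) (zr t) i" if t: "t \<in> S" "0 < t" and i: "i < dim" for t i
  proof -
    have tJ: "t \<in> J" using t sub by blast
    have rU: "r t = Nres R (cU (U t))" using cU[OF tJ] by (simp add: r_def c_def)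
    have vX: "v t = Xr (U t) 0" using Xr[of 0 t] X(1)[of t] by simp
    have v'X: "v' t = KX (Xr (U t))" using v'pos[OF t] KXeq by simp
    show ?thesis using i
    proof (cases rule: less_dim_cases)
      case 1
      then show ?thesis by (simp add: X'_def Xd_def AK_rows(1) qv_def v'X)
    next
      case (2 k)
      have k: "k \<in> Low" "k \<notin> High" using 2 Low_High by auto
      have "Re (ec (h t) k) = (\<Sum>p\<in>Low. Re (A0 k p) * Xr (U t) (ix p))"
        using k by (simp add: eh[OF tJ] gen_def coefX[OF tJ])
      then have "Re (ec (c' t) k) = Xd R (U t) (zr t) (ix k)"
        using ix_less[OF k(1)] ix_inv[OF k(1)]
        by (simp add: Xd_def AK_rows(2)[OF k(1)] c'pos[OF t] qv_def v'X vX rU)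
      then show ?thesis using ix_less[OF k(1)] ix_inv[OF k(1)] by (simp add: X'_def 2)
    next
      case 3
      have z: "\<zeta>' t = pointwise_deriv L (fst (W t)) 0 - zr t" using eqs tJ t(2) by blast
      have "pointwise_deriv L (fst (W t)) 0 = Re (pointwise_deriv L (fst (cstate (W t))) 0)"
        by (rule pointwise_deriv_real[OF dom[OF tJ]])
      also have "\<dots> = (\<Sum>p\<in>Low. Re (pd p) * Xr (U t) (ix p)) + tail (h t)"
        unfolding Re_deriv_eq_tail[OF dom[OF tJ]] by (simp add: h_def coefX[OF tJ])
      also have "tail (h t) = tail (c' t) - v t * tail av - v' t * tail bv - tail (r t)"
        using bounded_linear.linear[OF bounded_linear_tail] unfolding c'pos[OF t]
        by (simp add: linear_add linear_scale)
      finally show ?thesis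
        unfolding 3 by (simp add: X'_def Xd_def AK_rows(3)[simplified] z qv_def v'X vX rU)
    qed
  qed
  obtain LB where LB: "\<And>U U'. norm (F R U - F R U') \<le> (LA + LB * R) * norm (U - U')"
    using F_lipschitz[of R] R by (metis order_refl)
  have Fc: "continuous_on UNIV (F R)"
  proof (rule lipschitz_on_continuous_on[of "\<bar>LA + LB * R\<bar>"], rule lipschitz_onI, unfold dist_norm)
    show "norm (F R U - F R U') \<le> \<bar>LA + LB * R\<bar> * norm (U - U')" for U U'
      by (rule order_trans[OF LB mult_right_mono]) auto
  qed simp
  have Uc': "continuous_on S U" by (rule continuous_on_subset[OF Uc sub])
  have FUc: "continuous_on S (\<lambda>t. F R (U t))" by (rule continuous_on_compose2[OF Fc Uc']) auto
  have zrS': "continuous_on S (\<lambda>t. if i = 2 * n0 + 2 then zr t else 0)" for i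
    by (cases "i = 2 * n0 + 2") (auto intro: continuous_on_subset[OF zrc] simp: S_def)
  have zrS: "continuous_on S zr" by (rule continuous_on_subset[OF zrc]) (simp add: S_def)
  have Nc: "continuous_on S (\<lambda>t. Nres R (cU (U t)))"
    by (rule continuous_on_eq[OF continuous_on_subset[OF rc sub]]) (use sub cU in \<open>auto simp: r_def c_def\<close>)
  have XrUc: "continuous_on S (\<lambda>t. Xr (U t) i)" for i by (rule bounded_linear.continuous_on[OF bounded_linear_Xr Uc'])
  \<comment> \<open>Continuity extends the equations from positive times to time 0.\<close>
  have X'eq: "X' t i = Xd R (U t) (zr t) i" if t: "t \<in> S" and i: "i < dim" for t i
  proof (rule eq_on_Icc_of_eq_pos[OF t0(2) _ _ _ t[unfolded S_def], folded S_def])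
    show "continuous_on S (\<lambda>t. X' t i)" by (rule continuous_on_subset[OF X'c sub])
    show "continuous_on S (\<lambda>t. Xd R (U t) (zr t) i)"
      unfolding Xd_def using Nc by (intro continuous_intros zrS' XrUc bounded_linear.continuous_on[OF bounded_linear_qv])
        (auto intro: continuous_on_const)
    show "X' t i = Xd R (U t) (zr t) i" if "t \<in> {0<..t0}" for t using X'pos[of t i] that i by (simp add: S_def)
  qed
  have vc: "continuous_on J v" using vd(1) by (intro DERIV_continuous_on) auto
  have c'eq: "c' t = h t + v t *\<^sub>R av + v' t *\<^sub>R bv + r t" if t: "t \<in> S" for t
  proof (rule eq_on_Icc_of_eq_pos[OF t0(2) _ _ _ t[unfolded S_def], folded S_def])
    show "continuous_on S c'" by (rule continuous_on_subset[OF c'c sub])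
    show "continuous_on S (\<lambda>t. h t + v t *\<^sub>R av + v' t *\<^sub>R bv + r t)"
      by (rule continuous_on_subset[OF _ sub]) (intro continuous_intros hc vc vd(2) rc)
    show "c' t = h t + v t *\<^sub>R av + v' t *\<^sub>R bv + r t" if "t \<in> {0<..t0}" for t using c'pos[of t] that by (simp add: S_def)
  qed
  have Y: "ec (U t) (Inl j) = (\<Sum>l<dim. Q j l * of_real (Xr (U t) l))" if "j < dim" for t j
  proof -
    have "(\<Sum>l<dim. Q j l * of_real (Xr (U t) l)) = (\<Sum>l<dim. Q j l * complex_of_real (X t l))"
      by (intro sum.cong refl) (simp only: Xr lessThan_iff)
    then show ?thesis using that by (simp only: U ec_join if_True)
  qed
  show "modal_solution {0..t0} U (\<lambda>t. F R (U t) + zr t *\<^sub>R Gz)"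
    unfolding modal_solution_def S_def[symmetric]
  proof (intro conjI allI ballI)
    show "continuous_on S U" by (rule Uc')
    show "continuous_on S (\<lambda>t. F R (U t) + zr t *\<^sub>R Gz)" by (intro continuous_intros FUc zrS)
    fix i t assume t: "t \<in> S"
    then have tJ: "t \<in> J" using sub by blast
    show "((\<lambda>t. ec (U t) i) has_vector_derivative m i * ec (U t) i + ec (F R (U t) + zr t *\<^sub>R Gz) i) (at t within S)"
    proof (cases i)
      case (Inl j)
      show ?thesis
      proof (cases "j < dim")
        case True
        have "((\<lambda>t. \<Sum>i<dim. Q j i * of_real (X t i)) has_vector_derivative (\<Sum>i<dim. Q j i * complex_of_real (X' t i))) (at t within S)"
          by (intro has_vector_derivative_sum has_vector_derivative_mult_right
              bounded_linear.has_vector_derivative[OF bounded_linear_of_real] has_vector_derivative_within_subset[OF Xd[OF tJ] sub]) auto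
        also have "(\<Sum>i<dim. Q j i * complex_of_real (X' t i)) = (\<Sum>i<dim. Q j i * of_real (Xd R (U t) (zr t) i))"
          by (intro sum.cong refl) (simp only: X'eq[OF t] lessThan_iff)
        also have "\<dots> = \<mu> j * ec (U t) (Inl j) + (lowF R (U t) j - of_real (zr t) * Q j (2 * n0 + 2))"
          by (rule sum_Q_Xd[OF Y True])
        also have "\<dots> = m i * ec (U t) i + ec (F R (U t) + zr t *\<^sub>R Gz) i"
          using True by (simp add: Inl m_def F_def Gz_def ec_join scaleR_conv_of_real)
        finally show ?thesis using True by (simp only: Inl U ec_join if_True)
      qed (simp add: Inl m_def F_def Gz_def ec_join U)
    next
      case (Inr k)
      show ?thesis
      proof (cases "k \<in> High")
        case True
        have "((\<lambda>t. ec (c t) k) has_vector_derivative ec (c' t) k) (at t within S)"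
          by (rule bounded_linear.has_vector_derivative[OF bounded_linear_ec has_vector_derivative_within_subset[OF cd[OF tJ] sub]])
        also have "ec (c' t) k = lam k * ec (c t) k + ec (highF R (U t)) k"
        proof -
          have "v' t = KX (Xr (U t))"
            using X'eq[OF t, of 0] by (simp add: X'_def Xd_def AK_rows(1) qv_def)
          moreover have "v t = Xr (U t) 0" using Xr[of 0 t] X(1)[of t] by simp
          moreover have "r t = Nres R (cU (U t))" using cU[OF tJ] by (simp add: r_def c_def)
          ultimately show ?thesis
            using True by (simp add: c'eq[OF t] highF_def eh[OF tJ] gen_def c_def ec_cf Wh[OF tJ])
        qed
        finally show ?thesis using True
          by (simp add: Inr U ec_join m_def F_def Gz_def c_def)
      qed (simp add: Inr m_def F_def Gz_def ec_join U)
    qed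
  qed
qed

end

section \<open>Exponential stability\<close>

text \<open>An almost everywhere bound on a continuous function holds on a closed set. This set
  contains the open half-line, where a closed condition valid almost everywhere is valid everywhere,
  and hence also its closure, including time 0.\<close>

lemma abs_le_of_Linf_norm:
  assumes zr: "continuous_on {0..} zr" and L: "(Linf_norm {0..} zr)\<^sup>2 \<le> ereal \<delta>" and t: "0 \<le> t"
  shows "\<bar>zr t\<bar> \<le> sqrt \<delta>"
proof -
  obtain r where r: "Linf_norm {0..} zr = ereal r"
    using L by (cases "Linf_norm {0..} zr") (auto simp: power2_eq_square)
  have r2: "r\<^sup>2 \<le> \<delta>" using L by (simp add: r)
  have rs: "r \<le> sqrt \<delta>" by (rule real_le_rsqrt[OF r2])
  have "AE x in lebesgue_on {0..}. ereal \<bar>zr x\<bar> \<le> ereal r"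
    using esssup_AE[where M = "lebesgue_on {0..}" and f = "\<lambda>x. ereal \<bar>zr x\<bar>"] r by (simp add: Linf_norm_def)
  then have ae: "AE x in lebesgue. x \<in> {0..} \<longrightarrow> \<bar>zr x\<bar> \<le> r"
    by (simp add: AE_restrict_space_iff)
  define C where "C = {x \<in> {0..}. \<bar>zr x\<bar> \<le> sqrt \<delta>}"
  have C: "closed C"
  proof -
    have "closed ({0..} \<inter> (\<lambda>x. \<bar>zr x\<bar>) -` {..sqrt \<delta>})"
      by (intro continuous_closed_preimage continuous_intros zr)
    moreover have "C = {0..} \<inter> (\<lambda>x. \<bar>zr x\<bar>) -` {..sqrt \<delta>}" by (auto simp: C_def)
    ultimately show ?thesis by simp
  qed
  have "AE x \<in> {0<..} in lebesgue. x \<in> C"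
    using ae by eventually_elim (use rs in \<open>auto simp: C_def\<close>)
  from mem_closed_if_AE_lebesgue_open[OF _ C this]
  have "{0<..} \<subseteq> C" by (meson open_greaterThan subsetI)
  then have "closure {0<..} \<subseteq> C" using C by (rule closure_minimal)
  then have "t \<in> C" using t by auto
  then show ?thesis by (simp add: C_def)
qed

lemma Linf_norm_le:
  assumes u: "continuous_on {0..L} u" and b: "\<And>x. x \<in> {0..L} \<Longrightarrow> \<bar>u x\<bar> \<le> R"
  shows "Linf_norm {0<..<L} u \<le> ereal R"
  unfolding Linf_norm_def
proof (rule esssup_I)
  have "continuous_on {0<..<L} (\<lambda>x. \<bar>u x\<bar>)" by (intro continuous_intros continuous_on_subset[OF u]) auto
  from continuous_imp_measurable_on_sets_lebesgue[OF this]
  show "(\<lambda>x. ereal \<bar>u x\<bar>) \<in> borel_measurable (lebesgue_on {0<..<L})" by simp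
  have "AE x in lebesgue_on {0<..<L}. x \<in> {0<..<L}" using AE_space[of "lebesgue_on {0<..<L}"] by simp
  then show "AE x in lebesgue_on {0<..<L}. ereal \<bar>u x\<bar> \<le> ereal R"
    by eventually_elim (simp add: b)
qed

lemma C1_on_continuous: "C1_on S g \<Longrightarrow> continuous_on S g"
  unfolding C1_on_def by (metis DERIV_continuous_on)

context wave_modal
begin

lemma Nres_clamp_inactive:
  assumes "\<And>x. x \<in> {0..L} \<Longrightarrow> \<bar>w1 c x\<bar> \<le> R" "R \<le> R'"
  shows "Nres R c = Nres R' c"
proof -
  have h: "res_state (\<lambda>x. rho x (clamp r (w1 c x))) \<in> hspace L" for r
    by (intro res_state_hspace rho_clamp_cont w1_cont)
  have "clamp R (w1 c x) = clamp R' (w1 c x)" if "x \<in> {0..L}" for x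
    using assms(1)[OF that] assms(2) by (simp add: clamp_def)
  then have eq: "\<forall>x\<in>{0..L}. rho x (clamp R (w1 c x)) = rho x (clamp R' (w1 c x))" by simp
  have "AE x in lebesgue_on {0..L}. x \<in> {0..L}" using AE_space[of "lebesgue_on {0..L}"] by simp
  then have "AE x in lebesgue_on {0..L}. rho x (clamp R (w1 c x)) = rho x (clamp R' (w1 c x))"
    by eventually_elim (use eq in blast)
  then have "heq L (res_state (\<lambda>x. rho x (clamp R (w1 c x)))) (res_state (\<lambda>x. rho x (clamp R' (w1 c x))))"
    by (simp add: heq_def res_state_def)
  then show ?thesis
    unfolding Nres_def by (intro ell2_eqI) (simp only: ec_cf[OF h] coef_heq h)
qed

lemma F_clamp_inactive:
  assumes "\<And>x. x \<in> {0..L} \<Longrightarrow> \<bar>w1 (cU U) x\<bar> \<le> R" "R \<le> R'"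
  shows "F R U = F R' U"
  using Nres_clamp_inactive[OF assms] by (simp add: F_def lowF_def[abs_def] highF_def)

definition Kc :: real where "Kc = card Low * (dim * \<sigma>) + 1"

lemma Kc_pos: "0 < Kc" using \<sigma>_nonneg by (simp add: Kc_def add_nonneg_pos)

lemma w1_cU_le: "x \<in> {0..L} \<Longrightarrow> \<bar>w1 (cU U) x\<bar> \<le> Cw * Kc * norm U"
  using order_trans[OF w1_le mult_left_mono[OF norm_cU[of U] Cw_nonneg]] by (simp add: Kc_def mult.assoc)

lemma norm_coords_le:
  obtains C where "0 \<le> C"
    "\<And>u \<xi> v. cstate u \<in> hspace L \<Longrightarrow> norm (coords u \<xi> v) \<le> C * (hnorm L (cstate u) + \<bar>\<xi>\<bar> + \<bar>v\<bar>)"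
proof -
  define CQ where "CQ = (\<Sum>j<dim. \<Sum>i<dim. cmod (Q j i))"
  have CQ: "0 \<le> CQ" by (auto simp: CQ_def intro!: sum_nonneg)
  have Cd0: "0 \<le> Cd" using Cd(1) by simp
  show thesis
  proof (rule that[of "CQ * (Cd + 1) + Cd"])
    show "0 \<le> CQ * (Cd + 1) + Cd" using CQ Cd0 by simp
    fix u \<xi> v assume u: "cstate u \<in> hspace L"
    define E where "E = hnorm L (cstate u) + \<bar>\<xi>\<bar> + \<bar>v\<bar>"
    have hn: "0 \<le> hnorm L (cstate u)" by (rule hnorm_nonneg[OF u])
    have cf: "norm (cf (cstate u)) \<le> Cd * E"
      by (rule order_trans[OF norm_cf_le[OF u] mult_left_mono]) (use hn Cd0 in \<open>auto simp: E_def\<close>)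
    have x: "\<bar>cX u \<xi> v i\<bar> \<le> (Cd + 1) * E" for i
    proof -
      have "\<bar>Re (coef (cstate u) k)\<bar> \<le> Cd * E" for k
        using order_trans[OF abs_Re_le_cmod cmod_ec_le[of "cf (cstate u)" k]] cf by (simp add: ec_cf u)
      moreover have "0 \<le> Cd * E" "\<bar>\<xi>\<bar> \<le> E" "\<bar>v\<bar> \<le> E" using hn Cd0 by (auto simp: E_def)
      ultimately show ?thesis by (auto simp: cX_def distrib_right intro: add_increasing add_increasing2 order_trans)
    qed
    have "norm (coords u \<xi> v) \<le> (\<Sum>j<dim. cmod (\<Sum>i<dim. Q j i * of_real (cX u \<xi> v i))) + norm (ell2_trunc High (cf (cstate u)))"
      unfolding coords_def by (rule norm_join)
    also have "\<dots> \<le> (\<Sum>j<dim. \<Sum>i<dim. cmod (Q j i) * ((Cd + 1) * E)) + Cd * E"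
    proof (intro add_mono sum_mono order_trans[OF norm_ell2_trunc cf] order_trans[OF norm_sum])
      fix j i show "cmod (Q j i * of_real (cX u \<xi> v i)) \<le> cmod (Q j i) * ((Cd + 1) * E)"
        unfolding norm_mult norm_of_real by (rule mult_left_mono[OF x]) simp
    qed
    also have "\<dots> = (CQ * (Cd + 1) + Cd) * E"
      by (simp only: CQ_def sum_distrib_right distrib_right mult.assoc)
    finally show "norm (coords u \<xi> v) \<le> (CQ * (Cd + 1) + Cd) * (hnorm L (cstate u) + \<bar>\<xi>\<bar> + \<bar>v\<bar>)" by (simp only: E_def)
  qed
qed

lemma coords_cong:
  assumes "cstate u \<in> hspace L" "cstate u' \<in> hspace L" "heq L (cstate u) (cstate u')"
  shows "coords u \<xi> v = coords u' \<xi> v"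
proof -
  have c: "coef (cstate u) = coef (cstate u')"
    by (rule ext) (rule coef_heq[OF assms(3,1,2)])
  then have "cf (cstate u) = cf (cstate u')" by (intro ell2_eqI) (simp add: ec_cf assms)
  then show ?thesis by (simp only: coords_def cX_def c)
qed

text \<open>Two solutions are compared with a clamping level so high that it affects neither of them on \<open>[0,t]\<close>.\<close>

lemma solution_unique:
  assumes sol: "modal_solution {0..} U (\<lambda>t. F R (U t) + zr t *\<^sub>R Gz)"
    and R: "0 \<le> R" "\<And>t x. 0 \<le> t \<Longrightarrow> x \<in> {0..L} \<Longrightarrow> \<bar>w1 (cU (U t)) x\<bar> \<le> R"
    and zr: "C1_on {0..} zr" and W0: "cstate W0 \<in> domA L \<alpha>" and U0: "U 0 = coords W0 \<xi>0 v0"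
    and W: "solution_from L \<alpha> f ye n0 e d lam K zr W0 \<xi>0 v0 T W \<zeta> v" and t: "0 \<le> t" "ereal t < T"
  shows "U t = coords (W t) (xi L n0 e d lam (W t) (\<zeta> t)) (v t)"
proof -
  let ?V = "\<lambda>t. coords (W t) (xi L n0 e d lam (W t) (\<zeta> t)) (v t)"
  have cl: "classical_solution L \<alpha> f ye n0 e d lam K zr T W \<zeta> v"
    and init: "heq L (cstate (W 0)) (cstate W0)" "xi L n0 e d lam (W 0) (\<zeta> 0) = \<xi>0" "v 0 = v0"
    using W by (simp_all add: solution_from_def)
  have T: "0 < T" using cl by (simp add: classical_solution_def)
  have dom: "cstate (W s) \<in> domA L \<alpha>" if "0 \<le> s" "ereal s < T" for s
    using cl that unfolding classical_solution_def Let_def by blast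
  have dom0: "cstate (W 0) \<in> domA L \<alpha>" by (rule dom) (use T in \<open>auto simp: zero_ereal_def\<close>)
  have V0: "U 0 = ?V 0"
    using coords_cong[OF domA_hspace[OF dom0] domA_hspace[OF W0] init(1)] by (simp add: U0 init)
  show ?thesis
  proof (cases "t = 0")
    case True
    then show ?thesis by (simp only: V0)
  next
    case False
    then have t0: "0 < t" using t by simp
    note M = classical_imp_modal[OF cl zr]
    \<comment> \<open>The competing solution is bounded on a compact time interval before any
      clamping level is involved; the level \<open>R'\<close> is then taken above that
      bound.\<close>
    have "continuous_on {0..t} ?V"
      by (rule continuous_on_subset[OF M(1)]) (use t in \<open>auto intro: le_less_trans[of "ereal _" "ereal t"]\<close>)
    then have "bounded (?V ` {0..t})" by (intro compact_imp_bounded compact_continuous_image) auto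
    then obtain B where "\<forall>y\<in>?V ` {0..t}. norm y \<le> B" by (auto simp only: bounded_iff)
    then have B: "norm (?V s) \<le> B" if "s \<in> {0..t}" for s using that by blast
    define R' where "R' = max R (Cw * Kc * B)"
    have R': "0 \<le> R'" "R \<le> R'" using R(1) by (auto simp: R'_def)
    have VR: "\<bar>w1 (cU (?V s)) x\<bar> \<le> R'" if "s \<in> {0..t}" "x \<in> {0..L}" for s x
    proof -
      have "Cw * Kc * norm (?V s) \<le> Cw * Kc * B"
        using B[OF that(1)] Cw_nonneg Kc_pos by (intro mult_left_mono) auto
      then show ?thesis using w1_cU_le[OF that(2), of "?V s"] by (simp add: R'_def)
    qed
    have sV: "modal_solution {0..t} ?V (\<lambda>t. F R' (?V t) + zr t *\<^sub>R Gz)"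
      by (rule M(2)) (use t t0 VR R' in auto)
    have sU: "modal_solution {0..t} U (\<lambda>t. F R (U t) + zr t *\<^sub>R Gz)"
      by (rule modal_solution_subset[OF sol]) auto
    obtain LB where LB: "\<And>U U'. norm (F R' U - F R' U') \<le> (LA + LB * R') * norm (U - U')"
      using F_lipschitz[of R'] R' by (metis order_refl)
    show ?thesis
    proof (rule modal_solution_unique[OF sU sV t(1) V0, of "\<bar>LA + LB * R'\<bar>"])
      fix s assume s: "s \<in> {0..t}"
      have "F R (U s) = F R' (U s)" by (rule F_clamp_inactive[OF R(2) R'(2)]) (use s in auto)
      then have "norm (F R (U s) + zr s *\<^sub>R Gz - (F R' (?V s) + zr s *\<^sub>R Gz)) = norm (F R' (U s) - F R' (?V s))" by simp
      also have "\<dots> \<le> (LA + LB * R') * norm (U s - ?V s)" by (rule LB)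
      also have "\<dots> \<le> \<bar>LA + LB * R'\<bar> * norm (U s - ?V s)" by (rule mult_right_mono) auto
      finally show "norm (F R (U s) + zr s *\<^sub>R Gz - (F R' (?V s) + zr s *\<^sub>R Gz)) \<le> \<bar>LA + LB * R'\<bar> * norm (U s - ?V s)" .
    qed simp
  qed
qed

text \<open>The Lipschitz bound \<open>w / 2\<close> leaves the rate \<open>w / 2\<close>. The
  kernel acting on the reference signal is split: the fraction \<open>\<eta>\<close> of the exponent
  weights the supremum, and the rest is integrated.\<close>

lemma modal_decay:
  assumes sol: "modal_solution {0..} U (\<lambda>t. F R (U t) + zr t *\<^sub>R Gz)" and R: "0 \<le> R"
    and lip: "\<And>U U'. norm (F R U - F R U') \<le> w / 2 * norm (U - U')"
    and zr: "continuous_on {0..} zr" and t: "0 \<le> t" and eta: "0 \<le> \<eta>" "\<eta> < 1"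
    and M: "\<And>s. s \<in> {0..t} \<Longrightarrow> exp (- (\<eta> * (w / 2) * (t - s))) * \<bar>zr s\<bar> \<le> M"
  shows "norm (U t) \<le> exp (- (w / 2) * t) * norm (U 0) + norm Gz * M / ((1 - \<eta>) * (w / 2))"
proof -
  \<comment> \<open>The part of the rate left for integration; \<open>1 / a\<close> is the source of
    the dependence on \<open>\<eta>\<close>.\<close>
  define a where "a = (1 - \<eta>) * (w / 2)"
  have a: "a > 0" using eta w by (simp add: a_def)
  have M0: "0 \<le> M" using M[of t] t by (auto intro: order_trans[OF abs_ge_zero])
  have zr': "continuous_on {0..t} zr" by (rule continuous_on_subset[OF zr]) auto
  have "norm (U t) \<le> exp (- (w - w / 2) * t) * norm (U 0) +
      integral {0..t} (\<lambda>s. exp (- (w - w / 2) * (t - s)) * (norm Gz * \<bar>zr s\<bar>))"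
  proof (rule modal_solution_gronwall[OF modal_solution_subset[OF sol] t])
    show "norm (F R (U s) + zr s *\<^sub>R Gz) \<le> w / 2 * norm (U s) + norm Gz * \<bar>zr s\<bar>" for s
      using lip[of "U s" 0] norm_triangle_ineq[of "F R (U s)" "zr s *\<^sub>R Gz"] by (simp add: F_zero[OF R] mult.commute)
  qed (use w in \<open>auto intro!: continuous_intros zr'\<close>)
  also have "integral {0..t} (\<lambda>s. exp (- (w - w / 2) * (t - s)) * (norm Gz * \<bar>zr s\<bar>)) \<le>
      integral {0..t} (\<lambda>s. exp (- a * (t - s)) * (norm Gz * M))"
  proof (rule integral_le)
    fix s assume s: "s \<in> {0..t}"
    have "exp (- (w - w / 2) * (t - s)) * (norm Gz * \<bar>zr s\<bar>) =
        exp (- a * (t - s)) * (norm Gz * (exp (- (\<eta> * (w / 2) * (t - s))) * \<bar>zr s\<bar>))"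
      by (simp add: a_def field_simps flip: exp_add)
    also have "\<dots> \<le> exp (- a * (t - s)) * (norm Gz * M)" by (intro mult_left_mono M s) auto
    finally show "exp (- (w - w / 2) * (t - s)) * (norm Gz * \<bar>zr s\<bar>) \<le> exp (- a * (t - s)) * (norm Gz * M)" .
  qed (auto intro!: integrable_continuous_interval continuous_intros zr')
  also have "\<dots> = (1 - exp (- a * t)) / a * (norm Gz * M)"
    by (rule integral_unique[OF has_integral_mult_left[OF has_integral_exp_decay]]) (use a t in auto)
  also have "\<dots> \<le> 1 / a * (norm Gz * M)" using a M0 by (intro mult_right_mono divide_right_mono) auto
  finally show ?thesis by (simp add: a_def mult_ac)
qed

end

lemma sq_sum3_le: "(a + b + c)\<^sup>2 \<le> 3 * (a\<^sup>2 + b\<^sup>2 + (c::real)\<^sup>2)"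
  using sum_squares_bound[of a b] sum_squares_bound[of a c] sum_squares_bound[of b c]
  by (simp add: power2_eq_square algebra_simps)

lemma sq_sum2_le: "(a + b)\<^sup>2 \<le> 2 * a\<^sup>2 + 2 * (b::real)\<^sup>2"
  using sum_squares_bound[of a b] by (simp add: power2_eq_square algebra_simps)

context wave_modal
begin

lemma closed_loop_stability:
  assumes LA: "LA \<le> w / 4"
  shows "\<exists>\<kappa> C1 \<delta>. 0 < \<kappa> \<and> \<kappa> < 1 \<and> C1 > 0 \<and> \<delta> > 0 \<and>
    (\<forall>\<eta>. 0 \<le> \<eta> \<and> \<eta> < 1 \<longrightarrow> (\<exists>C2>0.
      \<forall>(W0 :: rstate) (\<xi>0 :: real) (v0 :: real) (zr :: real \<Rightarrow> real).
        cstate W0 \<in> domA L \<alpha> \<longrightarrow>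
        (hnorm L (cstate W0))\<^sup>2 + \<bar>\<xi>0\<bar>\<^sup>2 + \<bar>v0\<bar>\<^sup>2 \<le> \<delta> \<longrightarrow>
        C1_on {0..} zr \<longrightarrow>
        (Linf_norm {0..} zr)\<^sup>2 \<le> ereal \<delta> \<longrightarrow>
        (\<exists>W \<zeta> v.
          maximal_solution L \<alpha> f ye n0 e d lam K zr W0 \<xi>0 v0 \<infinity> W \<zeta> v \<and>
          (\<forall>t\<ge>0.
            Linf_norm {0<..<L} (fst (W t)) < 1 \<and>
            (hnorm L (cstate (W t)))\<^sup>2 + \<bar>xi L n0 e d lam (W t) (\<zeta> t)\<bar>\<^sup>2 + \<bar>v t\<bar>\<^sup>2
              \<le> C1 * exp (- 2 * \<kappa> * t) * ((hnorm L (cstate W0))\<^sup>2 + \<bar>\<xi>0\<bar>\<^sup>2 + \<bar>v0\<bar>\<^sup>2)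
                + C2 * (SUP s\<in>{0..t}. exp (- 2 * \<eta> * \<kappa> * (t - s)) * \<bar>zr s\<bar>\<^sup>2)))))"
proof -
  obtain LB where LB: "LB \<ge> 0"
    "\<And>R U U'. 0 \<le> R \<Longrightarrow> R \<le> 1 \<Longrightarrow> norm (F R U - F R U') \<le> (LA + LB * R) * norm (U - U')"
    using F_lipschitz[of 1] by metis
  \<comment> \<open>The level \<open>1 / 2\<close> gives the strict bound on w1; the other one
    limits the share of the residual to \<open>LB * R \<le> w / 4\<close>.\<close>
  define R where "R = min (1 / 2) (w / (4 * (LB + 1)))"
  have R: "0 < R" "R < 1" using w LB(1) by (auto simp: R_def)
  have LBR: "LB * R \<le> w / 4"
  proof -
    have "LB * R \<le> (LB + 1) * (w / (4 * (LB + 1)))" using LB(1) R by (intro mult_mono) (auto simp: R_def)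
    also have "\<dots> = w / 4" using LB(1) by (simp add: field_simps)
    finally show ?thesis .
  qed
  have lip: "norm (F R U - F R U') \<le> w / 2 * norm (U - U')" for U U'
    by (rule order_trans[OF LB(2) mult_right_mono]) (use R LA LBR in auto)
  obtain Cu where Cu: "0 \<le> Cu"
    "\<And>u \<xi> v. cstate u \<in> hspace L \<Longrightarrow> norm (coords u \<xi> v) \<le> Cu * (hnorm L (cstate u) + \<bar>\<xi>\<bar> + \<bar>v\<bar>)"
    using norm_coords_le by metis
  define \<kappa> where "\<kappa> = w / 2"
  have k: "0 < \<kappa>" "\<kappa> < 1" using w by (auto simp: \<kappa>_def)
  \<comment> \<open>\<open>D * q\<close> will bound \<open>U\<close> for all times when data and
    reference are of size \<open>q\<close>: the factor \<open>sqrt 3\<close> comes from summing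
    three squares, and the last term is the response to the reference with
    \<open>\<eta> = 0\<close>.\<close>
  define D where "D = Cu * sqrt 3 + norm Gz / \<kappa>"
  have D: "0 \<le> D" using Cu k by (simp add: D_def)
  \<comment> \<open>Chosen so that \<open>Cw * Kc * (D * q) \<le> R\<close>, which keeps the clamp
    inactive; \<open>\<delta>\<close> is \<open>q\<^sup>2\<close>, and the added \<open>1\<close>
    excludes a zero denominator.\<close>
  define q where "q = R / (Cw * Kc * D + 1)"
  have CwK: "0 \<le> Cw * Kc * D" using Cw_nonneg Kc_pos D by simp
  have q: "0 < q" using R CwK by (simp add: q_def add_nonneg_pos)
  have qR: "Cw * Kc * (D * q) \<le> R"
  proof -
    have "Cw * Kc * (D * q) \<le> (Cw * Kc * D + 1) * q" using q by (simp add: algebra_simps)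
    also have "\<dots> = R" using CwK by (simp add: q_def)
    finally show ?thesis .
  qed
  \<comment> \<open>Back from \<open>U\<close> to the energy: one term for W, two equal ones for
    \<xi> and v.\<close>
  define Cv where "Cv = (Ce * Kc)\<^sup>2 + 2 * (dim * \<sigma>)\<^sup>2"
  have Cv: "0 \<le> Cv" by (simp add: Cv_def)
  \<comment> \<open>The factor 2 comes from squaring a sum of two terms, the factor 3 from the
    initial norm; the added \<open>1\<close> makes the constant positive.\<close>
  define C1 where "C1 = Cv * 2 * (3 * Cu\<^sup>2) + 1"
  have C1: "C1 > 0" using Cv by (simp add: C1_def add_nonneg_pos)
  show ?thesis
  proof (rule exI[of _ \<kappa>], rule exI[of _ C1], rule exI[of _ "q\<^sup>2"], intro conjI allI impI)
    fix \<eta> :: real assume eta: "0 \<le> \<eta> \<and> \<eta> < 1"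
    define C3 where "C3 = norm Gz / ((1 - \<eta>) * \<kappa>)"
    define C2 where "C2 = Cv * 2 * C3\<^sup>2 + 1"
    have C2: "C2 > 0" using Cv by (simp add: C2_def add_nonneg_pos)
    show "\<exists>C2>0.
      \<forall>(W0 :: rstate) (\<xi>0 :: real) (v0 :: real) (zr :: real \<Rightarrow> real).
        cstate W0 \<in> domA L \<alpha> \<longrightarrow>
        (hnorm L (cstate W0))\<^sup>2 + \<bar>\<xi>0\<bar>\<^sup>2 + \<bar>v0\<bar>\<^sup>2 \<le> q\<^sup>2 \<longrightarrow>
        C1_on {0..} zr \<longrightarrow>
        (Linf_norm {0..} zr)\<^sup>2 \<le> ereal (q\<^sup>2) \<longrightarrow>
        (\<exists>W \<zeta> v.
          maximal_solution L \<alpha> f ye n0 e d lam K zr W0 \<xi>0 v0 \<infinity> W \<zeta> v \<and>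
          (\<forall>t\<ge>0.
            Linf_norm {0<..<L} (fst (W t)) < 1 \<and>
            (hnorm L (cstate (W t)))\<^sup>2 + \<bar>xi L n0 e d lam (W t) (\<zeta> t)\<bar>\<^sup>2 + \<bar>v t\<bar>\<^sup>2
              \<le> C1 * exp (- 2 * \<kappa> * t) * ((hnorm L (cstate W0))\<^sup>2 + \<bar>\<xi>0\<bar>\<^sup>2 + \<bar>v0\<bar>\<^sup>2)
                + C2 * (SUP s\<in>{0..t}. exp (- 2 * \<eta> * \<kappa> * (t - s)) * \<bar>zr s\<bar>\<^sup>2)))"
    proof (rule exI[of _ C2], intro conjI C2 allI impI)
      fix W0 :: rstate and \<xi>0 v0 :: real and zr :: "real \<Rightarrow> real"
      assume W0: "cstate W0 \<in> domA L \<alpha>" and small: "(hnorm L (cstate W0))\<^sup>2 + \<bar>\<xi>0\<bar>\<^sup>2 + \<bar>v0\<bar>\<^sup>2 \<le> q\<^sup>2"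
        and zr: "C1_on {0..} zr" and zq: "(Linf_norm {0..} zr)\<^sup>2 \<le> ereal (q\<^sup>2)"
      define E0 where "E0 = (hnorm L (cstate W0))\<^sup>2 + \<bar>\<xi>0\<bar>\<^sup>2 + \<bar>v0\<bar>\<^sup>2"
      have W0h: "cstate W0 \<in> hspace L" by (rule domA_hspace[OF W0])
      have zc: "continuous_on {0..} zr" by (rule C1_on_continuous[OF zr])
      have zb: "\<bar>zr s\<bar> \<le> q" if "0 \<le> s" for s
        using abs_le_of_Linf_norm[OF zc zq that] q by simp
      obtain U where sol: "modal_solution {0..} U (\<lambda>t. F R (U t) + zr t *\<^sub>R Gz)" and U0: "U 0 = coords W0 \<xi>0 v0"
      proof -
        have "continuous_on {0..} (\<lambda>t. zr t *\<^sub>R Gz)" by (intro continuous_intros zc)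
        moreover have "norm (zr t *\<^sub>R Gz) \<le> q * norm Gz" if "0 \<le> t" for t
          using mult_right_mono[OF zb[OF that] norm_ge_zero[of Gz]] by simp
        ultimately show thesis
          using semilinear_solution_exists[of "F R" "w / 2" "\<lambda>t. zr t *\<^sub>R Gz" "q * norm Gz" "coords W0 \<xi>0 v0"] lip w that
          by auto
      qed
      have nU0: "(norm (U 0))\<^sup>2 \<le> 3 * Cu\<^sup>2 * E0"
      proof -
        have "(norm (U 0))\<^sup>2 \<le> (Cu * (hnorm L (cstate W0) + \<bar>\<xi>0\<bar> + \<bar>v0\<bar>))\<^sup>2"
          unfolding U0 by (rule power_mono[OF Cu(2)[OF W0h]]) simp
        also have "\<dots> \<le> Cu\<^sup>2 * (3 * E0)"
          unfolding power_mult_distrib E0_def by (intro mult_left_mono sq_sum3_le) simp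
        finally show ?thesis by simp
      qed
      have decay: "norm (U t) \<le> exp (- \<kappa> * t) * norm (U 0) + norm Gz * M / ((1 - \<theta>) * \<kappa>)"
        if "0 \<le> t" "0 \<le> \<theta>" "\<theta> < 1" "\<And>s. s \<in> {0..t} \<Longrightarrow> exp (- (\<theta> * \<kappa> * (t - s))) * \<bar>zr s\<bar> \<le> M" for t \<theta> M
        using modal_decay[OF sol _ lip zc that(1-3), of M] that(4) R by (simp add: \<kappa>_def)
      have Ub: "norm (U t) \<le> D * q" if t: "0 \<le> t" for t
      proof -
        have "norm (U 0) \<le> Cu * sqrt 3 * q"
        proof (rule power2_le_imp_le)
          have "(norm (U 0))\<^sup>2 \<le> 3 * Cu\<^sup>2 * q\<^sup>2"
            by (rule order_trans[OF nU0 mult_left_mono]) (use small in \<open>auto simp: E0_def\<close>)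
          then show "(norm (U 0))\<^sup>2 \<le> (Cu * sqrt 3 * q)\<^sup>2" by (simp add: power_mult_distrib mult_ac)
        qed (use Cu q in simp)
        moreover have "exp (- \<kappa> * t) * norm (U 0) \<le> 1 * norm (U 0)"
          using k t by (intro mult_right_mono) auto
        \<comment> \<open>The uniform bound uses exponent 0 instead of the given
          \<open>\<eta>\<close>, so that \<open>\<delta>\<close> does not depend on
          \<open>\<eta>\<close>.\<close>
        moreover have "norm (U t) \<le> exp (- \<kappa> * t) * norm (U 0) + norm Gz * q / ((1 - 0) * \<kappa>)"
          by (rule decay) (use t zb in auto)
        ultimately show ?thesis by (simp add: D_def distrib_right)
      qed
      have w1R: "\<bar>w1 (cU (U t)) x\<bar> \<le> R" if "0 \<le> t" "x \<in> {0..L}" for t x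
      proof -
        have "Cw * Kc * norm (U t) \<le> Cw * Kc * (D * q)"
          using Ub[OF that(1)] Cw_nonneg Kc_pos by (intro mult_left_mono) auto
        then show ?thesis using w1_cU_le[OF that(2), of "U t"] qR by linarith
      qed
      have R0: "0 \<le> R" using R by simp
      have cU0: "cU (U 0) = cf (cstate W0)" unfolding U0 by (rule cU_coords[OF W0h])
      have X0: "Xr (U 0) (2 * n0 + 2) = \<xi>0" "Xr (U 0) 0 = v0"
        unfolding U0 by (subst Xr_coords; simp add: cX_def)+
      obtain W \<zeta> v where
        W: "solution_from L \<alpha> f ye n0 e d lam K zr W0 \<xi>0 v0 \<infinity> W \<zeta> v"
        "\<And>t. 0 \<le> t \<Longrightarrow> cstate (W t) \<in> domA L \<alpha> \<and> cf (cstate (W t)) = cU (U t) \<and>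
          xi L n0 e d lam (W t) (\<zeta> t) = Xr (U t) (2 * n0 + 2) \<and> v t = Xr (U t) 0"
        using modal_imp_classical[OF sol R0 w1R zr W0 cU0] unfolding X0 by blast
      have Wh: "cstate (W t) \<in> hspace L" if "0 \<le> t" for t using W(2)[OF that] domA_hspace by blast
      show "\<exists>W \<zeta> v.
          maximal_solution L \<alpha> f ye n0 e d lam K zr W0 \<xi>0 v0 \<infinity> W \<zeta> v \<and>
          (\<forall>t\<ge>0.
            Linf_norm {0<..<L} (fst (W t)) < 1 \<and>
            (hnorm L (cstate (W t)))\<^sup>2 + \<bar>xi L n0 e d lam (W t) (\<zeta> t)\<bar>\<^sup>2 + \<bar>v t\<bar>\<^sup>2
              \<le> C1 * exp (- 2 * \<kappa> * t) * ((hnorm L (cstate W0))\<^sup>2 + \<bar>\<xi>0\<bar>\<^sup>2 + \<bar>v0\<bar>\<^sup>2)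
                + C2 * (SUP s\<in>{0..t}. exp (- 2 * \<eta> * \<kappa> * (t - s)) * \<bar>zr s\<bar>\<^sup>2))"
      proof (rule exI[of _ W], rule exI[of _ \<zeta>], rule exI[of _ v], rule conjI)
        show "maximal_solution L \<alpha> f ye n0 e d lam K zr W0 \<xi>0 v0 \<infinity> W \<zeta> v"
          unfolding maximal_solution_def
        proof (intro conjI W(1) allI impI)
          fix T' :: ereal and W' \<zeta>' v' t
          assume s': "solution_from L \<alpha> f ye n0 e d lam K zr W0 \<xi>0 v0 T' W' \<zeta>' v'"
          show "T' \<le> \<infinity>" by simp
          assume t': "0 \<le> t \<and> ereal t < T'"
          then have t: "0 \<le> t" "ereal t < T'" by auto
          have h': "cstate (W' t) \<in> hspace L"
            using s' t domA_hspace unfolding solution_from_def classical_solution_def Let_def by blast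
          have Ueq: "U t = coords (W' t) (xi L n0 e d lam (W' t) (\<zeta>' t)) (v' t)"
            by (rule solution_unique[OF sol R0 w1R zr W0 U0 s' t])
          have c: "cf (cstate (W' t)) = cf (cstate (W t))"
            using arg_cong[OF Ueq, of cU] W(2)[OF t(1)] by (simp add: cU_coords[OF h'])
          show "heq L (cstate (W' t)) (cstate (W t))" by (rule heq_of_cf_eq[OF h' Wh[OF t(1)] c])
          show "v' t = v t"
            using arg_cong[OF Ueq, of "\<lambda>U. Xr U 0"] W(2)[OF t(1)] by (simp add: Xr_coords cX_def)
          have "xi L n0 e d lam (W' t) (\<zeta>' t) = xi L n0 e d lam (W t) (\<zeta> t)"
            using arg_cong[OF Ueq, of "\<lambda>U. Xr U (2 * n0 + 2)"] W(2)[OF t(1)] Xr_coords[of "2 * n0 + 2"] by (simp add: cX_def)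
          then show "\<zeta>' t = \<zeta> t"
            using tail_sum_eq[OF h'] tail_sum_eq[OF Wh[OF t(1)]] by (simp add: xi_def c)
        qed
        show "\<forall>t\<ge>0.
            Linf_norm {0<..<L} (fst (W t)) < 1 \<and>
            (hnorm L (cstate (W t)))\<^sup>2 + \<bar>xi L n0 e d lam (W t) (\<zeta> t)\<bar>\<^sup>2 + \<bar>v t\<bar>\<^sup>2
              \<le> C1 * exp (- 2 * \<kappa> * t) * ((hnorm L (cstate W0))\<^sup>2 + \<bar>\<xi>0\<bar>\<^sup>2 + \<bar>v0\<bar>\<^sup>2)
                + C2 * (SUP s\<in>{0..t}. exp (- 2 * \<eta> * \<kappa> * (t - s)) * \<bar>zr s\<bar>\<^sup>2)"
        proof (intro allI impI conjI)
          fix t :: real assume t: "0 \<le> t"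
          have cW: "cf (cstate (W t)) = cU (U t)" using W(2)[OF t] by blast
          have fw: "fst (W t) x = w1 (cU (U t)) x" if "x \<in> {0..L}" for x
            by (rule fst_cstate_eq_w1[OF Wh[OF t] cW that])
          have "Linf_norm {0<..<L} (fst (W t)) \<le> ereal R"
          proof (rule Linf_norm_le)
            show "continuous_on {0..L} (fst (W t))" by (rule continuous_on_eq[OF w1_cont]) (simp add: fw)
          qed (simp add: fw w1R[OF t])
          also have "\<dots> < 1" using R by simp
          finally show "Linf_norm {0<..<L} (fst (W t)) < 1" .
          define g where "g = (\<lambda>s. exp (- 2 * \<eta> * \<kappa> * (t - s)) * \<bar>zr s\<bar>\<^sup>2)"
          define S where "S = (SUP s\<in>{0..t}. g s)"
          have bdd: "bdd_above (g ` {0..t})"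
          proof (rule bdd_aboveI2)
            fix s assume s: "s \<in> {0..t}"
            then have "exp (- 2 * \<eta> * \<kappa> * (t - s)) \<le> 1" using eta k by auto
            moreover have "\<bar>zr s\<bar>\<^sup>2 \<le> q\<^sup>2" using zb[of s] s by (intro power_mono) auto
            ultimately show "g s \<le> 1 * q\<^sup>2" unfolding g_def by (intro mult_mono) auto
          qed
          have gS: "g s \<le> S" if "s \<in> {0..t}" for s unfolding S_def by (rule cSUP_upper[OF that bdd])
          have S0: "0 \<le> S" by (rule order_trans[OF _ gS[of t]]) (use t in \<open>auto simp: g_def\<close>)
          \<comment> \<open>The decay estimate is linear in the norm, so it receives the square root
            of the supremum of squares; squaring at the end restores the statement.\<close>
          have M: "exp (- (\<eta> * \<kappa> * (t - s))) * \<bar>zr s\<bar> \<le> sqrt S" if s: "s \<in> {0..t}" for s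
          proof (rule real_le_rsqrt)
            have "(exp (- (\<eta> * \<kappa> * (t - s))) * \<bar>zr s\<bar>)\<^sup>2 = g s"
              by (simp add: g_def power_mult_distrib flip: exp_double)
            then show "(exp (- (\<eta> * \<kappa> * (t - s))) * \<bar>zr s\<bar>)\<^sup>2 \<le> S" using gS[OF s] by simp
          qed
          have "norm (U t) \<le> exp (- \<kappa> * t) * norm (U 0) + C3 * sqrt S"
            using decay[OF t _ _ M] eta by (simp add: C3_def)
          then have "(norm (U t))\<^sup>2 \<le> (exp (- \<kappa> * t) * norm (U 0) + C3 * sqrt S)\<^sup>2" by (intro power_mono) auto
          also have "\<dots> \<le> 2 * (exp (- \<kappa> * t) * norm (U 0))\<^sup>2 + 2 * (C3 * sqrt S)\<^sup>2" by (rule sq_sum2_le)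
          also have "\<dots> = 2 * (exp (- 2 * \<kappa> * t) * (norm (U 0))\<^sup>2) + 2 * (C3\<^sup>2 * S)"
            using S0 by (simp add: power_mult_distrib flip: exp_double)
          also have "\<dots> \<le> 2 * (exp (- 2 * \<kappa> * t) * (3 * Cu\<^sup>2 * E0)) + 2 * (C3\<^sup>2 * S)"
            by (intro add_right_mono mult_left_mono nU0) auto
          finally have nU: "(norm (U t))\<^sup>2 \<le> 2 * (exp (- 2 * \<kappa> * t) * (3 * Cu\<^sup>2 * E0)) + 2 * (C3\<^sup>2 * S)" .
          have x: "\<bar>Xr (U t) i\<bar>\<^sup>2 \<le> (dim * \<sigma>)\<^sup>2 * (norm (U t))\<^sup>2" if "i < dim" for i
            unfolding power_mult_distrib[symmetric] by (rule power_mono[OF Xr_le[OF that]]) simp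
          have "hnorm L (cstate (W t)) \<le> Ce * Kc * norm (U t)"
          proof -
            have "Ce * norm (cU (U t)) \<le> Ce * (Kc * norm (U t))"
              unfolding Kc_def using Ce(1) by (intro mult_left_mono norm_cU) simp
            then show ?thesis using hnorm_le_norm_cf[OF Wh[OF t]] by (simp only: cW mult.assoc)
          qed
          then have "(hnorm L (cstate (W t)))\<^sup>2 \<le> (Ce * Kc)\<^sup>2 * (norm (U t))\<^sup>2"
            unfolding power_mult_distrib[symmetric] by (rule power_mono) (rule hnorm_nonneg[OF Wh[OF t]])
          then have "(hnorm L (cstate (W t)))\<^sup>2 + \<bar>xi L n0 e d lam (W t) (\<zeta> t)\<bar>\<^sup>2 + \<bar>v t\<bar>\<^sup>2 \<le> Cv * (norm (U t))\<^sup>2"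
            using x[of 0] x[of "2 * n0 + 2"] W(2)[OF t] by (simp add: Cv_def distrib_right)
          also have "\<dots> \<le> Cv * (2 * (exp (- 2 * \<kappa> * t) * (3 * Cu\<^sup>2 * E0)) + 2 * (C3\<^sup>2 * S))"
            by (rule mult_left_mono[OF nU Cv])
          also have "\<dots> = (Cv * 2 * (3 * Cu\<^sup>2)) * (exp (- 2 * \<kappa> * t) * E0) + (Cv * 2 * C3\<^sup>2) * S"
            by (simp add: algebra_simps)
          also have "\<dots> \<le> C1 * (exp (- 2 * \<kappa> * t) * E0) + C2 * S"
            by (intro add_mono mult_right_mono S0) (auto simp: C1_def C2_def E0_def)
          finally show "(hnorm L (cstate (W t)))\<^sup>2 + \<bar>xi L n0 e d lam (W t) (\<zeta> t)\<bar>\<^sup>2 + \<bar>v t\<bar>\<^sup>2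
              \<le> C1 * exp (- 2 * \<kappa> * t) * ((hnorm L (cstate W0))\<^sup>2 + \<bar>\<xi>0\<bar>\<^sup>2 + \<bar>v0\<bar>\<^sup>2)
                + C2 * (SUP s\<in>{0..t}. exp (- 2 * \<eta> * \<kappa> * (t - s)) * \<bar>zr s\<bar>\<^sup>2)"
            by (simp only: E0_def S_def g_def mult.assoc)
        qed
      qed
    qed
  qed (use k C1 q in auto)
qed

end

theorem theorem1:
  fixes L \<alpha> :: real and f ye :: "real \<Rightarrow> real"
    and n0 :: nat and e d :: "int \<Rightarrow> state" and lam :: "int \<Rightarrow> complex"
    and K :: "real mat"
  assumes "L > 0"
    and "C2_on UNIV f"
    and "steady_state L f ye"
    and "\<alpha> > 1" and "1 / (2 * L) * ln ((\<alpha> - 1) / (\<alpha> + 1)) < -1"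
    and "spectral_family L \<alpha> f ye n0 e d lam"
    and "controllable (mat_A L \<alpha> f ye n0 e d lam) (mat_B L \<alpha> n0 e d lam)"
    and "K \<in> carrier_mat 1 (2 * n0 + 3)"
    and "hurwitz (mat_A L \<alpha> f ye n0 e d lam + mat_B L \<alpha> n0 e d lam * K)"
  shows "\<exists>\<kappa> C1 \<delta>. 0 < \<kappa> \<and> \<kappa> < 1 \<and> C1 > 0 \<and> \<delta> > 0 \<and>
    (\<forall>\<eta>. 0 \<le> \<eta> \<and> \<eta> < 1 \<longrightarrow> (\<exists>C2>0.
      \<forall>(W0 :: rstate) (\<xi>0 :: real) (v0 :: real) (zr :: real \<Rightarrow> real).
        cstate W0 \<in> domA L \<alpha> \<longrightarrow>
        (hnorm L (cstate W0))\<^sup>2 + \<bar>\<xi>0\<bar>\<^sup>2 + \<bar>v0\<bar>\<^sup>2 \<le> \<delta> \<longrightarrow>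
        C1_on {0..} zr \<longrightarrow>
        (Linf_norm {0..} zr)\<^sup>2 \<le> ereal \<delta> \<longrightarrow>
        (\<exists>W \<zeta> v.
          maximal_solution L \<alpha> f ye n0 e d lam K zr W0 \<xi>0 v0 \<infinity> W \<zeta> v \<and>
          (\<forall>t\<ge>0.
            Linf_norm {0<..<L} (fst (W t)) < 1 \<and>
            (hnorm L (cstate (W t)))\<^sup>2 + \<bar>xi L n0 e d lam (W t) (\<zeta> t)\<bar>\<^sup>2 + \<bar>v t\<bar>\<^sup>2
              \<le> C1 * exp (- 2 * \<kappa> * t) * ((hnorm L (cstate W0))\<^sup>2 + \<bar>\<xi>0\<bar>\<^sup>2 + \<bar>v0\<bar>\<^sup>2)
                + C2 * (SUP s\<in>{0..t}. exp (- 2 * \<eta> * \<kappa> * (t - s)) * \<bar>zr s\<bar>\<^sup>2)))))"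
proof -
  interpret wave_loop L \<alpha> f ye n0 e d lam K
    using assms by unfold_locales auto
  have hur: "hurwitz AK" using assms by (simp add: AK_def)
  obtain \<mu> w0 where w0: "w0 > 0" "\<And>i. i < 2 * n0 + 3 \<Longrightarrow> Re (\<mu> i) \<le> - w0"
    and tri: "\<And>\<epsilon> \<sigma>. \<epsilon> > 0 \<Longrightarrow> \<sigma> > 0 \<Longrightarrow> \<exists>P Q N :: nat \<Rightarrow> nat \<Rightarrow> complex.
       (\<forall>i<2 * n0 + 3. \<forall>k<2 * n0 + 3. (\<Sum>j<2 * n0 + 3. of_real (AK $$ (i, j)) * P j k) = P i k * \<mu> k + (\<Sum>j<2 * n0 + 3. P i j * N j k)) \<and>
       (\<forall>i<2 * n0 + 3. \<forall>k<2 * n0 + 3. (\<Sum>j<2 * n0 + 3. P i j * Q j k) = of_bool (i = k) \<and> (\<Sum>j<2 * n0 + 3. Q i j * P j k) = of_bool (i = k)) \<and>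
       (\<forall>i<2 * n0 + 3. \<forall>k<2 * n0 + 3. cmod (N i k) \<le> \<epsilon> \<and> cmod (P i k) \<le> \<sigma>)"
    by (rule hurwitz_triangularization[OF AK_dim hur]) (rule that)
  \<comment> \<open>The low modes offer \<open>w0\<close> and the high modes offer \<open>1\<close>;
    the smaller rate serves both.\<close>
  define w where "w = min w0 1"
  have w: "w > 0" "w \<le> 1" "w \<le> w0" using w0(1) by (auto simp: w_def)
  define n where "n = real (2 * n0 + 3)"
  have n: "n > 0" by (simp add: n_def)
  define c where "c = norm av + (\<Sum>i<2 * n0 + 3. \<bar>K $$ (0, i)\<bar>) * norm bv"
  have c: "0 \<le> c" by (auto simp: c_def intro!: add_nonneg_nonneg mult_nonneg_nonneg sum_nonneg)
  \<comment> \<open>With these choices the two summands of \<open>LA\<close> are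
    \<open>w / 8\<close> and \<open>w / 8 * (c / (c + 1))\<close>, together at most
    \<open>w / 4\<close>. The constants \<open>n\<close> and \<open>c\<close> do not depend on the
    basis \<open>P\<close>, so there is no circularity.\<close>
  define \<epsilon> where "\<epsilon> = w / (8 * n * n)"
  define \<sigma> where "\<sigma> = w / (8 * n * (c + 1))"
  have "\<epsilon> > 0" "\<sigma> > 0" using w n c by (auto simp: \<epsilon>_def \<sigma>_def)
  from tri[OF this] obtain P Q N where
    PQN: "\<forall>i<2 * n0 + 3. \<forall>k<2 * n0 + 3. (\<Sum>j<2 * n0 + 3. of_real (AK $$ (i, j)) * P j k) = P i k * \<mu> k + (\<Sum>j<2 * n0 + 3. P i j * N j k)"
    "\<forall>i<2 * n0 + 3. \<forall>k<2 * n0 + 3. (\<Sum>j<2 * n0 + 3. P i j * Q j k) = of_bool (i = k) \<and> (\<Sum>j<2 * n0 + 3. Q i j * P j k) = of_bool (i = k)"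
    "\<forall>i<2 * n0 + 3. \<forall>k<2 * n0 + 3. cmod (N i k) \<le> \<epsilon> \<and> cmod (P i k) \<le> \<sigma>"
    by blast
  have m: "Re (\<mu> i) \<le> - w" if "i < 2 * n0 + 3" for i using w0(2)[OF that] w(3) by linarith
  interpret wave_modal L \<alpha> f ye n0 e d lam K \<mu> P Q N w \<epsilon> \<sigma>
    by unfold_locales (use w m PQN in blast)+
  have "LA = n * (n * \<epsilon>) + n * \<sigma> * c" unfolding LA_def n_def c_def ..
  also have "n * (n * \<epsilon>) = w / 8" using n by (simp add: \<epsilon>_def)
  also have "n * \<sigma> * c = w / 8 * (c / (c + 1))" using n by (simp add: \<sigma>_def)
  also have "w / 8 * (c / (c + 1)) \<le> w / 8 * 1" using w c by (intro mult_left_mono) auto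
  finally have "LA \<le> w / 4" by simp
  then show ?thesis by (rule closed_loop_stability)
qed


end
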